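(* Let $m\geq 2$ be an integer, let $V\in\mathbb N^m$ be a nonzero vector, and let $(G_n)_{n\geq 0}$ be the discrete-time gap process with parameter $m$ and initial condition $G_0=PV$. Then: (i) (Small phases) if $m\leq 59$, then, as $n\to\infty$, $\dfrac{G_n-nv_1}{\sqrt n}$ converges in distribution to a centered Gaussian vector; (ii) (Large phases) if $m\geq 60$, then there is a complex-valued random variable $W^{DT}$ with expectation $\dfrac{\Gamma(|PV|)}{\Gamma(|PV|+\lambda_2)}\,u_2(PV)$ such that, as $n\to\infty$, $$G_n=nv_1+2\Re\left(n^{\lambda_2}W^{DT}v_2\right)+o\left(n^{\sigma_2}\right)$$ almost surely and in $\mathrm L^p$ for every $p\geq 1$.
   Context: Replacement matrix: $R_m$ is the $m\times m$ matrix with $(R_m)_{k,k}=-(m+k-1)$ for $1\le k\le m$, $(R_m)_{k,k+1}=m+k$ for $1\le k\le m-1$, $(R_m)_{m,1}=2m$, and all other entries $0$ (every row sums to $1$). $P=\mathrm{Diag}(m,m+1,\dots,2m-1)$. For a vector $X$, $|X|$ is the sum of its coordinates. Gap process: the Pólya urn process with $m$ colors and replacement matrix $R_m$, i.e. the Markov chain $(G_n)_{n\ge 0}$ such that, conditionally on $G_n$, for each $k\in\{1,\dots,m\}$, $G_{n+1}=G_n+(\text{$k$-th row of }R_m)$ with probability $G_n^{(k)}/|G_n|$, where $G_n^{(k)}$ is the $k$-th coordinate. Started from $G_0=PV$ with $V\in\mathbb N^m\setminus\{0\}$ the process is well defined for all times, and $|G_n|=n+|PV|$. (It counts the insertion gaps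 of each type in the fringe nodes of a B-tree.) Spectral notation: the characteristic polynomial of $R_m$ is $\chi_m(X)=\prod_{k=m}^{2m-1}(X+k)-\frac{(2m)!}{m!}$. Its roots are simple, $1$ is the root with largest real part, and two distinct roots with the same real part are complex conjugate. For $m\ge 60$, $\lambda_2=\sigma_2+i\tau_2$ denotes the root having the second largest real part $\sigma_2$ and positive imaginary part $\tau_2$. For a root $\lambda$ put $$H_{m+1}(X)=\sum_{k=1}^m\frac1{X+k},\qquad u(\lambda)(x_1,\dots,x_m)=\sum_{k=1}^m\left(\prod_{j=0}^{k-2}\frac{\lambda+m+j}{1+m+j}\right)x_k,$$ and let $v(\lambda)\in\mathbb C^m$ be the vector with $k$-th coordinate $$\frac{1}{(m+\lambda)H_{m+1}(m+\lambda-1)}\prod_{j=1}^{k-1}\frac{m+j}{m+j+\lambda}.$$ (These are dual bases of eigenforms and eigenvectors of the transpose of $R_m$.) Put $v_1=v(1)=\frac1{H_{m+1}(m)}\left(\frac1{m+1},\dots,\frac1{2m}\right)$, $v_2=v(\lambda_2)$, $u_2=u(\lambda_2)$. $\Gamma$ is Euler's Gamma function; $\Re$ of a complex vector is taken coordinatewise. *)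

theory Defs
  imports
    "HOL-Probability.Probability"
    "HOL-Computational_Algebra.Polynomial"
    "HOL-Library.Landau_Symbols"
begin

text \<open>Vectors of dimension \<open>m\<close> are functions on \<open>nat\<close> of which only the coordinates in
  \<open>{1..m}\<close> matter; as a space, \<open>\<real>\<^sup>m\<close> is \<open>powertop_real {1..m}\<close>, resp.
  \<open>PiM {1..m} (\<lambda>_. borel)\<close>.\<close>

definition repl_mat :: "nat \<Rightarrow> nat \<Rightarrow> nat \<Rightarrow> real" where
  "repl_mat m i j =
     (if j = i then - real (m + i - 1)
      else if i < m \<and> j = i + 1 then real (m + i)
      else if i = m \<and> j = 1 then real (2 * m)
      else 0)"

definition coord_sum :: "nat \<Rightarrow> (nat \<Rightarrow> real) \<Rightarrow> real" where
  "coord_sum m x = (\<Sum>k=1..m. x k)"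

text \<open>The vector \<open>P V\<close> for \<open>P = Diag(m, m+1, \<dots>, 2m-1)\<close>.\<close>

definition gap_init :: "nat \<Rightarrow> (nat \<Rightarrow> nat) \<Rightarrow> nat \<Rightarrow> real" where
  "gap_init m V k = real (m + k - 1) * real (V k)"

text \<open>The chain is specified through its finite-dimensional distributions: for every path
  \<open>g 0, \<dots>, g n\<close> (with \<open>g\<close> arbitrary after time \<open>n\<close>) and every colour \<open>k\<close>. For a path of positive
  probability the transition probabilities over \<open>k \<in> {1..m}\<close> sum to one, and for \<open>m \<ge> 2\<close> the rows of
  the replacement matrix are pairwise distinct, so no other transitions occur.\<close>

definition is_gap_process ::
  "nat \<Rightarrow> (nat \<Rightarrow> nat) \<Rightarrow> 'a measure \<Rightarrow> (nat \<Rightarrow> 'a \<Rightarrow> nat \<Rightarrow> real) \<Rightarrow> bool" where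
  "is_gap_process m V M G \<longleftrightarrow>
     (\<forall>n. \<forall>j\<in>{1..m}. (\<lambda>\<omega>. G n \<omega> j) \<in> borel_measurable M) \<and>
     (AE \<omega> in M. \<forall>j\<in>{1..m}. G 0 \<omega> j = gap_init m V j) \<and>
     (\<forall>n g. \<forall>k\<in>{1..m}.
        measure M {\<omega> \<in> space M. (\<forall>i\<le>n. \<forall>j\<in>{1..m}. G i \<omega> j = g i j) \<and>
                                (\<forall>j\<in>{1..m}. G (Suc n) \<omega> j = g n j + repl_mat m k j)} =
        measure M {\<omega> \<in> space M. \<forall>i\<le>n. \<forall>j\<in>{1..m}. G i \<omega> j = g i j} *
          (g n k / coord_sum m (g n)))"

definition char_poly_gap :: "nat \<Rightarrow> complex poly" where
  "char_poly_gap m = (\<Prod>k=m..2*m-1. [:of_nat k, 1:]) - [:fact (2 * m) / fact m:]"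

definition root_real_parts :: "nat \<Rightarrow> real set" where
  "root_real_parts m = Re ` {z. poly (char_poly_gap m) z = 0}"

definition sigma2 :: "nat \<Rightarrow> real" where
  "sigma2 m = Max (root_real_parts m - {Max (root_real_parts m)})"

definition lambda2 :: "nat \<Rightarrow> complex" where
  "lambda2 m = (THE z. poly (char_poly_gap m) z = 0 \<and> Re z = sigma2 m \<and> Im z > 0)"

text \<open>The subscript \<open>m + 1\<close> of \<open>H\<close> in the usual notation is the present \<open>m\<close> plus one.\<close>

definition H_sum :: "nat \<Rightarrow> 'a::field \<Rightarrow> 'a" where
  "H_sum m x = (\<Sum>k=1..m. 1 / (x + of_nat k))"

definition eig_form :: "nat \<Rightarrow> 'a::field \<Rightarrow> (nat \<Rightarrow> 'a) \<Rightarrow> 'a" where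
  "eig_form m z x =
     (\<Sum>k=1..m. (\<Prod>j<k-1. (z + of_nat m + of_nat j) / (1 + of_nat m + of_nat j)) * x k)"

definition eig_vec :: "nat \<Rightarrow> 'a::field \<Rightarrow> nat \<Rightarrow> 'a" where
  "eig_vec m z k =
     1 / ((of_nat m + z) * H_sum m (of_nat m + z - 1)) *
     (\<Prod>j=1..<k. (of_nat m + of_nat j) / (of_nat m + of_nat j + z))"

definition v1 :: "nat \<Rightarrow> nat \<Rightarrow> real" where
  "v1 m = eig_vec m 1"

lemma v1_explicit:
  assumes "k \<ge> 1"
  shows "v1 m k = 1 / (H_sum m (real m) * real (m + k))"
proof -
  have "(\<Prod>j=1..<k. (real m + real j) / (real m + real j + 1)) = (real m + 1) / (real m + real k)"
    using assms
  proof (induction k rule: dec_induct)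
    case (step k)
    then show ?case by (simp add: add_ac)
  qed simp
  then show ?thesis
    by (simp add: v1_def eig_vec_def add_eq_0_iff)
qed

text \<open>Weak convergence on \<open>\<real>\<^sup>I\<close>; the library's \<open>weak_conv_m\<close> is for distributions on \<open>\<real>\<close> only.\<close>

definition weak_conv_pow ::
  "nat set \<Rightarrow> (nat \<Rightarrow> (nat \<Rightarrow> real) measure) \<Rightarrow> (nat \<Rightarrow> real) measure \<Rightarrow> bool" where
  "weak_conv_pow I \<mu> \<nu> \<longleftrightarrow>
     (\<forall>f. continuous_map (powertop_real I) euclideanreal f \<and>
          bounded (f ` topspace (powertop_real I)) \<longrightarrow>
          (\<lambda>n. \<integral>x. f x \<partial>\<mu> n) \<longlonglongrightarrow> (\<integral>x. f x \<partial>\<nu>))"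

text \<open>Degenerate Gaussian vectors are allowed (\<open>s = 0\<close>), as is necessary here: the limit is
  supported by the hyperplane of vectors with coordinate sum zero.\<close>

definition centered_gaussian :: "nat set \<Rightarrow> (nat \<Rightarrow> real) measure \<Rightarrow> bool" where
  "centered_gaussian I \<nu> \<longleftrightarrow>
     prob_space \<nu> \<and> sets \<nu> = sets (PiM I (\<lambda>_. borel)) \<and>
     (\<forall>a. \<exists>s\<ge>0. distr \<nu> borel (\<lambda>x. \<Sum>i\<in>I. a i * x i) =
                 distr std_normal_distribution borel (\<lambda>z. s * z))"

definition gap_fluctuation ::
  "nat \<Rightarrow> (nat \<Rightarrow> 'a \<Rightarrow> nat \<Rightarrow> real) \<Rightarrow> nat \<Rightarrow> 'a \<Rightarrow> nat \<Rightarrow> real" where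
  "gap_fluctuation m G n \<omega> = (\<lambda>k\<in>{1..m}. (G n \<omega> k - real n * v1 m k) / sqrt (real n))"

definition gap_remainder ::
  "nat \<Rightarrow> (nat \<Rightarrow> 'a \<Rightarrow> nat \<Rightarrow> real) \<Rightarrow> ('a \<Rightarrow> complex) \<Rightarrow> nat \<Rightarrow> 'a \<Rightarrow> nat \<Rightarrow> real" where
  "gap_remainder m G W n \<omega> k =
     G n \<omega> k - real n * v1 m k -
     2 * Re (of_nat n powr lambda2 m * W \<omega> * eig_vec m (lambda2 m) k)"

end

theory Submission
  imports Defs "HOL-Computational_Algebra.Fundamental_Theorem_Algebra" "HOL-Real_Asymp.Real_Asymp"
begin

text \<open>
  A root \<open>s + it\<close> in the right half plane is a point at which the product of the
  \<open>s + k + it\<close>, \<open>m \<le> k < 2m\<close>, has the modulus of the product of the \<open>1 + k\<close> and an argument in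
  \<open>2\<pi>\<int>\<close>. Both modulus and argument are monotone in \<open>t\<close>, so whether a root other than \<open>1\<close> has real
  part above \<open>1/2\<close> is decided by comparing \<open>2\<pi>\<close> with the argument at the point of the line
  \<open>s = 1/2\<close> that has the right modulus. This comparison is monotone in \<open>m\<close>, and only \<open>m = 59\<close> and
  \<open>m = 60\<close> need numerics.

  For a root \<open>z\<close> the eigenform \<open>u(z)\<close> satisfies
  \<open>u(z)(G\<^sub>n\<^sub>+\<^sub>1) = (1 + z / (n + N)) u(z)(G\<^sub>n) + \<xi>\<^sub>n\<close> with \<open>N = |PV|\<close> and bounded martingale
  differences \<open>\<xi>\<^sub>n\<close>. Bounds for all even moments of the resulting weighted sums of the \<open>\<xi>\<^sub>n\<close> have a
  polynomial rate for roots of real part above \<open>1/2\<close>; they give convergence almost surely and in all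
  \<open>L\<^sup>p\<close> without martingale theory. If all roots other than \<open>1\<close> have real part below \<open>1/2\<close>, the
  characteristic function of the fluctuations is computed by a Lindeberg comparison, in which the
  solution of the Lyapunov equation for the limit covariance makes one step of the chain change the
  comparison quantity by only \<open>O(n\<^sup>-\<^sup>3\<^sup>/\<^sup>2)\<close>.
\<close>

section \<open>Roots of the characteristic polynomial\<close>

text \<open>The threshold \<open>1/2\<close> comes from weights: the noise of step \<open>j\<close>
  reaches time \<open>n\<close> multiplied by about \<open>(n / j) powr Re z\<close>. The sum of the
  squared weights is dominated by small \<open>j\<close> if \<open>Re z > 1/2\<close>, so that early
  steps leave a random limit, and by \<open>j\<close> of order \<open>n\<close> if
  \<open>Re z < 1/2\<close>, so that no single step matters and the scale is \<open>sqrt n\<close>.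
  The strict numerical comparisons keep the second largest real part off the borderline. Passing
  from \<open>m\<close> to \<open>m + 1\<close> removes the factor with \<open>k = m\<close> and
  adds those with \<open>k = 2m\<close> and \<open>k = 2m + 1\<close>; monotonicity in
  \<open>m\<close> is thus a statement about three factors. In the Lindeberg comparison the drift is
  a priori only of order \<open>1/j\<close> at step \<open>j\<close>, which is not summable. It is
  therefore not estimated but cancelled, by letting the coefficients of the linear form follow the
  recursion backwards from the final time. The limit covariance appears as the solution of a linear
  equation, not as a limit of variances, and its positivity is read off from the characteristic
  functions.\<close>

definition gap_roots :: "nat \<Rightarrow> complex set" where
  "gap_roots m = {z. (\<Prod>j<m. z + of_nat (m + j)) = (\<Prod>j<m. 1 + of_nat (m + j))}"

lemma fact_add_prod: "(fact (m + n) :: 'a::field_char_0) = fact m * (\<Prod>j<n. 1 + of_nat (m + j))"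
  by (induction n) (auto simp: algebra_simps)

text \<open>The constant \<open>(2m)! / m!\<close> is the product of the same \<open>m\<close>
  factors taken at \<open>1\<close>; in this form roots can be compared with \<open>1\<close> factor
  by factor.\<close>

lemma poly_char_poly_gap:
  assumes "m \<ge> 1"
  shows "poly (char_poly_gap m) z = (\<Prod>j<m. z + of_nat (m + j)) - (\<Prod>j<m. 1 + of_nat (m + j))"
proof -
  have "(\<Prod>k=m..2*m-1. poly [:of_nat k, 1:] z) = (\<Prod>j<m. z + of_nat (m + j))"
    by (rule prod.reindex_bij_witness[where i = "\<lambda>j. m + j" and j = "\<lambda>k. k - m"])
       (use assms in \<open>auto simp: add_ac\<close>)
  moreover have "(fact (2 * m) / fact m :: complex) = (\<Prod>j<m. 1 + of_nat (m + j))"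
    using fact_add_prod[of m m, where 'a = complex] by (simp add: mult_2)
  ultimately show ?thesis
    by (simp add: char_poly_gap_def poly_prod)
qed

lemma gap_roots_eq: "m \<ge> 1 \<Longrightarrow> gap_roots m = {z. poly (char_poly_gap m) z = 0}"
  by (simp add: gap_roots_def poly_char_poly_gap)

lemma one_in_gap_roots: "1 \<in> gap_roots m"
  by (simp add: gap_roots_def)

lemma cnj_in_gap_roots:
  assumes "z \<in> gap_roots m" shows "cnj z \<in> gap_roots m"
proof -
  have "cnj (\<Prod>j<m. z + of_nat (m + j)) = cnj (\<Prod>j<m. 1 + of_nat (m + j))"
    using assms by (simp add: gap_roots_def)
  then show ?thesis by (simp add: gap_roots_def)
qed

text \<open>At a root the product has a nonzero value. Hence the denominators in
  \<open>eig_vec\<close> and in its normalising \<open>H_sum\<close> do not vanish.\<close>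

lemma gap_root_factor_nz:
  assumes "z \<in> gap_roots m" "j < m" shows "z + of_nat (m + j) \<noteq> 0"
proof
  assume "z + of_nat (m + j) = 0"
  then have "(\<Prod>j<m. z + of_nat (m + j)) = 0"
    using assms(2) by (intro prod_zero) auto
  then have "(\<Prod>j<m. 1 + of_nat (m + j) :: complex) = 0"
    using assms(1) by (simp only: gap_roots_def mem_Collect_eq)
  then have "\<exists>j. (1 + of_nat (m + j) :: complex) = 0" by (metis finite_lessThan prod_zero_iff)
  then show False
    by (metis of_nat_Suc of_nat_0 of_nat_eq_iff nat.distinct(1))
qed

lemma cmod_prod_less:
  assumes "m \<ge> 1" "\<And>j. j < m \<Longrightarrow> cmod (z + of_nat (m + j)) < cmod (w + of_nat (m + j))"
  shows "cmod (\<Prod>j<m. z + of_nat (m + j)) < cmod (\<Prod>j<m. w + of_nat (m + j))"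
proof -
  have "0 \<in> {..<m}" using assms(1) by simp
  moreover have "0 < cmod (w + of_nat (m + j))" if "j < m" for j
    using assms(2)[OF that] norm_ge_zero le_less_trans by blast
  ultimately show ?thesis unfolding prod_norm[symmetric]
    by (intro prod_mono_strict[of 0] conjI less_imp_le[OF assms(2)] assms(2)) auto
qed

text \<open>The product has the same modulus at all roots, so no root dominates another one in every
  factor. The elementary localisations of roots that follow rest on this.\<close>

lemma gap_roots_no_cmod_less:
  assumes "m \<ge> 1" "z \<in> gap_roots m" "w \<in> gap_roots m"
    "\<And>j. j < m \<Longrightarrow> cmod (z + of_nat (m + j)) < cmod (w + of_nat (m + j))"
  shows False
  using cmod_prod_less[of m z w] assms by (simp add: gap_roots_def)

lemma cmod_less_iff: "cmod z < cmod w \<longleftrightarrow> (Re z)\<^sup>2 + (Im z)\<^sup>2 < (Re w)\<^sup>2 + (Im w)\<^sup>2"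
  by (simp add: cmod_def)

lemma gap_roots_Re_ge_1:
  assumes "m \<ge> 1" "z \<in> gap_roots m" "Re z \<ge> 1"
  shows "z = 1"
proof (rule ccontr)
  assume "z \<noteq> 1"
  show False
  proof (rule gap_roots_no_cmod_less[OF assms(1) one_in_gap_roots assms(2)])
    fix j assume "j < m"
    have *: "(1 + real (m + j))\<^sup>2 \<le> (Re z + real (m + j))\<^sup>2"
      using assms(3) by (intro power_mono) auto
    have "(1 + real (m + j))\<^sup>2 < (Re z + real (m + j))\<^sup>2 + (Im z)\<^sup>2"
    proof (cases "Im z = 0")
      case True
      then have "Re z > 1" using \<open>z \<noteq> 1\<close> assms(3) by (auto simp: complex_eq_iff)
      then have "(1 + real (m + j))\<^sup>2 < (Re z + real (m + j))\<^sup>2"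
        by (intro power_strict_mono) auto
      then show ?thesis using True by simp
    next
      case False
      then show ?thesis using * 
        by (smt (verit) zero_less_power2)
    qed
    then show "cmod (1 + of_nat (m + j)) < cmod (z + of_nat (m + j))"
      by (simp add: cmod_less_iff)
  qed
qed

text \<open>Of two roots on one vertical line, the one farther from the real axis would dominate the
  other in every factor.\<close>

lemma gap_roots_same_Re:
  assumes "m \<ge> 1" "z \<in> gap_roots m" "w \<in> gap_roots m" "Re z = Re w"
  shows "w = z \<or> w = cnj z"
proof -
  have *: "\<not> (Im a)\<^sup>2 < (Im b)\<^sup>2" if "a \<in> gap_roots m" "b \<in> gap_roots m" "Re a = Re b" for a b
  proof
    assume "(Im a)\<^sup>2 < (Im b)\<^sup>2"
    then show False
      using that gap_roots_no_cmod_less[OF assms(1) that(1,2)] by (simp add: cmod_less_iff)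
  qed
  have "(Im z)\<^sup>2 = (Im w)\<^sup>2" using *[of z w] *[of w z] assms by linarith
  then show ?thesis using assms(4) by (auto simp: complex_eq_iff power2_eq_iff)
qed

text \<open>The bound \<open>- m\<close> keeps all factors nonnegative, so that a real root below
  \<open>1\<close> is dominated by \<open>1\<close>. Further to the left there can be real roots:
  for even \<open>m\<close>, \<open>- 3 * m\<close> is one.\<close>

lemma gap_roots_real:
  assumes "m \<ge> 1" "z \<in> gap_roots m" "Re z \<ge> - real m" "Im z = 0"
  shows "z = 1"
proof (rule ccontr)
  assume "z \<noteq> 1"
  then have r: "Re z < 1" using gap_roots_Re_ge_1[OF assms(1,2)] by fastforce
  show False
  proof (rule gap_roots_no_cmod_less[OF assms(1) assms(2) one_in_gap_roots])
    fix j assume "j < m"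
    have "(Re z + real (m + j))\<^sup>2 < (1 + real (m + j))\<^sup>2"
      using r assms(3) by (intro power_strict_mono) auto
    then show "cmod (z + of_nat (m + j)) < cmod (1 + of_nat (m + j))"
      using assms(4) by (simp add: cmod_less_iff)
  qed
qed

text \<open>The sum is the logarithmic derivative of the product: that it is nonzero makes the roots
  simple and the normalisation of \<open>eig_vec\<close> meaningful. Off the real axis all terms
  have imaginary parts of the same sign. On the axis the terms themselves have the same sign, except
  between the zeros of the first and the last factor, where there is no root.\<close>

lemma gap_root_H_nz:
  assumes m: "m \<ge> 1" and z: "z \<in> gap_roots m"
  shows "(\<Sum>j<m. 1 / (z + of_nat (m + j))) \<noteq> 0"
proof (cases "Im z = 0")
  case False
  have "Im (1 / (z + of_nat (m + j))) = - Im z * (1 / (cmod (z + of_nat (m + j)))\<^sup>2)" for j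
    by (simp add: Im_divide cmod_power2)
  then have "Im (\<Sum>j<m. 1 / (z + of_nat (m + j))) = - Im z * (\<Sum>j<m. 1 / (cmod (z + of_nat (m + j)))\<^sup>2)"
    by (simp only: Im_sum sum_distrib_left)
  moreover have "(\<Sum>j<m. 1 / (cmod (z + of_nat (m + j)))\<^sup>2) > 0"
    using m gap_root_factor_nz[OF z] by (intro sum_pos) (auto simp: lessThan_empty_iff)
  ultimately have "Im (\<Sum>j<m. 1 / (z + of_nat (m + j))) \<noteq> 0" using False by simp
  then show ?thesis by (metis zero_complex.sel(2))
next
  case True
  define x where "x = Re z"
  have zx: "z = of_real x" using True by (simp add: x_def complex_eq_iff)
  have nz: "x + real (m + j) \<noteq> 0" if "j < m" for j
    using gap_root_factor_nz[OF z that] unfolding zx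
    by (metis of_real_add of_real_eq_0_iff of_real_of_nat_eq)
  have eq: "(\<Sum>j<m. 1 / (z + of_nat (m + j))) = of_real (\<Sum>j<m. 1 / (x + real (m + j)))"
    by (simp add: zx)
  consider "x > - real m" | "x < - real (2 * m - 1)" | "- real (2 * m - 1) \<le> x" "x \<le> - real m"
    by linarith
  then have "(\<Sum>j<m. 1 / (x + real (m + j))) \<noteq> 0"
  proof cases
    case 1
    then have "(\<Sum>j<m. 1 / (x + real (m + j))) > 0"
      using m by (intro sum_pos) (auto simp: lessThan_empty_iff)
    then show ?thesis by simp
  next
    case 2
    have "(\<Sum>j<m. - (1 / (x + real (m + j)))) > 0"
      using m 2 by (intro sum_pos) (auto simp: lessThan_empty_iff of_nat_diff)
    then show ?thesis by (simp add: sum_negf)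
  next
    case 3
    have False
    proof (rule gap_roots_no_cmod_less[OF m z one_in_gap_roots])
      \<comment> \<open>In this range every factor has modulus at most \<open>m - 1\<close>, whereas
        the factors at \<open>1\<close> exceed \<open>m\<close>.\<close>
      fix j assume j: "j < m"
      have "\<bar>x + real (m + j)\<bar> < 1 + real (m + j)"
        using 3 j m by (auto simp: of_nat_diff abs_if)
      moreover have "z + of_nat (m + j) = of_real (x + real (m + j))"
        unfolding zx by simp
      moreover have "1 + of_nat (m + j) = complex_of_real (1 + real (m + j))"
        by simp
      moreover have "\<bar>1 + real (m + j)\<bar> = 1 + real (m + j)" by simp
      ultimately show "cmod (z + of_nat (m + j)) < cmod (1 + of_nat (m + j))" by (simp only: norm_of_real)
    qed
    then show ?thesis ..
  qed
  then show ?thesis unfolding eq of_real_eq_0_iff .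
qed

lemma char_poly_gap_alt:
  "m \<ge> 1 \<Longrightarrow> char_poly_gap m = (\<Prod>j<m. [:of_nat (m + j), 1:]) - [:\<Prod>j<m. 1 + of_nat (m + j):]"
  by (simp add: poly_eq_poly_eq_iff[symmetric] fun_eq_iff poly_char_poly_gap poly_prod add_ac
      del: of_nat_add)

text \<open>At a root the derivative is the product times the sum of \<open>gap_root_H_nz\<close>,
  hence nonzero, so no root is multiple. The exact count is what later makes the eigenforms separate
  vectors.\<close>

lemma card_gap_roots:
  assumes m: "m \<ge> 1"
  shows "finite (gap_roots m)" "card (gap_roots m) = m"
proof -
  let ?p = "char_poly_gap m"
  have deg0: "degree (\<Prod>j<m. [:of_nat (m + j), 1 :: complex:]) = m"
    by (subst degree_prod_eq_sum_degree) auto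
  have deg: "degree ?p = m"
    unfolding char_poly_gap_alt[OF m] diff_conv_add_uminus
    by (subst degree_add_eq_left) (use m deg0 in \<open>auto simp del: of_nat_add\<close>)
  then have nz: "?p \<noteq> 0" using m by auto
  have "rsquarefree ?p"
    unfolding rsquarefree_roots
  proof (intro allI notI, elim conjE)
    fix z assume 0: "poly ?p z = 0" and 1: "poly (pderiv ?p) z = 0"
    then have z: "z \<in> gap_roots m" using gap_roots_eq[OF m] by blast
    have fz: "\<And>j. j < m \<Longrightarrow> z + of_nat (m + j) \<noteq> 0" using gap_root_factor_nz[OF z] by blast
    have "poly (pderiv ?p) z = (\<Sum>j<m. \<Prod>i\<in>{..<m}-{j}. z + of_nat (m + i))"
      unfolding char_poly_gap_alt[OF m]
      by (simp add: pderiv_diff pderiv_prod poly_sum poly_prod pderiv_pCons add_ac)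
    also have "\<dots> = (\<Sum>j<m. (\<Prod>i<m. z + of_nat (m + i)) * (1 / (z + of_nat (m + j))))"
    proof (intro sum.cong refl)
      fix j assume "j \<in> {..<m}"
      then have "(\<Prod>i<m. z + of_nat (m + i)) = (z + of_nat (m + j)) * (\<Prod>i\<in>{..<m}-{j}. z + of_nat (m + i))"
        by (intro prod.remove) auto
      then show "(\<Prod>i\<in>{..<m}-{j}. z + of_nat (m + i)) = (\<Prod>i<m. z + of_nat (m + i)) * (1 / (z + of_nat (m + j)))"
        using fz[of j] \<open>j \<in> {..<m}\<close> by simp
    qed
    also have "\<dots> = (\<Prod>i<m. z + of_nat (m + i)) * (\<Sum>j<m. 1 / (z + of_nat (m + j)))"
      by (simp add: sum_distrib_left)
    also have "\<dots> \<noteq> 0" using gap_root_H_nz[OF m z] fz by auto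
    finally show False using 1 by simp
  qed
  then have dec: "smult (lead_coeff ?p) (\<Prod>z|poly ?p z = 0. [:-z, 1:]) = ?p"
    by (rule complex_poly_decompose_rsquarefree)
  show fin: "finite (gap_roots m)"
    unfolding gap_roots_eq[OF m] using poly_roots_finite[OF nz] .
  have "degree ?p = degree (\<Prod>z|poly ?p z = 0. [:-z, 1:])"
    using nz arg_cong[OF dec, of degree] by simp
  also have "\<dots> = card (gap_roots m)"
    by (subst degree_prod_eq_sum_degree) (auto simp: gap_roots_eq[OF m])
  finally show "card (gap_roots m) = m" using deg by simp
qed

section \<open>The phase transition at dimension 60\<close>

definition modprod :: "nat \<Rightarrow> real \<Rightarrow> real \<Rightarrow> real" where
  "modprod m s t = (\<Prod>j<m. (s + real (m + j))\<^sup>2 + t\<^sup>2)"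

text \<open>A continuous determination of the argument of the product, deliberately not reduced
  modulo \<open>2 * pi\<close>: for \<open>s > 0\<close> each summand is the principal argument of
  one factor. Counting turns is what separates the two phases.\<close>

definition argsum :: "nat \<Rightarrow> real \<Rightarrow> real \<Rightarrow> real" where
  "argsum m s t = (\<Sum>j<m. arctan (t / (s + real (m + j))))"

lemma Complex_polar_arctan:
  assumes "x > 0"
  shows "Complex x t = of_real (sqrt (x\<^sup>2 + t\<^sup>2)) * cis (arctan (t / x))"
proof -
  have "1 + (t / x)\<^sup>2 = (x\<^sup>2 + t\<^sup>2) / x\<^sup>2" using assms by (simp add: field_simps)
  then have "sqrt (1 + (t / x)\<^sup>2) = sqrt (x\<^sup>2 + t\<^sup>2) / x" using assms by (simp add: real_sqrt_divide)
  moreover have "sqrt (x\<^sup>2 + t\<^sup>2) > 0" using assms by (simp add: sum_power2_gt_zero_iff)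
  ultimately show ?thesis using assms
    by (simp add: complex_eq_iff cos_arctan sin_arctan)
qed

lemma sqrt_prod: "sqrt (\<Prod>i\<in>A. f i) = (\<Prod>i\<in>A. sqrt (f i))"
  by (induction A rule: infinite_finite_induct) (auto simp: real_sqrt_mult)

lemma prod_Complex_polar:
  assumes "s > 0" "m \<ge> 1"
  shows "(\<Prod>j<m. Complex s t + of_nat (m + j)) = of_real (sqrt (modprod m s t)) * cis (argsum m s t)"
proof -
  have "Complex s t + of_nat (m + j) =
     of_real (sqrt ((s + real (m + j))\<^sup>2 + t\<^sup>2)) * cis (arctan (t / (s + real (m + j))))" for j
    using Complex_polar_arctan[of "s + real (m + j)" t] assms by (simp add: complex_eq_iff)
  then have "(\<Prod>j<m. Complex s t + of_nat (m + j)) =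
     (\<Prod>j<m. of_real (sqrt ((s + real (m + j))\<^sup>2 + t\<^sup>2))) * (\<Prod>j<m. cis (arctan (t / (s + real (m + j)))))"
    by (simp only: prod.distrib)
  also have "(\<Prod>j<m. cis (arctan (t / (s + real (m + j))))) = cis (argsum m s t)"
    \<comment> \<open>Only the upper bound of the product is generalised; the \<open>m\<close>
      inside the factors stays fixed during the induction.\<close>
    unfolding argsum_def by (induction m rule: nat.induct[where P = "\<lambda>n. (\<Prod>j<n. cis (arctan (t / (s + real (m + j))))) = cis (\<Sum>j<n. arctan (t / (s + real (m + j))))"])
      (simp_all add: cis_mult)
  also have "(\<Prod>j<m. of_real (sqrt ((s + real (m + j))\<^sup>2 + t\<^sup>2))) = (of_real (sqrt (modprod m s t)) :: complex)"
    unfolding modprod_def sqrt_prod of_real_prod ..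
  finally show ?thesis .
qed

lemma modprod_strict_mono:
  assumes "m \<ge> 1" "0 < s" "s \<le> s'" "0 \<le> t" "t \<le> t'" "s < s' \<or> t < t'"
  shows "modprod m s t < modprod m s' t'"
proof -
  have "0 \<in> {..<m}" using assms(1) by simp
  have less: "(s + real (m + j))\<^sup>2 + t\<^sup>2 < (s' + real (m + j))\<^sup>2 + t'\<^sup>2" for j
  proof -
    have "(s + real (m + j))\<^sup>2 \<le> (s' + real (m + j))\<^sup>2" "t\<^sup>2 \<le> t'\<^sup>2"
      using assms by (auto intro!: power_mono)
    moreover have "(s + real (m + j))\<^sup>2 < (s' + real (m + j))\<^sup>2 \<or> t\<^sup>2 < t'\<^sup>2"
      using assms by (auto intro!: power_strict_mono)
    ultimately show ?thesis by linarith
  qed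
  have "0 < (s' + real (m + j))\<^sup>2 + t'\<^sup>2" for j
    using assms by (intro add_pos_nonneg) auto
  with \<open>0 \<in> {..<m}\<close> show ?thesis
    unfolding modprod_def
    by (intro prod_mono_strict[of 0] conjI less less_imp_le[OF less]) auto
qed

lemma argsum_mono:
  assumes "0 < s" "s \<le> s'" "0 \<le> t'" "t' \<le> t"
  shows "argsum m s' t' \<le> argsum m s t"
  unfolding argsum_def arctan_le_iff
  by (intro sum_mono, subst arctan_le_iff, intro frac_le) (use assms in auto)

lemma gap_root_polar:
  assumes "m \<ge> 1" "z \<in> gap_roots m" "Re z > 0"
  shows "modprod m (Re z) (Im z) = modprod m 1 0" "cis (argsum m (Re z) (Im z)) = 1"
proof -
  have 1: "of_real (sqrt (modprod m (Re z) (Im z))) * cis (argsum m (Re z) (Im z)) =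
    of_real (sqrt (modprod m 1 0)) * cis (argsum m 1 0)"
    using assms(2) prod_Complex_polar[of "Re z" m "Im z"] prod_Complex_polar[of 1 m 0] assms
    by (simp add: gap_roots_def one_complex.code[symmetric] del: of_nat_add)
  have nn: "modprod m s t \<ge> 0" for s t by (simp add: modprod_def prod_nonneg)
  have pos: "modprod m 1 0 > 0" unfolding modprod_def by (intro prod_pos) auto
  have 0: "argsum m 1 0 = 0" by (simp add: argsum_def)
  from arg_cong[OF 1, of cmod] show 2: "modprod m (Re z) (Im z) = modprod m 1 0"
    using nn by (simp add: norm_mult)
  show "cis (argsum m (Re z) (Im z)) = 1"
    using 1 pos by (simp add: 0 2)
qed

lemma gap_rootI:
  assumes "m \<ge> 1" "s > 0" "modprod m s t = modprod m 1 0" "cis (argsum m s t) = 1"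
  shows "Complex s t \<in> gap_roots m"
proof -
  have 0: "argsum m 1 0 = 0" by (simp add: argsum_def)
  show ?thesis
    using prod_Complex_polar[of s m t] prod_Complex_polar[of 1 m 0] assms
    by (simp add: gap_roots_def one_complex.code[symmetric] 0 del: of_nat_add)
qed

text \<open>A root with real part at least \<open>1/2\<close> in the upper half plane lies at height
  at most \<open>\<tau>\<close>, because its modulus would otherwise be too large. Moving right and
  down from \<open>(1/2, \<tau>)\<close> decreases the argument, which then lies strictly between
  \<open>0\<close> and \<open>2 * pi\<close> and cannot be a multiple of
  \<open>2 * pi\<close>.\<close>

lemma gap_roots_Re_less_half:
  assumes m: "m \<ge> 1" and z: "z \<in> gap_roots m" "z \<noteq> 1"
    and \<tau>: "\<tau> \<ge> 0" "modprod m 1 0 \<le> modprod m (1/2) \<tau>" "argsum m (1/2) \<tau> < 2 * pi"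
  shows "Re z < 1/2"
proof (rule ccontr)
  assume "\<not> Re z < 1/2"
  define w where "w = (if Im z \<ge> 0 then z else cnj z)"
  have w: "w \<in> gap_roots m" "w \<noteq> 1" "Re w \<ge> 1/2" "Im w \<ge> 0"
    using z \<open>\<not> Re z < 1/2\<close> cnj_in_gap_roots by (auto simp: w_def)
  have "Im w \<noteq> 0" using gap_roots_real[OF m w(1)] w by auto
  then have pos: "Im w > 0" using w by simp
  note polar = gap_root_polar[OF m w(1)]
  have "Im w \<le> \<tau>"
  proof (rule ccontr)
    assume "\<not> Im w \<le> \<tau>"
    then have "modprod m (1/2) \<tau> < modprod m (Re w) (Im w)"
      using \<tau> w m by (intro modprod_strict_mono) auto
    then show False using \<tau>(2) polar w by simp
  qed
  then have "argsum m (Re w) (Im w) \<le> argsum m (1/2) \<tau>"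
    using w pos by (intro argsum_mono) auto
  then have lt: "argsum m (Re w) (Im w) < 2 * pi" using \<tau> by simp
  have gt: "argsum m (Re w) (Im w) > 0"
    unfolding argsum_def using m w pos by (intro sum_pos) (auto simp: lessThan_empty_iff)
  have "cos (argsum m (Re w) (Im w)) = 1"
    using polar(2) w by (simp add: complex_eq_iff)
  then obtain n :: int where "argsum m (Re w) (Im w) = of_int n * 2 * pi"
    by (auto simp: cos_one_2pi_int)
  then have "0 < real_of_int n" "real_of_int n < 1" using lt gt by (auto simp: zero_less_mult_iff)
  then show False
    unfolding of_int_0_less_iff of_int_less_1_iff by linarith
qed

text \<open>Strict monotonicity in \<open>s\<close> gives continuity of the implicit function
  without derivatives: within the interval, \<open>y < g t\<close> is equivalent to
  \<open>f y t < c\<close>, an open condition on \<open>t\<close>, and likewise for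
  \<open>y > g t\<close>.\<close>

lemma implicit_function_mono:
  fixes f :: "real \<Rightarrow> real \<Rightarrow> real"
  assumes ab: "a \<le> b"
    and contt: "\<And>s. s \<in> {a..b} \<Longrightarrow> continuous_on T (f s)"
    and conts: "\<And>t. t \<in> T \<Longrightarrow> continuous_on {a..b} (\<lambda>s. f s t)"
    and mono: "\<And>s s' t. t \<in> T \<Longrightarrow> a \<le> s \<Longrightarrow> s < s' \<Longrightarrow> s' \<le> b \<Longrightarrow> f s t < f s' t"
    and ends: "\<And>t. t \<in> T \<Longrightarrow> f a t \<le> c" "\<And>t. t \<in> T \<Longrightarrow> c \<le> f b t"
  obtains g where "continuous_on T g" "\<And>t. t \<in> T \<Longrightarrow> g t \<in> {a..b} \<and> f (g t) t = c"
proof -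
  have "\<forall>t\<in>T. \<exists>s\<in>{a..b}. f s t = c"
    using IVT'[of "\<lambda>s. f s t" a c b for t] ends conts ab by (metis atLeastAtMost_iff)
  then obtain g where g: "\<And>t. t \<in> T \<Longrightarrow> g t \<in> {a..b} \<and> f (g t) t = c" by metis
  have "continuous_on T g"
    unfolding continuous_on_def
  proof (intro ballI order_tendstoI)
    fix t0 y assume t0: "t0 \<in> T" and y: "y < g t0"
    show "\<forall>\<^sub>F t in at t0 within T. y < g t"
    proof (cases "y < a")
      case True
      then have "\<forall>t\<in>T. y < g t" using g by force
      then show ?thesis by (simp add: eventually_at_filter)
    next
      case False
      then have yab: "y \<in> {a..b}" using y g[OF t0] by auto
      have "f y t0 < c" using mono[OF t0, of y "g t0"] y yab g[OF t0] by auto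
      then have "\<forall>\<^sub>F t in at t0 within T. f y t < c"
        using contt[OF yab] t0 by (auto simp: continuous_on_def intro: order_tendstoD)
      moreover have "\<forall>\<^sub>F t in at t0 within T. t \<in> T" by (simp add: eventually_at_filter)
      ultimately show ?thesis
      proof eventually_elim
        case (elim t)
        have "y \<noteq> g t" using elim g by force
        moreover have "\<not> g t < y" using elim g[of t] mono[of t "g t" y] yab by force
        ultimately show ?case by simp
      qed
    qed
  next
    fix t0 y assume t0: "t0 \<in> T" and y: "y > g t0"
    show "\<forall>\<^sub>F t in at t0 within T. g t < y"
    proof (cases "y > b")
      case True
      then have "\<forall>t\<in>T. y > g t" using g by force
      then show ?thesis by (simp add: eventually_at_filter)
    next
      case False
      then have yab: "y \<in> {a..b}" using y g[OF t0] by auto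
      have "f y t0 > c" using mono[OF t0, of "g t0" y] y yab g[OF t0] by auto
      then have "\<forall>\<^sub>F t in at t0 within T. f y t > c"
        using contt[OF yab] t0 by (auto simp: continuous_on_def intro: order_tendstoD)
      moreover have "\<forall>\<^sub>F t in at t0 within T. t \<in> T" by (simp add: eventually_at_filter)
      ultimately show ?thesis
      proof eventually_elim
        case (elim t)
        have "y \<noteq> g t" using elim g by force
        moreover have "\<not> g t > y" using elim g[of t] mono[of t y "g t"] yab by force
        ultimately show ?case by simp
      qed
    qed
  qed
  then show ?thesis using g that by blast
qed

text \<open>On the curve of points with the correct modulus, from \<open>1\<close> to the line
  \<open>s = 1/2\<close>, the argument varies continuously from \<open>0\<close> to more than
  \<open>2 * pi\<close>. Where it equals \<open>2 * pi\<close> there is a root. The curve is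
  parametrised by the height \<open>t\<close>, over which the modulus determines
  \<open>s\<close>.\<close>

lemma gap_roots_Re_greater_half:
  assumes m: "m \<ge> 1"
    and \<tau>: "\<tau> \<ge> 0" "modprod m (1/2) \<tau> \<le> modprod m 1 0" "2 * pi < argsum m (1/2) \<tau>"
  obtains z where "z \<in> gap_roots m" "z \<noteq> 1" "Re z > 1/2"
proof -
  have cont_mod: "continuous_on A (\<lambda>t. modprod m s t)" "continuous_on A (\<lambda>s. modprod m s t)" for A s t
    unfolding modprod_def by (intro continuous_intros)+
  \<comment> \<open>At height \<open>1 + 2 * m\<close> already the imaginary part exceeds each
    factor at \<open>1\<close>, which is at most \<open>2 * m\<close>. This supplies the upper end
    for the intermediate value theorem.\<close>
  have "modprod m 1 0 \<le> modprod m (1/2) (1 + 2 * real m)"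
    unfolding modprod_def
  proof (intro prod_mono conjI)
    fix j assume "j \<in> {..<m}"
    then have "(1 + real (m + j))\<^sup>2 \<le> (1 + 2 * real m)\<^sup>2" by (intro power_mono) auto
    then show "(1 + real (m + j))\<^sup>2 + 0\<^sup>2 \<le> (1 / 2 + real (m + j))\<^sup>2 + (1 + 2 * real m)\<^sup>2"
      by (smt (verit) zero_le_power2 zero_power2)
  qed auto
  moreover have "\<tau> \<le> 1 + 2 * real m"
  proof (rule ccontr)
    assume "\<not> ?thesis"
    then have "modprod m (1/2) (1 + 2 * real m) < modprod m (1/2) \<tau>"
      using m by (intro modprod_strict_mono) auto
    then show False using \<tau>(2) calculation by simp
  qed
  ultimately obtain \<rho> where \<rho>: "\<tau> \<le> \<rho>" "modprod m (1/2) \<rho> = modprod m 1 0"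
    using IVT'[of "modprod m (1/2)" \<tau> "modprod m 1 0" "1 + 2 * real m"] \<tau>(2) cont_mod by blast
  \<comment> \<open>Going up from \<open>\<tau>\<close> to the point \<open>\<rho>\<close> where the
    curve meets the line can only increase the argument.\<close>
  have arg\<rho>: "2 * pi < argsum m (1/2) \<rho>"
    using argsum_mono[of "1/2" "1/2" \<tau> \<rho> m] \<tau> \<rho> by simp
  obtain g where g: "continuous_on {0..\<rho>} g"
      "\<And>t. t \<in> {0..\<rho>} \<Longrightarrow> g t \<in> {1/2..1} \<and> modprod m (g t) t = modprod m 1 0"
  proof (rule implicit_function_mono[of "1/2" 1 "{0..\<rho>}" "modprod m" "modprod m 1 0"])
    fix t assume t: "t \<in> {0..\<rho>}"
    show "modprod m (1/2) t \<le> modprod m 1 0"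
      using modprod_strict_mono[of m "1/2" "1/2" t \<rho>] t m \<rho> by (cases "t = \<rho>") auto
    show "modprod m 1 0 \<le> modprod m 1 t"
      using modprod_strict_mono[of m 1 1 0 t] t m by (cases "t = 0") auto
  qed (use m cont_mod in \<open>auto intro: modprod_strict_mono\<close>)
  have inj: "s = s'" if "modprod m s t = modprod m s' t" "s > 0" "s' > 0" "t \<ge> 0" for s s' t
  proof (rule ccontr)
    assume "s \<noteq> s'"
    then consider "s < s'" | "s' < s" by linarith
    then show False
      using modprod_strict_mono[of m s s' t t] modprod_strict_mono[of m s' s t t] that m by cases auto
  qed
  have g\<rho>: "g \<rho> = 1/2"
  proof (rule inj)
    have "\<rho> \<in> {0..\<rho>}" using \<rho> \<tau> by simp
    then have "g \<rho> \<in> {1/2..1}" "modprod m (g \<rho>) \<rho> = modprod m 1 0" using g(2) by blast+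
    then show "modprod m (g \<rho>) \<rho> = modprod m (1/2) \<rho>" "g \<rho> > 0" using \<rho>(2) by auto
  qed (use \<rho> \<tau> in auto)
  have "continuous_on {0..\<rho>} (\<lambda>t. argsum m (g t) t)"
    unfolding argsum_def
  proof (intro continuous_intros g(1) ballI)
    fix j t assume "t \<in> {0..\<rho>}"
    then have "g t \<ge> 1/2" using g(2)[of t] by auto
    then have "g t + real (m + j) > 0" by (intro add_pos_nonneg) auto
    then show "g t + real (m + j) \<noteq> 0" by simp
  qed
  moreover have "argsum m (g 0) 0 = 0" by (simp add: argsum_def)
  ultimately obtain t where t: "0 \<le> t" "t \<le> \<rho>" "argsum m (g t) t = 2 * pi"
    using IVT'[of "\<lambda>t. argsum m (g t) t" 0 "2 * pi" \<rho>] arg\<rho> g\<rho> \<tau> \<rho> by auto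
  have "t \<noteq> \<rho>" using t(3) arg\<rho> g\<rho> by (metis order_less_irrefl)
  have "t \<noteq> 0" using t(3) by (auto simp: argsum_def)
  have gt: "g t \<in> {1/2..1}" "modprod m (g t) t = modprod m 1 0" using g(2)[of t] t by auto
  have "modprod m (1/2) t < modprod m 1 0"
    using modprod_strict_mono[of m "1/2" "1/2" t \<rho>] t \<open>t \<noteq> \<rho>\<close> m \<rho> by auto
  then have "g t \<noteq> 1/2" using gt(2) by (metis order_less_irrefl)
  show ?thesis
  proof (rule that)
    show "Complex (g t) t \<in> gap_roots m"
      using gt m t by (intro gap_rootI) (auto simp: complex_eq_iff)
    show "Complex (g t) t \<noteq> 1" using \<open>t \<noteq> 0\<close> by (simp add: complex_eq_iff)
    show "1/2 < Re (Complex (g t) t)" using gt \<open>g t \<noteq> 1/2\<close> by auto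
  qed
qed

section \<open>Monotonicity of the comparison in the dimension\<close>

lemma prod_double_shift:
  fixes h :: "nat \<Rightarrow> 'a::comm_monoid_mult"
  shows "(\<Prod>j<Suc m. h (Suc m + j)) * h m = (\<Prod>j<m. h (m + j)) * (h (2 * m) * h (2 * m + 1))"
proof -
  have "(\<Prod>j<Suc (Suc m). h (m + j)) = (\<Prod>j<m. h (m + j)) * (h (2 * m) * h (2 * m + 1))"
    by (simp add: mult_2 mult.assoc)
  moreover have "(\<Prod>j<Suc (Suc m). h (m + j)) = h m * (\<Prod>j<Suc m. h (Suc m + j))"
    by (subst prod.lessThan_Suc_shift) simp
  ultimately show ?thesis by (simp only: mult.commute)
qed

lemma sum_double_shift:
  fixes h :: "nat \<Rightarrow> 'a::comm_monoid_add"
  shows "(\<Sum>j<Suc m. h (Suc m + j)) + h m = (\<Sum>j<m. h (m + j)) + (h (2 * m) + h (2 * m + 1))"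
proof -
  have "(\<Sum>j<Suc (Suc m). h (m + j)) = (\<Sum>j<m. h (m + j)) + (h (2 * m) + h (2 * m + 1))"
    by (simp add: mult_2 add.assoc)
  moreover have "(\<Sum>j<Suc (Suc m). h (m + j)) = h m + (\<Sum>j<Suc m. h (Suc m + j))"
    by (subst sum.lessThan_Suc_shift) simp
  ultimately show ?thesis by (simp only: add.commute)
qed

text \<open>The modulus on the line \<open>s = 1/2\<close>, squared and divided by its value at
  \<open>1\<close>. The condition on the modulus becomes a comparison with \<open>1\<close>, which
  makes different \<open>m\<close> comparable.\<close>

definition modratio :: "nat \<Rightarrow> real \<Rightarrow> real" where
  "modratio m t = (\<Prod>j<m. ((real (m + j) + 1/2)\<^sup>2 + t\<^sup>2) / (real (m + j) + 1)\<^sup>2)"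

lemma modprod_modratio: "modprod m (1/2) t = modratio m t * modprod m 1 0"
  unfolding modprod_def modratio_def prod.distrib[symmetric]
  by (intro prod.cong refl) (simp add: add_ac)

lemma modprod_one_pos: "modprod m 1 0 > 0"
  unfolding modprod_def by (intro prod_pos) auto

text \<open>With \<open>y = 2m + 1\<close>, the point of this estimate is
  \<open>(y - 1/2 + it) (y + 1/2 + it) = y\<^sup>2 - 1/4 - t\<^sup>2 + 2ity\<close>.\<close>

lemma modratio_Suc_le:
  assumes "t^4 + t\<^sup>2 / 2 + 1/16 \<le> (2 * real m + 1)\<^sup>2 * (2 * t\<^sup>2 + 1/2)"
  shows "modratio (Suc m) t \<le> modratio m t"
proof -
  define h where "h k = ((real k + 1/2)\<^sup>2 + t\<^sup>2) / (real k + 1)\<^sup>2" for k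
  define y where "y = 2 * real m + 1"
  have y: "y \<ge> 1" by (simp add: y_def)
  have mr: "modratio m t = (\<Prod>j<m. h (m + j))" for m
    by (simp add: modratio_def h_def)
  have hpos: "h k > 0" for k unfolding h_def by (intro divide_pos_pos add_pos_nonneg) auto
  have h1: "h (2 * m) = ((y - 1/2)\<^sup>2 + t\<^sup>2) / y\<^sup>2" by (simp add: h_def y_def)
  have h2: "h (2 * m + 1) = ((y + 1/2)\<^sup>2 + t\<^sup>2) / (y + 1)\<^sup>2" by (simp add: h_def y_def add_ac)
  have h3: "h m = (y\<^sup>2 + 4 * t\<^sup>2) / (y + 1)\<^sup>2"
  proof -
    have e: "real m + 1/2 = y / 2" "real m + 1 = (y + 1) / 2" by (simp_all add: y_def field_simps)
    have "h m = ((y / 2)\<^sup>2 + t\<^sup>2) / ((y + 1) / 2)\<^sup>2" unfolding h_def e ..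
    also have "\<dots> = (y\<^sup>2 + 4 * t\<^sup>2) / (y + 1)\<^sup>2" using y by (simp add: power_divide divide_simps)
    finally show ?thesis .
  qed
  \<comment> \<open>Cleared of denominators, \<open>h (2 * m) * h (2 * m + 1) \<le> h m\<close>
    compares the squared modulus of the product described above with that of
    \<open>y * (y + 2it)\<close>; the difference is exactly the assumed inequality.\<close>
  have "((y - 1/2)\<^sup>2 + t\<^sup>2) * ((y + 1/2)\<^sup>2 + t\<^sup>2)
      = y\<^sup>2 * (y\<^sup>2 + 4 * t\<^sup>2) + (t^4 + t\<^sup>2 / 2 + 1/16) - y\<^sup>2 * (2 * t\<^sup>2 + 1/2)"
    by (simp add: power2_eq_square power4_eq_xxxx field_simps)
  also have "\<dots> \<le> y\<^sup>2 * (y\<^sup>2 + 4 * t\<^sup>2)" using assms by (simp add: y_def)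
  finally have "h (2 * m) * h (2 * m + 1) \<le> h m"
    using y unfolding h1 h2 h3 by (simp add: divide_simps) (simp add: mult_ac)
  then have "modratio (Suc m) t * h m \<le> modratio m t * h m"
    unfolding mr prod_double_shift using hpos by (intro mult_left_mono prod_nonneg) (auto intro: less_imp_le)
  then show ?thesis using hpos[of m] by simp
qed

text \<open>Subadditivity from concavity: the derivative of \<open>arctan\<close> decreases on the
  positive axis.\<close>

lemma arctan_add_le:
  assumes "a \<ge> 0" "b \<ge> 0"
  shows "arctan (a + b) \<le> arctan a + arctan b"
proof -
  have "(\<lambda>x. arctan x + arctan b - arctan (x + b)) 0 \<le> (\<lambda>x. arctan x + arctan b - arctan (x + b)) a"
  proof (rule DERIV_nonneg_imp_nondecreasing[OF assms(1)])
    fix x assume x: "0 \<le> x" "x \<le> a"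
    have "((\<lambda>x. arctan x + arctan b - arctan (x + b)) has_real_derivative
        inverse (1 + x\<^sup>2) - inverse (1 + (x + b)\<^sup>2)) (at x)"
      by (auto intro!: derivative_eq_intros)
    moreover have "inverse (1 + (x + b)\<^sup>2) \<le> inverse (1 + x\<^sup>2)"
      using x assms by (intro le_imp_inverse_le add_left_mono power_mono) (auto intro: add_pos_nonneg)
    ultimately show "\<exists>y. ((\<lambda>x. arctan x + arctan b - arctan (x + b)) has_real_derivative y) (at x) \<and> 0 \<le> y"
      by - (rule exI, rule conjI, assumption, simp)
  qed
  then show ?thesis by simp
qed

lemma arctan_upper_bound:
  assumes "a \<ge> 0"
  shows "arctan a \<le> a - a^3 / 3 + a^5 / 5"
proof -
  have "(\<lambda>x. x - x^3 / 3 + x^5 / 5 - arctan x) 0 \<le> (\<lambda>x. x - x^3 / 3 + x^5 / 5 - arctan x) a"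
  proof (rule DERIV_nonneg_imp_nondecreasing[OF assms(1)])
    fix x :: real
    have "((\<lambda>x. x - x^3 / 3 + x^5 / 5 - arctan x) has_real_derivative
        1 - x\<^sup>2 + x^4 - inverse (1 + x\<^sup>2)) (at x)"
      by (auto intro!: derivative_eq_intros simp: power2_eq_square)
    moreover have "(1 - x\<^sup>2 + x^4) * (1 + x\<^sup>2) = 1 + x^6"
      by algebra
    then have "inverse (1 + x\<^sup>2) \<le> 1 - x\<^sup>2 + x^4"
      by (simp add: inverse_eq_divide pos_divide_le_eq add_pos_nonneg)
    ultimately show "\<exists>y. ((\<lambda>x. x - x^3 / 3 + x^5 / 5 - arctan x) has_real_derivative y) (at x) \<and> 0 \<le> y"
      by - (rule exI, rule conjI, assumption, simp)
  qed
  then show ?thesis by simp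
qed

lemma arctan_lower_bound:
  assumes "a \<ge> 0"
  shows "a - a^3 / 3 \<le> arctan a"
proof -
  have "(\<lambda>x. arctan x - (x - x^3 / 3)) 0 \<le> (\<lambda>x. arctan x - (x - x^3 / 3)) a"
  proof (rule DERIV_nonneg_imp_nondecreasing[OF assms(1)])
    fix x :: real
    have "((\<lambda>x. arctan x - (x - x^3 / 3)) has_real_derivative
        inverse (1 + x\<^sup>2) - (1 - x\<^sup>2)) (at x)"
      by (auto intro!: derivative_eq_intros simp: power2_eq_square)
    moreover have "(1 - x\<^sup>2) * (1 + x\<^sup>2) = 1 - x^4"
      by (simp add: power2_eq_square power4_eq_xxxx algebra_simps)
    then have "1 - x\<^sup>2 \<le> inverse (1 + x\<^sup>2)"
      by (simp add: inverse_eq_divide pos_le_divide_eq add_pos_nonneg)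
    ultimately show "\<exists>y. ((\<lambda>x. arctan x - (x - x^3 / 3)) has_real_derivative y) (at x) \<and> 0 \<le> y"
      by - (rule exI, rule conjI, assumption, simp)
  qed
  then show ?thesis by simp
qed

text \<open>With \<open>y = 2m + 1\<close>, the sum loses the arctangent of \<open>2t/y\<close> and
  gains those of \<open>t/(y - 1/2)\<close> and \<open>t/(y + 1/2)\<close>. The latter two arguments
  add up to \<open>2ty/(y\<^sup>2 - 1/4) \<ge> 2t/y\<close>, and subadditivity concludes.\<close>

lemma argsum_Suc_ge:
  assumes t: "t \<ge> 0"
  shows "argsum m (1/2) t \<le> argsum (Suc m) (1/2) t"
proof -
  define h where "h k = arctan (t / (1/2 + real k))" for k
  define y where "y = 2 * real m + 1"
  have y: "y \<ge> 1" by (simp add: y_def)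
  have ar: "argsum m (1/2) t = (\<Sum>j<m. h (m + j))" for m
    by (simp add: argsum_def h_def)
  have h1: "h (2 * m) = arctan (t / (y - 1/2))" by (simp add: h_def y_def)
  have h2: "h (2 * m + 1) = arctan (t / (y + 1/2))" by (simp add: h_def y_def add_ac)
  have h3: "h m = arctan (2 * t / y)"
  proof -
    have "1/2 + real m = y / 2" by (simp add: y_def field_simps)
    then show ?thesis by (simp only: h_def) (simp add: mult.commute)
  qed
  have "(y - 1/2) * (y + 1/2) \<le> y * y" by (simp add: algebra_simps)
  moreover have "(y - 1/2) * (y + 1/2) > 0" using y by (intro mult_pos_pos) auto
  ultimately have "2 * t * y / (y * y) \<le> 2 * t * y / ((y - 1/2) * (y + 1/2))"
    using t y by (intro divide_left_mono mult_pos_pos mult_nonneg_nonneg) auto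
  also have "\<dots> = t / (y - 1/2) + t / (y + 1/2)"
    using y by (simp add: add_frac_eq algebra_simps)
  finally have "h m \<le> arctan (t / (y - 1/2) + t / (y + 1/2))"
    unfolding h3 arctan_le_iff using y by simp
  also have "\<dots> \<le> h (2 * m) + h (2 * m + 1)"
    unfolding h1 h2 using t y by (intro arctan_add_le) auto
  finally show ?thesis unfolding ar using sum_double_shift[of h m] by linarith
qed

section \<open>Numerics at the dimensions 59 and 60\<close>

lemma modratio_prod_nat:
  "modratio m (real n / 16) =
     real (\<Prod>j<m. 64 * (2 * (m + j) + 1)\<^sup>2 + n\<^sup>2) / real (\<Prod>j<m. 256 * (m + j + 1)\<^sup>2)"
proof -
  have "((real k + 1/2)\<^sup>2 + (real n / 16)\<^sup>2) / (real k + 1)\<^sup>2 =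
     real (64 * (2 * k + 1)\<^sup>2 + n\<^sup>2) / real (256 * (k + 1)\<^sup>2)" for k
    by (simp add: field_simps power2_eq_square)
  from this[of "m + j" for j] show ?thesis
    unfolding modratio_def of_nat_prod prod_dividef[symmetric] by simp
qed

text \<open>The numerical bounds are obtained from integer arithmetic with directed rounding, since the
  exact rational products and sums are too large.\<close>

primrec prod_floor :: "(nat \<Rightarrow> nat) \<Rightarrow> (nat \<Rightarrow> nat) \<Rightarrow> nat \<Rightarrow> nat \<Rightarrow> nat \<Rightarrow> nat" where
  "prod_floor p q 0 k x = x"
| "prod_floor p q (Suc n) k x = prod_floor p q n (k + 1) (x * p k div q k)"

primrec prod_ceil :: "(nat \<Rightarrow> nat) \<Rightarrow> (nat \<Rightarrow> nat) \<Rightarrow> nat \<Rightarrow> nat \<Rightarrow> nat \<Rightarrow> nat" where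
  "prod_ceil p q 0 k x = x"
| "prod_ceil p q (Suc n) k x = prod_ceil p q n (k + 1) (x * p k div q k + 1)"

lemma prod_floor_numeral:
  "prod_floor p q (numeral n) k x = prod_floor p q (pred_numeral n) (k + 1) (x * p k div q k)"
  by (simp add: numeral_eq_Suc)

lemma prod_ceil_numeral:
  "prod_ceil p q (numeral n) k x = prod_ceil p q (pred_numeral n) (k + 1) (x * p k div q k + 1)"
  by (simp add: numeral_eq_Suc)

lemma prod_floor_le:
  "real (prod_floor p q n k x) \<le> real x * (\<Prod>j<n. real (p (k + j)) / real (q (k + j)))"
proof (induction n arbitrary: k x)
  case (Suc n)
  have "real (x * p k div q k) \<le> real (x * p k) / real (q k)" by (rule of_nat_div_le_of_nat)
  then have "real (x * p k div q k) * (\<Prod>j<n. real (p (Suc k + j)) / real (q (Suc k + j))) \<le>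
    real (x * p k) / real (q k) * (\<Prod>j<n. real (p (Suc k + j)) / real (q (Suc k + j)))"
    by (intro mult_right_mono prod_nonneg) auto
  also have "\<dots> = real x * (\<Prod>j<Suc n. real (p (k + j)) / real (q (k + j)))"
    by (subst prod.lessThan_Suc_shift) simp
  finally show ?case using Suc[of "k + 1" "x * p k div q k"] by simp
qed simp

lemma prod_ceil_ge:
  "real x * (\<Prod>j<n. real (p (k + j)) / real (q (k + j))) \<le> real (prod_ceil p q n k x)"
proof (induction n arbitrary: k x)
  case (Suc n)
  have "real (x * p k) / real (q k) \<le> real (x * p k div q k + 1)"
    using real_of_int_div3[of "int (x * p k)" "int (q k)"]
    by (simp only: of_int_of_nat_eq zdiv_int[symmetric] of_nat_add)
  then have "real (x * p k) / real (q k) * (\<Prod>j<n. real (p (Suc k + j)) / real (q (Suc k + j))) \<le>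
    real (x * p k div q k + 1) * (\<Prod>j<n. real (p (Suc k + j)) / real (q (Suc k + j)))"
    by (intro mult_right_mono prod_nonneg) auto
  moreover have "real (x * p k) / real (q k) * (\<Prod>j<n. real (p (Suc k + j)) / real (q (Suc k + j))) =
      real x * (\<Prod>j<Suc n. real (p (k + j)) / real (q (k + j)))"
    by (subst prod.lessThan_Suc_shift) simp
  ultimately show ?case using Suc[of "x * p k div q k + 1" "k + 1"] by simp
qed simp

text \<open>\<open>10 ^ 7\<close> represents \<open>1\<close> in fixed-point arithmetic. The heights
  \<open>145/16\<close> and \<open>73/8 = 146/16\<close> are test points: at the first, for
  \<open>m = 59\<close>, the modulus is already large enough while the argument is still below
  \<open>2 * pi\<close>; at the second, for \<open>m = 60\<close>, the modulus is not yet too large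
  while the argument exceeds \<open>2 * pi\<close>.\<close>

lemma modratio_59: "1 \<le> modratio 59 (145/16)"
proof -
  let ?p = "\<lambda>k. 64 * (2 * k + 1)\<^sup>2 + 145\<^sup>2" and ?q = "\<lambda>k. 256 * (k + 1)\<^sup>2"
  have "10 ^ 7 \<le> prod_floor ?p ?q 59 59 (10 ^ 7)"
    by (simp add: prod_floor_numeral)
  then have "10 ^ 7 \<le> real (prod_floor ?p ?q 59 59 (10 ^ 7))"
    by (metis of_nat_le_iff of_nat_numeral of_nat_power)
  also have "\<dots> \<le> real (10 ^ 7) * modratio 59 (145/16)"
    using prod_floor_le[where x = "10 ^ 7" and p = ?p and q = ?q and n = 59 and k = 59] modratio_prod_nat[of 59 145]
    by (simp only: of_nat_prod prod_dividef of_nat_numeral)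
  finally show ?thesis by simp
qed

lemma modratio_60: "modratio 60 (73/8) \<le> 1"
proof -
  let ?p = "\<lambda>k. 64 * (2 * k + 1)\<^sup>2 + 146\<^sup>2" and ?q = "\<lambda>k. 256 * (k + 1)\<^sup>2"
  have e: "(73/8 :: real) = real 146 / 16" by simp
  have "real (10 ^ 7) * modratio 60 (73/8) \<le> real (prod_ceil ?p ?q 60 60 (10 ^ 7))"
    using prod_ceil_ge[where x = "10 ^ 7" and p = ?p and q = ?q and n = 60 and k = 60] modratio_prod_nat[of 60 146] unfolding e
    by (simp only: of_nat_prod prod_dividef of_nat_numeral)
  also have "prod_ceil ?p ?q 60 60 (10 ^ 7) \<le> 10 ^ 7"
    by (simp add: prod_ceil_numeral)
  finally show ?thesis by simp
qed

lemma of_int_div_bounds: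
  fixes a b :: int
  assumes "b > 0"
  shows "real_of_int (a div b) \<le> of_int a / of_int b" "of_int a / of_int b \<le> real_of_int (a div b + 1)"
  using real_of_int_div4[of a b] real_of_int_div3[of a b] by auto

lemma argsum_59: "argsum 59 (1/2) (145/16) < 2 * pi"
proof -
  \<comment> \<open>\<open>f k\<close> is an integer upper bound of \<open>10 ^ 6\<close> times the
    Taylor bound at \<open>145 / (8 * k)\<close>. It is used at odd numbers, because
    \<open>(145/16) / (1/2 + k) = 145 / (8 * (2 * k + 1))\<close>.\<close>
  define f :: "int \<Rightarrow> int" where
    "f k = 10 ^ 6 * (15 * 145 * (8 * k) ^ 4 - 5 * 145 ^ 3 * (8 * k)\<^sup>2 + 3 * 145 ^ 5) div (15 * (8 * k) ^ 5) + 1" for k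
  have "arctan ((145/16) / (1/2 + real k)) \<le> of_int (f (2 * int k + 1)) / 10 ^ 6" for k
  proof -
    define q where "q = 8 * (2 * int k + 1)"
    have q: "q > 0" by (simp add: q_def)
    have "(145/16) / (1/2 + real k) = 145 / real_of_int q" by (simp add: q_def field_simps)
    then have "arctan ((145/16) / (1/2 + real k)) \<le> 145 / real_of_int q - (145 / real_of_int q)^3 / 3 + (145 / real_of_int q)^5 / 5"
      using arctan_upper_bound[of "145 / real_of_int q"] q by simp
    also have "\<dots> = (15 * 145 * real_of_int q ^ 4 - 5 * 145 ^ 3 * (real_of_int q)\<^sup>2 + 3 * 145 ^ 5) / (15 * real_of_int q ^ 5)"
      using q by (simp add: field_simps eval_nat_numeral)
    also have "10 ^ 6 * \<dots> = real_of_int (10 ^ 6 * (15 * 145 * q ^ 4 - 5 * 145 ^ 3 * q\<^sup>2 + 3 * 145 ^ 5)) / real_of_int (15 * q ^ 5)"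
      by simp
    also have "\<dots> \<le> of_int (f (2 * int k + 1))"
      unfolding f_def q_def[symmetric] using q by (intro of_int_div_bounds) simp
    finally show ?thesis by simp
  qed
  then have "argsum 59 (1/2) (145/16) \<le> (\<Sum>j<59. of_int (f (2 * int (59 + j) + 1)) / 10 ^ 6)"
    unfolding argsum_def by (intro sum_mono) blast
  also have "\<dots> = of_int (\<Sum>j<59. f (2 * int (59 + j) + 1)) / 10 ^ 6"
    by (simp add: sum_divide_distrib)
  also have "(\<Sum>j<59. f (2 * int (59 + j) + 1)) \<le> 6280000"
    by (simp add: lessThan_nat_numeral f_def)
  finally show ?thesis using pi_approx by simp
qed

lemma argsum_60: "2 * pi < argsum 60 (1/2) (73/8)"
proof -
  \<comment> \<open>As for \<open>m = 59\<close>, with the cubic lower bound at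
    \<open>146 / (8 * k)\<close> and with division that rounds down.\<close>
  define f :: "int \<Rightarrow> int" where
    "f k = 10 ^ 6 * (3 * 146 * (8 * k)\<^sup>2 - 146 ^ 3) div (3 * (8 * k) ^ 3)" for k
  have "of_int (f (2 * int k + 1)) / 10 ^ 6 \<le> arctan ((73/8) / (1/2 + real k))" for k
  proof -
    define q where "q = 8 * (2 * int k + 1)"
    have q: "q > 0" by (simp add: q_def)
    have "of_int (f (2 * int k + 1)) \<le> real_of_int (10 ^ 6 * (3 * 146 * q\<^sup>2 - 146 ^ 3)) / real_of_int (3 * q ^ 3)"
      unfolding f_def q_def[symmetric] using q by (intro of_int_div_bounds) simp
    also have "\<dots> = 10 ^ 6 * ((3 * 146 * (real_of_int q)\<^sup>2 - 146 ^ 3) / (3 * real_of_int q ^ 3))"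
      by simp
    also have "(3 * 146 * (real_of_int q)\<^sup>2 - 146 ^ 3) / (3 * real_of_int q ^ 3) = 146 / real_of_int q - (146 / real_of_int q)^3 / 3"
      using q by (simp add: field_simps eval_nat_numeral)
    also have "\<dots> \<le> arctan (146 / real_of_int q)"
      using q by (intro arctan_lower_bound) simp
    also have "146 / real_of_int q = (73/8) / (1/2 + real k)" by (simp add: q_def field_simps)
    finally show ?thesis by simp
  qed
  then have "(\<Sum>j<60. of_int (f (2 * int (60 + j) + 1)) / 10 ^ 6) \<le> argsum 60 (1/2) (73/8)"
    unfolding argsum_def by (intro sum_mono) blast
  moreover have "(\<Sum>j<60. real_of_int (f (2 * int (60 + j) + 1)) / 10 ^ 6) = of_int (\<Sum>j<60. f (2 * int (60 + j) + 1)) / 10 ^ 6"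
    by (simp add: sum_divide_distrib)
  moreover have "6284000 \<le> (\<Sum>j<60. f (2 * int (60 + j) + 1))"
    by (simp add: lessThan_nat_numeral f_def)
  then have "6284000 \<le> real_of_int (\<Sum>j<60. f (2 * int (60 + j) + 1))"
    by (metis of_int_le_iff of_int_numeral)
  ultimately have "6.284 \<le> argsum 60 (1/2) (73/8)" by (simp add: pos_divide_le_eq)
  then show ?thesis using pi_approx by simp
qed

text \<open>One test height serves the whole range: going down from \<open>59\<close>, the
  normalised modulus at this height only grows, apart from the case \<open>m = 2\<close>, and the
  argument only shrinks.\<close>

lemma gap_roots_small_phases:
  assumes "2 \<le> m" "m \<le> 59" "z \<in> gap_roots m" "z \<noteq> 1"
  shows "Re z < 1/2"
proof (rule gap_roots_Re_less_half[of m z "145/16"])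
  show "modprod m 1 0 \<le> modprod m (1/2) (145/16)"
  \<comment> \<open>At this height the monotonicity estimate holds from \<open>2 * n + 1 = 7\<close>
    on but not at \<open>2 * n + 1 = 5\<close>, so the smallest dimension is computed
    directly.\<close>
  proof (cases "m = 2")
    case True
    then show ?thesis by (simp add: modprod_def eval_nat_numeral)
  next
    case False
    have "modratio 59 (145/16) \<le> modratio m (145/16)"
    proof (rule dec_induct[OF assms(2), where P = "\<lambda>n. modratio n (145/16) \<le> modratio m (145/16)"])
      fix n assume n: "m \<le> n" "modratio n (145/16) \<le> modratio m (145/16)"
      have "(7::real)\<^sup>2 \<le> (2 * real n + 1)\<^sup>2" using n False assms by (intro power_mono) auto
      then have "modratio (Suc n) (145/16) \<le> modratio n (145/16)"
        by (intro modratio_Suc_le) (simp add: eval_nat_numeral)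
      then show "modratio (Suc n) (145/16) \<le> modratio m (145/16)" using n by simp
    qed simp
    then show ?thesis
      using modratio_59 modprod_one_pos[of m] by (simp add: modprod_modratio)
  qed
  have "argsum m (1/2) (145/16) \<le> argsum 59 (1/2) (145/16)"
    by (rule dec_induct[OF assms(2), where P = "\<lambda>n. argsum m (1/2) (145/16) \<le> argsum n (1/2) (145/16)"])
       (rule order_refl, erule order_trans, rule argsum_Suc_ge, simp)
  then show "argsum m (1/2) (145/16) < 2 * pi" using argsum_59 by simp
qed (use assms in auto)

lemma gap_roots_large_phases:
  assumes "60 \<le> m"
  obtains z where "z \<in> gap_roots m" "z \<noteq> 1" "Re z > 1/2"
proof (rule gap_roots_Re_greater_half[of m "73/8"])
  have "modratio m (73/8) \<le> modratio 60 (73/8)"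
  proof (rule dec_induct[OF assms, where P = "\<lambda>n. modratio n (73/8) \<le> modratio 60 (73/8)"])
    fix n :: nat assume n: "60 \<le> n" "modratio n (73/8) \<le> modratio 60 (73/8)"
    have "(121::real)\<^sup>2 \<le> (2 * real n + 1)\<^sup>2" using n by (intro power_mono) auto
    then have "modratio (Suc n) (73/8) \<le> modratio n (73/8)"
      by (intro modratio_Suc_le) (simp add: eval_nat_numeral)
    then show "modratio (Suc n) (73/8) \<le> modratio 60 (73/8)" using n by simp
  qed simp
  then show "modprod m (1/2) (73/8) \<le> modprod m 1 0"
    using modratio_60 modprod_one_pos[of m] by (simp add: modprod_modratio)
  have "argsum 60 (1/2) (73/8) \<le> argsum m (1/2) (73/8)"
    by (rule dec_induct[OF assms, where P = "\<lambda>n. argsum 60 (1/2) (73/8) \<le> argsum n (1/2) (73/8)"])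
       (rule order_refl, erule order_trans, rule argsum_Suc_ge, simp)
  then show "2 * pi < argsum m (1/2) (73/8)" using argsum_60 by simp
qed (use assms that in auto)

section \<open>Eigenforms and eigenvectors\<close>

definition eig_coeff :: "nat \<Rightarrow> 'a::field \<Rightarrow> nat \<Rightarrow> 'a" where
  "eig_coeff m z k = (\<Prod>j<k-1. (z + of_nat m + of_nat j) / (1 + of_nat m + of_nat j))"

lemma eig_form_eq: "eig_form m z x = (\<Sum>k=1..m. eig_coeff m z k * x k)"
  by (simp add: eig_form_def eig_coeff_def)

lemma one_plus_of_nat_neq_0:
  "1 + of_nat m + of_nat j \<noteq> (0 :: 'a::field_char_0)"
  by (metis of_nat_add of_nat_Suc of_nat_eq_0_iff nat.distinct(1) add.commute add_Suc_right)

lemma eig_coeff_1: "eig_coeff m z (Suc 0) = 1"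
  by (simp add: eig_coeff_def)

lemma eig_coeff_Suc:
  assumes "k \<ge> 1"
  shows "eig_coeff m (z::complex) (Suc k) * of_nat (m + k) = eig_coeff m z k * (z + of_nat (m + k - 1))"
proof -
  obtain i where i: "k = Suc i" using assms by (cases k) auto
  have "(1 + of_nat m + of_nat i :: complex) \<noteq> 0" by (rule one_plus_of_nat_neq_0)
  then show ?thesis
    by (simp add: eig_coeff_def i field_simps)
qed

lemma repl_mat_row_sum:
  assumes "m \<ge> 2" "k \<in> {1..m}"
  shows "(\<Sum>j=1..m. of_real (repl_mat m k j) * f j) =
     - of_nat (m + k - 1) * f k + (if k < m then of_nat (m + k) * f (k + 1) else of_nat (2 * m) * (f 1 :: complex))"
proof -
  have "(\<Sum>j=1..m. of_real (repl_mat m k j) * f j) =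
    (\<Sum>j=1..m. (if j = k then - of_nat (m + k - 1) * f k else 0) +
       (if k < m \<and> j = k + 1 then of_nat (m + k) * f (k + 1) else 0) +
       (if k = m \<and> j = 1 then of_nat (2 * m) * f 1 else 0))"
    using assms by (intro sum.cong refl) (auto simp: repl_mat_def)
  also have "\<dots> = - of_nat (m + k - 1) * f k + (if k < m then of_nat (m + k) * f (k + 1) else of_nat (2 * m) * f 1)"
    using assms by (cases "k < m") (auto simp: sum.distrib)
  finally show ?thesis .
qed

text \<open>The rows before the last one are the recursion of the coefficients and hold for every
  \<open>z\<close>. The last row closes the cycle through the entry \<open>2 * m\<close>, and there
  the characteristic equation enters.\<close>

lemma eig_form_row:
  assumes m: "m \<ge> 2" and z: "z \<in> gap_roots m" and k: "k \<in> {1..m}"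
  shows "(\<Sum>j=1..m. eig_coeff m z j * of_real (repl_mat m k j)) = z * eig_coeff m z k"
proof -
  have "(\<Sum>j=1..m. eig_coeff m z j * of_real (repl_mat m k j)) =
    - of_nat (m + k - 1) * eig_coeff m z k +
      (if k < m then of_nat (m + k) * eig_coeff m z (k + 1) else of_nat (2 * m) * eig_coeff m z 1)"
    using repl_mat_row_sum[OF m k, of "eig_coeff m z"] by (simp only: mult.commute)
  also have "\<dots> = z * eig_coeff m z k"
  proof (cases "k < m")
    case True
    then show ?thesis
      using eig_coeff_Suc[of k m z] k by (simp add: algebra_simps)
  next
    case False
    then have km: "k = m" using k by simp
    obtain i where i: "m = Suc i" using m by (cases m) auto
    have "(\<Prod>j<m. (z + of_nat (m + j)) / (1 + of_nat (m + j))) = 1"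
      using z gap_root_factor_nz[OF one_in_gap_roots, of _ m]
      by (subst prod_dividef) (simp add: gap_roots_def del: of_nat_add)
    then have "eig_coeff m z m * ((z + of_nat (m + i)) / (1 + of_nat (m + i))) = 1"
      unfolding i eig_coeff_def by (simp add: add_ac)
    moreover have "(1 + of_nat (m + i) :: complex) = of_nat (2 * m)" by (simp add: i)
    moreover have "(of_nat (2 * m) :: complex) \<noteq> 0" using m by simp
    ultimately have "eig_coeff m z m * (z + of_nat (m + i)) = of_nat (2 * m)"
      by (simp add: field_simps)
    moreover have "m + k - 1 = m + i" by (simp add: km i)
    ultimately show ?thesis
      using False by (simp add: km eig_coeff_1 algebra_simps)
  qed
  finally show ?thesis .
qed

lemma eig_vec_Suc:
  assumes z: "z \<in> gap_roots m" and "1 \<le> k" "k < m"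
  shows "eig_vec m z (Suc k) * (of_nat (m + k) + z) = of_nat (m + k) * eig_vec m z k"
proof -
  have "z + of_nat (m + k) \<noteq> 0" using gap_root_factor_nz[OF z] assms by simp
  then have "of_nat m + of_nat k + z \<noteq> 0" by (simp add: add_ac)
  then show ?thesis using assms by (simp add: eig_vec_def)
qed

text \<open>For the eigenvector the characteristic equation enters in the first column, which
  receives the contribution of the last coordinate.\<close>

lemma eig_vec_last:
  assumes m: "m \<ge> 2" and z: "z \<in> gap_roots m"
  shows "eig_vec m z m * of_nat (2 * m) = (of_nat m + z) * eig_vec m z 1"
proof -
  obtain i where i: "m = Suc i" using m by (cases m) auto
  have 1: "(\<Prod>j=1..<m. f (m + j)) * f m = (\<Prod>j<m. f (m + j))" for f :: "nat \<Rightarrow> complex"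
    unfolding i lessThan_atLeast0 by (subst prod.atLeast_Suc_lessThan[of 0]) (auto simp: mult_ac)
  have 2: "(\<Prod>j<m. 1 + of_nat (m + j)) = (\<Prod>j=1..<m. of_nat (m + j)) * (of_nat (2 * m) :: complex)"
  proof -
    have "(\<Prod>j<m. 1 + of_nat (m + j)) = (\<Prod>j<Suc i. of_nat (m + Suc j) :: complex)"
      by (intro prod.cong) (auto simp: i)
    also have "\<dots> = (\<Prod>j<i. of_nat (m + Suc j)) * of_nat (2 * m)"
      using i by (simp only: prod.lessThan_Suc) simp
    also have "(\<Prod>j<i. of_nat (m + Suc j)) = (\<Prod>j=1..<m. of_nat (m + j) :: complex)"
      by (rule prod.reindex_bij_witness[where i = "\<lambda>j. j - 1" and j = Suc]) (auto simp: i)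
    finally show ?thesis .
  qed
  let ?A = "\<Prod>j=1..<m. (of_nat (m + j) :: complex)" and ?B = "\<Prod>j=1..<m. z + of_nat (m + j)"
  have Bnz: "?B \<noteq> 0" using gap_root_factor_nz[OF z] by (simp del: of_nat_add)
  have "?B * (z + of_nat m) = ?A * of_nat (2 * m)"
    using z 1[of "\<lambda>k. z + of_nat k"] unfolding gap_roots_def 2 by simp
  then have "?A / ?B * of_nat (2 * m) = of_nat m + z"
    using Bnz by (metis add.commute nonzero_mult_div_cancel_left times_divide_eq_left)
  moreover have "(\<Prod>j=1..<m. (of_nat m + of_nat j) / (of_nat m + of_nat j + z)) = ?A / ?B"
    by (simp add: prod_dividef add_ac)
  ultimately have "(\<Prod>j=1..<m. (of_nat m + of_nat j) / (of_nat m + of_nat j + z)) * of_nat (2 * m) = of_nat m + z"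
    by metis
  then show ?thesis by (simp add: eig_vec_def del: of_nat_mult)
qed

lemma repl_mat_col_sum:
  assumes "m \<ge> 2" "j \<in> {1..m}"
  shows "(\<Sum>k=1..m. of_real (repl_mat m k j) * f k) =
     - of_nat (m + j - 1) * f j + (if j > 1 then of_nat (m + j - 1) * f (j - 1) else of_nat (2 * m) * (f m :: complex))"
proof -
  have "(\<Sum>k=1..m. of_real (repl_mat m k j) * f k) =
    (\<Sum>k=1..m. (if k = j then - of_nat (m + j - 1) * f j else 0) +
       (if k = j - 1 then (if j > 1 then of_nat (m + j - 1) * f (j - 1) else 0) else 0) +
       (if k = m then (if j = 1 then of_nat (2 * m) * f m else 0) else 0))"
    using assms by (intro sum.cong refl) (auto simp: repl_mat_def)
  also have "\<dots> = - of_nat (m + j - 1) * f j + (if j > 1 then of_nat (m + j - 1) * f (j - 1) else of_nat (2 * m) * f m)"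
    using assms by (cases "j > 1") (auto simp: sum.distrib)
  finally show ?thesis .
qed

lemma eig_vec_col:
  assumes m: "m \<ge> 2" and z: "z \<in> gap_roots m" and j: "j \<in> {1..m}"
  shows "(\<Sum>k=1..m. of_real (repl_mat m k j) * eig_vec m z k) = z * eig_vec m z j"
proof (cases "j > 1")
  case True
  then obtain i where i: "j = Suc i" "1 \<le> i" "i < m" using j by (cases j) auto
  then show ?thesis
    unfolding repl_mat_col_sum[OF m j] using True eig_vec_Suc[OF z, of i]
    by (simp add: algebra_simps)
next
  case False
  then have "j = 1" using j by simp
  then show ?thesis
    unfolding repl_mat_col_sum[OF m j] using eig_vec_last[OF m z]
    by (simp add: algebra_simps)
qed

text \<open>The double sum of form, matrix and vector is evaluated from both sides, once as
  \<open>z\<close> and once as \<open>w\<close> times the pairing.\<close>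

lemma eig_orthogonal:
  assumes m: "m \<ge> 2" and z: "z \<in> gap_roots m" and w: "w \<in> gap_roots m" and "z \<noteq> w"
  shows "eig_form m z (eig_vec m w) = 0"
proof -
  have "z * eig_form m z (eig_vec m w) = (\<Sum>k=1..m. (z * eig_coeff m z k) * eig_vec m w k)"
    by (simp add: eig_form_eq sum_distrib_left mult.assoc)
  also have "\<dots> = (\<Sum>k=1..m. \<Sum>j=1..m. eig_coeff m z j * of_real (repl_mat m k j) * eig_vec m w k)"
    by (intro sum.cong refl) (simp add: eig_form_row[OF m z, symmetric] sum_distrib_right)
  also have "\<dots> = (\<Sum>j=1..m. eig_coeff m z j * (\<Sum>k=1..m. of_real (repl_mat m k j) * eig_vec m w k))"
    by (subst sum.swap) (simp add: sum_distrib_left mult.assoc)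
  also have "\<dots> = (\<Sum>j=1..m. eig_coeff m z j * (w * eig_vec m w j))"
    by (intro sum.cong refl) (simp only: eig_vec_col[OF m w])
  also have "\<dots> = w * eig_form m z (eig_vec m w)"
    by (simp add: eig_form_eq sum_distrib_left mult_ac)
  finally show ?thesis using \<open>z \<noteq> w\<close> by simp
qed

text \<open>The recursions of form and vector cancel up to the factors \<open>z + m + i\<close>, so
  the \<open>i\<close>-th product of coordinates is a constant times \<open>1 / (z + m + i)\<close>.
  These add up to the \<open>H_sum\<close> in the normalisation of \<open>eig_vec\<close>.\<close>

lemma eig_normalized:
  assumes m: "m \<ge> 2" and z: "z \<in> gap_roots m"
  shows "eig_form m z (eig_vec m z) = 1"
proof -
  have fz: "z + of_nat (m + j) \<noteq> 0" if "j < m" for j using gap_root_factor_nz[OF z that] .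
  define c where "c = 1 / ((of_nat m + z) * H_sum m (of_nat m + z - 1))"
  have prod: "eig_coeff m z (Suc i) * eig_vec m z (Suc i) = c * ((of_nat m + z) / (z + of_nat (m + i)))"
    if "i < m" for i
    using that
  proof (induction i)
    case 0
    then show ?case using fz[of 0] by (simp add: eig_coeff_def eig_vec_def c_def add_ac)
  next
    case (Suc i)
    have a: "eig_coeff m z (Suc (Suc i)) * of_nat (m + Suc i) = eig_coeff m z (Suc i) * (z + of_nat (m + i))"
      using eig_coeff_Suc[of "Suc i" m z] by simp
    have b: "eig_vec m z (Suc (Suc i)) * (z + of_nat (m + Suc i)) = of_nat (m + Suc i) * eig_vec m z (Suc i)"
      using eig_vec_Suc[OF z, of "Suc i"] Suc.prems by (simp add: add_ac)
    have nz: "(of_nat (m + Suc i) :: complex) \<noteq> 0" "z + of_nat (m + Suc i) \<noteq> 0" "z + of_nat (m + i) \<noteq> 0"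
      using fz[of i] fz[of "Suc i"] Suc.prems of_nat_eq_0_iff[of "m + Suc i", where 'a = complex] by auto
    have "eig_coeff m z (Suc (Suc i)) * eig_vec m z (Suc (Suc i)) * (of_nat (m + Suc i) * (z + of_nat (m + Suc i)))
       = (eig_coeff m z (Suc i) * (z + of_nat (m + i))) * (of_nat (m + Suc i) * eig_vec m z (Suc i))"
      unfolding a[symmetric] b[symmetric] by (simp only: mult_ac)
    also have "\<dots> = of_nat (m + Suc i) * ((z + of_nat (m + i)) * (eig_coeff m z (Suc i) * eig_vec m z (Suc i)))"
      by (simp only: mult_ac)
    also have "\<dots> = of_nat (m + Suc i) * (c * (of_nat m + z))"
      using Suc nz by simp
    finally have "eig_coeff m z (Suc (Suc i)) * eig_vec m z (Suc (Suc i)) * (z + of_nat (m + Suc i)) = c * (of_nat m + z)"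
      using nz(1) by (metis (no_types, lifting) mult.left_commute mult_left_cancel)
    then show ?case using nz(2) by (simp only: eq_divide_eq times_divide_eq_right) simp
  qed
  have shift: "(\<Sum>k=1..m. f k) = (\<Sum>i<m. f (Suc i))" for f :: "nat \<Rightarrow> complex"
    by (rule sum.reindex_bij_witness[where i = Suc and j = "\<lambda>k. k - 1"]) auto
  have H: "H_sum m (of_nat m + z - 1) = (\<Sum>i<m. 1 / (z + of_nat (m + i)))"
    unfolding H_sum_def shift by (intro sum.cong refl) (simp add: add_ac)
  have "eig_form m z (eig_vec m z) = (\<Sum>i<m. c * ((of_nat m + z) / (z + of_nat (m + i))))"
    unfolding eig_form_eq shift by (intro sum.cong refl prod) auto
  also have "\<dots> = c * (of_nat m + z) * H_sum m (of_nat m + z - 1)"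
    unfolding H sum_distrib_left by (intro sum.cong refl) simp
  also have "\<dots> = 1"
    using gap_root_H_nz[OF _ z] fz[of 0] m unfolding c_def H by (simp add: add_ac)
  finally show ?thesis .
qed

text \<open>As a function of \<open>z\<close>, \<open>eig_form m z y\<close> is a polynomial of degree less than \<open>m\<close> with \<open>m\<close> roots.\<close>

lemma eig_form_inj:
  assumes m: "m \<ge> 2" and y: "\<And>z. z \<in> gap_roots m \<Longrightarrow> eig_form m z y = 0" and k: "k \<in> {1..m}"
  shows "y k = (0 :: complex)"
proof -
  define b where "b k = (\<Prod>j<k-1. smult (1 / (1 + of_nat m + of_nat j)) [:of_nat m + of_nat j, 1 :: complex:])" for k
  define p where "p = (\<Sum>k=1..m. smult (y k) (b k))"
  have polyb: "poly (b k) z = eig_coeff m z k" for k z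
    by (simp add: b_def poly_prod eig_coeff_def add_divide_distrib[symmetric] add_ac)
  have polyp: "poly p z = eig_form m z y" for z
    by (simp add: p_def poly_sum polyb eig_form_eq mult.commute)
  have "degree (b k) \<le> m - 1" if "k \<in> {1..m}" for k
  proof -
    have "degree (b k) \<le> (\<Sum>j<k-1. 1)"
      unfolding b_def
      by (rule order.trans[OF degree_prod_sum_le], simp, rule sum_mono,
          simp only: o_def, rule order.trans[OF degree_smult_le], simp)
    also have "\<dots> \<le> m - 1" using that by auto
    finally show ?thesis .
  qed
  then have "degree p \<le> m - 1"
    unfolding p_def by (intro degree_sum_le) (auto intro: order.trans[OF degree_smult_le])
  have "p = 0"
  proof (rule ccontr)
    assume "p \<noteq> 0"
    then have "card {z. poly p z = 0} \<le> degree p" "finite {z. poly p z = 0}"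
      using card_poly_roots_bound poly_roots_finite by auto
    moreover have "gap_roots m \<subseteq> {z. poly p z = 0}" using y by (auto simp: polyp)
    ultimately have "card (gap_roots m) \<le> degree p" using card_mono order.trans by blast
    then show False using \<open>degree p \<le> m - 1\<close> card_gap_roots(2)[of m] m by simp
  qed
  then have form0: "eig_form m z y = 0" for z by (simp add: polyp[symmetric])
  show ?thesis using k
  proof (induction k rule: less_induct)
    case (less k)
    \<comment> \<open>At this point all coefficients with index beyond \<open>k\<close> contain a
      vanishing factor, and the coordinates before \<open>k\<close> vanish by induction: only the
      \<open>k\<close>-th term is left, with a nonzero coefficient.\<close>
    define z :: complex where "z = - of_nat (m + k - 1)"
    have "eig_form m z y = (\<Sum>i\<in>{1..m}. if i = k then eig_coeff m z k * y k else 0)"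
      unfolding eig_form_eq
    proof (intro sum.cong refl)
      fix i assume i: "i \<in> {1..m}"
      consider "i < k" | "i = k" | "i > k" by linarith
      then show "eig_coeff m z i * y i = (if i = k then eig_coeff m z k * y k else 0)"
      proof cases
        case 1
        then show ?thesis using less i by auto
      next
        case 3
        have "z + of_nat m + of_nat (k - 1) = 0"
          using less.prems by (simp add: z_def flip: of_nat_add)
        moreover have "k - 1 \<in> {..<i-1}" using 3 less.prems by auto
        ultimately have "eig_coeff m z i = 0"
          unfolding eig_coeff_def by (auto intro!: prod_zero bexI[of _ "k - 1"])
        then show ?thesis using 3 by simp
      qed simp
    qed
    also have "\<dots> = eig_coeff m z k * y k" using less.prems by simp
    finally have "eig_coeff m z k * y k = 0" using form0 by simp
    moreover have "eig_coeff m z k \<noteq> 0"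
    proof -
      have "z + of_nat m + of_nat j \<noteq> 0" if "j < k - 1" for j
      proof -
        have "z + of_nat m + of_nat j = of_nat (m + j) - of_nat (m + k - 1)" by (simp add: z_def)
        moreover have "m + j \<noteq> m + k - 1" using that by auto
        ultimately show ?thesis by (metis eq_iff_diff_eq_0 of_nat_eq_iff)
      qed
      then show ?thesis unfolding eig_coeff_def using one_plus_of_nat_neq_0[of m, where 'a = complex] by auto
    qed
    ultimately show ?case by simp
  qed
qed

lemma eig_form_diff: "eig_form m z (\<lambda>k. x k - y k) = eig_form m z x - eig_form m z y"
  by (simp add: eig_form_eq right_diff_distrib sum_subtractf)

text \<open>By duality the difference of the two sides is annihilated by every eigenform, hence zero
  by \<open>eig_form_inj\<close>.\<close>

lemma eig_decomposition:
  assumes m: "m \<ge> 2" and k: "k \<in> {1..m}"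
  shows "(\<Sum>z\<in>gap_roots m. eig_form m z x * eig_vec m z k) = x k"
proof -
  define y where "y k = x k - (\<Sum>z\<in>gap_roots m. eig_form m z x * eig_vec m z k)" for k
  have fin: "finite (gap_roots m)" using card_gap_roots(1)[of m] m by simp
  have "eig_form m w y = 0" if w: "w \<in> gap_roots m" for w
  proof -
    have "eig_form m w (\<lambda>k. \<Sum>z\<in>gap_roots m. eig_form m z x * eig_vec m z k)
       = (\<Sum>z\<in>gap_roots m. eig_form m z x * eig_form m w (eig_vec m z))"
      unfolding eig_form_eq[of m w] sum_distrib_left by (subst sum.swap) (simp add: mult_ac)
    also have "\<dots> = (\<Sum>z\<in>gap_roots m. if z = w then eig_form m w x else 0)"
      by (intro sum.cong refl) (use eig_orthogonal[OF m w] eig_normalized[OF m] in auto)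
    also have "\<dots> = eig_form m w x" using fin w by simp
    finally show ?thesis unfolding y_def eig_form_diff by simp
  qed
  from eig_form_inj[OF m this k] show ?thesis by (simp add: y_def)
qed

lemma eig_coeff_cnj: "eig_coeff m (cnj z) k = cnj (eig_coeff m z k)"
  by (simp add: eig_coeff_def)

lemma eig_form_cnj: "eig_form m (cnj z) (\<lambda>k. of_real (x k)) = cnj (eig_form m z (\<lambda>k. of_real (x k)))"
  by (simp add: eig_form_eq eig_coeff_cnj)

lemma eig_vec_cnj: "eig_vec m (cnj z) k = cnj (eig_vec m z k)"
  by (simp add: eig_vec_def H_sum_def)

lemma eig_vec_1: "eig_vec m 1 k = complex_of_real (v1 m k)"
  by (simp add: eig_vec_def H_sum_def v1_def)

lemma eig_form_1: "eig_form m 1 x = (\<Sum>k=1..m. x k :: complex)"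
  using one_plus_of_nat_neq_0[where 'a = complex] by (simp add: eig_form_eq eig_coeff_def)

text \<open>The definitions by \<open>Max\<close> and \<open>THE\<close> become meaningful here: a
  root beyond \<open>1/2\<close> exists, so the second largest real part exceeds \<open>1/2\<close>.
  It cannot belong to a real root, and a vertical line carries at most one conjugate pair.\<close>

lemma lambda2_props:
  assumes m: "m \<ge> 60"
  shows "lambda2 m \<in> gap_roots m" "Re (lambda2 m) = sigma2 m" "Im (lambda2 m) > 0"
    "1/2 < sigma2 m" "sigma2 m < 1"
    "\<And>z. z \<in> gap_roots m \<Longrightarrow> z \<notin> {1, lambda2 m, cnj (lambda2 m)} \<Longrightarrow> Re z < sigma2 m"
proof -
  have m1: "m \<ge> 1" using m by simp
  have fin: "finite (gap_roots m)" using card_gap_roots(1)[OF m1] .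
  have rr: "root_real_parts m = Re ` gap_roots m"
    by (simp add: root_real_parts_def gap_roots_eq[OF m1])
  have Max1: "Max (root_real_parts m) = 1"
    unfolding rr using fin one_in_gap_roots gap_roots_Re_ge_1[OF m1]
    by (intro Max_eqI) (force simp: image_iff)+
  define S where "S = Re ` gap_roots m - {1}"
  have s2: "sigma2 m = Max S" unfolding sigma2_def Max1 S_def rr[symmetric] ..
  have finS: "finite S" using fin by (simp add: S_def)
  have inS: "Re z \<in> S" if "z \<in> gap_roots m" "z \<noteq> 1" for z
    using that gap_roots_Re_ge_1[OF m1 that(1)] by (auto simp: S_def)
  obtain z where z: "z \<in> gap_roots m" "z \<noteq> 1" "Re z > 1/2"
    using gap_roots_large_phases[OF m] .
  have "Re z \<le> sigma2 m" unfolding s2 using finS inS z by (intro Max_ge) auto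
  then show half: "1/2 < sigma2 m" using z by simp
  have "sigma2 m \<in> S" unfolding s2 using finS inS[OF z(1,2)] by (intro Max_in) auto
  then obtain w where w: "w \<in> gap_roots m" "Re w = sigma2 m" "Re w \<noteq> 1" by (auto simp: S_def)
  then show lt1: "sigma2 m < 1" using gap_roots_Re_ge_1[OF m1 w(1)] by fastforce
  have imw: "Im w \<noteq> 0" using gap_roots_real[OF m1 w(1)] w half by auto
  define w' where "w' = (if Im w > 0 then w else cnj w)"
  have w': "w' \<in> gap_roots m" "Re w' = sigma2 m" "Im w' > 0"
    using w imw cnj_in_gap_roots by (auto simp: w'_def)
  have "lambda2 m = w'"
    unfolding lambda2_def
  proof (rule the_equality)
    show "poly (char_poly_gap m) w' = 0 \<and> Re w' = sigma2 m \<and> 0 < Im w'"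
      using w' gap_roots_eq[OF m1] by auto
    fix x assume x: "poly (char_poly_gap m) x = 0 \<and> Re x = sigma2 m \<and> 0 < Im x"
    then have "x \<in> gap_roots m" using gap_roots_eq[OF m1] by auto
    then have "x = w' \<or> x = cnj w'" using gap_roots_same_Re[OF m1 w'(1)] w' x by simp
    then show "x = w'" using x w' by auto
  qed
  then show l2: "lambda2 m \<in> gap_roots m" "Re (lambda2 m) = sigma2 m" "Im (lambda2 m) > 0"
    using w' by simp_all
  fix x assume x: "x \<in> gap_roots m" "x \<notin> {1, lambda2 m, cnj (lambda2 m)}"
  then have "Re x \<le> sigma2 m" unfolding s2 using finS inS by (intro Max_ge) auto
  moreover have "Re x \<noteq> sigma2 m"
    using gap_roots_same_Re[OF m1 l2(1) x(1)] l2 x by auto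
  ultimately show "Re x < sigma2 m" by simp
qed

section \<open>Gaussian vectors and weak convergence\<close>

text \<open>Lagrange's reduction: complete the square in one variable at a time.\<close>

lemma psd_sum_of_squares:
  fixes B :: "'i \<Rightarrow> 'i \<Rightarrow> real"
  assumes "finite I" "\<And>i j. B i j = B j i"
    "\<And>a. (\<Sum>i\<in>I. \<Sum>j\<in>I. a i * a j * B i j) \<ge> 0"
  shows "\<exists>L. \<forall>i\<in>I. \<forall>j\<in>I. B i j = (\<Sum>k\<in>I. L k i * L k j)"
  using assms
proof (induction I arbitrary: B rule: finite_induct)
  case empty
  then show ?case by simp
next
  case (insert x I)
  note sym = insert.prems(1) and psd = insert.prems(2)
  have expand: "(\<Sum>i\<in>insert x I. \<Sum>j\<in>insert x I. a i * a j * B i j) =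
     (a x)\<^sup>2 * B x x + 2 * a x * (\<Sum>j\<in>I. a j * B x j) + (\<Sum>i\<in>I. \<Sum>j\<in>I. a i * a j * B i j)" for a
  proof -
    have "(\<Sum>i\<in>I. a i * a x * B i x) = a x * (\<Sum>j\<in>I. a j * B x j)"
      "(\<Sum>j\<in>I. a x * a j * B x j) = a x * (\<Sum>j\<in>I. a j * B x j)"
      by (auto simp: sum_distrib_left sym[of _ x] mult_ac intro!: sum.cong)
    then show ?thesis
      using insert.hyps by (simp add: sum.distrib power2_eq_square algebra_simps)
  qed
  have Bxx: "B x x \<ge> 0"
  proof -
    define a where "a i = (if i = x then 1 else 0 :: real)" for i
    have "a i = 0" if "i \<in> I" for i using that insert.hyps by (auto simp: a_def)
    then show ?thesis using psd[of a] unfolding expand by (simp add: a_def)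
  qed
  \<comment> \<open>A vanishing pivot forces its whole row to vanish; otherwise the form would be
    affine and nonconstant in the \<open>x\<close>-coordinate and take negative values.\<close>
  have Bx0: "B x j = 0" if "B x x = 0" "j \<in> I" for j
  proof -
    have q: "0 \<le> 2 * t * B x j + B j j" for t
    proof -
      have "j \<noteq> x" using insert.hyps that by auto
      define a where "a i = (if i = x then t else if i = j then 1 else 0)" for i
      have ax: "a x = t" by (simp add: a_def)
      have aI: "a i = (if i = j then 1 else 0)" if "i \<in> I" for i
        using that insert.hyps \<open>j \<noteq> x\<close> by (auto simp: a_def)
      have s1: "(\<Sum>i\<in>I. a i * f i) = f j" for f :: "'i \<Rightarrow> real"
      proof -
        have "(\<Sum>i\<in>I. a i * f i) = (\<Sum>i\<in>I. if i = j then f j else 0)"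
          by (intro sum.cong refl) (simp add: aI)
        then show ?thesis using \<open>j \<in> I\<close> insert.hyps by simp
      qed
      have "(\<Sum>i\<in>I. \<Sum>k\<in>I. a i * a k * B i k) = (\<Sum>i\<in>I. a i * (\<Sum>k\<in>I. a k * B i k))"
        by (simp add: sum_distrib_left mult.assoc)
      then show ?thesis
        using psd[of a] unfolding expand ax by (simp add: s1 that)
    qed
    show ?thesis
    proof (rule ccontr)
      assume nz: "B x j \<noteq> 0"
      \<comment> \<open>With this value of \<open>t\<close> the nonnegative expression of
        \<open>q\<close> becomes \<open>- 1\<close>.\<close>
      then have "2 * (- (B j j + 1) / (2 * B x j)) * B x j = - (B j j + 1)" by simp
      then show False using q[of "- (B j j + 1) / (2 * B x j)"] by linarith
    qed
  qed
  define B' where "B' i j = B i j - B x i * B x j / B x x" for i j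
  have "\<exists>L. \<forall>i\<in>I. \<forall>j\<in>I. B' i j = (\<Sum>k\<in>I. L k i * L k j)"
  proof (rule insert.IH)
    show "B' i j = B' j i" for i j by (simp add: B'_def sym[of i j])
    fix a :: "'i \<Rightarrow> real"
    define s where "s = (\<Sum>j\<in>I. a j * B x j)"
    have 1: "(\<Sum>i\<in>I. \<Sum>j\<in>I. a i * a j * B' i j) = (\<Sum>i\<in>I. \<Sum>j\<in>I. a i * a j * B i j) - s * s / B x x"
      unfolding s_def sum_product
      by (simp add: B'_def right_diff_distrib sum_subtractf sum_divide_distrib mult_ac)
    \<comment> \<open>The minimiser in the \<open>x\<close>-coordinate turns the full form into the
      reduced one. If the pivot is zero, division by zero yields the value \<open>0\<close>, which
      is also correct.\<close>
    define b where "b = a(x := - s / B x x)"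
    have bI: "i \<in> I \<Longrightarrow> b i = a i" for i using insert.hyps by (auto simp: b_def)
    have "0 \<le> (b x)\<^sup>2 * B x x + 2 * b x * (\<Sum>j\<in>I. b j * B x j) + (\<Sum>i\<in>I. \<Sum>j\<in>I. b i * b j * B i j)"
      using psd[of b] unfolding expand .
    also have "(\<Sum>j\<in>I. b j * B x j) = s" unfolding s_def by (intro sum.cong refl) (simp add: bI)
    also have "(\<Sum>i\<in>I. \<Sum>j\<in>I. b i * b j * B i j) = (\<Sum>i\<in>I. \<Sum>j\<in>I. a i * a j * B i j)"
      by (intro sum.cong refl) (simp add: bI)
    also have "(b x)\<^sup>2 * B x x + 2 * b x * s = - (s * s / B x x)"
      by (cases "B x x = 0") (simp_all add: b_def power2_eq_square field_simps)
    finally show "0 \<le> (\<Sum>i\<in>I. \<Sum>j\<in>I. a i * a j * B' i j)" unfolding 1 by simp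
  qed
  then obtain L where L: "\<forall>i\<in>I. \<forall>j\<in>I. B' i j = (\<Sum>k\<in>I. L k i * L k j)" ..
  \<comment> \<open>The new row is the pivot row divided by the root of the pivot; the rows of the
    smaller factor are extended by \<open>0\<close> in column \<open>x\<close>.\<close>
  define L' where "L' k i = (if k = x then B x i / sqrt (B x x) else if i = x then 0 else L k i)" for k i
  show ?case
  proof (intro exI ballI)
    fix i j assume ij: "i \<in> insert x I" "j \<in> insert x I"
    have sq: "B x i / sqrt (B x x) * (B x j / sqrt (B x x)) = B x i * B x j / B x x"
      using Bxx by simp
    have "(\<Sum>k\<in>insert x I. L' k i * L' k j) = B x i * B x j / B x x + (\<Sum>k\<in>I. L' k i * L' k j)"
      using insert.hyps sq by (simp add: L'_def)
    also have "(\<Sum>k\<in>I. L' k i * L' k j) = (if i = x \<or> j = x then 0 else B' i j)"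
    proof (cases "i = x \<or> j = x")
      case True
      then show ?thesis using insert.hyps by (auto simp: L'_def intro!: sum.neutral)
    next
      case False
      then have "B' i j = (\<Sum>k\<in>I. L k i * L k j)" using L ij by auto
      also have "\<dots> = (\<Sum>k\<in>I. L' k i * L' k j)"
        using False insert.hyps by (intro sum.cong) (auto simp: L'_def)
      finally show ?thesis using False by simp
    qed
    finally show "B i j = (\<Sum>k\<in>insert x I. L' k i * L' k j)"
      using ij Bx0 sym[of i x] by (cases "B x x = 0") (auto simp: B'_def)
  qed
qed

section \<open>Gaussian vectors with a prescribed covariance\<close>

lemma borel_measurable_cis [measurable (raw)]:
  "f \<in> borel_measurable M \<Longrightarrow> (\<lambda>x. cis (f x)) \<in> borel_measurable M"
  by (rule measurable_compose[OF _ borel_measurable_continuous_onI]) (auto intro: continuous_intros)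

lemma char_std_normal_scaled:
  "char (distr std_normal_distribution borel (\<lambda>z. s * z)) t = of_real (exp (- (s * t)\<^sup>2 / 2))"
proof -
  have "char (distr std_normal_distribution borel (\<lambda>z. s * z)) t = char std_normal_distribution (s * t)"
    unfolding char_def by (subst integral_distr) (auto simp: mult_ac)
  then show ?thesis by (simp add: char_std_normal_distribution)
qed

text \<open>The vector is a linear image of independent standard normal variables, with the matrix
  from \<open>psd_sum_of_squares\<close>; degenerate \<open>B\<close> cause no difficulty. Each
  linear form is recognised as normal by its characteristic function.\<close>

lemma centered_gaussian_exists:
  fixes B :: "nat \<Rightarrow> nat \<Rightarrow> real"
  assumes I: "finite I" and sym: "\<And>i j. B i j = B j i"
    and psd: "\<And>a. (\<Sum>i\<in>I. \<Sum>j\<in>I. a i * a j * B i j) \<ge> 0"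
  shows "\<exists>\<nu>. centered_gaussian I \<nu> \<and>
    (\<forall>a. (\<integral>x. cis (\<Sum>i\<in>I. a i * x i) \<partial>\<nu>) = of_real (exp (- (\<Sum>i\<in>I. \<Sum>j\<in>I. a i * a j * B i j) / 2)))"
proof -
  obtain L where L: "\<And>i j. i \<in> I \<Longrightarrow> j \<in> I \<Longrightarrow> B i j = (\<Sum>k\<in>I. L k i * L k j)"
    using psd_sum_of_squares[OF I sym psd] by blast
  have std: "prob_space std_normal_distribution" by (rule prob_space_normal_density) simp
  interpret N: product_prob_space "\<lambda>_::nat. std_normal_distribution" I
    by (rule product_prob_spaceI) (rule std)
  define Z where "Z = PiM I (\<lambda>_::nat. std_normal_distribution)"
  define T where "T z = (\<lambda>i\<in>I. \<Sum>k\<in>I. L k i * z k)" for z :: "nat \<Rightarrow> real"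
  define \<nu> where "\<nu> = distr Z (PiM I (\<lambda>_. borel)) T"
  have comp: "(\<lambda>z. z k) \<in> borel_measurable Z" if "k \<in> I" for k
    unfolding Z_def using measurable_component_singleton[OF that, of "\<lambda>_. std_normal_distribution"] by simp
  have T: "T \<in> measurable Z (PiM I (\<lambda>_. borel))"
    unfolding T_def by (intro measurable_restrict borel_measurable_sum borel_measurable_times comp) auto
  have compB: "(\<lambda>x. x k) \<in> borel_measurable (PiM I (\<lambda>_. borel))" if "k \<in> I" for k
    using measurable_component_singleton[OF that] .
  have lin: "(\<lambda>x. \<Sum>i\<in>I. a i * x i) \<in> borel_measurable (PiM I (\<lambda>_. borel))" for a :: "nat \<Rightarrow> real"
    by (intro borel_measurable_sum borel_measurable_times compB) auto
  define b where "b a k = (\<Sum>i\<in>I. a i * L k i)" for a :: "nat \<Rightarrow> real" and k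
  have linT: "(\<Sum>i\<in>I. a i * T z i) = (\<Sum>k\<in>I. b a k * z k)" for a z
    unfolding T_def b_def by (simp add: sum_distrib_left sum_distrib_right mult.assoc) (rule sum.swap)
  have Q: "(\<Sum>k\<in>I. (b a k)\<^sup>2) = (\<Sum>i\<in>I. \<Sum>j\<in>I. a i * a j * B i j)" for a
  proof -
    have "(\<Sum>i\<in>I. \<Sum>j\<in>I. a i * a j * B i j) = (\<Sum>i\<in>I. \<Sum>j\<in>I. \<Sum>k\<in>I. (a i * L k i) * (a j * L k j))"
      by (intro sum.cong refl) (simp add: L sum_distrib_left mult_ac)
    also have "\<dots> = (\<Sum>i\<in>I. \<Sum>k\<in>I. \<Sum>j\<in>I. (a i * L k i) * (a j * L k j))"
      by (intro sum.cong refl sum.swap)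
    also have "\<dots> = (\<Sum>k\<in>I. \<Sum>i\<in>I. \<Sum>j\<in>I. (a i * L k i) * (a j * L k j))"
      by (rule sum.swap)
    also have "\<dots> = (\<Sum>k\<in>I. (b a k)\<^sup>2)"
      by (simp add: b_def power2_eq_square sum_product)
    finally show ?thesis ..
  qed
  have cis_sum: "cis (\<Sum>k\<in>I. f k) = (\<Prod>k\<in>I. cis (f k))" for f
    using I by (induction I rule: finite_induct) (auto simp: cis_mult[symmetric])
  have charZ: "(\<integral>z. cis (\<Sum>k\<in>I. b a k * z k) \<partial>Z) = of_real (exp (- (\<Sum>i\<in>I. \<Sum>j\<in>I. a i * a j * B i j) / 2))" for a
  proof -
    have "(\<integral>z. cis (\<Sum>k\<in>I. b a k * z k) \<partial>Z) = (\<integral>z. (\<Prod>k\<in>I. cis (b a k * z k)) \<partial>Z)"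
      by (simp add: cis_sum)
    also have "\<dots> = (\<Prod>k\<in>I. \<integral>x. cis (b a k * x) \<partial>std_normal_distribution)"
      unfolding Z_def
      by (rule N.product_integral_prod[OF I]) (intro finite_measure.integrable_const_bound[where B = 1] prob_space.finite_measure std AE_I2, auto)
    also have "\<dots> = (\<Prod>k\<in>I. of_real (exp (- (b a k)\<^sup>2 / 2)))"
    proof (intro prod.cong refl)
      fix k
      have "(\<integral>x. cis (b a k * x) \<partial>std_normal_distribution) = char std_normal_distribution (b a k)"
        by (simp add: char_def cis_conv_exp mult_ac)
      then show "(\<integral>x. cis (b a k * x) \<partial>std_normal_distribution) = of_real (exp (- (b a k)\<^sup>2 / 2))"
        by (simp add: char_std_normal_distribution)
    qed
    also have "\<dots> = of_real (exp (\<Sum>k\<in>I. - (b a k)\<^sup>2 / 2))"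
      using I by (simp add: exp_sum)
    also have "(\<Sum>k\<in>I. - (b a k)\<^sup>2 / 2) = - (\<Sum>i\<in>I. \<Sum>j\<in>I. a i * a j * B i j) / 2"
      by (simp add: Q[symmetric] sum_divide_distrib sum_negf)
    finally show ?thesis .
  qed
  have prob\<nu>: "prob_space \<nu>"
    unfolding \<nu>_def
    by (rule prob_space.prob_space_distr[OF _ T]) (auto simp: Z_def intro: prob_space_PiM std)
  have char\<nu>: "(\<integral>x. cis (\<Sum>i\<in>I. a i * x i) \<partial>\<nu>) = of_real (exp (- (\<Sum>i\<in>I. \<Sum>j\<in>I. a i * a j * B i j) / 2))" for a
  proof -
    have "(\<integral>x. cis (\<Sum>i\<in>I. a i * x i) \<partial>\<nu>) = (\<integral>z. cis (\<Sum>i\<in>I. a i * T z i) \<partial>Z)"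
      unfolding \<nu>_def by (rule integral_distr[OF T]) (use lin in measurable)
    then show ?thesis by (simp add: linT charZ)
  qed
  have "centered_gaussian I \<nu>"
    unfolding centered_gaussian_def
  proof (intro conjI allI prob\<nu>)
    show "sets \<nu> = sets (PiM I (\<lambda>_. borel))" by (simp add: \<nu>_def)
    fix a :: "nat \<Rightarrow> real"
    define s where "s = sqrt (\<Sum>i\<in>I. \<Sum>j\<in>I. a i * a j * B i j)"
    have s2: "s\<^sup>2 = (\<Sum>i\<in>I. \<Sum>j\<in>I. a i * a j * B i j)" unfolding s_def using psd[of a] by simp
    have meas: "(\<lambda>x. \<Sum>i\<in>I. a i * x i) \<in> measurable \<nu> borel" unfolding \<nu>_def using lin by simp
    show "\<exists>s\<ge>0. distr \<nu> borel (\<lambda>x. \<Sum>i\<in>I. a i * x i) = distr std_normal_distribution borel (\<lambda>z. s * z)"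
    proof (intro exI conjI)
      show "0 \<le> s" unfolding s_def using psd by simp
      show "distr \<nu> borel (\<lambda>x. \<Sum>i\<in>I. a i * x i) = distr std_normal_distribution borel (\<lambda>z. s * z)"
      proof (rule Levy_uniqueness)
        show "real_distribution (distr \<nu> borel (\<lambda>x. \<Sum>i\<in>I. a i * x i))"
          by (rule prob_space.real_distribution_distr[OF prob\<nu> meas])
        show "real_distribution (distr std_normal_distribution borel (\<lambda>z. s * z))"
          by (rule prob_space.real_distribution_distr) (auto intro: prob_space_normal_density)
        show "char (distr \<nu> borel (\<lambda>x. \<Sum>i\<in>I. a i * x i)) = char (distr std_normal_distribution borel (\<lambda>z. s * z))"
        proof
          fix t
          have "char (distr \<nu> borel (\<lambda>x. \<Sum>i\<in>I. a i * x i)) t = (\<integral>x. cis (\<Sum>i\<in>I. (t * a i) * x i) \<partial>\<nu>)"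
            unfolding char_def by (subst integral_distr[OF meas]) (auto simp: cis_conv_exp sum_distrib_left mult_ac)
          also have "\<dots> = of_real (exp (- (s * t)\<^sup>2 / 2))"
            unfolding char\<nu> power_mult_distrib s2
            by (simp add: sum_distrib_left sum_distrib_right power2_eq_square mult_ac)
          finally show "char (distr \<nu> borel (\<lambda>x. \<Sum>i\<in>I. a i * x i)) t = char (distr std_normal_distribution borel (\<lambda>z. s * z)) t"
            by (simp add: char_std_normal_scaled)
        qed
      qed
    qed
  qed
  then show ?thesis using char\<nu> by blast
qed

text \<open>Trigonometric polynomials. The free phase \<open>s\<close> covers the sine as well and
  makes the class closed under products, so it is an algebra to which Stone-Weierstrass applies; its
  integrals are determined by the characteristic function.\<close>

inductive_set trig_funs :: "nat set \<Rightarrow> ((nat \<Rightarrow> real) \<Rightarrow> real) set" for I where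
  cos: "(\<lambda>x. c * cos (s + (\<Sum>i\<in>I. a i * x i))) \<in> trig_funs I"
| add: "f \<in> trig_funs I \<Longrightarrow> g \<in> trig_funs I \<Longrightarrow> (\<lambda>x. f x + g x) \<in> trig_funs I"

lemma trig_funs_const: "(\<lambda>x. c) \<in> trig_funs I"
  using trig_funs.cos[of c 0 "\<lambda>_. 0" I] by simp

lemma trig_funs_mult_cos:
  assumes "f \<in> trig_funs I"
  shows "(\<lambda>x. f x * (c * cos (s + (\<Sum>i\<in>I. a i * x i)))) \<in> trig_funs I"
  using assms
proof induction
  case (cos c' s' a')
  have eq: "c' * cos (s' + (\<Sum>i\<in>I. a' i * x i)) * (c * cos (s + (\<Sum>i\<in>I. a i * x i))) =
     c' * c / 2 * cos ((s' - s) + (\<Sum>i\<in>I. (a' i - a i) * x i)) +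
     c' * c / 2 * cos ((s' + s) + (\<Sum>i\<in>I. (a' i + a i) * x i))" for x
  proof -
    have "(s' + (\<Sum>i\<in>I. a' i * x i)) - (s + (\<Sum>i\<in>I. a i * x i)) = (s' - s) + (\<Sum>i\<in>I. (a' i - a i) * x i)"
      "(s' + (\<Sum>i\<in>I. a' i * x i)) + (s + (\<Sum>i\<in>I. a i * x i)) = (s' + s) + (\<Sum>i\<in>I. (a' i + a i) * x i)"
      by (simp_all add: left_diff_distrib distrib_right sum_subtractf sum.distrib)
    then show ?thesis
      using cos_times_cos[of "s' + (\<Sum>i\<in>I. a' i * x i)" "s + (\<Sum>i\<in>I. a i * x i)"]
      by (simp add: field_simps)
  qed
  show ?case unfolding eq by (intro trig_funs.intros)
next
  case (add f g)
  then show ?case by (simp add: distrib_right trig_funs.add)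
qed

lemma trig_funs_mult:
  assumes "g \<in> trig_funs I" "f \<in> trig_funs I"
  shows "(\<lambda>x. f x * g x) \<in> trig_funs I"
  using assms
proof induction
  case (cos c s a)
  then show ?case by (intro trig_funs_mult_cos)
next
  case (add g g')
  then show ?case by (simp add: distrib_left trig_funs.add)
qed

lemma trig_funs_continuous: "f \<in> trig_funs I \<Longrightarrow> continuous_on A f"
  by (induction rule: trig_funs.induct)
     (auto intro!: continuous_intros continuous_on_subset[OF continuous_on_product_coordinates])

lemma trig_funs_bounded: "f \<in> trig_funs I \<Longrightarrow> \<exists>H. \<forall>x. \<bar>f x\<bar> \<le> H"
proof (induction rule: trig_funs.induct)
  case (cos c s a)
  have "\<bar>c * cos y\<bar> \<le> \<bar>c\<bar>" for y by (simp add: abs_mult mult_left_le)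
  then show ?case by blast
next
  case (add f g)
  then obtain H H' where "\<And>x. \<bar>f x\<bar> \<le> H" "\<And>x. \<bar>g x\<bar> \<le> H'" by blast
  then have "\<bar>f x + g x\<bar> \<le> H + H'" for x by (metis abs_triangle_ineq add_mono order_trans)
  then show ?case by blast
qed

text \<open>Needed to pass between vectors that are \<open>undefined\<close> and vectors that are
  \<open>0\<close> outside \<open>I\<close>.\<close>

lemma trig_funs_cong:
  "f \<in> trig_funs I \<Longrightarrow> (\<And>i. i \<in> I \<Longrightarrow> x i = y i) \<Longrightarrow> f x = f y"
  by (induction rule: trig_funs.induct) (auto cong: sum.cong)

lemma trig_funs_measurable:
  "f \<in> trig_funs I \<Longrightarrow> f \<in> borel_measurable (PiM I (\<lambda>_. borel))"
proof (induction rule: trig_funs.induct)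
  case (cos c s a)
  have "(\<lambda>x. x i) \<in> borel_measurable (PiM I (\<lambda>_. borel))" if "i \<in> I" for i
    using measurable_component_singleton[OF that] .
  then show ?case by measurable
qed auto

lemma trig_funs_polynomial:
  assumes "real_polynomial_function (p :: real \<Rightarrow> real)" "f \<in> trig_funs I"
  shows "(\<lambda>x. p (f x)) \<in> trig_funs I"
  using assms
proof (induction p rule: real_polynomial_function.induct)
  case (linear p)
  then obtain c where "p = (\<lambda>x. x * c)"
    using real_bounded_linear by blast
  then show ?case using linear trig_funs_mult[OF trig_funs_const] by simp
qed (auto intro: trig_funs_const trig_funs.add trig_funs_mult)

text \<open>Stone-Weierstrass gives no control outside the box; composing with a polynomial that
  approximates the clipping function restores a global bound that does not depend on the box.\<close>

lemma trig_funs_clipped_approx: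
  fixes f :: "(nat \<Rightarrow> real) \<Rightarrow> real"
  assumes I: "finite I" and f: "continuous_on UNIV f" "\<And>x. \<bar>f x\<bar> \<le> B" and e: "e > 0" "e \<le> 1" and K: "K \<ge> 0"
  shows "\<exists>g\<in>trig_funs I. (\<forall>x. (\<forall>i\<in>I. \<bar>x i\<bar> \<le> K) \<and> (\<forall>i. i \<notin> I \<longrightarrow> x i = 0) \<longrightarrow> \<bar>f x - g x\<bar> \<le> 2 * e) \<and>
     (\<forall>x. \<bar>g x\<bar> \<le> B + 2)"
proof -
  \<comment> \<open>Pinning the coordinates outside \<open>I\<close> to \<open>0\<close> makes the
    box compact in the product topology of all of \<open>nat \<Rightarrow> real\<close>.\<close>
  define S where "S = {x :: nat \<Rightarrow> real. (\<forall>i\<in>I. \<bar>x i\<bar> \<le> K) \<and> (\<forall>i. i \<notin> I \<longrightarrow> x i = 0)}"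
  have "x \<in> S \<longleftrightarrow> (\<forall>i. x i \<in> (if i \<in> I then {-K..K} else {0}))" for x
    unfolding S_def by (auto simp: abs_le_iff minus_le_iff)
  then have S_eq: "S = PiE UNIV (\<lambda>i. if i \<in> I then {-K..K} else {0})"
    by (simp only: set_eq_iff PiE_UNIV_domain Pi_iff) simp
  have "compactin (product_topology (\<lambda>_. euclidean) UNIV) S"
    unfolding S_eq compactin_PiE by (auto simp: compactin_euclidean_iff)
  then have compact: "compact S"
    by (simp add: euclidean_product_topology)
  interpret function_ring_on "trig_funs I" S
  proof 
    fix x y assume xy: "x \<in> S" "y \<in> S" "x \<noteq> y"
    then obtain i where i: "x i \<noteq> y i" by auto
    then have iI: "i \<in> I" using xy by (auto simp: S_def)
    \<comment> \<open>The scaling keeps \<open>\<theta> * x i\<close> in \<open>[-1, 1]\<close>,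
      where the sine is injective; the phase \<open>- pi / 2\<close> below turns the cosine into
      that sine.\<close>
    define \<theta> where "\<theta> = 1 / (K + 1)"
    have \<theta>: "\<theta> > 0" using K by (simp add: \<theta>_def)
    define h where "h = (\<lambda>x. 1 * cos (- pi / 2 + (\<Sum>j\<in>I. (if j = i then \<theta> else 0) * x j)))"
    have "(\<Sum>j\<in>I. (if j = i then \<theta> else 0) * x j) = \<theta> * x i" for x
      using I iI by (simp add: if_distrib[of "\<lambda>a. a * _"] cong: if_cong)
    then have h: "h x = sin (\<theta> * x i)" for x
      by (simp add: h_def cos_diff)
    have rng: "\<theta> * z i \<in> {- (pi / 2)..pi / 2}" if "z \<in> S" for z
    proof -
      have "\<bar>z i\<bar> \<le> K" using that iI by (auto simp: S_def)
      then have "\<bar>\<theta> * z i\<bar> \<le> 1" using K by (simp add: \<theta>_def abs_mult divide_simps)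
      then show ?thesis using pi_ge_two by (auto simp: abs_le_iff)
    qed
    have "h x \<noteq> h y"
    proof
      assume "h x = h y"
      then have "sin (\<theta> * x i) = sin (\<theta> * y i)" by (simp only: h)
      then have "\<theta> * x i = \<theta> * y i"
        using rng[OF xy(1)] rng[OF xy(2)] sin_inj_pi[of "\<theta> * x i" "\<theta> * y i"]
        by (simp only: atLeastAtMost_iff minus_divide_left)
      then show False using i \<theta> by simp
    qed
    moreover have "h \<in> trig_funs I" unfolding h_def by (rule trig_funs.cos)
    ultimately show "\<exists>f\<in>trig_funs I. f x \<noteq> f y" by blast
  qed (use compact in \<open>auto intro: trig_funs_continuous trig_funs.add trig_funs_mult trig_funs_const\<close>)
  have "continuous_on S f" using f(1) continuous_on_subset by blast
  from Stone_Weierstrass_basic[OF this e(1)] obtain h where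
    h: "h \<in> trig_funs I" "\<And>x. x \<in> S \<Longrightarrow> \<bar>f x - h x\<bar> < e" by blast
  obtain H where H: "\<And>x. \<bar>h x\<bar> \<le> H" using trig_funs_bounded[OF h(1)] by blast
  \<comment> \<open>Since \<open>e \<le> 1\<close>, the approximation stays within
    \<open>B + 1\<close> on the box, so clipping at this level changes nothing there.\<close>
  define clip where "clip y = max (- (B + 1)) (min (B + 1) y)" for y :: real
  have "compact {-H..H}" "continuous_on {-H..H} clip"
    unfolding clip_def by (auto intro!: continuous_intros)
  then obtain p where p: "real_polynomial_function p" "\<And>y. y \<in> {-H..H} \<Longrightarrow> \<bar>clip y - p y\<bar> < e"
    using Stone_Weierstrass_real_polynomial_function[OF _ _ e(1)] by metis
  have B: "B \<ge> 0" using f(2) abs_ge_zero order_trans by blast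
  have Hm: "h x \<in> {-H..H}" for x using H[of x] by (auto simp: abs_le_iff)
  show ?thesis
  proof (intro bexI conjI allI impI)
    show "(\<lambda>x. p (h x)) \<in> trig_funs I" by (rule trig_funs_polynomial[OF p(1) h(1)])
    fix x
    have "\<bar>clip (h x)\<bar> \<le> B + 1" using B unfolding clip_def by auto
    then show "\<bar>p (h x)\<bar> \<le> B + 2" using p(2)[OF Hm[of x]] e by linarith
    assume "(\<forall>i\<in>I. \<bar>x i\<bar> \<le> K) \<and> (\<forall>i. i \<notin> I \<longrightarrow> x i = 0)"
    then have "x \<in> S" by (simp add: S_def)
    then have "\<bar>f x - h x\<bar> < e" by (rule h(2))
    moreover from this have "clip (h x) = h x" using f(2)[of x] e unfolding clip_def by auto
    ultimately show "\<bar>f x - p (h x)\<bar> \<le> 2 * e" using p(2)[OF Hm[of x]] by linarith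
  qed
qed

text \<open>Points of \<open>powertop_real I\<close> and of \<open>PiM I\<close> are
  \<open>undefined\<close> outside \<open>I\<close>, whereas the approximation takes place in the
  topology of \<open>nat \<Rightarrow> real\<close> on vectors vanishing outside \<open>I\<close>.
  \<open>zero_outside\<close> and \<open>restrict\<close> translate between the two.\<close>

definition zero_outside :: "nat set \<Rightarrow> (nat \<Rightarrow> real) \<Rightarrow> nat \<Rightarrow> real" where
  "zero_outside I x i = (if i \<in> I then x i else 0)"

lemma zero_outside_measurable: "zero_outside I \<in> borel_measurable (PiM I (\<lambda>_. borel))"
proof (rule measurable_coordinatewise_then_product)
  fix i
  show "(\<lambda>x. zero_outside I x i) \<in> borel_measurable (PiM I (\<lambda>_. borel))"
  proof (cases "i \<in> I")
    case True
    then show ?thesis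
      using measurable_component_singleton[OF True, of "\<lambda>_. borel"] by (simp add: zero_outside_def)
  qed (simp add: zero_outside_def)
qed

lemma restrict_zero_outside: "x \<in> extensional I \<Longrightarrow> restrict (zero_outside I x) I = x"
  by (auto simp: zero_outside_def restrict_def extensional_def fun_eq_iff)

lemma powertop_continuous_restrict:
  assumes "continuous_map (powertop_real I) euclideanreal f"
  shows "continuous_on UNIV (\<lambda>x. f (restrict x I))"
proof -
  have "continuous_map euclidean (powertop_real I) (\<lambda>x. restrict x I)"
    unfolding continuous_map_componentwise
  proof (intro conjI ballI)
    show "(\<lambda>x. restrict x I) ` topspace euclidean \<subseteq> extensional I" by auto
    fix k assume "k \<in> I"
    then show "continuous_map euclidean euclideanreal (\<lambda>x. restrict x I k)"
      by (simp add: continuous_map_iff_continuous2)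
  qed
  from continuous_map_compose[OF this assms] show ?thesis
    by (simp add: continuous_map_iff_continuous2 o_def)
qed

lemma powertop_continuous_measurable:
  fixes I :: "nat set"
  assumes "continuous_map (powertop_real I) euclideanreal f"
  shows "f \<in> borel_measurable (PiM I (\<lambda>_. borel))"
proof -
  have "(\<lambda>x. f (restrict (zero_outside I x) I)) \<in> borel_measurable (PiM I (\<lambda>_. borel))"
    using measurable_compose[OF zero_outside_measurable
        borel_measurable_continuous_onI[OF powertop_continuous_restrict[OF assms]]] .
  then show ?thesis
    by (rule measurable_cong[THEN iffD1, rotated])
       (simp add: restrict_zero_outside space_PiM PiE_iff)
qed

section \<open>Weak convergence from characteristic functions and tightness\<close>

lemma trig_funs_integral_conv:
  fixes \<mu> :: "nat \<Rightarrow> (nat \<Rightarrow> real) measure"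
  assumes prob: "\<And>n. prob_space (\<mu> n)" "prob_space \<nu>"
    and sets: "\<And>n. sets (\<mu> n) = sets (PiM I (\<lambda>_. borel))" "sets \<nu> = sets (PiM I (\<lambda>_. borel))"
    and char: "\<And>a. (\<lambda>n. \<integral>x. cis (\<Sum>i\<in>I. a i * x i) \<partial>\<mu> n) \<longlonglongrightarrow> (\<integral>x. cis (\<Sum>i\<in>I. a i * x i) \<partial>\<nu>)"
    and f: "f \<in> trig_funs I"
  shows "(\<lambda>n. \<integral>x. f x \<partial>\<mu> n) \<longlonglongrightarrow> (\<integral>x. f x \<partial>\<nu>)"
proof -
  have int: "integrable \<kappa> g" if k: "prob_space \<kappa>" "sets \<kappa> = sets (PiM I (\<lambda>_. borel))" "g \<in> trig_funs I"
    for g and \<kappa> :: "(nat \<Rightarrow> real) measure"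
  proof -
    obtain H where H: "\<And>x. \<bar>g x\<bar> \<le> H" using trig_funs_bounded[OF k(3)] by blast
    have "g \<in> borel_measurable \<kappa>"
      using trig_funs_measurable[OF that(3)] that(2) measurable_cong_sets by blast
    then show ?thesis
      using that(1) H by (intro finite_measure.integrable_const_bound[where B = H]) (auto intro: prob_space.finite_measure)
  qed
  show ?thesis
    using f
  proof induction
    case (cos c s a)
    have eq: "(\<integral>x. c * cos (s + (\<Sum>i\<in>I. a i * x i)) \<partial>\<kappa>) = c * Re (cis s * (\<integral>x. cis (\<Sum>i\<in>I. a i * x i) \<partial>\<kappa>))"
      if "prob_space \<kappa>" "sets \<kappa> = sets (PiM I (\<lambda>_. borel))" for \<kappa> :: "(nat \<Rightarrow> real) measure"
    proof -
      have m: "(\<lambda>x. cis (\<Sum>i\<in>I. a i * x i)) \<in> borel_measurable (PiM I (\<lambda>_. borel))"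
      proof -
        have "(\<lambda>x. x i) \<in> borel_measurable (PiM I (\<lambda>_. borel))" if "i \<in> I" for i
          using measurable_component_singleton[OF that] .
        then have "(\<lambda>x. \<Sum>i\<in>I. a i * x i) \<in> borel_measurable (PiM I (\<lambda>_. borel))" by measurable
        then show ?thesis by measurable
      qed
      then have "(\<lambda>x. cis (\<Sum>i\<in>I. a i * x i)) \<in> borel_measurable \<kappa>"
        using that(2) measurable_cong_sets by blast
      then have "integrable \<kappa> (\<lambda>x. cis (\<Sum>i\<in>I. a i * x i))"
        using that(1) by (intro finite_measure.integrable_const_bound[where B = 1]) (auto intro: prob_space.finite_measure)
      then have i: "integrable \<kappa> (\<lambda>x. of_real c * (cis s * cis (\<Sum>i\<in>I. a i * x i)))" by simp
      have "c * cos (s + (\<Sum>i\<in>I. a i * x i)) = Re (of_real c * (cis s * cis (\<Sum>i\<in>I. a i * x i)))" for x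
        by (simp add: cis_mult)
      then have "(\<integral>x. c * cos (s + (\<Sum>i\<in>I. a i * x i)) \<partial>\<kappa>) =
         Re (\<integral>x. of_real c * (cis s * cis (\<Sum>i\<in>I. a i * x i)) \<partial>\<kappa>)"
        by (simp only: integral_Re[OF i])
      then show ?thesis by (simp only: integral_mult_right_zero) simp
    qed
    show ?case
      unfolding eq[OF prob(1) sets(1)] eq[OF prob(2) sets(2)]
      by (intro tendsto_intros char)
  next
    case (add f g)
    then show ?case
      by (simp add: int[OF prob(1) sets(1)] int[OF prob(2) sets(2)] tendsto_add)
  qed
qed

text \<open>On a box that carries almost all mass of \<open>\<nu>\<close> and, eventually, of the
  \<open>\<mu> n\<close>, the test function is replaced by a trigonometric polynomial with a bound
  independent of the box. For trigonometric polynomials the hypothesis gives convergence.\<close>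

lemma weak_conv_pow_of_char:
  fixes \<mu> :: "nat \<Rightarrow> (nat \<Rightarrow> real) measure"
  assumes I: "finite I"
    and prob: "\<And>n. prob_space (\<mu> n)" "prob_space \<nu>"
    and sets: "\<And>n. sets (\<mu> n) = sets (PiM I (\<lambda>_. borel))" "sets \<nu> = sets (PiM I (\<lambda>_. borel))"
    and char: "\<And>a. (\<lambda>n. \<integral>x. cis (\<Sum>i\<in>I. a i * x i) \<partial>\<mu> n) \<longlonglongrightarrow> (\<integral>x. cis (\<Sum>i\<in>I. a i * x i) \<partial>\<nu>)"
    and tight: "\<And>e. e > 0 \<Longrightarrow> \<exists>K. \<forall>\<^sub>F n in sequentially. measure (\<mu> n) {x \<in> space (\<mu> n). \<exists>i\<in>I. \<bar>x i\<bar> > K} \<le> e"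
  shows "weak_conv_pow I \<mu> \<nu>"
  unfolding weak_conv_pow_def
proof (intro allI impI, elim conjE)
  fix f assume cont: "continuous_map (powertop_real I) euclideanreal f"
    and bdd: "bounded (f ` topspace (powertop_real I))"
  obtain B where B: "\<And>x. x \<in> extensional I \<Longrightarrow> \<bar>f x\<bar> \<le> B"
    using bdd by (auto simp: bounded_iff PiE_UNIV_domain PiE_def)
  then have "\<bar>f (restrict undefined I)\<bar> \<le> B" by simp
  then have B0: "B \<ge> 0" by linarith
  have fm: "f \<in> borel_measurable (PiM I (\<lambda>_. borel))"
    by (rule powertop_continuous_measurable[OF cont])
  have compm: "(\<lambda>x. x i) \<in> borel_measurable (PiM I (\<lambda>_. borel))" if "i \<in> I" for i
    using measurable_component_singleton[OF that] .
  have tailm: "{x \<in> space (PiM I (\<lambda>_. borel)). \<exists>i\<in>I. \<bar>x i\<bar> > K} \<in> sets (PiM I (\<lambda>_. borel))" for K :: real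
    using compm I by measurable
  have space: "space \<kappa> = space (PiM I (\<lambda>_. borel))" if "sets \<kappa> = sets (PiM I (\<lambda>_. borel))" for \<kappa> :: "(nat \<Rightarrow> real) measure"
    using that by (rule sets_eq_imp_space_eq)
  \<comment> \<open>The error is \<open>2 * e\<close> on the box and at most
    \<open>B + (B + 2)\<close> outside, where the mass is at most \<open>e\<close>.\<close>
  have approx: "\<bar>(\<integral>x. f x \<partial>\<kappa>) - (\<integral>x. g x \<partial>\<kappa>)\<bar> \<le> 2 * e + (2 * B + 2) * e"
    if \<kappa>: "prob_space \<kappa>" "sets \<kappa> = sets (PiM I (\<lambda>_. borel))"
      and tail: "measure \<kappa> {x \<in> space \<kappa>. \<exists>i\<in>I. \<bar>x i\<bar> > K} \<le> e"
      and g: "g \<in> trig_funs I" "\<And>x. \<bar>g x\<bar> \<le> B + 2"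
        "\<And>x. (\<forall>i\<in>I. \<bar>x i\<bar> \<le> K) \<Longrightarrow> (\<forall>i. i \<notin> I \<longrightarrow> x i = 0) \<Longrightarrow> \<bar>f (restrict x I) - g x\<bar> \<le> 2 * e"
      and "e > 0"
    for \<kappa> :: "(nat \<Rightarrow> real) measure" and g e K
  proof -
    interpret \<kappa>: prob_space \<kappa> by fact
    define T where "T = {x \<in> space \<kappa>. \<exists>i\<in>I. \<bar>x i\<bar> > K}"
    have T: "T \<in> sets \<kappa>" using tailm \<kappa>(2) unfolding T_def space[OF \<kappa>(2)] by simp
    have ms: "f \<in> borel_measurable \<kappa>" "g \<in> borel_measurable \<kappa>"
      using fm trig_funs_measurable[OF g(1)] \<kappa>(2) measurable_cong_sets by blast+
    have ext: "x \<in> extensional I" if "x \<in> space \<kappa>" for x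
      using that unfolding space[OF \<kappa>(2)] by (auto simp: space_PiM PiE_def)
    have ints: "integrable \<kappa> f" "integrable \<kappa> g"
      using ms g(2) B ext
      by (intro \<kappa>.integrable_const_bound[of f B] \<kappa>.integrable_const_bound[of g "B + 2"] AE_I2; simp)+
    have "\<bar>f x - g x\<bar> \<le> 2 * e + (2 * B + 2) * indicat_real T x" if x: "x \<in> space \<kappa>" for x
    proof (cases "x \<in> T")
      case True
      have "\<bar>f x\<bar> \<le> B" "\<bar>g x\<bar> \<le> B + 2" using B ext x g by auto
      then show ?thesis using True \<open>e > 0\<close> by simp
    next
      case False
      have "\<bar>f (restrict (zero_outside I x) I) - g (zero_outside I x)\<bar> \<le> 2 * e"
        by (rule g(3)) (use False x in \<open>auto simp: T_def zero_outside_def not_less\<close>)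
      moreover have "g (zero_outside I x) = g x"
        by (rule trig_funs_cong[OF g(1)]) (simp add: zero_outside_def)
      ultimately show ?thesis using False by (simp add: restrict_zero_outside ext x)
    qed
    moreover have intT: "integrable \<kappa> (indicat_real T)"
      using T by (intro integrable_real_indicator) (auto simp: \<kappa>.emeasure_eq_measure)
    ultimately have "(\<integral>x. \<bar>f x - g x\<bar> \<partial>\<kappa>) \<le> (\<integral>x. 2 * e + (2 * B + 2) * indicat_real T x \<partial>\<kappa>)"
      using ints T by (intro integral_mono) auto
    also have "\<dots> = 2 * e + (2 * B + 2) * measure \<kappa> T"
      using T intT by (subst Bochner_Integration.integral_add) (auto simp: \<kappa>.prob_space)
    also have "\<dots> \<le> 2 * e + (2 * B + 2) * e"
      using tail B0 unfolding T_def by (intro add_left_mono mult_left_mono) auto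
    finally show ?thesis
      using ints integral_abs_bound[of \<kappa> "\<lambda>x. f x - g x"] by simp
  qed
  show "(\<lambda>n. \<integral>x. f x \<partial>\<mu> n) \<longlonglongrightarrow> (\<integral>x. f x \<partial>\<nu>)"
  proof (rule LIMSEQ_I)
    fix r :: real assume r: "r > 0"
    \<comment> \<open>Replacing the test function costs at most \<open>r / 4\<close> under
      \<open>\<mu> n\<close> and under \<open>\<nu>\<close>; a further \<open>r / 4\<close> is
      allowed for the trigonometric polynomial.\<close>
    define e where "e = min 1 (r / (4 * (2 * B + 4)))"
    have e: "e > 0" "e \<le> 1" using r B0 by (auto simp: e_def)
    have "e * (2 * B + 4) \<le> r / (4 * (2 * B + 4)) * (2 * B + 4)"
      using B0 by (intro mult_right_mono) (auto simp: e_def)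
    also have "r / (4 * d) * d = r / 4" if "d > 0" for d :: real using that by simp
    then have "r / (4 * (2 * B + 4)) * (2 * B + 4) = r / 4" using B0 by (metis add_nonneg_pos mult_nonneg_nonneg zero_le_numeral zero_less_numeral)
    finally have e2: "2 * e + (2 * B + 2) * e \<le> r / 4" by (simp add: algebra_simps)
    obtain K1 where K1: "\<forall>\<^sub>F n in sequentially. measure (\<mu> n) {x \<in> space (\<mu> n). \<exists>i\<in>I. \<bar>x i\<bar> > K1} \<le> e"
      using tight[OF e(1)] by blast
    interpret \<nu>: prob_space \<nu> by fact
    \<comment> \<open>A single measure is tight: the complements of growing boxes decrease to the
      empty set.\<close>
    define T where "T k = {x \<in> space \<nu>. \<exists>i\<in>I. \<bar>x i\<bar> > real k}" for k :: nat
    have Tm: "T k \<in> sets \<nu>" for k using tailm sets(2) unfolding T_def space[OF sets(2)] by simp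
    have "decseq T"
      unfolding decseq_def T_def by (auto intro: order.strict_trans1[OF of_nat_mono])
    then have "(\<lambda>k. measure \<nu> (T k)) \<longlonglongrightarrow> measure \<nu> (\<Inter>k. T k)"
      using Tm by (intro \<nu>.finite_Lim_measure_decseq) auto
    moreover have "(\<Inter>k. T k) = {}"
    proof -
      have False if xT: "x \<in> (\<Inter>k. T k)" for x
      proof -
        obtain k :: nat where k: "(\<Sum>i\<in>I. \<bar>x i\<bar>) \<le> real k" using real_arch_simple by blast
        obtain i where i: "i \<in> I" "\<bar>x i\<bar> > real k" using xT by (auto simp: T_def)
        have "\<bar>x i\<bar> \<le> (\<Sum>i\<in>I. \<bar>x i\<bar>)" using I i by (intro member_le_sum) auto
        then show False using i k by simp
      qed
      then show ?thesis by blast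
    qed
    ultimately have "(\<lambda>k. measure \<nu> (T k)) \<longlonglongrightarrow> 0" by simp
    then obtain k where k: "measure \<nu> (T k) < e"
      using e by (metis LIMSEQ_D abs_of_nonneg diff_zero le_refl measure_nonneg real_norm_def)
    define K where "K = max (max K1 (real k)) 0"
    have tail_mono: "measure \<kappa> {x \<in> space \<kappa>. \<exists>i\<in>I. \<bar>x i\<bar> > K} \<le> measure \<kappa> {x \<in> space \<kappa>. \<exists>i\<in>I. \<bar>x i\<bar> > K'}"
      if \<kappa>: "prob_space \<kappa>" "sets \<kappa> = sets (PiM I (\<lambda>_. borel))" and "K' \<le> K" for \<kappa> :: "(nat \<Rightarrow> real) measure" and K'
    proof -
      interpret \<kappa>: prob_space \<kappa> by fact
      show ?thesis
        using tailm \<kappa>(2) \<open>K' \<le> K\<close> unfolding space[OF \<kappa>(2)]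
        by (intro \<kappa>.finite_measure_mono) (auto intro: order.strict_trans1[OF \<open>K' \<le> K\<close>])
    qed
    have "K \<ge> 0" by (simp add: K_def)
    moreover have "\<bar>f (restrict x I)\<bar> \<le> B" for x using B by simp
    ultimately obtain g where g: "g \<in> trig_funs I" "\<And>x. \<bar>g x\<bar> \<le> B + 2"
        "\<And>x. (\<forall>i\<in>I. \<bar>x i\<bar> \<le> K) \<Longrightarrow> (\<forall>i. i \<notin> I \<longrightarrow> x i = 0) \<Longrightarrow> \<bar>f (restrict x I) - g x\<bar> \<le> 2 * e"
      using trig_funs_clipped_approx[OF I powertop_continuous_restrict[OF cont], of B e K] e by blast
    have \<nu>: "\<bar>(\<integral>x. f x \<partial>\<nu>) - (\<integral>x. g x \<partial>\<nu>)\<bar> \<le> 2 * e + (2 * B + 2) * e"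
    proof (rule approx[OF prob(2) sets(2) _ g e(1)])
      show "measure \<nu> {x \<in> space \<nu>. \<exists>i\<in>I. K < \<bar>x i\<bar>} \<le> e"
        using tail_mono[OF prob(2) sets(2), of "real k"] k by (auto simp: K_def T_def)
    qed
    have "r / 4 > 0" using r by simp
    from tendstoD[OF trig_funs_integral_conv[OF prob sets char g(1)] this]
    have "\<forall>\<^sub>F n in sequentially. \<bar>(\<integral>x. g x \<partial>\<mu> n) - (\<integral>x. g x \<partial>\<nu>)\<bar> < r / 4"
      unfolding dist_real_def .
    with K1 have "\<forall>\<^sub>F n in sequentially. norm ((\<integral>x. f x \<partial>\<mu> n) - (\<integral>x. f x \<partial>\<nu>)) < r"
    proof eventually_elim
      case (elim n)
      have "\<bar>(\<integral>x. f x \<partial>\<mu> n) - (\<integral>x. g x \<partial>\<mu> n)\<bar> \<le> 2 * e + (2 * B + 2) * e"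
      proof (rule approx[OF prob(1) sets(1) _ g e(1)])
        show "measure (\<mu> n) {x \<in> space (\<mu> n). \<exists>i\<in>I. K < \<bar>x i\<bar>} \<le> e"
          using tail_mono[OF prob(1) sets(1), of K1 n] elim(1) by (auto simp: K_def)
      qed
      then show ?case using \<nu> elim(2) e2 r unfolding real_norm_def by linarith
    qed
    then show "\<exists>no. \<forall>n\<ge>no. norm ((\<integral>x. f x \<partial>\<mu> n) - (\<integral>x. f x \<partial>\<nu>)) < r"
      by (simp add: eventually_sequentially)
  qed
qed

section \<open>The law of the gap process\<close>

lemma repl_mat_row_1:
  assumes "m \<ge> 2" "k \<in> {1..m}"
  shows "(\<Sum>j=1..m. repl_mat m k j) = 1"
proof -
  have "complex_of_real (\<Sum>j=1..m. repl_mat m k j) = (\<Sum>j=1..m. of_real (repl_mat m k j) * 1)"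
    by simp
  also have "\<dots> = 1"
    unfolding repl_mat_row_sum[OF assms] using assms by (auto simp: of_nat_diff)
  finally show ?thesis by (metis of_real_eq_1_iff)
qed

text \<open>The diagonal entry is the only negative one in its column; this is how a transition
  reveals its colour.\<close>

lemma repl_mat_diag_less:
  assumes "m \<ge> 2" "k \<in> {1..m}" "k' \<in> {1..m}" "k \<noteq> k'"
  shows "repl_mat m k k < repl_mat m k' k"
  using assms by (auto simp: repl_mat_def)

locale gap_process = prob_space M for M :: "'a measure" +
  fixes m :: nat and V :: "nat \<Rightarrow> nat" and G :: "nat \<Rightarrow> 'a \<Rightarrow> nat \<Rightarrow> real"
  assumes m_ge_2: "m \<ge> 2"
    and V_nonzero: "\<exists>k\<in>{1..m}. V k \<noteq> 0"
    and gap: "is_gap_process m V M G"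
begin

definition T :: "nat \<Rightarrow> real" where "T n = coord_sum m (gap_init m V) + real n"

lemma T_Suc: "T (Suc n) = T n + 1" by (simp add: T_def)

text \<open>The value \<open>2\<close> keeps \<open>T n - 1\<close> away from zero, as the
  telescoping error terms \<open>1 / (t - 1) - 1 / t\<close> of the growth estimates
  require.\<close>

lemma T_0_ge: "T 0 \<ge> 2"
proof -
  obtain k where k: "k \<in> {1..m}" "V k \<noteq> 0" using V_nonzero by blast
  have "2 * 1 \<le> real (m + k - 1) * real (V k)"
    using k m_ge_2 by (intro mult_mono) auto
  also have "\<dots> \<le> (\<Sum>k=1..m. real (m + k - 1) * real (V k))"
    by (rule member_le_sum[of k "{1..m}" "\<lambda>k. real (m + k - 1) * real (V k)"]) (use k in auto)
  also have "\<dots> = T 0"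
    by (simp add: T_def coord_sum_def gap_init_def)
  finally show ?thesis by simp
qed

lemma T_ge: "T n \<ge> 2 + real n" using T_0_ge by (simp add: T_def)

lemma T_pos: "T n > 0" using T_ge[of n] by linarith

lemma T_ge_1: "T n \<ge> 1" using T_ge[of n] by linarith

lemma T_mono: "i \<le> j \<Longrightarrow> T i \<le> T j" by (simp add: T_def)

section \<open>Finite histories and their probabilities\<close>

definition path :: "nat \<Rightarrow> 'a \<Rightarrow> nat \<Rightarrow> nat \<Rightarrow> real" where
  "path n \<omega> = (\<lambda>i j. if i \<le> n \<and> j \<in> {1..m} then G i \<omega> j else 0)"

definition path_step :: "nat \<Rightarrow> (nat \<Rightarrow> nat \<Rightarrow> real) \<Rightarrow> nat \<Rightarrow> nat \<Rightarrow> nat \<Rightarrow> real" where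
  "path_step n v k = (\<lambda>i j. if i = Suc n \<and> j \<in> {1..m} then v n j + repl_mat m k j else v i j)"

text \<open>The finitely many formal histories. Those of probability zero are included, even with
  negative entries, and are discarded only almost surely.\<close>

primrec paths :: "nat \<Rightarrow> (nat \<Rightarrow> nat \<Rightarrow> real) set" where
  "paths 0 = {\<lambda>i j. if i = 0 \<and> j \<in> {1..m} then gap_init m V j else 0}"
| "paths (Suc n) = (\<lambda>(v, k). path_step n v k) ` (paths n \<times> {1..m})"

lemma finite_paths: "finite (paths n)"
  by (induction n) auto

lemma paths_zero:
  assumes "v \<in> paths n" "n < i \<or> j \<notin> {1..m}"
  shows "v i j = 0"
  using assms
proof (induction n arbitrary: v)
  case (Suc n)
  then obtain w k where v: "v = path_step n w k" "w \<in> paths n" by auto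
  from Suc.IH[OF v(2)] Suc.prems(2) show ?case unfolding v path_step_def by auto
qed auto

lemma paths_coord_sum:
  assumes "v \<in> paths n" "i \<le> n"
  shows "(\<Sum>j=1..m. v i j) = T i"
  using assms
proof (induction n arbitrary: v i)
  case 0
  then show ?case by (simp add: T_def coord_sum_def)
next
  case (Suc n)
  then obtain w k where v: "v = path_step n w k" "w \<in> paths n" "k \<in> {1..m}" by auto
  show ?case
  proof (cases "i = Suc n")
    case True
    then have "(\<Sum>j=1..m. v i j) = (\<Sum>j=1..m. w n j) + (\<Sum>j=1..m. repl_mat m k j)"
      by (simp add: v path_step_def sum.distrib)
    also have "\<dots> = T n + 1"
      using Suc.IH[OF v(2) order_refl] repl_mat_row_1[OF m_ge_2 v(3)] by simp
    finally show ?thesis using True by (simp add: T_Suc)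
  next
    case False
    then show ?thesis using Suc.IH[OF v(2)] Suc.prems by (simp add: v path_step_def)
  qed
qed

text \<open>Turns sums over histories up to time \<open>n + 1\<close> into double sums over shorter
  histories and colours.\<close>

lemma path_step_inj: "inj_on (\<lambda>(v, k). path_step n v k) (paths n \<times> {1..m})"
proof (rule inj_onI, clarify)
  fix v k v' k'
  assume v: "v \<in> paths n" "v' \<in> paths n" and k: "k \<in> {1..m}" "k' \<in> {1..m}"
    and eq: "path_step n v k = path_step n v' k'"
  have vv: "v = v'"
  proof (intro ext)
    fix i j
    show "v i j = v' i j"
      using fun_cong[OF fun_cong[OF eq, of i], of j] paths_zero[OF v(1), of i j] paths_zero[OF v(2), of i j]
      by (cases "i \<le> n") (auto simp: path_step_def)
  qed
  have "repl_mat m k k = repl_mat m k' k"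
    using fun_cong[OF fun_cong[OF eq, of "Suc n"], of k] k by (simp add: path_step_def vv)
  then have "k = k'" using repl_mat_diag_less[OF m_ge_2 k] by auto
  then show "v = v' \<and> k = k'" using vv by simp
qed

lemma G_measurable [measurable]: "j \<in> {1..m} \<Longrightarrow> (\<lambda>\<omega>. G n \<omega> j) \<in> borel_measurable M"
  using gap by (auto simp: is_gap_process_def)

lemma path_eq_iff:
  assumes "v \<in> paths n"
  shows "path n \<omega> = v \<longleftrightarrow> (\<forall>i\<le>n. \<forall>j\<in>{1..m}. G i \<omega> j = v i j)"
  using paths_zero[OF assms] by (auto simp: path_def fun_eq_iff not_le)

lemma path_event: "v \<in> paths n \<Longrightarrow> {\<omega> \<in> space M. path n \<omega> = v} \<in> events"
  by (simp add: path_eq_iff)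

lemma prob_path_step:
  assumes v: "v \<in> paths n" and k: "k \<in> {1..m}"
  shows "prob {\<omega> \<in> space M. path (Suc n) \<omega> = path_step n v k} =
    prob {\<omega> \<in> space M. path n \<omega> = v} * (v n k / T n)"
proof -
  have "path_step n v k \<in> paths (Suc n)" using v k by force
  then have "{\<omega> \<in> space M. path (Suc n) \<omega> = path_step n v k} =
    {\<omega> \<in> space M. (\<forall>i\<le>n. \<forall>j\<in>{1..m}. G i \<omega> j = v i j) \<and>
       (\<forall>j\<in>{1..m}. G (Suc n) \<omega> j = v n j + repl_mat m k j)}"
    by (auto simp: path_eq_iff path_step_def le_Suc_eq)
  moreover have "coord_sum m (v n) = T n"
    using paths_coord_sum[OF v, of n] by (simp add: coord_sum_def)
  ultimately show ?thesis
    using gap k by (simp add: is_gap_process_def path_eq_iff[OF v])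
qed

text \<open>The specification only prescribes the measure of cylinders. That the formal histories
  exhaust the whole mass follows by induction, since the entries of each history add up to
  \<open>T n\<close> and the transition weights therefore to one.\<close>

lemma sum_prob_paths: "(\<Sum>v\<in>paths n. prob {\<omega> \<in> space M. path n \<omega> = v}) = 1"
proof (induction n)
  case 0
  let ?v = "\<lambda>i j. if i = 0 \<and> j \<in> {1..m} then gap_init m V j else 0"
  have "AE \<omega> in M. path 0 \<omega> = ?v"
    using gap by (subst path_eq_iff) (auto simp: is_gap_process_def)
  moreover have "{\<omega> \<in> space M. path 0 \<omega> = ?v} \<in> events" by (rule path_event) simp
  ultimately have "prob {\<omega> \<in> space M. path 0 \<omega> = ?v} = 1"
    by (subst prob_Collect_eq_1) auto
  then show ?case by simp
next
  case (Suc n)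
  have "(\<Sum>v\<in>paths (Suc n). prob {\<omega> \<in> space M. path (Suc n) \<omega> = v}) =
    (\<Sum>(v, k)\<in>paths n \<times> {1..m}. prob {\<omega> \<in> space M. path (Suc n) \<omega> = path_step n v k})"
    unfolding paths.simps by (subst sum.reindex[OF path_step_inj]) (simp add: case_prod_unfold)
  also have "\<dots> = (\<Sum>v\<in>paths n. \<Sum>k=1..m. prob {\<omega> \<in> space M. path n \<omega> = v} * (v n k / T n))"
    unfolding sum.cartesian_product[symmetric] by (intro sum.cong refl prob_path_step)
  also have "\<dots> = (\<Sum>v\<in>paths n. prob {\<omega> \<in> space M. path n \<omega> = v})"
  proof (intro sum.cong refl)
    fix v assume v: "v \<in> paths n"
    have "(\<Sum>k=1..m. prob {\<omega> \<in> space M. path n \<omega> = v} * (v n k / T n)) =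
      prob {\<omega> \<in> space M. path n \<omega> = v} * ((\<Sum>k=1..m. v n k) / T n)"
      by (simp only: sum_distrib_left sum_divide_distrib)
    also have "(\<Sum>k=1..m. v n k) = T n" using paths_coord_sum[OF v, of n] by simp
    finally show "(\<Sum>k=1..m. prob {\<omega> \<in> space M. path n \<omega> = v} * (v n k / T n)) =
      prob {\<omega> \<in> space M. path n \<omega> = v}" using T_pos[of n] by simp
  qed
  finally show ?case using Suc by simp
qed

lemma AE_path_in_paths: "AE \<omega> in M. path n \<omega> \<in> paths n \<and> prob {\<omega>' \<in> space M. path n \<omega>' = path n \<omega>} > 0"
proof -
  define S where "S = {v \<in> paths n. prob {\<omega> \<in> space M. path n \<omega> = v} > 0}"
  have S: "S \<subseteq> paths n" "finite S" using finite_paths[of n] by (auto simp: S_def)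
  have U: "{\<omega> \<in> space M. path n \<omega> \<in> S} = (\<Union>v\<in>S. {\<omega> \<in> space M. path n \<omega> = v})" by auto
  have ev: "(\<lambda>v. {\<omega> \<in> space M. path n \<omega> = v}) ` S \<subseteq> events" using S path_event by auto
  have Uev: "{\<omega> \<in> space M. path n \<omega> \<in> S} \<in> events"
    unfolding U using S ev by (intro sets.finite_UN) auto
  have "prob {\<omega> \<in> space M. path n \<omega> \<in> S} = (\<Sum>v\<in>S. prob {\<omega> \<in> space M. path n \<omega> = v})"
    unfolding U using S ev by (intro finite_measure_finite_Union) (auto simp: disjoint_family_on_def)
  also have "\<dots> = (\<Sum>v\<in>paths n. prob {\<omega> \<in> space M. path n \<omega> = v})"
    using finite_paths S by (intro sum.mono_neutral_left) (auto simp: S_def not_less measure_le_0_iff)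
  finally have "prob {\<omega> \<in> space M. path n \<omega> \<in> S} = 1" using sum_prob_paths by simp
  then have "AE \<omega> in M. path n \<omega> \<in> S" using Uev by (subst (asm) prob_Collect_eq_1) auto
  then show ?thesis by (simp add: S_def)
qed

text \<open>No combinatorial argument is needed for the gaps to stay nonnegative: along a path of positive
  probability, a negative gap would make the measure of some cylinder negative.\<close>

lemma paths_nonneg:
  assumes "v \<in> paths n" "prob {\<omega> \<in> space M. path n \<omega> = v} > 0" "k \<in> {1..m}"
  shows "v n k \<ge> 0"
proof -
  have "0 \<le> prob {\<omega> \<in> space M. path n \<omega> = v} * (v n k / T n)"
    using prob_path_step[OF assms(1,3)] measure_nonneg by metis
  then show ?thesis using assms(2) T_pos[of n] by (simp add: zero_le_mult_iff zero_le_divide_iff not_less)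
qed

text \<open>Almost surely a history takes finitely many values, so every functional of it is
  integrable and has a finite sum as expectation. Measurability is assumed of the composition,
  because \<open>F\<close> is an arbitrary function on histories.\<close>

lemma
  fixes F :: "(nat \<Rightarrow> nat \<Rightarrow> real) \<Rightarrow> 'b::{banach, second_countable_topology}"
  assumes meas: "(\<lambda>\<omega>. F (path n \<omega>)) \<in> borel_measurable M"
  shows integrable_path: "integrable M (\<lambda>\<omega>. F (path n \<omega>))"
    and expectation_path: "(\<integral>\<omega>. F (path n \<omega>) \<partial>M) = (\<Sum>v\<in>paths n. prob {\<omega> \<in> space M. path n \<omega> = v} *\<^sub>R F v)"
proof -
  let ?g = "\<lambda>\<omega>. \<Sum>v\<in>paths n. indicator {\<omega> \<in> space M. path n \<omega> = v} \<omega> *\<^sub>R F v"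
  have eq: "AE \<omega> in M. F (path n \<omega>) = ?g \<omega>"
    using AE_path_in_paths[of n] AE_space
  proof eventually_elim
    case (elim \<omega>)
    have "?g \<omega> = (\<Sum>v\<in>paths n. if v = path n \<omega> then F (path n \<omega>) else 0)"
      using elim by (intro sum.cong refl) (auto simp: indicator_def)
    then show ?case using elim finite_paths by simp
  qed
  have ind: "integrable M (indicat_real {\<omega> \<in> space M. path n \<omega> = v})" if "v \<in> paths n" for v
    using path_event[OF that] by (intro integrable_real_indicator) (auto simp: emeasure_eq_measure)
  then have int: "integrable M ?g"
    by (intro Bochner_Integration.integrable_sum integrable_scaleR_left)
  show "integrable M (\<lambda>\<omega>. F (path n \<omega>))"
    using int by (subst integrable_cong_AE[OF meas _ eq]) auto
  have "(\<integral>\<omega>. F (path n \<omega>) \<partial>M) = (\<integral>\<omega>. ?g \<omega> \<partial>M)"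
    using int by (intro integral_cong_AE[OF meas _ eq]) auto
  also have "\<dots> = (\<Sum>v\<in>paths n. \<integral>\<omega>. indicator {\<omega> \<in> space M. path n \<omega> = v} \<omega> *\<^sub>R F v \<partial>M)"
    using ind by (intro Bochner_Integration.integral_sum integrable_scaleR_left)
  also have "\<dots> = (\<Sum>v\<in>paths n. prob {\<omega> \<in> space M. path n \<omega> = v} *\<^sub>R F v)"
    using ind path_event[of _ n] by (intro sum.cong refl) (simp add: Int_absorb2 Collect_restrict)
  finally show "(\<integral>\<omega>. F (path n \<omega>) \<partial>M) = (\<Sum>v\<in>paths n. prob {\<omega> \<in> space M. path n \<omega> = v} *\<^sub>R F v)" .
qed

text \<open>The Markov property in integrated form: the next step is averaged out under the
  expectation. This takes the place of conditional expectations throughout.\<close>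

lemma expectation_path_Suc:
  fixes F :: "(nat \<Rightarrow> nat \<Rightarrow> real) \<Rightarrow> 'b::{banach, second_countable_topology}"
  assumes meas: "(\<lambda>\<omega>. F (path (Suc n) \<omega>)) \<in> borel_measurable M"
    and meas': "\<And>k. k \<in> {1..m} \<Longrightarrow> (\<lambda>\<omega>. F (path_step n (path n \<omega>) k)) \<in> borel_measurable M"
  shows "(\<integral>\<omega>. F (path (Suc n) \<omega>) \<partial>M) =
    (\<integral>\<omega>. (\<Sum>k=1..m. (G n \<omega> k / T n) *\<^sub>R F (path_step n (path n \<omega>) k)) \<partial>M)"
proof -
  let ?H = "\<lambda>v. \<Sum>k=1..m. (v n k / T n) *\<^sub>R F (path_step n v k)"
  have H: "?H (path n \<omega>) = (\<Sum>k=1..m. (G n \<omega> k / T n) *\<^sub>R F (path_step n (path n \<omega>) k))" for \<omega>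
    by (intro sum.cong refl) (simp add: path_def)
  have Hm: "(\<lambda>\<omega>. ?H (path n \<omega>)) \<in> borel_measurable M"
    unfolding H by (intro borel_measurable_sum borel_measurable_scaleR meas' borel_measurable_divide) auto
  have "(\<integral>\<omega>. F (path (Suc n) \<omega>) \<partial>M) = (\<Sum>(v, k)\<in>paths n \<times> {1..m}.
      prob {\<omega> \<in> space M. path (Suc n) \<omega> = path_step n v k} *\<^sub>R F (path_step n v k))"
    unfolding expectation_path[OF meas] paths.simps
    by (subst sum.reindex[OF path_step_inj]) (simp add: case_prod_unfold)
  also have "\<dots> = (\<Sum>v\<in>paths n. \<Sum>k=1..m.
      (prob {\<omega> \<in> space M. path n \<omega> = v} * (v n k / T n)) *\<^sub>R F (path_step n v k))"
    unfolding sum.cartesian_product[symmetric] by (intro sum.cong refl) (simp only: prob_path_step)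
  also have "\<dots> = (\<Sum>v\<in>paths n. prob {\<omega> \<in> space M. path n \<omega> = v} *\<^sub>R ?H v)"
    by (simp add: scaleR_sum_right)
  also have "\<dots> = (\<integral>\<omega>. ?H (path n \<omega>) \<partial>M)"
    using expectation_path[OF Hm] by simp
  finally show ?thesis unfolding H .
qed

lemma AE_gap_facts:
  "AE \<omega> in M. \<forall>n. (\<Sum>k=1..m. G n \<omega> k) = T n \<and> (\<forall>k\<in>{1..m}. 0 \<le> G n \<omega> k) \<and>
     (\<exists>k\<in>{1..m}. \<forall>j\<in>{1..m}. G (Suc n) \<omega> j = G n \<omega> j + repl_mat m k j)"
  unfolding AE_all_countable
proof
  fix n
  show "AE \<omega> in M. (\<Sum>k=1..m. G n \<omega> k) = T n \<and> (\<forall>k\<in>{1..m}. 0 \<le> G n \<omega> k) \<and>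
     (\<exists>k\<in>{1..m}. \<forall>j\<in>{1..m}. G (Suc n) \<omega> j = G n \<omega> j + repl_mat m k j)"
    using AE_path_in_paths[of n] AE_path_in_paths[of "Suc n"]
  proof eventually_elim
    case (elim \<omega>)
    obtain w k where w: "path (Suc n) \<omega> = path_step n w k" "w \<in> paths n" "k \<in> {1..m}"
      using elim by auto
    have eqn: "path n \<omega> n j = G n \<omega> j" if "j \<in> {1..m}" for j using that by (simp add: path_def)
    have "w n j = G n \<omega> j" if "j \<in> {1..m}" for j
      using fun_cong[OF fun_cong[OF w(1), of n], of j] that by (simp add: path_step_def path_def)
    moreover have "G (Suc n) \<omega> j = w n j + repl_mat m k j" if "j \<in> {1..m}" for j
      using fun_cong[OF fun_cong[OF w(1), of "Suc n"], of j] that by (simp add: path_step_def path_def)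
    ultimately have "\<exists>k\<in>{1..m}. \<forall>j\<in>{1..m}. G (Suc n) \<omega> j = G n \<omega> j + repl_mat m k j"
      using w(3) by (intro bexI[of _ k]) auto
    moreover have "\<forall>k\<in>{1..m}. 0 \<le> G n \<omega> k"
      using paths_nonneg[of "path n \<omega>" n] elim eqn by fastforce
    moreover have "(\<Sum>k=1..m. G n \<omega> k) = T n"
      using paths_coord_sum[of "path n \<omega>" n n] elim by (simp add: eqn)
    ultimately show ?case by blast
  qed
qed

lemma AE_G_0: "AE \<omega> in M. \<forall>j\<in>{1..m}. G 0 \<omega> j = gap_init m V j"
  using gap by (simp add: is_gap_process_def)

end

section \<open>Moments of the eigenforms\<close>

text \<open>In the binomial expansion every term with at least two factors \<open>y\<close> is
  bounded by \<open>y\<^sup>2\<close> times the power \<open>2 * p\<close> of the larger of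
  \<open>|x|\<close> and \<open>|y|\<close>; the binomial coefficients add up to
  \<open>4 ^ (p + 1)\<close>. The linear term is kept since its expectation will vanish.\<close>

lemma power_add_even_le:
  fixes x y :: real
  shows "(x + y) ^ (2 * p + 2) \<le>
    x ^ (2 * p + 2) + real (2 * p + 2) * x ^ (2 * p + 1) * y + 4 ^ (p + 1) * (y\<^sup>2 * (x ^ (2 * p) + y ^ (2 * p)))"
proof -
  define n where "n = 2 * p + 2"
  define c where "c = y\<^sup>2 * (x ^ (2 * p) + y ^ (2 * p))"
  have c: "c \<ge> 0" by (simp add: c_def power_mult)
  have summand: "y ^ k * x ^ (n - k) \<le> c" if k: "2 \<le> k" "k \<le> n" for k
  proof -
    define M where "M = max \<bar>x\<bar> \<bar>y\<bar>"
    have M: "M \<ge> 0" "\<bar>x\<bar> \<le> M" "\<bar>y\<bar> \<le> M" by (auto simp: M_def)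
    have "y ^ k * x ^ (n - k) \<le> \<bar>y\<bar> ^ k * \<bar>x\<bar> ^ (n - k)"
      by (metis abs_ge_self abs_mult power_abs)
    also have "\<dots> = y\<^sup>2 * (\<bar>y\<bar> ^ (k - 2) * \<bar>x\<bar> ^ (n - k))"
    proof -
      have "\<bar>y\<bar> ^ k = \<bar>y\<bar> ^ 2 * \<bar>y\<bar> ^ (k - 2)" using k by (metis le_add_diff_inverse power_add)
      then show ?thesis by simp
    qed
    also have "\<dots> \<le> y\<^sup>2 * (M ^ (k - 2) * M ^ (n - k))"
      using M by (intro mult_left_mono mult_mono power_mono) auto
    also have "M ^ (k - 2) * M ^ (n - k) = M ^ (2 * p)"
    proof -
      have "k - 2 + (n - k) = 2 * p" using k by (simp add: n_def)
      then show ?thesis by (metis power_add)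
    qed
    also have "M ^ (2 * p) \<le> x ^ (2 * p) + y ^ (2 * p)"
      unfolding M_def max_def by (auto simp: power_even_abs zero_le_even_power')
    finally show ?thesis by (simp add: c_def mult_left_mono)
  qed
  have n: "n = Suc (Suc (2 * p))" by (simp add: n_def)
  have "(y + x) ^ n = (\<Sum>k\<le>n. real (n choose k) * y ^ k * x ^ (n - k))"
    by (rule binomial_ring)
  also have "\<dots> = x ^ n + real n * y * x ^ (n - 1) + (\<Sum>k\<in>{2..n}. real (n choose k) * y ^ k * x ^ (n - k))"
  proof -
    have "{..n} = insert 0 (insert 1 {2..n})" using n by auto
    then show ?thesis by simp
  qed
  also have "(\<Sum>k\<in>{2..n}. real (n choose k) * y ^ k * x ^ (n - k)) \<le> (\<Sum>k\<in>{2..n}. real (n choose k) * c)"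
    using summand by (intro sum_mono) (auto simp: mult.assoc intro!: mult_left_mono)
  also have "(\<Sum>k\<in>{2..n}. real (n choose k) * c) \<le> (\<Sum>k\<le>n. real (n choose k) * c)"
    using c by (intro sum_mono2) auto
  also have "\<dots> = 4 ^ (p + 1) * c"
  proof -
    have "(\<Sum>k\<le>n. real (n choose k)) = 2 ^ n"
      by (metis choose_row_sum of_nat_numeral of_nat_power of_nat_sum)
    moreover have "(2::real) ^ n = 4 ^ (p + 1)" by (simp add: n_def power_mult)
    ultimately show ?thesis by (simp add: sum_distrib_right[symmetric])
  qed
  finally show ?thesis
    by (simp add: n_def c_def add.commute mult_ac)
qed

text \<open>The recursion that the induction on \<open>p\<close> in
  \<open>martingale_moment_bound\<close> produces.\<close>

primrec moment_const :: "nat \<Rightarrow> real" where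
  "moment_const 0 = 1"
| "moment_const (Suc p) = 4 ^ (p + 1) * (moment_const p + 1)"

lemma moment_const_pos: "moment_const p > 0"
  by (induction p) (auto intro!: mult_pos_pos add_pos_pos)

text \<open>A Burkholder-type inequality for martingales with deterministically bounded increments.
  Only the orthogonality of the increment to the powers of the current value is needed.\<close>

lemma (in prob_space) martingale_moment_bound:
  fixes D :: "nat \<Rightarrow> 'a \<Rightarrow> real"
  assumes meas: "\<And>j. j \<le> n \<Longrightarrow> D j \<in> borel_measurable M"
    and D0: "\<And>\<omega>. D 0 \<omega> = 0"
    and incr: "AE \<omega> in M. \<forall>j<n. \<bar>D (Suc j) \<omega> - D j \<omega>\<bar> \<le> b j"
    and orth: "\<And>q j. j < n \<Longrightarrow> expectation (\<lambda>\<omega>. D j \<omega> ^ q * (D (Suc j) \<omega> - D j \<omega>)) = 0"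
    and j: "j \<le> n"
  shows "integrable M (\<lambda>\<omega>. D j \<omega> ^ q)"
    and "expectation (\<lambda>\<omega>. D j \<omega> ^ (2 * p)) \<le> moment_const p * (\<Sum>i<j. (b i)\<^sup>2) ^ p"
proof -
  have bnd: "AE \<omega> in M. \<bar>D j \<omega>\<bar> \<le> (\<Sum>i<j. b i)" if "j \<le> n" for j
    using that
  proof (induction j)
    case (Suc j)
    then have "AE \<omega> in M. \<bar>D j \<omega>\<bar> \<le> (\<Sum>i<j. b i)" by simp
    with incr show ?case
    proof eventually_elim
      case (elim \<omega>)
      then have "\<bar>D (Suc j) \<omega> - D j \<omega>\<bar> \<le> b j" using Suc.prems by simp
      then show ?case using elim by simp
    qed
  qed (simp add: D0)
  have intgen: "integrable M (\<lambda>\<omega>. D i \<omega> ^ q * (D j \<omega> - D i \<omega>) ^ r)" if "i \<le> n" "j \<le> n" for i j q r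
  proof (rule integrable_const_bound)
    show "AE \<omega> in M. norm (D i \<omega> ^ q * (D j \<omega> - D i \<omega>) ^ r) \<le> (\<Sum>i<i. b i) ^ q * ((\<Sum>i<j. b i) + (\<Sum>i<i. b i)) ^ r"
      using bnd[OF that(1)] bnd[OF that(2)]
    proof eventually_elim
      case (elim \<omega>)
      then show ?case
        unfolding real_norm_def abs_mult power_abs
        by (intro mult_mono power_mono) (auto intro!: zero_le_power add_nonneg_nonneg order.trans[OF abs_ge_zero])
    qed
    show "(\<lambda>\<omega>. D i \<omega> ^ q * (D j \<omega> - D i \<omega>) ^ r) \<in> borel_measurable M"
      using meas that by (intro borel_measurable_times borel_measurable_power borel_measurable_diff) auto
  qed
  have int: "integrable M (\<lambda>\<omega>. D j \<omega> ^ q)" if "j \<le> n" for j q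
    using intgen[OF that that, of q 0] by simp
  from int[OF j] show "integrable M (\<lambda>\<omega>. D j \<omega> ^ q)" .
  define S where "S j = (\<Sum>i<j. (b i)\<^sup>2)" for j
  have S0: "S j \<ge> 0" for j by (auto simp: S_def intro: sum_nonneg)
  have Smono: "S i \<le> S j" if "i \<le> j" for i j
    unfolding S_def using that by (intro sum_mono2) auto
  have "\<forall>j\<le>n. expectation (\<lambda>\<omega>. D j \<omega> ^ (2 * p)) \<le> moment_const p * S j ^ p"
  proof (induction p)
    case 0
    then show ?case by (simp add: prob_space)
  next
    case (Suc p)
    define c where "c = moment_const (Suc p)"
    have cpos: "c > 0" unfolding c_def by (rule moment_const_pos)
    show ?case
    proof (intro allI impI)
      fix j assume jn: "j \<le> n"
      \<comment> \<open>During the inner induction \<open>S j ^ p\<close> is frozen at the final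
        time; the other factor \<open>S i\<close> then grows by exactly \<open>(b i)\<^sup>2\<close>
        in each step.\<close>
      have "expectation (\<lambda>\<omega>. D i \<omega> ^ (2 * p + 2)) \<le> c * (S i * S j ^ p)" if "i \<le> j" for i
        using that
      proof (induction i)
        case 0
        then show ?case by (simp add: D0 S_def)
      next
        case (Suc i)
        then have ij: "i < j" "i \<le> n" "Suc i \<le> n" using jn by auto
        let ?y = "\<lambda>\<omega>. D (Suc i) \<omega> - D i \<omega>"
        have bS: "(b i)\<^sup>2 \<le> S j"
          using Smono[of "Suc i" j] S0[of i] ij by (simp add: S_def)
        have ae: "AE \<omega> in M. D (Suc i) \<omega> ^ (2 * p + 2) \<le>
           D i \<omega> ^ (2 * p + 2) + real (2 * p + 2) * (D i \<omega> ^ (2 * p + 1) * ?y \<omega>)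
             + 4 ^ (p + 1) * ((b i)\<^sup>2 * (D i \<omega> ^ (2 * p) + S j ^ p))"
          using incr
        proof eventually_elim
          case (elim \<omega>)
          have y: "\<bar>?y \<omega>\<bar> \<le> b i" using elim ij jn by auto
          then have y2: "(?y \<omega>)\<^sup>2 \<le> (b i)\<^sup>2" by (metis abs_ge_zero power2_abs power_mono)
          have "?y \<omega> ^ (2 * p) = ((?y \<omega>)\<^sup>2) ^ p" by (simp add: power_mult)
          also have "\<dots> \<le> S j ^ p" using y2 bS by (intro power_mono) auto
          finally have "(?y \<omega>)\<^sup>2 * (D i \<omega> ^ (2 * p) + ?y \<omega> ^ (2 * p)) \<le> (b i)\<^sup>2 * (D i \<omega> ^ (2 * p) + S j ^ p)"
            using y2 by (intro mult_mono add_left_mono add_nonneg_nonneg) auto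
          then have "4 ^ (p + 1) * ((?y \<omega>)\<^sup>2 * (D i \<omega> ^ (2 * p) + ?y \<omega> ^ (2 * p))) \<le>
              4 ^ (p + 1) * ((b i)\<^sup>2 * (D i \<omega> ^ (2 * p) + S j ^ p))"
            by (rule mult_left_mono) simp
          moreover have e: "D i \<omega> + ?y \<omega> = D (Suc i) \<omega>" by simp
          note power_add_even_le[of "D i \<omega>" "?y \<omega>" p, unfolded e mult.assoc]
          ultimately show ?case by linarith
        qed
        have i1: "integrable M (\<lambda>\<omega>. real (2 * p + 2) * (D i \<omega> ^ (2 * p + 1) * ?y \<omega>))"
          using intgen[OF ij(2,3), of "2 * p + 1" 1] by (intro integrable_mult_right) simp
        have i2: "integrable M (\<lambda>\<omega>. 4 ^ (p + 1) * ((b i)\<^sup>2 * (D i \<omega> ^ (2 * p) + S j ^ p)))"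
          using int[OF ij(2), of "2 * p"] by (intro integrable_mult_right Bochner_Integration.integrable_add) auto
        have i3: "integrable M (\<lambda>\<omega>. D i \<omega> ^ (2 * p + 2) + real (2 * p + 2) * (D i \<omega> ^ (2 * p + 1) * ?y \<omega>))"
          using int[OF ij(2)] i1 by (rule Bochner_Integration.integrable_add)
        have "expectation (\<lambda>\<omega>. D (Suc i) \<omega> ^ (2 * p + 2)) \<le>
          expectation (\<lambda>\<omega>. D i \<omega> ^ (2 * p + 2) + real (2 * p + 2) * (D i \<omega> ^ (2 * p + 1) * ?y \<omega>)
             + 4 ^ (p + 1) * ((b i)\<^sup>2 * (D i \<omega> ^ (2 * p) + S j ^ p)))"
          by (rule integral_mono_AE[OF int[OF ij(3)] Bochner_Integration.integrable_add[OF i3 i2] ae])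
        also have "\<dots> = expectation (\<lambda>\<omega>. D i \<omega> ^ (2 * p + 2)) +
            real (2 * p + 2) * expectation (\<lambda>\<omega>. D i \<omega> ^ (2 * p + 1) * ?y \<omega>) +
            4 ^ (p + 1) * ((b i)\<^sup>2 * (expectation (\<lambda>\<omega>. D i \<omega> ^ (2 * p)) + S j ^ p))"
          unfolding Bochner_Integration.integral_add[OF i3 i2] Bochner_Integration.integral_add[OF int[OF ij(2)] i1]
          by (simp only: integral_mult_right_zero Bochner_Integration.integral_add[OF int[OF ij(2)] integrable_const] lebesgue_integral_const prob_space)
             (simp add: prob_space)
        also have "\<dots> = expectation (\<lambda>\<omega>. D i \<omega> ^ (2 * p + 2)) +
            4 ^ (p + 1) * ((b i)\<^sup>2 * (expectation (\<lambda>\<omega>. D i \<omega> ^ (2 * p)) + S j ^ p))"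
          using orth[of i "2 * p + 1"] ij jn by simp
        also have "\<dots> \<le> c * (S i * S j ^ p) + 4 ^ (p + 1) * ((b i)\<^sup>2 * (moment_const p * S j ^ p + S j ^ p))"
        proof (intro add_mono mult_left_mono)
          have "expectation (\<lambda>\<omega>. D i \<omega> ^ (2 * p)) \<le> moment_const p * S i ^ p"
            using \<open>\<forall>j\<le>n. expectation (\<lambda>\<omega>. D j \<omega> ^ (2 * p)) \<le> moment_const p * S j ^ p\<close> ij by simp
          also have "\<dots> \<le> moment_const p * S j ^ p"
            using Smono[of i j] ij S0 less_imp_le[OF moment_const_pos[of p]] by (intro mult_left_mono power_mono) auto
          finally show "expectation (\<lambda>\<omega>. D i \<omega> ^ (2 * p)) \<le> moment_const p * S j ^ p" .
        qed (use Suc.IH ij in auto)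
        also have "\<dots> = c * (S (Suc i) * S j ^ p)"
          by (simp add: c_def S_def algebra_simps)
        finally show ?case .
      qed
      from this[of j] show "expectation (\<lambda>\<omega>. D j \<omega> ^ (2 * Suc p)) \<le> moment_const (Suc p) * S j ^ Suc p"
        by (simp add: c_def)
    qed
  qed
  then show "expectation (\<lambda>\<omega>. D j \<omega> ^ (2 * p)) \<le> moment_const p * (\<Sum>i<j. (b i)\<^sup>2) ^ p"
    using j by (simp add: S_def)
qed

context gap_process
begin

section \<open>The recursion of the eigenforms and its noise\<close>

definition U :: "complex \<Rightarrow> nat \<Rightarrow> 'a \<Rightarrow> complex" where
  "U z n \<omega> = eig_form m z (\<lambda>k. of_real (G n \<omega> k))"

text \<open>The martingale difference: drawing colour \<open>k\<close> adds
  \<open>z * eig_coeff m z k\<close> to \<open>U z\<close>, and its average over the colours is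
  \<open>z * U z n / T n\<close>.\<close>

definition xi :: "complex \<Rightarrow> nat \<Rightarrow> 'a \<Rightarrow> complex" where
  "xi z n \<omega> = U z (Suc n) \<omega> - (1 + z / of_real (T n)) * U z n \<omega>"

definition coeff_sum :: "complex \<Rightarrow> real" where
  "coeff_sum z = (\<Sum>k=1..m. cmod (eig_coeff m z k))"

definition xi_bound :: "complex \<Rightarrow> real" where
  "xi_bound z = 2 * cmod z * coeff_sum z"

lemma coeff_sum_nonneg: "coeff_sum z \<ge> 0"
  by (simp add: coeff_sum_def sum_nonneg)

lemma xi_bound_nonneg: "xi_bound z \<ge> 0"
  by (simp add: xi_bound_def coeff_sum_nonneg)

lemma U_measurable [measurable]: "U z n \<in> borel_measurable M"
proof -
  have "(\<lambda>\<omega>. \<Sum>k=1..m. eig_coeff m z k * of_real (G n \<omega> k)) \<in> borel_measurable M"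
    by (intro borel_measurable_sum borel_measurable_times borel_measurable_of_real) auto
  then show ?thesis by (simp add: U_def[abs_def] eig_form_eq)
qed

lemma xi_measurable [measurable]: "xi z n \<in> borel_measurable M"
  unfolding xi_def[abs_def] by measurable

lemma eig_form_repl_row:
  assumes "z \<in> gap_roots m" "k \<in> {1..m}"
  shows "eig_form m z (\<lambda>j. of_real (repl_mat m k j)) = z * eig_coeff m z k"
  using eig_form_row[OF m_ge_2 assms] by (simp add: eig_form_eq)

lemma eig_form_cong: "(\<And>k. k \<in> {1..m} \<Longrightarrow> x k = y k) \<Longrightarrow> eig_form m z x = eig_form m z y"
  unfolding eig_form_eq by (intro sum.cong) auto

lemma eig_form_add: "eig_form m z (\<lambda>k. x k + y k) = eig_form m z x + eig_form m z y"
  by (simp add: eig_form_eq distrib_left sum.distrib)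

lemma U_step:
  assumes "z \<in> gap_roots m" "k \<in> {1..m}" "\<forall>j\<in>{1..m}. G (Suc n) \<omega> j = G n \<omega> j + repl_mat m k j"
  shows "U z (Suc n) \<omega> = U z n \<omega> + z * eig_coeff m z k"
proof -
  have "U z (Suc n) \<omega> = eig_form m z (\<lambda>j. of_real (G n \<omega> j) + of_real (repl_mat m k j))"
    unfolding U_def using assms(3) by (intro eig_form_cong) simp
  then show ?thesis by (simp add: eig_form_add eig_form_repl_row[OF assms(1,2)] U_def)
qed

lemma coeff_le_coeff_sum: "k \<in> {1..m} \<Longrightarrow> cmod (eig_coeff m z k) \<le> coeff_sum z"
  unfolding coeff_sum_def by (intro member_le_sum) auto

text \<open>Nonnegative gaps with sum \<open>T n\<close> bound the eigenform linearly in
  \<open>T n\<close>; both the jump and its average are therefore bounded uniformly in time.\<close>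

lemma AE_xi_bound:
  assumes z: "z \<in> gap_roots m"
  shows "AE \<omega> in M. \<forall>n. cmod (xi z n \<omega>) \<le> xi_bound z \<and> cmod (U z n \<omega>) \<le> coeff_sum z * T n"
  using AE_gap_facts
proof eventually_elim
  case (elim \<omega>)
  show ?case
  proof
    fix n
    from elim obtain k where k: "k \<in> {1..m}" "\<forall>j\<in>{1..m}. G (Suc n) \<omega> j = G n \<omega> j + repl_mat m k j"
      and s: "(\<Sum>k=1..m. G n \<omega> k) = T n" and nn: "\<forall>k\<in>{1..m}. 0 \<le> G n \<omega> k" by blast
    have le: "G n \<omega> i \<le> T n" if "i \<in> {1..m}" for i
      unfolding s[symmetric] using nn that by (intro member_le_sum) auto
    have "cmod (U z n \<omega>) \<le> (\<Sum>i=1..m. cmod (eig_coeff m z i) * T n)"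
      unfolding U_def eig_form_eq using nn le
      by (intro order.trans[OF norm_sum] sum_mono) (auto simp: norm_mult intro!: mult_left_mono)
    then have Ub: "cmod (U z n \<omega>) \<le> coeff_sum z * T n"
      by (simp add: coeff_sum_def sum_distrib_right)
    have "xi z n \<omega> = z * eig_coeff m z k - z * (U z n \<omega> / of_real (T n))"
      unfolding xi_def U_step[OF z k] by (simp add: algebra_simps)
    also have "cmod \<dots> \<le> cmod z * cmod (eig_coeff m z k) + cmod z * (cmod (U z n \<omega>) / T n)"
      using T_pos[of n] by (intro order.trans[OF norm_triangle_ineq4]) (simp add: norm_mult norm_divide)
    also have "\<dots> \<le> cmod z * coeff_sum z + cmod z * coeff_sum z"
      using Ub T_pos[of n] coeff_le_coeff_sum[OF k(1)]
      by (intro add_mono mult_left_mono) (auto simp: pos_divide_le_eq)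
    finally show "cmod (xi z n \<omega>) \<le> xi_bound z \<and> cmod (U z n \<omega>) \<le> coeff_sum z * T n"
      using Ub by (simp add: xi_bound_def)
  qed
qed

text \<open>Recovers the history up to time \<open>n\<close> from the next one, so that a function
  of the past times the next increment is a function of a single history, as
  \<open>expectation_path_Suc\<close> requires.\<close>

definition path_cut :: "nat \<Rightarrow> (nat \<Rightarrow> nat \<Rightarrow> real) \<Rightarrow> nat \<Rightarrow> nat \<Rightarrow> real" where
  "path_cut n v = (\<lambda>i j. if i \<le> n then v i j else 0)"

lemma path_cut_path: "path_cut n (path (Suc n) \<omega>) = path n \<omega>"
  by (auto simp: path_cut_def path_def fun_eq_iff)

lemma path_cut_path_step: "path_cut n (path_step n (path n \<omega>) k) = path n \<omega>"
  by (auto simp: path_cut_def path_def path_step_def fun_eq_iff)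

lemma eig_form_path: "i \<le> n \<Longrightarrow> eig_form m z (\<lambda>k. of_real (path n \<omega> i k)) = U z i \<omega>"
  unfolding U_def by (intro eig_form_cong) (simp add: path_def)

text \<open>After averaging over the colours, the mean jump \<open>z * U z n / T n\<close> cancels
  against the compensator, whose weights add up to one. This is the form in which the martingale
  property is used.\<close>

lemma xi_orthogonal:
  assumes z: "z \<in> gap_roots m" and F: "(\<lambda>\<omega>. F (path n \<omega>)) \<in> borel_measurable M"
  shows "expectation (\<lambda>\<omega>. F (path n \<omega>) * xi z n \<omega>) = (0 :: complex)"
proof -
  define H where "H v = F (path_cut n v) * (eig_form m z (\<lambda>k. of_real (v (Suc n) k)) -
     (1 + z / of_real (T n)) * eig_form m z (\<lambda>k. of_real (v n k)))" for v :: "nat \<Rightarrow> nat \<Rightarrow> real"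
  have 1: "H (path (Suc n) \<omega>) = F (path n \<omega>) * xi z n \<omega>" for \<omega>
    unfolding H_def path_cut_path xi_def using eig_form_path[of "Suc n" "Suc n"] eig_form_path[of n "Suc n"]
    by simp
  have 2: "H (path_step n (path n \<omega>) k) = F (path n \<omega>) * (z * eig_coeff m z k - z * U z n \<omega> / of_real (T n))"
    if "k \<in> {1..m}" for k \<omega>
  proof -
    have "eig_form m z (\<lambda>j. of_real (path_step n (path n \<omega>) k (Suc n) j)) =
      eig_form m z (\<lambda>j. of_real (G n \<omega> j) + of_real (repl_mat m k j))"
      by (intro eig_form_cong) (simp add: path_step_def path_def)
    moreover have "eig_form m z (\<lambda>j. of_real (path_step n (path n \<omega>) k n j)) = U z n \<omega>"
      unfolding U_def by (intro eig_form_cong) (simp add: path_step_def path_def)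
    ultimately show ?thesis
      unfolding H_def path_cut_path_step
      by (simp add: eig_form_add eig_form_repl_row[OF z that] U_def algebra_simps)
  qed
  have "expectation (\<lambda>\<omega>. H (path (Suc n) \<omega>)) =
    expectation (\<lambda>\<omega>. \<Sum>k=1..m. (G n \<omega> k / T n) *\<^sub>R H (path_step n (path n \<omega>) k))"
  proof (rule expectation_path_Suc)
    show "(\<lambda>\<omega>. H (path (Suc n) \<omega>)) \<in> borel_measurable M"
      unfolding 1 using F by measurable
    show "(\<lambda>\<omega>. H (path_step n (path n \<omega>) k)) \<in> borel_measurable M" if "k \<in> {1..m}" for k
      unfolding 2[OF that] using F by measurable
  qed
  also have "\<dots> = expectation (\<lambda>\<omega>. 0)"
  proof (rule integral_cong_AE)
    show "AE \<omega> in M. (\<Sum>k=1..m. (G n \<omega> k / T n) *\<^sub>R H (path_step n (path n \<omega>) k)) = 0"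
      using AE_gap_facts
    proof eventually_elim
      case (elim \<omega>)
      then have s: "(\<Sum>k=1..m. G n \<omega> k) = T n" by blast
      have "(\<Sum>k=1..m. (G n \<omega> k / T n) *\<^sub>R H (path_step n (path n \<omega>) k)) =
        (\<Sum>k=1..m. F (path n \<omega>) * z / of_real (T n) * (eig_coeff m z k * of_real (G n \<omega> k)) -
           F (path n \<omega>) * z * U z n \<omega> / of_real (T n) / of_real (T n) * of_real (G n \<omega> k))"
        by (intro sum.cong refl) (simp add: 2 scaleR_conv_of_real diff_divide_distrib algebra_simps)
      also have "\<dots> = F (path n \<omega>) * z / of_real (T n) * U z n \<omega> -
         F (path n \<omega>) * z * U z n \<omega> / of_real (T n) / of_real (T n) * of_real (T n)"
        unfolding sum_subtractf sum_distrib_left[symmetric] of_real_sum[symmetric] s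
        by (simp add: U_def eig_form_eq)
      also have "\<dots> = 0" using T_pos[of n] by simp
      finally show ?case .
    qed
    show "(\<lambda>\<omega>. \<Sum>k=1..m. (G n \<omega> k / T n) *\<^sub>R H (path_step n (path n \<omega>) k)) \<in> borel_measurable M"
    proof (intro borel_measurable_sum)
      fix k assume k: "k \<in> {1..m}"
      show "(\<lambda>\<omega>. (G n \<omega> k / T n) *\<^sub>R H (path_step n (path n \<omega>) k)) \<in> borel_measurable M"
        unfolding 2[OF k] using F k by measurable
    qed
  qed simp
  finally show ?thesis unfolding 1 by simp
qed

text \<open>The factor with which the value at time \<open>j\<close> enters the mean at time
  \<open>n\<close>.\<close>

definition gam :: "complex \<Rightarrow> nat \<Rightarrow> nat \<Rightarrow> complex" where
  "gam z n j = (\<Prod>i\<in>{j..<n}. 1 + z / of_real (T i))"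

lemma gam_self [simp]: "gam z n n = 1"
  by (simp add: gam_def)

lemma gam_Suc_right: "j < n \<Longrightarrow> gam z n j = (1 + z / of_real (T j)) * gam z n (Suc j)"
  unfolding gam_def by (rule prod.atLeast_Suc_lessThan)

lemma gam_Suc_left: "j \<le> n \<Longrightarrow> gam z (Suc n) j = gam z n j * (1 + z / of_real (T n))"
  unfolding gam_def by simp

text \<open>Variation of constants for the recursion: noise from step \<open>j\<close> is
  transported by the factors of the later steps only, whence \<open>Suc j\<close>.\<close>

lemma U_decomposition:
  assumes "k \<le> l" "l \<le> n"
  shows "gam z n l * U z l \<omega> = gam z n k * U z k \<omega> + (\<Sum>j\<in>{k..<l}. gam z n (Suc j) * xi z j \<omega>)"
  using assms
proof (induction l rule: dec_induct)
  case (step l)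
  have "gam z n (Suc l) * U z (Suc l) \<omega> = gam z n (Suc l) * xi z l \<omega> + gam z n l * U z l \<omega>"
    using step.prems gam_Suc_right[of l n z] by (simp add: xi_def algebra_simps)
  then show ?case using step by simp
qed simp

lemma cmod_even_power_le:
  "cmod w ^ (2 * p) \<le> 2 ^ p * (Re w ^ (2 * p) + Im w ^ (2 * p))"
proof -
  define M where "M = max ((Re w)\<^sup>2) ((Im w)\<^sup>2)"
  have "cmod w ^ (2 * p) = ((Re w)\<^sup>2 + (Im w)\<^sup>2) ^ p"
    by (simp add: power_mult cmod_power2)
  also have "\<dots> \<le> (2 * M) ^ p"
    by (intro power_mono add_nonneg_nonneg) (auto simp: M_def)
  also have "\<dots> = 2 ^ p * M ^ p" by (simp add: power_mult_distrib)
  also have "M ^ p \<le> Re w ^ (2 * p) + Im w ^ (2 * p)"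
    by (auto simp: M_def max_def power_mult)
  finally show ?thesis by simp
qed

text \<open>For a fixed final time \<open>n\<close> the partial sums of the transported noise form a
  martingale in their length. \<open>martingale_moment_bound\<close> is applied to real and
  imaginary part separately.\<close>

lemma
  assumes z: "z \<in> gap_roots m" and kn: "k \<le> n"
  shows U_moment_bound: "expectation (\<lambda>\<omega>. cmod (U z n \<omega> - gam z n k * U z k \<omega>) ^ (2 * p)) \<le>
      2 ^ (p + 1) * moment_const p * (\<Sum>j\<in>{k..<n}. (cmod (gam z n (Suc j)) * xi_bound z)\<^sup>2) ^ p"
    and U_moment_integrable: "integrable M (\<lambda>\<omega>. cmod (U z n \<omega> - gam z n k * U z k \<omega>) ^ (2 * p))"
proof -
  define W where "W l \<omega> = (\<Sum>j<l. gam z n (Suc (k + j)) * xi z (k + j) \<omega>)" for l \<omega>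
  define b where "b j = cmod (gam z n (Suc (k + j))) * xi_bound z" for j
  have Wm: "W l \<in> borel_measurable M" for l unfolding W_def[abs_def] by measurable
  \<comment> \<open>The partial sum depends on the history up to its own time only, which is what
    makes the next noise term orthogonal to its powers.\<close>
  have Wpath: "\<exists>F. \<forall>\<omega>. W l \<omega> = F (path (k + l) \<omega>)" for l
  proof -
    have "W l \<omega> = (\<Sum>j<l. gam z n (Suc (k + j)) *
        (eig_form m z (\<lambda>i. of_real (path (k + l) \<omega> (Suc (k + j)) i)) -
           (1 + z / of_real (T (k + j))) * eig_form m z (\<lambda>i. of_real (path (k + l) \<omega> (k + j) i))))" for \<omega>
      unfolding W_def xi_def by (intro sum.cong refl) (simp add: eig_form_path)
    then show ?thesis
      by (intro exI[of _ "\<lambda>v. \<Sum>j<l. gam z n (Suc (k + j)) * (eig_form m z (\<lambda>i. of_real (v (Suc (k + j)) i)) -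
           (1 + z / of_real (T (k + j))) * eig_form m z (\<lambda>i. of_real (v (k + j) i)))"]) blast
  qed
  have WU: "W (n - k) \<omega> = U z n \<omega> - gam z n k * U z k \<omega>" for \<omega>
  proof -
    have "W (n - k) \<omega> = (\<Sum>j\<in>{k..<n}. gam z n (Suc j) * xi z j \<omega>)"
      unfolding W_def by (rule sum.reindex_bij_witness[where i = "\<lambda>j. j - k" and j = "\<lambda>j. k + j"]) (use kn in auto)
    then show ?thesis using U_decomposition[of k n n z \<omega>] kn by simp
  qed
  have bsum: "(\<Sum>j<n - k. (b j)\<^sup>2) = (\<Sum>j\<in>{k..<n}. (cmod (gam z n (Suc j)) * xi_bound z)\<^sup>2)"
    unfolding b_def by (rule sum.reindex_bij_witness[where i = "\<lambda>j. j - k" and j = "\<lambda>j. k + j"]) (use kn in auto)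
  have Wincr: "AE \<omega> in M. \<forall>j<n - k. cmod (W (Suc j) \<omega> - W j \<omega>) \<le> b j"
    using AE_xi_bound[OF z]
  proof eventually_elim
    case (elim \<omega>)
    then show ?case by (auto simp: W_def b_def norm_mult intro!: mult_left_mono)
  qed
  have orth: "expectation (\<lambda>\<omega>. f (W j \<omega>) * (W (Suc j) \<omega> - W j \<omega>)) = 0"
    if "f \<in> borel_measurable borel" for f :: "complex \<Rightarrow> complex" and j
  proof -
    obtain F where F: "\<And>\<omega>. W j \<omega> = F (path (k + j) \<omega>)" using Wpath by blast
    have "(\<lambda>\<omega>. (\<lambda>v. f (F v) * gam z n (Suc (k + j))) (path (k + j) \<omega>)) \<in> borel_measurable M"
      unfolding F[symmetric] using Wm[of j] that by measurable
    from xi_orthogonal[OF z this] show ?thesis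
      by (simp add: W_def F[symmetric] mult.assoc)
  qed
  have real_part: "integrable M (\<lambda>\<omega>. R (W (n - k) \<omega>) ^ q)"
      "expectation (\<lambda>\<omega>. R (W (n - k) \<omega>) ^ (2 * p)) \<le> moment_const p * (\<Sum>i<n - k. (b i)\<^sup>2) ^ p"
    if R: "R = Re \<or> R = Im" for R q
  proof -
    have Rd: "R (x - y) = R x - R y" "R 0 = 0" "\<bar>R x\<bar> \<le> cmod x" for x y
      using R by (auto intro: abs_Re_le_cmod abs_Im_le_cmod)
    have Rm: "R \<in> borel_measurable borel" using R by auto
    have 1: "(\<lambda>\<omega>. R (W j \<omega>)) \<in> borel_measurable M" for j
      using measurable_compose[OF Wm Rm] .
    have 2: "R (W 0 \<omega>) = 0" for \<omega> by (simp add: W_def Rd)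
    have 3: "AE \<omega> in M. \<forall>j<n - k. \<bar>R (W (Suc j) \<omega>) - R (W j \<omega>)\<bar> \<le> b j"
      using Wincr by eventually_elim (metis Rd(1,3) order.trans)
    have 4: "expectation (\<lambda>\<omega>. R (W j \<omega>) ^ q * (R (W (Suc j) \<omega>) - R (W j \<omega>))) = 0" if "j < n - k" for j q
    proof -
      have fm: "(\<lambda>x. complex_of_real (R x ^ q)) \<in> borel_measurable borel" for q
        using Rm by measurable
      have o: "expectation (\<lambda>\<omega>. of_real (R (W j \<omega>) ^ q) * (W (Suc j) \<omega> - W j \<omega>)) = 0"
        by (rule orth[OF fm])
      obtain F where F: "\<And>\<omega>. W (Suc j) \<omega> = F (path (k + Suc j) \<omega>)" using Wpath by blast
      obtain F' where F': "\<And>\<omega>. W j \<omega> = F' (path (k + j) \<omega>)" using Wpath by blast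
      have cut: "path (k + j) \<omega> = path_cut (k + j) (path (k + Suc j) \<omega>)" for \<omega>
        using path_cut_path[of "k + j" \<omega>] by simp
      have "integrable M (\<lambda>\<omega>. of_real (R (W j \<omega>) ^ q) * (W (Suc j) \<omega> - W j \<omega>))"
        unfolding F F' cut
        by (rule integrable_path[where n = "k + Suc j"], unfold cut[symmetric] F[symmetric] F'[symmetric])
           (use 1 Wm in measurable)
      note i = this
      have "expectation (\<lambda>\<omega>. R (of_real (R (W j \<omega>) ^ q) * (W (Suc j) \<omega> - W j \<omega>))) = R 0"
        using R integral_Re[OF i] integral_Im[OF i] o by auto
      moreover have "R (of_real x * y) = x * R y" for x y using R by auto
      ultimately show ?thesis by (simp only: Rd) 
    qed
    show "integrable M (\<lambda>\<omega>. R (W (n - k) \<omega>) ^ q)"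
      "expectation (\<lambda>\<omega>. R (W (n - k) \<omega>) ^ (2 * p)) \<le> moment_const p * (\<Sum>i<n - k. (b i)\<^sup>2) ^ p"
      using martingale_moment_bound[where D = "\<lambda>j \<omega>. R (W j \<omega>)" and b = b and n = "n - k" and j = "n - k", OF 1 2 3 4]
      by auto
  qed
  let ?f = "\<lambda>\<omega>. 2 ^ p * (Re (W (n - k) \<omega>) ^ (2 * p) + Im (W (n - k) \<omega>) ^ (2 * p))"
  have intf: "integrable M ?f" using real_part(1)[of Re] real_part(1)[of Im] by auto
  have int: "integrable M (\<lambda>\<omega>. cmod (W (n - k) \<omega>) ^ (2 * p))"
    by (rule Bochner_Integration.integrable_bound[OF intf])
       (use Wm in \<open>auto simp: cmod_even_power_le abs_of_nonneg intro!: order.trans[OF cmod_even_power_le]\<close>)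
  then show "integrable M (\<lambda>\<omega>. cmod (U z n \<omega> - gam z n k * U z k \<omega>) ^ (2 * p))"
    unfolding WU .
  have "expectation (\<lambda>\<omega>. cmod (W (n - k) \<omega>) ^ (2 * p)) \<le> expectation ?f"
    by (intro integral_mono int intf cmod_even_power_le)
  also have "\<dots> = 2 ^ p * (expectation (\<lambda>\<omega>. Re (W (n - k) \<omega>) ^ (2 * p)) + expectation (\<lambda>\<omega>. Im (W (n - k) \<omega>) ^ (2 * p)))"
    using real_part(1)[of Re] real_part(1)[of Im] by simp
  also have "\<dots> \<le> 2 ^ p * (moment_const p * (\<Sum>i<n - k. (b i)\<^sup>2) ^ p + moment_const p * (\<Sum>i<n - k. (b i)\<^sup>2) ^ p)"
    using real_part(2)[of Re] real_part(2)[of Im] by (intro mult_left_mono add_mono) auto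
  finally show "expectation (\<lambda>\<omega>. cmod (U z n \<omega> - gam z n k * U z k \<omega>) ^ (2 * p)) \<le>
      2 ^ (p + 1) * moment_const p * (\<Sum>j\<in>{k..<n}. (cmod (gam z n (Suc j)) * xi_bound z)\<^sup>2) ^ p"
    unfolding WU bsum by (simp add: mult.assoc)
qed

end

section \<open>Growth of the transport factors\<close>

lemma ln_one_plus_lower:
  fixes x :: real
  assumes "x \<ge> 0"
  shows "x - x\<^sup>2 \<le> ln (1 + x)"
proof (cases "x \<le> 1")
  case True
  then show ?thesis using ln_one_plus_pos_lower_bound[of x] assms by simp
next
  case False
  then have "x - x\<^sup>2 \<le> 0" by (simp add: power2_eq_square mult_le_cancel_right1)
  also have "0 \<le> ln (1 + x)" using assms by simp
  finally show ?thesis .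
qed

text \<open>Replaces \<open>exp (s / t)\<close> by a power of \<open>(t + 1) / t\<close>, so that
  the main terms telescope in a product over \<open>t\<close>. The second-order errors
  \<open>1 / t\<^sup>2\<close> are bounded by \<open>1 / (t - 1) - 1 / t\<close> to telescope as
  well.\<close>

lemma cmod_one_plus_le:
  assumes t: "t \<ge> (2::real)" and s: "Re z \<le> s"
  shows "cmod (1 + z / of_real t) \<le> ((t + 1) / t) powr s * exp ((\<bar>s\<bar> + (cmod z)\<^sup>2) * (1 / (t - 1) - 1 / t))"
proof -
  define w where "w = z / of_real t"
  have Rew: "Re w = Re z / t" and cw: "cmod w = cmod z / t" using t by (simp_all add: w_def norm_divide)
  have "(cmod (1 + w))\<^sup>2 = 1 + (2 * Re w + (cmod w)\<^sup>2)"
    unfolding cmod_power2 by (simp add: power2_eq_square algebra_simps)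
  also have "\<dots> \<le> exp (2 * Re w + (cmod w)\<^sup>2)" by (rule exp_ge_add_one_self)
  also have "\<dots> = (exp (Re w + (cmod w)\<^sup>2 / 2))\<^sup>2"
    by (simp add: exp_double[symmetric] algebra_simps)
  finally have 1: "cmod (1 + w) \<le> exp (Re w + (cmod w)\<^sup>2 / 2)"
    by (rule power2_le_imp_le) simp
  have tt: "1 / t\<^sup>2 \<le> 1 / (t - 1) - 1 / t"
  proof -
    have "1 / (t - 1) - 1 / t = 1 / (t * (t - 1))" using t by (simp add: divide_simps)
    also have "\<dots> \<ge> 1 / t\<^sup>2"
      using t by (intro divide_left_mono) (auto simp: power2_eq_square)
    finally show ?thesis .
  qed
  have lnb: "\<bar>1 / t - ln ((t + 1) / t)\<bar> \<le> 1 / t\<^sup>2"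
  proof -
    have e: "(t + 1) / t = 1 + 1 / t" using t by (simp add: field_simps)
    have "1 / t - (1 / t)\<^sup>2 \<le> ln (1 + 1 / t)" "ln (1 + 1 / t) \<le> 1 / t"
      using t by (auto intro!: ln_one_plus_lower ln_add_one_self_le_self)
    then show ?thesis unfolding e by (simp add: power_divide)
  qed
  have "Re w + (cmod w)\<^sup>2 / 2 \<le> s / t + (cmod z)\<^sup>2 / 2 * (1 / t\<^sup>2)"
  proof -
    have "Re w \<le> s / t" using s t by (simp add: Rew divide_right_mono)
    moreover have "(cmod w)\<^sup>2 / 2 = (cmod z)\<^sup>2 / 2 * (1 / t\<^sup>2)" by (simp add: cw power_divide)
    ultimately show ?thesis by linarith
  qed
  also have "s / t = s * ln ((t + 1) / t) + s * (1 / t - ln ((t + 1) / t))"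
    by (simp add: algebra_simps)
  also have "s * (1 / t - ln ((t + 1) / t)) \<le> \<bar>s\<bar> * (1 / t\<^sup>2)"
  proof -
    have "s * (1 / t - ln ((t + 1) / t)) \<le> \<bar>s\<bar> * \<bar>1 / t - ln ((t + 1) / t)\<bar>"
      unfolding abs_mult[symmetric] by (rule abs_ge_self)
    also have "\<dots> \<le> \<bar>s\<bar> * (1 / t\<^sup>2)" using lnb by (rule mult_left_mono) simp
    finally show ?thesis .
  qed
  also have "s * ln ((t + 1) / t) + \<bar>s\<bar> * (1 / t\<^sup>2) + (cmod z)\<^sup>2 / 2 * (1 / t\<^sup>2) \<le>
      s * ln ((t + 1) / t) + (\<bar>s\<bar> + (cmod z)\<^sup>2) * (1 / t\<^sup>2)"
  proof -
    have "0 \<le> (cmod z)\<^sup>2 * (1 / t\<^sup>2)" by simp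
    then show ?thesis unfolding distrib_right by linarith
  qed
  also have "\<dots> \<le> s * ln ((t + 1) / t) + (\<bar>s\<bar> + (cmod z)\<^sup>2) * (1 / (t - 1) - 1 / t)"
    using tt by (intro add_left_mono mult_left_mono) auto
  finally have "exp (Re w + (cmod w)\<^sup>2 / 2) \<le> exp (s * ln ((t + 1) / t)) * exp ((\<bar>s\<bar> + (cmod z)\<^sup>2) * (1 / (t - 1) - 1 / t))"
    by (simp add: exp_add[symmetric])
  also have "exp (s * ln ((t + 1) / t)) = ((t + 1) / t) powr s"
    using t by (simp add: powr_def)
  finally show ?thesis using 1 unfolding w_def by linarith
qed

text \<open>The comparison of a sum with an integral, one step at a time, by the mean value theorem;
  it covers \<open>a < 1\<close> and \<open>a > 1\<close> alike.\<close>

lemma powr_increment_ge: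
  fixes a x :: real
  assumes "x > 0" "a \<ge> 0" "a \<noteq> 1"
  shows "(x + 1) powr (- a) \<le> ((x + 1) powr (1 - a) - x powr (1 - a)) / (1 - a)"
proof -
  have "\<exists>y>x. y < x + 1 \<and> (x + 1) powr (1 - a) - x powr (1 - a) = (x + 1 - x) * ((1 - a) * y powr (1 - a - 1))"
  proof (rule MVT2)
    fix y assume "x \<le> y" "y \<le> x + 1"
    then show "((\<lambda>y. y powr (1 - a)) has_real_derivative (1 - a) * y powr (1 - a - 1)) (at y)"
      using assms by (intro has_real_derivative_powr) auto
  qed simp
  then obtain y where y: "x < y" "y < x + 1" "(x + 1) powr (1 - a) - x powr (1 - a) = (1 - a) * y powr (- a)"
    by auto
  have "(x + 1) powr (- a) \<le> y powr (- a)"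
    using y assms by (intro powr_mono2') auto
  then show ?thesis using y(3) assms by simp
qed

context gap_process
begin

text \<open>Powers and error exponents both telescope, so the constant does not depend on the number
  of factors.\<close>

lemma gam_bound:
  assumes s: "Re z \<le> s"
  obtains K where "K \<ge> 1" "\<And>n j. j \<le> n \<Longrightarrow> cmod (gam z n j) \<le> K * (T n / T j) powr s"
proof
  define C where "C = \<bar>s\<bar> + (cmod z)\<^sup>2"
  have C: "C \<ge> 0" by (simp add: C_def)
  show "exp C \<ge> 1" using C by simp
  fix n j :: nat assume "j \<le> n"
  then have "cmod (gam z n j) \<le> (T n / T j) powr s * exp (C * (1 / (T j - 1) - 1 / (T n - 1)))"
  proof (induction n rule: dec_induct)
    case base
    then show ?case using T_pos[of j] by simp
  next
    case (step n)
    have "cmod (gam z (Suc n) j) = cmod (gam z n j) * cmod (1 + z / of_real (T n))"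
      using step by (simp add: gam_Suc_left norm_mult)
    also have "\<dots> \<le> ((T n / T j) powr s * exp (C * (1 / (T j - 1) - 1 / (T n - 1)))) *
       (((T n + 1) / T n) powr s * exp (C * (1 / (T n - 1) - 1 / T n)))"
      using step T_ge[of n] s unfolding C_def
      by (intro mult_mono cmod_one_plus_le) auto
    also have "\<dots> = ((T n / T j) powr s * ((T n + 1) / T n) powr s) *
       (exp (C * (1 / (T j - 1) - 1 / (T n - 1))) * exp (C * (1 / (T n - 1) - 1 / T n)))"
      by (simp only: mult_ac)
    also have "(T n / T j) powr s * ((T n + 1) / T n) powr s = (T (Suc n) / T j) powr s"
      using T_pos[of n] T_pos[of j] by (subst powr_mult[symmetric]) (auto simp: T_Suc)
    also have "exp (C * (1 / (T j - 1) - 1 / (T n - 1))) * exp (C * (1 / (T n - 1) - 1 / T n)) =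
       exp (C * (1 / (T j - 1) - 1 / (T (Suc n) - 1)))"
      unfolding exp_add[symmetric] T_Suc by (simp add: algebra_simps)
    finally show ?case .
  qed
  also have "\<dots> \<le> (T n / T j) powr s * exp C"
  proof -
    have "1 / (T j - 1) - 1 / (T n - 1) \<le> 1"
    proof -
      have "1 / (T j - 1) \<le> 1" "1 / (T n - 1) \<ge> 0" using T_ge[of j] T_ge[of n] by auto
      then show ?thesis by linarith
    qed
    then show ?thesis using C by (intro mult_left_mono) (auto simp: mult_left_le)
  qed
  finally show "cmod (gam z n j) \<le> exp C * (T n / T j) powr s" by (simp add: mult.commute)
qed

lemma sum_T_powr_le:
  assumes "a \<ge> 0" "a \<noteq> 1" "k \<le> n"
  shows "(\<Sum>j\<in>{k..<n}. T (Suc j) powr (- a)) \<le> (T n powr (1 - a) - T k powr (1 - a)) / (1 - a)"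
  using assms(3)
proof (induction n rule: dec_induct)
  case (step n)
  have "T (Suc n) powr (- a) \<le> (T (Suc n) powr (1 - a) - T n powr (1 - a)) / (1 - a)"
    unfolding T_Suc using powr_increment_ge[OF T_pos assms(1,2)] .
  then show ?case using step by (simp add: diff_divide_distrib)
qed simp

text \<open>The variance of the transported noise between times \<open>k\<close> and
  \<open>n\<close>. The excluded exponent \<open>s = 1/2\<close> would bring in a logarithm.\<close>

lemma sum_gam_sq_le:
  assumes K: "\<And>n j. j \<le> n \<Longrightarrow> cmod (gam z n j) \<le> K * (T n / T j) powr s" "K \<ge> 0"
    and s: "s \<ge> 0" "s \<noteq> 1/2" and "k \<le> n"
  shows "(\<Sum>j\<in>{k..<n}. (cmod (gam z n (Suc j)) * xi_bound z)\<^sup>2) \<le>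
    (K * xi_bound z)\<^sup>2 * (T n powr (2 * s) * ((T n powr (1 - 2 * s) - T k powr (1 - 2 * s)) / (1 - 2 * s)))"
proof -
  have "(\<Sum>j\<in>{k..<n}. (cmod (gam z n (Suc j)) * xi_bound z)\<^sup>2) \<le>
     (\<Sum>j\<in>{k..<n}. (K * xi_bound z)\<^sup>2 * (T n powr (2 * s) * T (Suc j) powr (- (2 * s))))"
  proof (rule sum_mono)
    fix j assume j: "j \<in> {k..<n}"
    have "cmod (gam z n (Suc j)) * xi_bound z \<le> (K * (T n / T (Suc j)) powr s) * xi_bound z"
      using j by (intro mult_right_mono K xi_bound_nonneg) auto
    then have "(cmod (gam z n (Suc j)) * xi_bound z)\<^sup>2 \<le> ((K * (T n / T (Suc j)) powr s) * xi_bound z)\<^sup>2"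
      by (intro power_mono) (auto intro: mult_nonneg_nonneg xi_bound_nonneg)
    also have "\<dots> = (K * xi_bound z)\<^sup>2 * ((T n / T (Suc j)) powr s)\<^sup>2"
      by (simp add: power_mult_distrib)
    also have "((T n / T (Suc j)) powr s)\<^sup>2 = (T n / T (Suc j)) powr (2 * s)"
      by (simp add: power2_eq_square powr_add[symmetric])
    also have "\<dots> = T n powr (2 * s) * T (Suc j) powr (- (2 * s))"
      using T_pos[of n] T_pos[of "Suc j"] by (simp add: powr_divide powr_minus_divide)
    finally show "(cmod (gam z n (Suc j)) * xi_bound z)\<^sup>2 \<le>
      (K * xi_bound z)\<^sup>2 * (T n powr (2 * s) * T (Suc j) powr (- (2 * s)))" .
  qed
  also have "\<dots> = (K * xi_bound z)\<^sup>2 * (T n powr (2 * s) * (\<Sum>j\<in>{k..<n}. T (Suc j) powr (- (2 * s))))"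
    by (simp add: sum_distrib_left)
  also have "\<dots> \<le> (K * xi_bound z)\<^sup>2 * (T n powr (2 * s) * ((T n powr (1 - 2 * s) - T k powr (1 - 2 * s)) / (1 - 2 * s)))"
    using s \<open>k \<le> n\<close> by (intro mult_left_mono sum_T_powr_le) auto
  finally show ?thesis .
qed

text \<open>For \<open>s > 1/2\<close> the sum of squared weights is dominated by its lower end:
  relative to \<open>T n powr (2 * s)\<close>, the noise after time \<open>k\<close> contributes
  only \<open>T k powr (1 - 2 * s)\<close>, which tends to zero with a polynomial rate.\<close>

lemma U_moment_large:
  assumes z: "z \<in> gap_roots m" and s: "Re z \<le> s" "s > 1/2"
  obtains C where "C > 0" "\<And>n k. k \<le> n \<Longrightarrow>
    expectation (\<lambda>\<omega>. cmod (U z n \<omega> - gam z n k * U z k \<omega>) ^ (2 * p)) \<le> C * (T n powr (2 * s) * T k powr (1 - 2 * s)) ^ p"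
proof -
  obtain K where K: "K \<ge> 1" "\<And>n j. j \<le> n \<Longrightarrow> cmod (gam z n j) \<le> K * (T n / T j) powr s"
    using gam_bound[OF s(1)] by blast
  define c where "c = (K * xi_bound z)\<^sup>2 / (2 * s - 1)"
  have c: "c \<ge> 0" using s by (simp add: c_def)
  have bound: "expectation (\<lambda>\<omega>. cmod (U z n \<omega> - gam z n k * U z k \<omega>) ^ (2 * p)) \<le>
    2 ^ (p + 1) * moment_const p * c ^ p * (T n powr (2 * s) * T k powr (1 - 2 * s)) ^ p" if "k \<le> n" for n k
  proof -
    have "(\<Sum>j\<in>{k..<n}. (cmod (gam z n (Suc j)) * xi_bound z)\<^sup>2) \<le>
      (K * xi_bound z)\<^sup>2 * (T n powr (2 * s) * ((T n powr (1 - 2 * s) - T k powr (1 - 2 * s)) / (1 - 2 * s)))"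
      by (rule sum_gam_sq_le) (use K s that in auto)
    also have "(T n powr (1 - 2 * s) - T k powr (1 - 2 * s)) / (1 - 2 * s) =
        (T k powr (1 - 2 * s) - T n powr (1 - 2 * s)) / (2 * s - 1)"
      by (metis minus_diff_eq minus_divide_divide)
    also have "(K * xi_bound z)\<^sup>2 * (T n powr (2 * s) * ((T k powr (1 - 2 * s) - T n powr (1 - 2 * s)) / (2 * s - 1))) \<le>
       (K * xi_bound z)\<^sup>2 * (T n powr (2 * s) * (T k powr (1 - 2 * s) / (2 * s - 1)))"
      using s by (intro mult_left_mono divide_right_mono) auto
    finally have "(\<Sum>j\<in>{k..<n}. (cmod (gam z n (Suc j)) * xi_bound z)\<^sup>2) \<le> c * (T n powr (2 * s) * T k powr (1 - 2 * s))"
      by (simp add: c_def)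
    then have "(\<Sum>j\<in>{k..<n}. (cmod (gam z n (Suc j)) * xi_bound z)\<^sup>2) ^ p \<le> (c * (T n powr (2 * s) * T k powr (1 - 2 * s))) ^ p"
      by (intro power_mono sum_nonneg) auto
    then have "2 ^ (p + 1) * moment_const p * (\<Sum>j\<in>{k..<n}. (cmod (gam z n (Suc j)) * xi_bound z)\<^sup>2) ^ p \<le>
       2 ^ (p + 1) * moment_const p * (c * (T n powr (2 * s) * T k powr (1 - 2 * s))) ^ p"
      using moment_const_pos[of p] by (intro mult_left_mono) auto
    from order.trans[OF U_moment_bound[OF z that, of p] this] show ?thesis
      by (simp add: power_mult_distrib mult.assoc)
  qed
  define C where "C = 2 ^ (p + 1) * moment_const p * c ^ p + 1"
  show thesis
  proof (rule that)
    show "C > 0" using moment_const_pos[of p] c by (auto simp: C_def intro!: add_nonneg_pos mult_nonneg_nonneg)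
    fix n k :: nat assume "k \<le> n"
    have "0 \<le> (T n powr (2 * s) * T k powr (1 - 2 * s)) ^ p" by simp
    with bound[OF \<open>k \<le> n\<close>] show "expectation (\<lambda>\<omega>. cmod (U z n \<omega> - gam z n k * U z k \<omega>) ^ (2 * p)) \<le> C * (T n powr (2 * s) * T k powr (1 - 2 * s)) ^ p"
      unfolding C_def distrib_right by linarith
  qed
qed

lemma AE_U_0: "AE \<omega> in M. U z 0 \<omega> = eig_form m z (\<lambda>k. of_real (gap_init m V k))"
  using AE_G_0 by eventually_elim (auto simp: U_def intro!: eig_form_cong)

lemma U_integrable_power:
  assumes z: "z \<in> gap_roots m"
  shows "integrable M (\<lambda>\<omega>. cmod (U z n \<omega>) ^ q)" "integrable M (U z n)"
proof -
  have ae: "AE \<omega> in M. cmod (U z n \<omega>) \<le> coeff_sum z * T n"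
    using AE_xi_bound[OF z] by eventually_elim blast
  show "integrable M (U z n)" by (rule integrable_const_bound[OF ae]) simp
  show "integrable M (\<lambda>\<omega>. cmod (U z n \<omega>) ^ q)"
  proof (rule integrable_const_bound)
    show "AE \<omega> in M. norm (cmod (U z n \<omega>) ^ q) \<le> (coeff_sum z * T n) ^ q"
      using ae by eventually_elim (auto intro!: power_mono)
  qed simp
qed

text \<open>Below \<open>1/2\<close> the sum of squared weights is dominated by its upper end and is
  of order \<open>T n\<close>; the initial value, transported with exponent below
  \<open>1/2\<close>, is no larger.\<close>

lemma U_second_moment_small:
  assumes z: "z \<in> gap_roots m" and s: "Re z < 1/2"
  obtains C where "C > 0" "\<And>n. expectation (\<lambda>\<omega>. (cmod (U z n \<omega>))\<^sup>2) \<le> C * T n"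
    "\<And>n. expectation (\<lambda>\<omega>. cmod (U z n \<omega>)) \<le> C * sqrt (T n)"
proof -
  \<comment> \<open>The sum estimate needs a nonnegative exponent, so roots with negative real part
    are treated as if it were zero.\<close>
  define s where "s = max 0 (Re z)"
  have s: "Re z \<le> s" "0 \<le> s" "s < 1/2" using assms(2) by (auto simp: s_def)
  obtain K where K: "K \<ge> 1" "\<And>n j. j \<le> n \<Longrightarrow> cmod (gam z n j) \<le> K * (T n / T j) powr s"
    using gam_bound[OF s(1)] by blast
  define u0 where "u0 = cmod (eig_form m z (\<lambda>k. of_real (gap_init m V k)))"
  define c where "c = (K * xi_bound z)\<^sup>2 / (1 - 2 * s)"
  define C where "C = 2 * (2 * 2 * moment_const 1 * c) + 2 * (K * u0)\<^sup>2 + 1"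
  have c: "c \<ge> 0" using s by (simp add: c_def)
  have C: "C \<ge> 1" unfolding C_def using c moment_const_pos[of 1] by simp
  have bound: "expectation (\<lambda>\<omega>. (cmod (U z n \<omega>))\<^sup>2) \<le> C * T n" for n
  proof -
    let ?X = "\<lambda>\<omega>. U z n \<omega> - gam z n 0 * U z 0 \<omega>"
    have "(\<Sum>j\<in>{0..<n}. (cmod (gam z n (Suc j)) * xi_bound z)\<^sup>2) \<le>
      (K * xi_bound z)\<^sup>2 * (T n powr (2 * s) * ((T n powr (1 - 2 * s) - T 0 powr (1 - 2 * s)) / (1 - 2 * s)))"
      by (rule sum_gam_sq_le) (use K s in auto)
    also have "\<dots> \<le> (K * xi_bound z)\<^sup>2 * (T n powr (2 * s) * (T n powr (1 - 2 * s) / (1 - 2 * s)))"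
      using s by (intro mult_left_mono divide_right_mono) auto
    also have "\<dots> = c * (T n powr (2 * s) * T n powr (1 - 2 * s))" by (simp add: c_def)
    also have "T n powr (2 * s) * T n powr (1 - 2 * s) = T n"
      using T_pos[of n] by (simp add: powr_add[symmetric])
    finally have "2 * 2 * moment_const 1 * (\<Sum>j\<in>{0..<n}. (cmod (gam z n (Suc j)) * xi_bound z)\<^sup>2) \<le> 2 * 2 * moment_const 1 * (c * T n)"
      using moment_const_pos[of 1] by (intro mult_left_mono) auto
    then have X: "expectation (\<lambda>\<omega>. (cmod (?X \<omega>))\<^sup>2) \<le> 2 * 2 * moment_const 1 * (c * T n)"
      using U_moment_bound[OF z, of 0 n 1] by (simp add: power2_eq_square)
    have Xi: "integrable M (\<lambda>\<omega>. (cmod (?X \<omega>))\<^sup>2)"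
      using U_moment_integrable[OF z, of 0 n 1] by simp
    have g0: "(cmod (gam z n 0))\<^sup>2 \<le> K\<^sup>2 * T n"
    proof -
      have "cmod (gam z n 0) \<le> K * (T n / T 0) powr s" by (rule K) simp
      also have "\<dots> \<le> K * T n powr (1/2)"
      proof (intro mult_left_mono)
        have "(T n / T 0) powr s \<le> T n powr s"
          using T_pos[of n] T_ge_1[of 0] s by (intro powr_mono2) (auto simp: divide_le_eq mult_le_cancel_left1)
        also have "\<dots> \<le> T n powr (1/2)" using s T_ge_1[of n] by (intro powr_mono) auto
        finally show "(T n / T 0) powr s \<le> T n powr (1/2)" .
      qed (use K in auto)
      finally have "(cmod (gam z n 0))\<^sup>2 \<le> (K * T n powr (1/2))\<^sup>2" by (intro power_mono) auto
      then show ?thesis using T_pos[of n] by (simp add: power_mult_distrib powr_half_sqrt)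
    qed
    have "AE \<omega> in M. (cmod (U z n \<omega>))\<^sup>2 \<le> 2 * (cmod (?X \<omega>))\<^sup>2 + 2 * (K\<^sup>2 * T n * u0\<^sup>2)"
      using AE_U_0[of z]
    proof eventually_elim
      case (elim \<omega>)
      have "(cmod (U z n \<omega>))\<^sup>2 \<le> (cmod (?X \<omega>) + cmod (gam z n 0 * U z 0 \<omega>))\<^sup>2"
        by (intro power_mono norm_ge_zero) (metis diff_add_cancel norm_triangle_ineq)
      also have "\<dots> \<le> 2 * (cmod (?X \<omega>))\<^sup>2 + 2 * (cmod (gam z n 0 * U z 0 \<omega>))\<^sup>2"
        using zero_le_power2[of "cmod (?X \<omega>) - cmod (gam z n 0 * U z 0 \<omega>)"]
        by (simp add: power2_eq_square algebra_simps)
      also have "(cmod (gam z n 0 * U z 0 \<omega>))\<^sup>2 \<le> K\<^sup>2 * T n * u0\<^sup>2"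
        unfolding norm_mult power_mult_distrib elim u0_def[symmetric] using g0 by (intro mult_right_mono) auto
      finally show ?case by simp
    qed
    then have "expectation (\<lambda>\<omega>. (cmod (U z n \<omega>))\<^sup>2) \<le> expectation (\<lambda>\<omega>. 2 * (cmod (?X \<omega>))\<^sup>2 + 2 * (K\<^sup>2 * T n * u0\<^sup>2))"
      using Xi U_integrable_power(1)[OF z, of n 2] by (intro integral_mono_AE) auto
    also have "\<dots> = 2 * expectation (\<lambda>\<omega>. (cmod (?X \<omega>))\<^sup>2) + 2 * (K\<^sup>2 * T n * u0\<^sup>2)"
      using Xi by (simp add: prob_space)
    also have "\<dots> \<le> 2 * (2 * 2 * moment_const 1 * (c * T n)) + 2 * (K\<^sup>2 * T n * u0\<^sup>2)"
      using X by simp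
    also have "\<dots> \<le> C * T n"
      using T_pos[of n] by (simp add: C_def algebra_simps power_mult_distrib)
    finally show ?thesis .
  qed
  have bound1: "expectation (\<lambda>\<omega>. cmod (U z n \<omega>)) \<le> C * sqrt (T n)" for n
  proof -
    define r where "r = sqrt (T n)"
    have r: "r > 0" "r * r = T n" using T_pos[of n] by (auto simp: r_def)
    \<comment> \<open>The elementary substitute for the Cauchy-Schwarz inequality, with
      \<open>r\<close> equal to the expected order of magnitude.\<close>
    have am: "x \<le> (x\<^sup>2 / r + r) / 2" for x :: real
      using zero_le_power2[of "x - r"] r(1) by (simp add: field_simps power2_eq_square)
    have "expectation (\<lambda>\<omega>. cmod (U z n \<omega>)) \<le> expectation (\<lambda>\<omega>. ((cmod (U z n \<omega>))\<^sup>2 / r + r) / 2)"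
      using U_integrable_power(1)[OF z, of n 2] U_integrable_power(1)[OF z, of n 1]
      by (intro integral_mono am) auto
    also have "\<dots> = (expectation (\<lambda>\<omega>. (cmod (U z n \<omega>))\<^sup>2) / r + r) / 2"
      using U_integrable_power(1)[OF z, of n 2] by (simp add: prob_space)
    also have "\<dots> \<le> (C * T n / r + r) / 2"
      using bound[of n] r by (intro divide_right_mono add_right_mono) auto
    also have "C * T n / r = C * r" using r by (simp add: r(2)[symmetric])
    also have "(C * r + r) / 2 \<le> C * r" using C r by simp
    finally show ?thesis by (simp add: r_def)
  qed
  show thesis using that[of C] C bound bound1 by auto
qed

end

section \<open>Large phases\<close>

lemma norm_add_even_power_le:
  fixes x y :: "'b::real_normed_vector"
  shows "norm (x + y) ^ (2 * q) \<le> 4 ^ q * (norm x ^ (2 * q) + norm y ^ (2 * q))"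
proof -
  define M where "M = max (norm x) (norm y)"
  have "norm (x + y) ^ (2 * q) \<le> (2 * M) ^ (2 * q)"
    by (intro power_mono order.trans[OF norm_triangle_ineq]) (auto simp: M_def)
  also have "\<dots> = 4 ^ q * M ^ (2 * q)" by (simp add: power_mult power_mult_distrib)
  also have "M ^ (2 * q) \<le> norm x ^ (2 * q) + norm y ^ (2 * q)" by (auto simp: M_def max_def)
  finally show ?thesis by simp
qed

context prob_space
begin

lemma AE_summable_of_expectation:
  fixes f :: "nat \<Rightarrow> 'a \<Rightarrow> real"
  assumes int: "\<And>n. integrable M (f n)" and nonneg: "\<And>n \<omega>. 0 \<le> f n \<omega>"
    and sum: "summable (\<lambda>n. expectation (f n))"
  shows "AE \<omega> in M. summable (\<lambda>n. f n \<omega>)"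
proof -
  have [measurable]: "f n \<in> borel_measurable M" for n using int by auto
  have "(\<integral>\<^sup>+\<omega>. (\<Sum>n. ennreal (f n \<omega>)) \<partial>M) = (\<Sum>n. \<integral>\<^sup>+\<omega>. ennreal (f n \<omega>) \<partial>M)"
    by (rule nn_integral_suminf) measurable
  also have "\<dots> = (\<Sum>n. ennreal (expectation (f n)))"
    using int nonneg by (intro suminf_cong nn_integral_eq_integral) auto
  also have "\<dots> = ennreal (\<Sum>n. expectation (f n))"
    using sum nonneg by (intro suminf_ennreal2) (auto intro: Bochner_Integration.integral_nonneg)
  finally have "(\<integral>\<^sup>+\<omega>. (\<Sum>n. ennreal (f n \<omega>)) \<partial>M) \<noteq> \<infinity>" by simp
  then have "AE \<omega> in M. (\<Sum>n. ennreal (f n \<omega>)) \<noteq> \<infinity>"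
    by (intro nn_integral_PInf_AE) measurable
  then show ?thesis
    by eventually_elim (use nonneg in \<open>auto intro!: summable_suminf_not_top\<close>)
qed

text \<open>Fatou's lemma, which also yields the integrability of the limit.\<close>

lemma expectation_le_of_AE_limit:
  fixes Y :: "nat \<Rightarrow> 'a \<Rightarrow> real"
  assumes int: "\<And>j. integrable M (Y j)" and nonneg: "\<And>j \<omega>. 0 \<le> Y j \<omega>"
    and [measurable]: "Z \<in> borel_measurable M" and Z: "\<And>\<omega>. 0 \<le> Z \<omega>"
    and lim: "AE \<omega> in M. (\<lambda>j. Y j \<omega>) \<longlonglongrightarrow> Z \<omega>"
    and le: "\<forall>\<^sub>F j in sequentially. expectation (Y j) \<le> c"
  shows "integrable M Z" "expectation Z \<le> c"
proof -
  have [measurable]: "Y j \<in> borel_measurable M" for j using int by auto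
  have "0 \<le> expectation (Y j)" for j using nonneg by simp
  then have c: "c \<ge> 0" using le by (auto simp: eventually_sequentially intro: order.trans)
  have "(\<integral>\<^sup>+\<omega>. ennreal (Z \<omega>) \<partial>M) = (\<integral>\<^sup>+\<omega>. liminf (\<lambda>j. ennreal (Y j \<omega>)) \<partial>M)"
  proof (rule nn_integral_cong_AE)
    show "AE \<omega> in M. ennreal (Z \<omega>) = liminf (\<lambda>j. ennreal (Y j \<omega>))"
      using lim
    proof eventually_elim
      case (elim \<omega>)
      then have "(\<lambda>j. ennreal (Y j \<omega>)) \<longlonglongrightarrow> ennreal (Z \<omega>)" by (intro tendsto_ennrealI)
      then show ?case by (simp add: lim_imp_Liminf)
    qed
  qed
  also have "\<dots> \<le> liminf (\<lambda>j. \<integral>\<^sup>+\<omega>. ennreal (Y j \<omega>) \<partial>M)"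
    by (rule nn_integral_liminf) measurable
  also have "\<dots> = liminf (\<lambda>j. ennreal (expectation (Y j)))"
    using int nonneg by (intro arg_cong[of _ _ liminf] ext nn_integral_eq_integral) auto
  also have "\<dots> \<le> ennreal c"
  proof -
    have "\<forall>\<^sub>F j in sequentially. ennreal (expectation (Y j)) \<le> ennreal c"
      using le by eventually_elim (rule ennreal_leI)
    then show ?thesis
      by (metis Liminf_le trivial_limit_sequentially)
  qed
  finally have le: "(\<integral>\<^sup>+\<omega>. ennreal (Z \<omega>) \<partial>M) \<le> ennreal c" .
  then show int: "integrable M Z"
    using Z by (intro integrableI_nonneg) (auto simp: less_top[symmetric] top_unique)
  show "expectation Z \<le> c"
    using le Z c int by (subst (asm) nn_integral_eq_integral) (auto simp: ennreal_le_iff)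
qed

text \<open>Convergence to zero almost surely and in all even moments, packaged because both modes
  behave alike under sums and domination. Even moments suffice to control every real exponent
  \<open>p \<ge> 1\<close>.\<close>

definition negligible :: "(nat \<Rightarrow> 'a \<Rightarrow> 'b::{second_countable_topology,real_normed_vector}) \<Rightarrow> bool" where
  "negligible Y \<longleftrightarrow> (\<forall>n. Y n \<in> borel_measurable M) \<and> (\<forall>n q. integrable M (\<lambda>\<omega>. norm (Y n \<omega>) ^ (2 * q))) \<and>
     (\<forall>q\<ge>1. (\<lambda>n. expectation (\<lambda>\<omega>. norm (Y n \<omega>) ^ (2 * q))) \<longlonglongrightarrow> 0) \<and>
     (AE \<omega> in M. (\<lambda>n. Y n \<omega>) \<longlonglongrightarrow> 0)"

lemma negligible_dominated:
  assumes Y: "negligible Y" and [measurable]: "\<And>n. Z n \<in> borel_measurable M"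
    and le: "\<And>n. AE \<omega> in M. norm (Z n \<omega>) \<le> c * norm (Y n \<omega>)" and c: "c \<ge> 0"
  shows "negligible Z"
  unfolding negligible_def
proof (intro conjI allI impI)
  have int: "integrable M (\<lambda>\<omega>. c ^ (2 * q) * norm (Y n \<omega>) ^ (2 * q))" for n q
    using Y by (auto simp: negligible_def)
  have leq: "AE \<omega> in M. norm (Z n \<omega>) ^ (2 * q) \<le> c ^ (2 * q) * norm (Y n \<omega>) ^ (2 * q)" for n q
    using le[of n] by eventually_elim (metis norm_ge_zero power_mono power_mult_distrib)
  show i: "integrable M (\<lambda>\<omega>. norm (Z n \<omega>) ^ (2 * q))" for n q
    by (rule Bochner_Integration.integrable_bound[OF int[of q n]]) (use leq[of n q] c in \<open>auto\<close>)
  show "(\<lambda>n. expectation (\<lambda>\<omega>. norm (Z n \<omega>) ^ (2 * q))) \<longlonglongrightarrow> 0" if "q \<ge> 1" for q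
  proof (rule tendsto_sandwich[OF _ _ tendsto_const])
    show "\<forall>\<^sub>F n in sequentially. expectation (\<lambda>\<omega>. norm (Z n \<omega>) ^ (2 * q)) \<le>
      c ^ (2 * q) * expectation (\<lambda>\<omega>. norm (Y n \<omega>) ^ (2 * q))"
      using integral_mono_AE[OF i int leq] by simp
    show "(\<lambda>n. c ^ (2 * q) * expectation (\<lambda>\<omega>. norm (Y n \<omega>) ^ (2 * q))) \<longlonglongrightarrow> 0"
      using Y that by (intro tendsto_mult_right_zero) (auto simp: negligible_def)
  qed simp
  have "AE \<omega> in M. \<forall>n. norm (Z n \<omega>) \<le> c * norm (Y n \<omega>)" using le by (simp add: AE_all_countable)
  moreover have "AE \<omega> in M. (\<lambda>n. Y n \<omega>) \<longlonglongrightarrow> 0" using Y by (simp add: negligible_def)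
  ultimately show "AE \<omega> in M. (\<lambda>n. Z n \<omega>) \<longlonglongrightarrow> 0"
  proof eventually_elim
    case (elim \<omega>)
    then have "(\<lambda>n. c * norm (Y n \<omega>)) \<longlonglongrightarrow> 0" by (intro tendsto_mult_right_zero tendsto_norm_zero)
    then show ?case
      by (rule Lim_null_comparison[rotated]) (use elim in auto)
  qed
qed simp

lemma negligible_add:
  assumes X: "negligible X" and Y: "negligible Y"
  shows "negligible (\<lambda>n \<omega>. X n \<omega> + Y n \<omega>)"
  unfolding negligible_def
proof (intro conjI allI impI)
  have [measurable]: "X n \<in> borel_measurable M" "Y n \<in> borel_measurable M" for n
    using X Y by (auto simp: negligible_def)
  have ix: "integrable M (\<lambda>\<omega>. norm (X n \<omega>) ^ (2 * q))" and iy: "integrable M (\<lambda>\<omega>. norm (Y n \<omega>) ^ (2 * q))" for n q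
    using X Y by (auto simp: negligible_def)
  have int: "integrable M (\<lambda>\<omega>. 4 ^ q * (norm (X n \<omega>) ^ (2 * q) + norm (Y n \<omega>) ^ (2 * q)))" for n q
    using ix iy by simp
  show "(\<lambda>\<omega>. X n \<omega> + Y n \<omega>) \<in> borel_measurable M" for n by measurable
  show i: "integrable M (\<lambda>\<omega>. norm (X n \<omega> + Y n \<omega>) ^ (2 * q))" for n q
    by (rule Bochner_Integration.integrable_bound[OF int[of q n]])
       (auto intro!: order.trans[OF norm_add_even_power_le])
  show "(\<lambda>n. expectation (\<lambda>\<omega>. norm (X n \<omega> + Y n \<omega>) ^ (2 * q))) \<longlonglongrightarrow> 0" if "q \<ge> 1" for q
  proof (rule tendsto_sandwich[OF _ _ tendsto_const])
    show "\<forall>\<^sub>F n in sequentially. expectation (\<lambda>\<omega>. norm (X n \<omega> + Y n \<omega>) ^ (2 * q)) \<le>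
      4 ^ q * (expectation (\<lambda>\<omega>. norm (X n \<omega>) ^ (2 * q)) + expectation (\<lambda>\<omega>. norm (Y n \<omega>) ^ (2 * q)))"
      using integral_mono[OF i int norm_add_even_power_le] ix iy by simp
    have "(\<lambda>n. 4 ^ q * (expectation (\<lambda>\<omega>. norm (X n \<omega>) ^ (2 * q)) + expectation (\<lambda>\<omega>. norm (Y n \<omega>) ^ (2 * q))))
        \<longlonglongrightarrow> 4 ^ q * (0 + 0)"
      using X Y that by (intro tendsto_intros) (auto simp: negligible_def)
    then show "(\<lambda>n. 4 ^ q * (expectation (\<lambda>\<omega>. norm (X n \<omega>) ^ (2 * q)) + expectation (\<lambda>\<omega>. norm (Y n \<omega>) ^ (2 * q))))
        \<longlonglongrightarrow> 0" by simp
  qed simp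
  have "AE \<omega> in M. (\<lambda>n. X n \<omega>) \<longlonglongrightarrow> 0" "AE \<omega> in M. (\<lambda>n. Y n \<omega>) \<longlonglongrightarrow> 0"
    using X Y by (auto simp: negligible_def)
  then show "AE \<omega> in M. (\<lambda>n. X n \<omega> + Y n \<omega>) \<longlonglongrightarrow> 0"
    by eventually_elim (rule tendsto_add_zero)
qed

lemma negligible_deterministic:
  assumes c: "c \<longlonglongrightarrow> 0" and Z: "Z \<in> borel_measurable M" "\<And>q. integrable M (\<lambda>\<omega>. cmod (Z \<omega>) ^ (2 * q))"
  shows "negligible (\<lambda>n \<omega>. c n * Z \<omega>)"
  unfolding negligible_def
proof (intro conjI allI impI)
  show "(\<lambda>\<omega>. c n * Z \<omega>) \<in> borel_measurable M" for n using Z by measurable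
  show "integrable M (\<lambda>\<omega>. cmod (c n * Z \<omega>) ^ (2 * q))" for n q
    using Z by (simp add: norm_mult power_mult_distrib)
  show "(\<lambda>n. expectation (\<lambda>\<omega>. cmod (c n * Z \<omega>) ^ (2 * q))) \<longlonglongrightarrow> 0" if "q \<ge> 1" for q
  proof -
    have "(\<lambda>n. cmod (c n) ^ (2 * q) * expectation (\<lambda>\<omega>. cmod (Z \<omega>) ^ (2 * q))) \<longlonglongrightarrow> cmod 0 ^ (2 * q) * expectation (\<lambda>\<omega>. cmod (Z \<omega>) ^ (2 * q))"
      using c by (intro tendsto_intros)
    then show ?thesis using that by (simp add: norm_mult power_mult_distrib power_0_left)
  qed
  show "AE \<omega> in M. (\<lambda>n. c n * Z \<omega>) \<longlonglongrightarrow> 0"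
    using c by (auto intro: tendsto_mult_left_zero)
qed

lemma negligible_zero: "negligible (\<lambda>n \<omega>. 0)"
  unfolding negligible_def by (auto simp: power_0_left)

lemma negligible_sum:
  assumes "finite A" "\<And>i. i \<in> A \<Longrightarrow> negligible (Y i)"
  shows "negligible (\<lambda>n \<omega>. \<Sum>i\<in>A. Y i n \<omega>)"
  using assms by (induction A rule: finite_induct) (auto intro: negligible_zero negligible_add)

text \<open>Any polynomial rate becomes summable after raising it to a high power; this is why
  moments of all orders are bounded and not only the second.\<close>

lemma powr_power_summable:
  assumes d: "d > (0::real)"
  obtains q :: nat where "q \<ge> 1" "summable (\<lambda>n. (real (Suc n) powr (- d)) ^ q)"
proof -
  obtain q :: nat where q: "real q > 2 / d" using reals_Archimedean2 by blast
  have q1: "q \<ge> 1" using q d by (cases q) (auto simp: field_simps not_less)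
  have "d * real q \<ge> 2" using q d by (simp add: field_simps)
  have s: "summable (\<lambda>n. real (Suc n) powr (- (d * real q)))"
    using \<open>d * real q \<ge> 2\<close> summable_Suc_iff[of "\<lambda>n. real n powr (- (d * real q))"]
    by (simp add: summable_real_powr_iff del: of_nat_Suc)
  have "(real (Suc n) powr (- d)) ^ q = real (Suc n) powr (- (d * real q))" for n
    by (simp add: powr_realpow[symmetric] powr_powr del: of_nat_Suc)
  then show thesis using that[OF q1] s by simp
qed

text \<open>For large \<open>q\<close> the moments of order \<open>2 * q\<close> are summable over
  \<open>n\<close>. Then so are almost surely the powers of the norms, and their terms tend to
  zero.\<close>

lemma negligible_of_rate:
  fixes Y :: "nat \<Rightarrow> 'a \<Rightarrow> 'b::{second_countable_topology,real_normed_vector}"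
  assumes [measurable]: "\<And>n. Y n \<in> borel_measurable M" and int: "\<And>n q. integrable M (\<lambda>\<omega>. norm (Y n \<omega>) ^ (2 * q))"
    and d: "d > 0" and rate: "\<And>q. \<exists>C. \<forall>n. expectation (\<lambda>\<omega>. norm (Y n \<omega>) ^ (2 * q)) \<le> C * (real (Suc n) powr (- d)) ^ q"
  shows "negligible Y"
  unfolding negligible_def
proof (intro conjI allI impI int)
  show "(\<lambda>n. expectation (\<lambda>\<omega>. norm (Y n \<omega>) ^ (2 * q))) \<longlonglongrightarrow> 0" if q: "q \<ge> 1" for q
  proof -
    obtain C where C: "\<And>n. expectation (\<lambda>\<omega>. norm (Y n \<omega>) ^ (2 * q)) \<le> C * (real (Suc n) powr (- d)) ^ q"
      using rate by blast
    have "(\<lambda>n. real n powr (- d)) \<longlonglongrightarrow> 0"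
      using d by (intro tendsto_neg_powr filterlim_real_sequentially) auto
    then have "(\<lambda>n. real (Suc n) powr (- d)) \<longlonglongrightarrow> 0"
      by (rule LIMSEQ_Suc[of "\<lambda>n. real n powr (- d)"])
    then have "(\<lambda>n. C * (real (Suc n) powr (- d)) ^ q) \<longlonglongrightarrow> C * 0 ^ q"
      by (intro tendsto_intros)
    then have "(\<lambda>n. C * (real (Suc n) powr (- d)) ^ q) \<longlonglongrightarrow> 0" using q by (simp add: power_0_left)
    then show ?thesis
      by (rule tendsto_sandwich[OF _ _ tendsto_const, rotated 2]) (use C in auto)
  qed
  obtain q where q: "q \<ge> 1" "summable (\<lambda>n. (real (Suc n) powr (- d)) ^ q)"
    using powr_power_summable[OF d] .
  obtain C where C: "\<And>n. expectation (\<lambda>\<omega>. norm (Y n \<omega>) ^ (2 * q)) \<le> C * (real (Suc n) powr (- d)) ^ q"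
    using rate by blast
  have "summable (\<lambda>n. expectation (\<lambda>\<omega>. norm (Y n \<omega>) ^ (2 * q)))"
  proof (rule summable_comparison_test')
    show "summable (\<lambda>n. C * (real (Suc n) powr (- d)) ^ q)" using q(2) by (rule summable_mult)
    show "norm (expectation (\<lambda>\<omega>. norm (Y n \<omega>) ^ (2 * q))) \<le> C * (real (Suc n) powr (- d)) ^ q" if "n \<ge> 0" for n
      using C[of n] by (simp add: abs_of_nonneg Bochner_Integration.integral_nonneg)
  qed
  then have "AE \<omega> in M. summable (\<lambda>n. norm (Y n \<omega>) ^ (2 * q))"
    by (intro AE_summable_of_expectation int) auto
  then show "AE \<omega> in M. (\<lambda>n. Y n \<omega>) \<longlonglongrightarrow> 0"
  proof eventually_elim
    case (elim \<omega>)
    then have "(\<lambda>n. norm (Y n \<omega>) ^ (2 * q)) \<longlonglongrightarrow> 0" by (rule summable_LIMSEQ_zero)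
    then have "(\<lambda>n. root (2 * q) (norm (Y n \<omega>) ^ (2 * q))) \<longlonglongrightarrow> root (2 * q) 0" by (rule tendsto_real_root)
    then show ?case using q(1) by (simp add: real_root_power_cancel tendsto_norm_zero_iff)
  qed
qed simp

text \<open>Polynomial rates for all moments replace the martingale convergence theorem: the limit is
  first obtained along powers of two, and the full sequence follows by Fatou's lemma.\<close>

lemma moment_Cauchy_limit:
  fixes X :: "nat \<Rightarrow> 'a \<Rightarrow> complex"
  assumes [measurable]: "\<And>n. X n \<in> borel_measurable M"
    and int: "\<And>n q. integrable M (\<lambda>\<omega>. cmod (X n \<omega>) ^ q)"
    and d: "d > 0"
    and rate: "\<And>q. \<exists>C. \<forall>k n. k \<le> n \<longrightarrow> expectation (\<lambda>\<omega>. cmod (X n \<omega> - X k \<omega>) ^ (2 * q)) \<le> C * (real (Suc k) powr (- d)) ^ q"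
  obtains Z where "Z \<in> borel_measurable M" "\<And>q. integrable M (\<lambda>\<omega>. cmod (Z \<omega>) ^ (2 * q))"
    "\<And>q n. integrable M (\<lambda>\<omega>. cmod (X n \<omega> - Z \<omega>) ^ (2 * q))"
    "\<And>q. \<exists>C. \<forall>n. expectation (\<lambda>\<omega>. cmod (X n \<omega> - Z \<omega>) ^ (2 * q)) \<le> C * (real (Suc n) powr (- d)) ^ q"
proof -
  have intd: "integrable M (\<lambda>\<omega>. cmod (X n \<omega> - X k \<omega>) ^ (2 * q))" for n k q
  proof -
    have i: "integrable M (\<lambda>\<omega>. 4 ^ q * (cmod (X n \<omega>) ^ (2 * q) + cmod (- X k \<omega>) ^ (2 * q)))"
      using int by simp
    show ?thesis
      by (rule Bochner_Integration.integrable_bound[OF i])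
         (use norm_add_even_power_le[of _ "- _"] in auto)
  qed
  \<comment> \<open>Along powers of two the increments are geometrically small in mean, however
    small \<open>d\<close> is; over consecutive indices the rate need not be summable.\<close>
  define D where "D j \<omega> = cmod (X (2 ^ Suc j) \<omega> - X (2 ^ j) \<omega>)" for j \<omega>
  have Dint: "integrable M (D j)" for j
  proof -
    have i: "integrable M (\<lambda>\<omega>. cmod (X (2 ^ Suc j) \<omega>) ^ 1 + cmod (X (2 ^ j) \<omega>) ^ 1)"
      using int by (intro Bochner_Integration.integrable_add)
    show ?thesis unfolding D_def[abs_def]
      by (rule Bochner_Integration.integrable_bound[OF i]) (auto intro: norm_triangle_ineq4)
  qed
  obtain C where C: "\<And>k n. k \<le> n \<Longrightarrow> expectation (\<lambda>\<omega>. cmod (X n \<omega> - X k \<omega>) ^ (2 * 1)) \<le> C * (real (Suc k) powr (- d)) ^ 1"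
    using rate[of 1] by blast
  have C0: "C \<ge> 0"
  proof -
    have "0 \<le> expectation (\<lambda>\<omega>. cmod (X 0 \<omega> - X 0 \<omega>) ^ (2 * 1))" by simp
    also have "\<dots> \<le> C" using C[of 0 0] by simp
    finally show ?thesis .
  qed
  \<comment> \<open>The rate at index \<open>2 ^ j\<close> is at most the square of
    \<open>a ^ j\<close>, so the first moment of the increment is of order
    \<open>a ^ j\<close>.\<close>
  define a where "a = 2 powr (- d / 2)"
  have a: "0 < a" "a < 1" using d by (auto simp: a_def intro: powr_less_one)
  have ED: "expectation (D j) \<le> (C + 1) / 2 * a ^ j" for j
  proof -
    define r where "r = a ^ j"
    have r: "r > 0" using a by (simp add: r_def)
    have r2: "(2 ^ j :: real) powr (- d) = r * r"
      by (simp add: r_def a_def powr_realpow[symmetric] powr_powr powr_add[symmetric] algebra_simps)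
    have am: "x \<le> (x\<^sup>2 / r + r) / 2" for x :: real
      using zero_le_power2[of "x - r"] r by (simp add: field_simps power2_eq_square)
    have i2: "integrable M (\<lambda>\<omega>. (D j \<omega>)\<^sup>2)"
      using intd[of "2 ^ Suc j" "2 ^ j" 1] by (simp add: D_def)
    have "expectation (\<lambda>\<omega>. (D j \<omega>)\<^sup>2) \<le> C * real (Suc (2 ^ j)) powr (- d)"
      using C[of "2 ^ j" "2 ^ Suc j"] by (simp add: D_def)
    also have "\<dots> \<le> C * (2 ^ j) powr (- d)"
      using C0 d by (intro mult_left_mono powr_mono2') auto
    finally have e2: "expectation (\<lambda>\<omega>. (D j \<omega>)\<^sup>2) \<le> C * (r * r)" by (simp add: r2)
    have "expectation (D j) \<le> expectation (\<lambda>\<omega>. ((D j \<omega>)\<^sup>2 / r + r) / 2)"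
      using i2 by (intro integral_mono Dint am) auto
    also have "\<dots> = (expectation (\<lambda>\<omega>. (D j \<omega>)\<^sup>2) / r + r) / 2"
      using i2 by (simp add: prob_space)
    also have "\<dots> \<le> (C * (r * r) / r + r) / 2"
      using e2 r by (intro divide_right_mono add_right_mono) auto
    also have "\<dots> = (C + 1) / 2 * r" using r by (simp add: field_simps)
    finally show ?thesis by (simp add: r_def)
  qed
  have sumD: "summable (\<lambda>j. expectation (D j))"
  proof (rule summable_comparison_test')
    show "summable (\<lambda>j. (C + 1) / 2 * a ^ j)" using a by (intro summable_mult summable_geometric) auto
    show "norm (expectation (D j)) \<le> (C + 1) / 2 * a ^ j" for j
      using ED[of j] by (simp add: D_def abs_of_nonneg Bochner_Integration.integral_nonneg)
  qed
  have "0 \<le> D j \<omega>" for j \<omega> by (simp add: D_def)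
  then have "AE \<omega> in M. summable (\<lambda>j. D j \<omega>)"
    by (rule AE_summable_of_expectation[OF Dint _ sumD])
  then have conv: "AE \<omega> in M. convergent (\<lambda>j. X (2 ^ j) \<omega>)"
  proof eventually_elim
    case (elim \<omega>)
    then have "summable (\<lambda>j. X (2 ^ Suc j) \<omega> - X (2 ^ j) \<omega>)"
      unfolding D_def by (rule summable_norm_cancel)
    then have "convergent (\<lambda>n. \<Sum>j<n. X (2 ^ Suc j) \<omega> - X (2 ^ j) \<omega>)"
      by (simp add: summable_iff_convergent)
    then have "convergent (\<lambda>n. X (2 ^ n) \<omega> - X (2 ^ 0) \<omega>)"
      unfolding sum_lessThan_telescope[of "\<lambda>j. X (2 ^ j) \<omega>"] .
    then show ?case by (simp add: convergent_diff_const_right_iff)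
  qed
  define Z where "Z \<omega> = lim (\<lambda>j. X (2 ^ j) \<omega>)" for \<omega>
  have Zm [measurable]: "Z \<in> borel_measurable M"
    unfolding Z_def[abs_def] by (rule borel_measurable_lim_metric) simp
  have lim: "AE \<omega> in M. (\<lambda>j. X (2 ^ j) \<omega>) \<longlonglongrightarrow> Z \<omega>"
    using conv by eventually_elim (simp add: Z_def convergent_LIMSEQ_iff)
  have main: "integrable M (\<lambda>\<omega>. cmod (X n \<omega> - Z \<omega>) ^ (2 * q)) \<and>
      expectation (\<lambda>\<omega>. cmod (X n \<omega> - Z \<omega>) ^ (2 * q)) \<le> C * (real (Suc n) powr (- d)) ^ q"
    if C: "\<And>k n. k \<le> n \<Longrightarrow> expectation (\<lambda>\<omega>. cmod (X n \<omega> - X k \<omega>) ^ (2 * q)) \<le> C * (real (Suc k) powr (- d)) ^ q"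
    for q C n
  proof -
    have l: "AE \<omega> in M. (\<lambda>j. cmod (X (2 ^ j) \<omega> - X n \<omega>) ^ (2 * q)) \<longlonglongrightarrow> cmod (X n \<omega> - Z \<omega>) ^ (2 * q)"
      using lim
    proof eventually_elim
      case (elim \<omega>)
      then have "(\<lambda>j. cmod (X (2 ^ j) \<omega> - X n \<omega>) ^ (2 * q)) \<longlonglongrightarrow> cmod (Z \<omega> - X n \<omega>) ^ (2 * q)"
        by (intro tendsto_intros)
      then show ?case by (simp add: norm_minus_commute)
    qed
    have "\<forall>\<^sub>F j in sequentially. expectation (\<lambda>\<omega>. cmod (X (2 ^ j) \<omega> - X n \<omega>) ^ (2 * q)) \<le> C * (real (Suc n) powr (- d)) ^ q"
      using eventually_ge_at_top[of n]
    proof eventually_elim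
      case (elim j)
      have "n \<le> 2 ^ j" using elim less_exp[of j] by linarith
      then show ?case by (rule C)
    qed
    from expectation_le_of_AE_limit[OF intd _ _ _ l this] show ?thesis by simp
  qed
  have Zint: "integrable M (\<lambda>\<omega>. cmod (X n \<omega> - Z \<omega>) ^ (2 * q))" for n q
    using rate[of q] main by blast
  show thesis
  proof (rule that[OF Zm _ Zint])
    show "\<exists>C. \<forall>n. expectation (\<lambda>\<omega>. cmod (X n \<omega> - Z \<omega>) ^ (2 * q)) \<le> C * (real (Suc n) powr (- d)) ^ q" for q
      using rate[of q] main by blast
    fix q
    have i: "integrable M (\<lambda>\<omega>. 4 ^ q * (cmod (X 0 \<omega>) ^ (2 * q) + cmod (- (X 0 \<omega> - Z \<omega>)) ^ (2 * q)))"
      using int Zint[of 0 q] unfolding norm_minus_cancel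
      by (intro integrable_mult_right Bochner_Integration.integrable_add)
    have "cmod (Z \<omega>) ^ (2 * q) \<le> 4 ^ q * (cmod (X 0 \<omega>) ^ (2 * q) + cmod (- (X 0 \<omega> - Z \<omega>)) ^ (2 * q))" for \<omega>
      using norm_add_even_power_le[of "X 0 \<omega>" "- (X 0 \<omega> - Z \<omega>)" q] by simp
    then show "integrable M (\<lambda>\<omega>. cmod (Z \<omega>) ^ (2 * q))"
      by (intro Bochner_Integration.integrable_bound[OF i]) auto
  qed
qed

end

section \<open>Asymptotics of the normalised eigenforms\<close>

lemma nat_powr_shift_asymp:
  fixes s t :: real
  shows "(\<lambda>n. real n powr s / (t + real n) powr s) \<longlonglongrightarrow> 1" "(\<lambda>n. 1 / (t + real n)) \<longlonglongrightarrow> 0"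
    "s > 0 \<Longrightarrow> (\<lambda>n. c * (t + real n) powr (- s)) \<longlonglongrightarrow> 0"
  by real_asymp+

lemma cmod_nat_powr: "n > 0 \<Longrightarrow> cmod (of_nat n powr z) = real n powr Re z"
  by (simp add: norm_powr_real_powr)

context gap_process
begin

lemma T_ge_Suc: "real (Suc n) \<le> T n"
  using T_ge[of n] by simp

lemma T_powr_le_Suc_powr: "d \<ge> 0 \<Longrightarrow> T n powr (- d) \<le> real (Suc n) powr (- d)"
  using T_ge_Suc[of n] by (intro powr_mono2') auto

lemma expectation_U: "z \<in> gap_roots m \<Longrightarrow> expectation (U z n) = gam z n 0 * eig_form m z (\<lambda>k. of_real (gap_init m V k))"
proof (induction n)
  case 0
  have "expectation (U z 0) = expectation (\<lambda>_. eig_form m z (\<lambda>k. of_real (gap_init m V k)))"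
    by (rule integral_cong_AE) (use AE_U_0[of z] in auto)
  then show ?case by (simp add: prob_space)
next
  case (Suc n)
  note int = U_integrable_power(2)[OF Suc.prems]
  have "expectation (\<lambda>\<omega>. 1 * xi z n \<omega>) = 0"
    by (rule xi_orthogonal[OF Suc.prems, where F = "\<lambda>_. 1"]) simp
  then have "expectation (\<lambda>\<omega>. U z (Suc n) \<omega> - (1 + z / of_real (T n)) * U z n \<omega>) = 0"
    by (simp add: xi_def)
  then have "expectation (U z (Suc n)) = (1 + z / of_real (T n)) * expectation (U z n)"
    using int[of n] int[of "Suc n"] by (simp add: Bochner_Integration.integral_diff)
  then show ?case using Suc by (simp add: gam_Suc_left)
qed

lemma gam_nonzero: "Re z > 0 \<Longrightarrow> gam z n j \<noteq> 0"
proof -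
  assume z: "Re z > 0"
  have "1 + z / of_real (T i) \<noteq> 0" for i
  proof
    assume "1 + z / of_real (T i) = 0"
    then have "Re (1 + z / of_real (T i)) = 0" by simp
    moreover have "Re z / T i > 0" using z T_pos[of i] by simp
    ultimately show False by simp
  qed
  then show ?thesis by (simp add: gam_def)
qed

lemma gam_split: "k \<le> n \<Longrightarrow> gam z n 0 = gam z n k * gam z k 0"
  unfolding gam_def by (subst mult.commute, rule prod.atLeastLessThan_concat[symmetric]) auto

text \<open>The product is a quotient of two Pochhammer symbols, at \<open>T 0 + z\<close> and at
  \<open>T 0\<close>; the limits of the corresponding \<open>Gamma_series\<close> give the constant
  in the expectation of the limit variable.\<close>

lemma gam_asymptotics:
  assumes z: "Re z > 0"
  shows "(\<lambda>n. gam z n 0 / of_nat n powr z) \<longlonglongrightarrow> Gamma (of_real (T 0)) / Gamma (of_real (T 0) + z)"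
proof -
  define t where "t = complex_of_real (T 0)"
  have nonint: "x \<notin> \<int>\<^sub>\<le>\<^sub>0" if "Re x > 0" for x :: complex
    using that by (auto elim!: nonpos_Ints_cases)
  have t: "Re t > 0" "Re (t + z) > 0" using T_pos[of 0] z by (simp_all add: t_def)
  have Tt: "complex_of_real (T i) = t + of_nat i" for i by (simp add: T_def t_def)
  have poch: "gam z n 0 = pochhammer (t + z) n / pochhammer t n" for n
  proof -
    have "1 + z / of_real (T i) = (t + z + of_nat i) / (t + of_nat i)" for i
    proof -
      have "of_real (T i) \<noteq> (0::complex)" using T_pos[of i] by simp
      then show ?thesis unfolding Tt by (simp add: field_simps)
    qed
    then show ?thesis
      by (simp add: gam_def pochhammer_prod prod_dividef[symmetric] lessThan_atLeast0[symmetric])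
  qed
  have nz: "Gamma_series (t + z) n \<noteq> 0" "pochhammer t (Suc n) \<noteq> 0" "pochhammer (t + z) (Suc n) \<noteq> 0" for n
  proof -
    have p: "pochhammer x k \<noteq> 0" if "Re x > 0" for x :: complex and k
      using nonint[OF that] by (auto simp: pochhammer_eq_0_iff)
    show "pochhammer t (Suc n) \<noteq> 0" "pochhammer (t + z) (Suc n) \<noteq> 0" using p t by blast+
    show "Gamma_series (t + z) n \<noteq> 0" using p[OF t(2)] by (simp add: Gamma_series_def del: pochhammer_Suc)
  qed
  have "(\<lambda>n. Gamma_series t n / Gamma_series (t + z) n) \<longlonglongrightarrow> Gamma t / Gamma (t + z)"
    using nonint[OF t(1)] nonint[OF t(2)]
    by (intro tendsto_divide Gamma_series_LIMSEQ) (auto simp: Gamma_eq_zero_iff)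
  \<comment> \<open>\<open>Gamma_series\<close> at \<open>n\<close> contains a Pochhammer symbol of
    length \<open>n + 1\<close>, so the product appears at \<open>Suc n\<close>. The surplus factor
    \<open>1 + z / T n\<close> tends to \<open>1\<close> and is divided out afterwards.\<close>
  moreover have "\<forall>\<^sub>F n in sequentially. Gamma_series t n / Gamma_series (t + z) n = gam z (Suc n) 0 / of_nat n powr z"
    using eventually_gt_at_top[of 0]
  proof eventually_elim
    case (elim n)
    have e: "exp ((t + z) * of_real (ln (real n))) = exp (t * of_real (ln (real n))) * of_nat n powr z"
      using elim by (simp add: powr_def distrib_right exp_add Ln_of_nat)
    show ?case
      unfolding Gamma_series_def poch e using elim nz[of n]
      by (simp add: field_simps del: pochhammer_Suc)
  qed
  ultimately have 1: "(\<lambda>n. gam z (Suc n) 0 / of_nat n powr z) \<longlonglongrightarrow> Gamma t / Gamma (t + z)"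
    by (rule Lim_transform_eventually)
  have Tlim: "(\<lambda>n. 1 / T n) \<longlonglongrightarrow> 0" unfolding T_def by (rule nat_powr_shift_asymp)
  have "(\<lambda>n. 1 + z * complex_of_real (1 / T n)) \<longlonglongrightarrow> 1 + z * of_real 0"
    by (intro tendsto_intros Tlim)
  moreover have "1 + z * complex_of_real (1 / T n) = 1 + z / complex_of_real (T n)" for n by simp
  ultimately have "(\<lambda>n. 1 + z / complex_of_real (T n)) \<longlonglongrightarrow> 1"
    by (simp only: of_real_0 mult_zero_right add_0_right)
  with 1 have "(\<lambda>n. gam z (Suc n) 0 / of_nat n powr z / (1 + z / of_real (T n))) \<longlonglongrightarrow> Gamma t / Gamma (t + z) / 1"
    by (rule tendsto_divide) simp
  moreover have "gam z (Suc n) 0 / of_nat n powr z / (1 + z / of_real (T n)) = gam z n 0 / of_nat n powr z" for n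
    using gam_nonzero[OF z, of "Suc n" 0] by (simp add: gam_Suc_left)
  ultimately show ?thesis by (simp add: t_def)
qed

lemma T_powr_asymp: "(\<lambda>n. real n powr s / T n powr s) \<longlonglongrightarrow> 1"
  unfolding T_def by (rule nat_powr_shift_asymp)

lemma T_powr_sq: "(T n powr s) ^ (2 * q) = (T n powr (2 * s)) ^ q"
  by (simp add: power_mult power2_eq_square powr_add[symmetric])

text \<open>The nonzero limit of the normalised product bounds it from below eventually, and the
  finitely many earlier values are nonzero.\<close>

lemma gam_lower_bound:
  assumes z: "Re z > 0"
  obtains c where "c > 0" "\<And>n. c * T n powr Re z \<le> cmod (gam z n 0)"
proof -
  define q where "q n = cmod (gam z n 0) / T n powr Re z" for n
  define L where "L = cmod (Gamma (of_real (T 0)) / Gamma (of_real (T 0) + z))"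
  have nonint: "x \<notin> \<int>\<^sub>\<le>\<^sub>0" if "Re x > 0" for x :: complex
    using that by (auto elim!: nonpos_Ints_cases)
  have L: "L > 0"
    using nonint[of "of_real (T 0)"] nonint[of "of_real (T 0) + z"] T_pos[of 0] z
    by (auto simp: L_def Gamma_eq_zero_iff)
  have qpos: "q n > 0" for n using gam_nonzero[OF z] T_pos[of n] by (simp add: q_def)
  have "(\<lambda>n. cmod (gam z n 0 / of_nat n powr z) * (real n powr Re z / T n powr Re z)) \<longlonglongrightarrow> L * 1"
    unfolding L_def by (intro tendsto_mult tendsto_norm gam_asymptotics z T_powr_asymp)
  moreover have "\<forall>\<^sub>F n in sequentially. cmod (gam z n 0 / of_nat n powr z) * (real n powr Re z / T n powr Re z) = q n"
    using eventually_gt_at_top[of 0]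
    by eventually_elim (simp add: q_def norm_divide cmod_nat_powr)
  ultimately have "q \<longlonglongrightarrow> L" using Lim_transform_eventually by fastforce
  then have "\<forall>\<^sub>F n in sequentially. q n > L / 2"
    using L by (intro order_tendstoD) auto
  then obtain n0 where n0: "\<And>n. n \<ge> n0 \<Longrightarrow> q n > L / 2" by (auto simp: eventually_sequentially)
  define c where "c = Min (insert (L / 2) (q ` {..<n0}))"
  have c: "c > 0" unfolding c_def using L qpos by (subst Min_gr_iff) auto
  have cq: "c \<le> q n" for n
  proof (cases "n < n0")
    case True
    then show ?thesis unfolding c_def by (intro Min_le) auto
  next
    case False
    have "c \<le> L / 2" unfolding c_def by (intro Min_le) auto
    then show ?thesis using n0[of n] False by simp
  qed
  have "c * T n powr Re z \<le> cmod (gam z n 0)" for n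
  proof -
    have "T n powr Re z > 0" using T_pos[of n] by simp
    then show ?thesis using cq[of n] unfolding q_def by (simp only: pos_le_divide_eq)
  qed
  with c show thesis by (rule that)
qed

text \<open>The root need not lie beyond \<open>1/2\<close>: its growth is bounded with an exponent
  \<open>r\<close> strictly between \<open>1/2\<close> and \<open>s\<close>, which leaves the rate
  \<open>2 * (s - r)\<close>.\<close>

lemma small_root_negligible:
  assumes z: "z \<in> gap_roots m" and s: "Re z < s" "1/2 < s"
  shows "negligible (\<lambda>n \<omega>. U z n \<omega> / of_real (T n powr s))"
proof -
  \<comment> \<open>The midpoint of \<open>1/2\<close> and \<open>s\<close> replaces
    \<open>Re z\<close> when the latter is too small, so that the large-exponent bound applies in
    all cases.\<close>
  define r where "r = max (Re z) ((s + 1/2) / 2)"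
  have r: "Re z \<le> r" "1/2 < r" "r < s" unfolding r_def less_max_iff_disj using s by auto
  define X where "X n \<omega> = U z n \<omega> - gam z n 0 * U z 0 \<omega>" for n \<omega>
  have X: "negligible (\<lambda>n \<omega>. X n \<omega> / of_real (T n powr s))"
  proof (rule negligible_of_rate)
    show "(\<lambda>\<omega>. X n \<omega> / of_real (T n powr s)) \<in> borel_measurable M" for n
      unfolding X_def by measurable
    have pw: "cmod (X n \<omega> / of_real (T n powr s)) ^ (2 * q) = cmod (X n \<omega>) ^ (2 * q) / (T n powr s) ^ (2 * q)" for n q \<omega>
      by (simp add: norm_divide power_divide)
    show "integrable M (\<lambda>\<omega>. cmod (X n \<omega> / of_real (T n powr s)) ^ (2 * q))" for n q
      unfolding pw unfolding X_def using U_moment_integrable[OF z, of 0 n q] by simp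
    show "2 * (s - r) > 0" using r by simp
    fix q
    obtain C where C: "C > 0" "\<And>n k. k \<le> n \<Longrightarrow>
      expectation (\<lambda>\<omega>. cmod (U z n \<omega> - gam z n k * U z k \<omega>) ^ (2 * q)) \<le> C * (T n powr (2 * r) * T k powr (1 - 2 * r)) ^ q"
      using U_moment_large[OF z r(1,2)] by blast
    show "\<exists>C. \<forall>n. expectation (\<lambda>\<omega>. cmod (X n \<omega> / of_real (T n powr s)) ^ (2 * q)) \<le> C * (real (Suc n) powr (- (2 * (s - r)))) ^ q"
    proof (intro exI allI)
      fix n
      have "expectation (\<lambda>\<omega>. cmod (X n \<omega> / of_real (T n powr s)) ^ (2 * q)) =
          expectation (\<lambda>\<omega>. cmod (X n \<omega>) ^ (2 * q)) / (T n powr s) ^ (2 * q)"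
        unfolding pw by simp
      also have "\<dots> \<le> C * (T n powr (2 * r) * T 0 powr (1 - 2 * r)) ^ q / (T n powr s) ^ (2 * q)"
        unfolding X_def by (intro divide_right_mono C) auto
      also have "(T n powr s) ^ (2 * q) = (T n powr (2 * s)) ^ q"
        by (simp add: power_mult power2_eq_square powr_add[symmetric])
      also have "C * (T n powr (2 * r) * T 0 powr (1 - 2 * r)) ^ q / (T n powr (2 * s)) ^ q =
         C * (T 0 powr (1 - 2 * r)) ^ q * (T n powr (2 * r) / T n powr (2 * s)) ^ q"
        by (simp add: power_mult_distrib power_divide)
      also have "T n powr (2 * r) / T n powr (2 * s) = T n powr (- (2 * (s - r)))"
        by (simp add: powr_diff[symmetric] algebra_simps)
      also have "C * (T 0 powr (1 - 2 * r)) ^ q * (T n powr (- (2 * (s - r)))) ^ q \<le>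
         C * (T 0 powr (1 - 2 * r)) ^ q * (real (Suc n) powr (- (2 * (s - r)))) ^ q"
        using C r by (intro mult_left_mono power_mono T_powr_le_Suc_powr) auto
      finally show "expectation (\<lambda>\<omega>. cmod (X n \<omega> / of_real (T n powr s)) ^ (2 * q)) \<le>
         C * (T 0 powr (1 - 2 * r)) ^ q * (real (Suc n) powr (- (2 * (s - r)))) ^ q" .
    qed
  qed
  obtain K where K: "K \<ge> 1" "\<And>n j. j \<le> n \<Longrightarrow> cmod (gam z n j) \<le> K * (T n / T j) powr r"
    using gam_bound[OF r(1)] by blast
  have "(\<lambda>n. gam z n 0 / of_real (T n powr s)) \<longlonglongrightarrow> 0"
  proof (rule Lim_null_comparison)
    show "\<forall>\<^sub>F n in sequentially. cmod (gam z n 0 / of_real (T n powr s)) \<le> K * T n powr (- (s - r))"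
    proof (intro always_eventually allI)
      fix n
      have "cmod (gam z n 0) \<le> K * (T n / T 0) powr r" by (rule K) simp
      also have "\<dots> \<le> K * T n powr r"
        using K r T_pos[of n] T_ge_1[of 0] by (intro mult_left_mono powr_mono2) (auto simp: divide_le_eq mult_le_cancel_left1)
      finally have "cmod (gam z n 0) / T n powr s \<le> K * T n powr r / T n powr s"
        by (intro divide_right_mono) auto
      also have "\<dots> = K * T n powr (- (s - r))" by (simp add: powr_diff)
      finally show "cmod (gam z n 0 / of_real (T n powr s)) \<le> K * T n powr (- (s - r))"
        by (simp add: norm_divide)
    qed
    have "s - r > 0" using r by simp
    then show "(\<lambda>n. K * T n powr (- (s - r))) \<longlonglongrightarrow> 0" unfolding T_def by (rule nat_powr_shift_asymp)
  qed
  then have "negligible (\<lambda>n \<omega>. gam z n 0 / of_real (T n powr s) * U z 0 \<omega>)"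
    by (rule negligible_deterministic) (use U_integrable_power(1)[OF z] in auto)
  from negligible_add[OF X this] show ?thesis
    by (simp add: X_def diff_divide_distrib)
qed

text \<open>Dividing the eigenform by its mean growth \<open>gam z n 0\<close> gives a martingale
  \<open>X\<close> that is Cauchy in all even moments with rate \<open>d = 2 * Re z - 1\<close>. The
  variable \<open>W\<close> is its limit times the constant that converts \<open>gam z n 0\<close>
  into \<open>n powr z\<close>.\<close>

lemma leading_root_limit:
  assumes z: "z \<in> gap_roots m" and s: "Re z > 1/2"
  obtains W where "W \<in> borel_measurable M" "integrable M W" "\<And>q. integrable M (\<lambda>\<omega>. cmod (W \<omega>) ^ (2 * q))"
    "expectation W = Gamma (of_real (T 0)) / Gamma (of_real (T 0) + z) * eig_form m z (\<lambda>k. of_real (gap_init m V k))"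
    "negligible (\<lambda>n \<omega>. (U z n \<omega> - of_nat n powr z * W \<omega>) / of_real (T n powr Re z))"
proof -
  define s where "s = Re z"
  define d where "d = 2 * s - 1"
  have sd: "s > 1/2" "d > 0" "Re z > 0" "Re z \<le> s" using assms by (auto simp: s_def d_def)
  obtain c where c: "c > 0" "\<And>n. c * T n powr s \<le> cmod (gam z n 0)"
    using gam_lower_bound[OF sd(3)] unfolding s_def by blast
  define X where "X n \<omega> = U z n \<omega> / gam z n 0" for n \<omega>
  have gnz: "gam z n k \<noteq> 0" for n k using gam_nonzero sd by blast
  have Xm [measurable]: "X n \<in> borel_measurable M" for n unfolding X_def[abs_def] by measurable
  have Xint: "integrable M (\<lambda>\<omega>. cmod (X n \<omega>) ^ q)" for n q
    unfolding X_def norm_divide power_divide using U_integrable_power(1)[OF z] by simp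
  have rate: "\<exists>C. \<forall>k n. k \<le> n \<longrightarrow> expectation (\<lambda>\<omega>. cmod (X n \<omega> - X k \<omega>) ^ (2 * q)) \<le> C * (real (Suc k) powr (- d)) ^ q" for q
  proof -
    obtain C where C: "C > 0" "\<And>n k. k \<le> n \<Longrightarrow>
      expectation (\<lambda>\<omega>. cmod (U z n \<omega> - gam z n k * U z k \<omega>) ^ (2 * q)) \<le> C * (T n powr (2 * s) * T k powr (1 - 2 * s)) ^ q"
      using U_moment_large[OF z sd(4,1)] by blast
    show ?thesis
    proof (intro exI allI impI)
      fix k n :: nat assume kn: "k \<le> n"
      have "X n \<omega> - X k \<omega> = (U z n \<omega> - gam z n k * U z k \<omega>) / gam z n 0" for \<omega>
        using gam_split[OF kn, of z] gnz by (simp add: X_def field_simps)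
      then have "expectation (\<lambda>\<omega>. cmod (X n \<omega> - X k \<omega>) ^ (2 * q)) =
          expectation (\<lambda>\<omega>. cmod (U z n \<omega> - gam z n k * U z k \<omega>) ^ (2 * q)) / cmod (gam z n 0) ^ (2 * q)"
        by (simp add: norm_divide power_divide)
      also have "\<dots> \<le> C * (T n powr (2 * s) * T k powr (1 - 2 * s)) ^ q / (c * T n powr s) ^ (2 * q)"
        using C kn c T_pos[of n] by (intro frac_le power_mono) (auto intro!: mult_nonneg_nonneg less_imp_le)
      also have "(c * T n powr s) ^ (2 * q) = c ^ (2 * q) * (T n powr (2 * s)) ^ q"
        by (simp only: power_mult_distrib T_powr_sq)
      also have "C * (T n powr (2 * s) * T k powr (1 - 2 * s)) ^ q / (c ^ (2 * q) * (T n powr (2 * s)) ^ q) =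
          C / c ^ (2 * q) * (T k powr (- d)) ^ q"
        using T_pos[of n] by (simp add: power_mult_distrib d_def)
      also have "\<dots> \<le> C / c ^ (2 * q) * (real (Suc k) powr (- d)) ^ q"
        using C c sd by (intro mult_left_mono power_mono T_powr_le_Suc_powr) auto
      finally show "expectation (\<lambda>\<omega>. cmod (X n \<omega> - X k \<omega>) ^ (2 * q)) \<le> C / c ^ (2 * q) * (real (Suc k) powr (- d)) ^ q" .
    qed
  qed
  obtain Z where Z: "Z \<in> borel_measurable M" "\<And>q. integrable M (\<lambda>\<omega>. cmod (Z \<omega>) ^ (2 * q))"
    "\<And>q n. integrable M (\<lambda>\<omega>. cmod (X n \<omega> - Z \<omega>) ^ (2 * q))"
    "\<And>q. \<exists>C. \<forall>n. expectation (\<lambda>\<omega>. cmod (X n \<omega> - Z \<omega>) ^ (2 * q)) \<le> C * (real (Suc n) powr (- d)) ^ q"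
    using moment_Cauchy_limit[OF Xm Xint sd(2) rate] by blast
  note [measurable] = Z(1)
  have XZ: "negligible (\<lambda>n \<omega>. X n \<omega> - Z \<omega>)"
    by (rule negligible_of_rate[OF _ Z(3) sd(2) Z(4)]) measurable
  have le1: "x \<le> 1 + x ^ 2" for x :: real
    using zero_le_power2[of "x - 1/2"] by (simp add: power2_eq_square algebra_simps)
  have Zint: "integrable M Z"
    by (rule Bochner_Integration.integrable_bound[where f = "\<lambda>\<omega>. 1 + cmod (Z \<omega>) ^ (2 * 1)"])
       (use Z(2)[of 1] le1 in auto)
  have Xint1: "integrable M (X n)" for n
    unfolding X_def[abs_def] using U_integrable_power(2)[OF z] by simp
  define u0 where "u0 = eig_form m z (\<lambda>k. of_real (gap_init m V k))"
  have EX: "expectation (X n) = u0" for n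
    unfolding X_def[abs_def] using expectation_U[OF z, of n] gnz by (simp add: u0_def)
  \<comment> \<open>The mean of \<open>X n\<close> does not depend on \<open>n\<close>; it passes to
    the limit because the second moment of the difference tends to zero.\<close>
  have EZ: "expectation Z = u0"
  proof -
    have close: "cmod (u0 - expectation Z) \<le> e" if e: "e > 0" for e
    proof -
      have am: "x \<le> x ^ (2 * 1) / (2 * e) + e / 2" for x :: real
        using zero_le_power2[of "x - e"] e by (simp add: field_simps power2_eq_square)
      have "(\<lambda>n. expectation (\<lambda>\<omega>. cmod (X n \<omega> - Z \<omega>) ^ (2 * 1))) \<longlonglongrightarrow> 0"
        using XZ by (auto simp: negligible_def)
      then have "\<forall>\<^sub>F n in sequentially. expectation (\<lambda>\<omega>. cmod (X n \<omega> - Z \<omega>) ^ (2 * 1)) < e * e"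
        using e by (intro order_tendstoD) auto
      then obtain n where n: "expectation (\<lambda>\<omega>. cmod (X n \<omega> - Z \<omega>) ^ (2 * 1)) < e * e"
        by (auto simp: eventually_sequentially)
      have "u0 - expectation Z = expectation (\<lambda>\<omega>. X n \<omega> - Z \<omega>)"
        using EX[of n] Xint1[of n] Zint by simp
      also have "cmod \<dots> \<le> expectation (\<lambda>\<omega>. cmod (X n \<omega> - Z \<omega>))" by (rule integral_norm_bound)
      also have "\<dots> \<le> expectation (\<lambda>\<omega>. cmod (X n \<omega> - Z \<omega>) ^ (2 * 1) / (2 * e) + e / 2)"
        using Z(3)[of n 1] Xint1[of n] Zint by (intro integral_mono am) auto
      also have "\<dots> = expectation (\<lambda>\<omega>. cmod (X n \<omega> - Z \<omega>) ^ (2 * 1)) / (2 * e) + e / 2"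
        using Z(3)[of n 1] by (simp add: prob_space)
      also have "\<dots> \<le> e * e / (2 * e) + e / 2"
        using n e by (intro add_right_mono divide_right_mono) auto
      also have "\<dots> = e" using e by simp
      finally show ?thesis .
    qed
    have "cmod (u0 - expectation Z) \<le> 0"
      by (rule field_le_epsilon) (use close in simp)
    then show ?thesis by simp
  qed
  define \<rho> where "\<rho> = Gamma (of_real (T 0)) / Gamma (of_real (T 0) + z)"
  define W where "W \<omega> = \<rho> * Z \<omega>" for \<omega>
  obtain K where K: "K \<ge> 1" "\<And>n j. j \<le> n \<Longrightarrow> cmod (gam z n j) \<le> K * (T n / T j) powr s"
    using gam_bound[OF sd(4)] by blast
  have gT: "cmod (gam z n 0) / T n powr s \<le> K" for n
  proof -
    have "cmod (gam z n 0) \<le> K * (T n / T 0) powr s" by (rule K) simp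
    also have "\<dots> \<le> K * T n powr s"
      using K sd T_pos[of n] T_ge_1[of 0] by (intro mult_left_mono powr_mono2) (auto simp: divide_le_eq mult_le_cancel_left1)
    finally show ?thesis using T_pos[of n] by (simp add: pos_divide_le_eq)
  qed
  have 1: "negligible (\<lambda>n \<omega>. gam z n 0 / of_real (T n powr s) * (X n \<omega> - Z \<omega>))"
  proof (rule negligible_dominated[OF XZ])
    show "AE \<omega> in M. cmod (gam z n 0 / of_real (T n powr s) * (X n \<omega> - Z \<omega>)) \<le> K * cmod (X n \<omega> - Z \<omega>)" for n
    proof (rule AE_I2)
      fix \<omega>
      have "cmod (gam z n 0 / of_real (T n powr s) * (X n \<omega> - Z \<omega>)) = cmod (gam z n 0) / T n powr s * cmod (X n \<omega> - Z \<omega>)"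
        by (simp add: norm_mult norm_divide)
      also have "\<dots> \<le> K * cmod (X n \<omega> - Z \<omega>)" by (rule mult_right_mono[OF gT norm_ge_zero])
      finally show "cmod (gam z n 0 / of_real (T n powr s) * (X n \<omega> - Z \<omega>)) \<le> K * cmod (X n \<omega> - Z \<omega>)" .
    qed
  qed (use K in auto)
  have "(\<lambda>n. (gam z n 0 - of_nat n powr z * \<rho>) / of_real (T n powr s)) \<longlonglongrightarrow> 0"
  proof (rule Lim_null_comparison)
    show "\<forall>\<^sub>F n in sequentially. cmod ((gam z n 0 - of_nat n powr z * \<rho>) / of_real (T n powr s)) \<le> cmod (gam z n 0 / of_nat n powr z - \<rho>)"
      using eventually_gt_at_top[of 0]
    proof eventually_elim
      case (elim n)
      have pz: "cmod (of_nat n powr z) = real n powr s" "of_nat n powr z \<noteq> (0::complex)"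
        using elim by (simp_all add: cmod_nat_powr s_def)
      have "gam z n 0 - of_nat n powr z * \<rho> = of_nat n powr z * (gam z n 0 / of_nat n powr z - \<rho>)"
        using pz by (simp add: field_simps)
      then have "cmod ((gam z n 0 - of_nat n powr z * \<rho>) / of_real (T n powr s)) =
          real n powr s / T n powr s * cmod (gam z n 0 / of_nat n powr z - \<rho>)"
        by (simp add: norm_mult norm_divide pz)
      also have "\<dots> \<le> 1 * cmod (gam z n 0 / of_nat n powr z - \<rho>)"
        using T_ge[of n] sd T_pos[of n] by (intro mult_right_mono) (auto simp: divide_le_eq intro!: powr_mono2)
      finally show ?case by simp
    qed
    have "(\<lambda>n. gam z n 0 / of_nat n powr z - \<rho>) \<longlonglongrightarrow> \<rho> - \<rho>"
      unfolding \<rho>_def by (intro tendsto_diff tendsto_const gam_asymptotics sd)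
    then show "(\<lambda>n. cmod (gam z n 0 / of_nat n powr z - \<rho>)) \<longlonglongrightarrow> 0"
      by (simp add: tendsto_norm_zero)
  qed
  then have 2: "negligible (\<lambda>n \<omega>. (gam z n 0 - of_nat n powr z * \<rho>) / of_real (T n powr s) * Z \<omega>)"
    by (rule negligible_deterministic[OF _ Z(1,2)])
  \<comment> \<open>The error splits into the bounded normalised growth times
    \<open>X n - Z\<close>, and a deterministic sequence tending to zero times
    \<open>Z\<close>.\<close>
  have eq: "gam z n 0 / of_real (T n powr s) * (X n \<omega> - Z \<omega>) + (gam z n 0 - of_nat n powr z * \<rho>) / of_real (T n powr s) * Z \<omega> =
     (U z n \<omega> - of_nat n powr z * W \<omega>) / of_real (T n powr s)" for n \<omega>
    using gnz[of n 0] by (simp add: X_def W_def add_divide_distrib[symmetric] algebra_simps)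
  show thesis
  proof (rule that)
    show "W \<in> borel_measurable M" unfolding W_def[abs_def] by measurable
    show "integrable M W" unfolding W_def[abs_def] using Zint by simp
    show "integrable M (\<lambda>\<omega>. cmod (W \<omega>) ^ (2 * q))" for q
      unfolding W_def norm_mult power_mult_distrib using Z(2) by simp
    show "expectation W = Gamma (of_real (T 0)) / Gamma (of_real (T 0) + z) * eig_form m z (\<lambda>k. of_real (gap_init m V k))"
      unfolding W_def[abs_def] using EZ by (simp add: \<rho>_def u0_def)
    show "negligible (\<lambda>n \<omega>. (U z n \<omega> - of_nat n powr z * W \<omega>) / of_real (T n powr Re z))"
      using negligible_add[OF 1 2] unfolding eq unfolding s_def .
  qed
qed

end

lemma (in prob_space) negligible_powr_expectation:
  fixes L :: "nat \<Rightarrow> 'a \<Rightarrow> real"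
  assumes L: "negligible L" and nonneg: "\<And>n \<omega>. 0 \<le> L n \<omega>" and p: "p \<ge> (1::real)"
  shows "integrable M (\<lambda>\<omega>. L n \<omega> powr p)" "(\<lambda>n. expectation (\<lambda>\<omega>. L n \<omega> powr p)) \<longlonglongrightarrow> 0"
proof -
  have [measurable]: "L n \<in> borel_measurable M" for n using L by (auto simp: negligible_def)
  obtain q :: nat where "real q > p" using reals_Archimedean2 by blast
  then have q: "q \<ge> 1" "p \<le> real (2 * q)" using p by (auto simp: Suc_le_eq) 
  have bound: "x powr p \<le> e powr p + e powr (p - real (2 * q)) * x ^ (2 * q)" if "x \<ge> 0" "e > 0" for x e :: real
  proof (cases "x \<le> e")
    case True
    then have "x powr p \<le> e powr p" using that p by (intro powr_mono2) auto
    also have "\<dots> \<le> e powr p + e powr (p - real (2 * q)) * x ^ (2 * q)" by simp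
    finally show ?thesis .
  next
    case False
    then have x: "x > 0" using that by simp
    have "x powr p = x powr (p - real (2 * q)) * x ^ (2 * q)"
      using x by (simp add: powr_realpow[symmetric] powr_add[symmetric])
    also have "\<dots> \<le> e powr (p - real (2 * q)) * x ^ (2 * q)"
      using False that q by (intro mult_right_mono powr_mono2') auto
    also have "\<dots> \<le> e powr p + e powr (p - real (2 * q)) * x ^ (2 * q)" by simp
    finally show ?thesis .
  qed
  have an: "norm (L n \<omega>) = L n \<omega>" for n \<omega> using nonneg by simp
  have iL: "integrable M (\<lambda>\<omega>. L n \<omega> ^ (2 * q))" for n
    using L unfolding negligible_def an by blast
  have ib: "integrable M (\<lambda>\<omega>. e powr p + e powr (p - real (2 * q)) * L n \<omega> ^ (2 * q))" for e n
    using iL by auto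
  show int: "integrable M (\<lambda>\<omega>. L n \<omega> powr p)" for n
    by (rule Bochner_Integration.integrable_bound[OF ib[of 1 n]]) (use bound[of _ 1] nonneg in auto)
  have Elim: "(\<lambda>n. expectation (\<lambda>\<omega>. L n \<omega> ^ (2 * q))) \<longlonglongrightarrow> 0"
    using L q unfolding negligible_def an by blast
  have le: "expectation (\<lambda>\<omega>. L n \<omega> powr p) \<le> e powr p + e powr (p - real (2 * q)) * expectation (\<lambda>\<omega>. L n \<omega> ^ (2 * q))"
    if "e > 0" for e n
    using integral_mono[OF int ib[of e n] bound[OF nonneg that]] iL by (simp add: prob_space)
  show "(\<lambda>n. expectation (\<lambda>\<omega>. L n \<omega> powr p)) \<longlonglongrightarrow> 0"
  proof (rule tendstoI)
    fix r :: real assume r: "r > 0"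
    define e where "e = (r / 2) powr (1 / p)"
    have e: "e > 0" "e powr p = r / 2" using r p by (auto simp: e_def powr_powr)
    have "(\<lambda>n. e powr p + e powr (p - real (2 * q)) * expectation (\<lambda>\<omega>. L n \<omega> ^ (2 * q))) \<longlonglongrightarrow>
       e powr p + e powr (p - real (2 * q)) * 0" by (intro tendsto_intros Elim)
    then have "\<forall>\<^sub>F n in sequentially. e powr p + e powr (p - real (2 * q)) * expectation (\<lambda>\<omega>. L n \<omega> ^ (2 * q)) < r"
      by (rule order_tendstoD) (use e r in simp)
    then show "\<forall>\<^sub>F n in sequentially. dist (expectation (\<lambda>\<omega>. L n \<omega> powr p)) 0 < r"
    proof eventually_elim
      case (elim n)
      have "0 \<le> expectation (\<lambda>\<omega>. L n \<omega> powr p)" by simp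
      then show ?case using le[OF e(1), of n] elim by simp
    qed
  qed
qed

context gap_process
begin

lemma U_1: "AE \<omega> in M. \<forall>n. U 1 n \<omega> = of_real (T n)"
  using AE_gap_facts
proof eventually_elim
  case (elim \<omega>)
  show ?case
  proof
    fix n
    have "U 1 n \<omega> = of_real (\<Sum>k=1..m. G n \<omega> k)" by (simp add: U_def eig_form_1)
    moreover from elim have "(\<Sum>k=1..m. G n \<omega> k) = T n" by blast
    ultimately show "U 1 n \<omega> = of_real (T n)" by (simp only:)
  qed
qed

lemma U_cnj: "U (cnj z) n \<omega> = cnj (U z n \<omega>)"
  unfolding U_def by (rule eig_form_cnj)

lemma G_eq_sum: "k \<in> {1..m} \<Longrightarrow> of_real (G n \<omega> k) = (\<Sum>z\<in>gap_roots m. U z n \<omega> * eig_vec m z k)"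
  unfolding U_def by (rule eig_decomposition[OF m_ge_2, symmetric])

lemma finite_roots: "finite (gap_roots m)"
  using card_gap_roots(1)[of m] m_ge_2 by simp

lemma T_powr_bigo: "(\<lambda>n. T n powr s) \<in> O(\<lambda>n. real n powr s)"
proof (rule bigoI_tendsto)
  have "(\<lambda>n. inverse (real n powr s / T n powr s)) \<longlonglongrightarrow> inverse 1"
    by (intro tendsto_inverse T_powr_asymp) simp
  then show "(\<lambda>n. T n powr s / real n powr s) \<longlonglongrightarrow> 1" by simp
  show "\<forall>\<^sub>F n in sequentially. real n powr s \<noteq> 0"
    using eventually_gt_at_top[of 0] by eventually_elim simp
qed

lemma large_phases:
  assumes m60: "m \<ge> 60"
  shows "\<exists>W :: 'a \<Rightarrow> complex.
      W \<in> borel_measurable M \<and> integrable M W \<and>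
      (\<integral>\<omega>. W \<omega> \<partial>M) =
        Gamma (of_real (coord_sum m (gap_init m V))) /
        Gamma (of_real (coord_sum m (gap_init m V)) + lambda2 m) *
        eig_form m (lambda2 m) (\<lambda>k. of_real (gap_init m V k)) \<and>
      (AE \<omega> in M. (\<lambda>n. L2_set (gap_remainder m G W n \<omega>) {1..m}) \<in> o(\<lambda>n. real n powr sigma2 m)) \<and>
      (\<forall>p::real. p \<ge> 1 \<longrightarrow>
         (\<forall>n. integrable M (\<lambda>\<omega>. L2_set (gap_remainder m G W n \<omega>) {1..m} powr p)) \<and>
         (\<lambda>n. (\<integral>\<omega>. L2_set (gap_remainder m G W n \<omega>) {1..m} powr p \<partial>M) powr (1 / p))
           \<in> o(\<lambda>n. real n powr sigma2 m))"
proof -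
  define l where "l = lambda2 m"
  define s where "s = sigma2 m"
  note l2 = lambda2_props[OF m60, folded l_def s_def]
  obtain W where W: "W \<in> borel_measurable M" "integrable M W"
    "\<And>q. integrable M (\<lambda>\<omega>. cmod (W \<omega>) ^ (2 * q))"
    "expectation W = Gamma (of_real (T 0)) / Gamma (of_real (T 0) + l) * eig_form m l (\<lambda>k. of_real (gap_init m V k))"
    "negligible (\<lambda>n \<omega>. (U l n \<omega> - of_nat n powr l * W \<omega>) / of_real (T n powr Re l))"
    by (rule leading_root_limit[OF l2(1)]) (use l2(2,4) in auto)
  note [measurable] = W(1)
  note W5 = W(5)[unfolded l2(2)]
  define R where "R = gap_roots m - {1, l, cnj l}"
  define rem where "rem n \<omega> k = gap_remainder m G W n \<omega> k" for n \<omega> k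
  have rem_meas [measurable]: "(\<lambda>\<omega>. rem n \<omega> k) \<in> borel_measurable M" if "k \<in> {1..m}" for n k
    unfolding rem_def gap_remainder_def using that by measurable
  \<comment> \<open>The scaled remainder is the real part of this variable. Root \<open>1\<close>
    leaves only the offset \<open>T 0 * v1 m k\<close>, the pair of \<open>l\<close> and its
    conjugate gives twice the leading error, and the roots in \<open>R\<close> have real part below
    \<open>s\<close>.\<close>
  define Y where "Y k n \<omega> = of_real (T 0 * v1 m k) / of_real (T n powr s) * 1 +
     (2 * eig_vec m l k * ((U l n \<omega> - of_nat n powr l * W \<omega>) / of_real (T n powr s)) +
     (\<Sum>z\<in>R. eig_vec m z k * (U z n \<omega> / of_real (T n powr s))))" for k n \<omega>
  have mult_negl: "negligible (\<lambda>n \<omega>. c * X n \<omega>)" if "negligible X" for c :: complex and X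
  proof (rule negligible_dominated[OF that, where c = "cmod c"])
    have [measurable]: "X n \<in> borel_measurable M" for n using that by (simp add: negligible_def)
    show "(\<lambda>\<omega>. c * X n \<omega>) \<in> borel_measurable M" for n by measurable
  qed (auto simp: norm_mult)
  have Yn: "negligible (Y k)" for k
    unfolding Y_def[abs_def]
  proof (intro negligible_add negligible_sum mult_negl W5)
    have "s > 0" using l2(4) by simp
    then have "(\<lambda>n. T 0 * v1 m k * (T 0 + real n) powr (- s)) \<longlonglongrightarrow> 0"
      by (rule nat_powr_shift_asymp(3))
    moreover have "(T 0 + real n) powr (- s) = inverse (T n powr s)" for n
      by (simp add: T_def powr_minus)
    ultimately have "(\<lambda>n. T 0 * v1 m k / T n powr s) \<longlonglongrightarrow> 0"
      by (simp only: divide_inverse)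
    from tendsto_of_real[OF this, where 'a = complex]
    have "(\<lambda>n. of_real (T 0 * v1 m k) / complex_of_real (T n powr s)) \<longlonglongrightarrow> 0" by simp
    then show "negligible (\<lambda>n \<omega>. complex_of_real (T 0 * v1 m k) / of_real (T n powr s) * 1)"
      by (rule negligible_deterministic[where Z = "\<lambda>_. 1"]) auto
    show "finite R" using finite_roots by (simp add: R_def)
    fix z assume "z \<in> R"
    then have "z \<in> gap_roots m" "Re z < s" using l2(6)[of z] by (auto simp: R_def)
    then show "negligible (\<lambda>n \<omega>. U z n \<omega> / of_real (T n powr s))"
      using l2(4) by (intro small_root_negligible) auto
  qed
  have rem_eq: "AE \<omega> in M. \<forall>n. \<forall>k\<in>{1..m}. rem n \<omega> k / T n powr s = Re (Y k n \<omega>)"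
    using U_1
  proof eventually_elim
    case (elim \<omega>)
    show ?case
    proof (intro allI ballI)
      fix n k assume k: "k \<in> {1..m}"
      have im: "Im l \<noteq> 0" using l2(3) by simp
      have ne: "1 \<noteq> l" "1 \<noteq> cnj l" "l \<noteq> cnj l"
        using im by (auto simp: complex_eq_iff)
      have roots: "gap_roots m = insert 1 (insert l (insert (cnj l) R))"
        using one_in_gap_roots l2(1) cnj_in_gap_roots[OF l2(1)] by (auto simp: R_def)
      have notin: "1 \<notin> R" "l \<notin> R" "cnj l \<notin> R" and finR: "finite R"
        using finite_roots by (auto simp: R_def)
      have "complex_of_real (G n \<omega> k) = U 1 n \<omega> * eig_vec m 1 k + (U l n \<omega> * eig_vec m l k +
         (U (cnj l) n \<omega> * eig_vec m (cnj l) k + (\<Sum>z\<in>R. U z n \<omega> * eig_vec m z k)))"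
        unfolding G_eq_sum[OF k] roots using ne notin finR by simp
      also have "U 1 n \<omega> * eig_vec m 1 k = of_real (T n * v1 m k)"
        using elim by (simp add: eig_vec_1)
      also have "U (cnj l) n \<omega> * eig_vec m (cnj l) k = cnj (U l n \<omega> * eig_vec m l k)"
        by (simp add: U_cnj eig_vec_cnj)
      finally have "G n \<omega> k = Re (of_real (T n * v1 m k) + (U l n \<omega> * eig_vec m l k +
         (cnj (U l n \<omega> * eig_vec m l k) + (\<Sum>z\<in>R. U z n \<omega> * eig_vec m z k))))"
        by (metis Re_complex_of_real)
      then have Gk: "G n \<omega> k = T n * v1 m k + 2 * Re (U l n \<omega> * eig_vec m l k) + Re (\<Sum>z\<in>R. U z n \<omega> * eig_vec m z k)"
        by simp
      have Tn: "T n = T 0 + real n" by (simp add: T_def)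
      have r: "rem n \<omega> k = T 0 * v1 m k + 2 * Re (U l n \<omega> * eig_vec m l k) + Re (\<Sum>z\<in>R. U z n \<omega> * eig_vec m z k)
          - 2 * Re (of_nat n powr l * W \<omega> * eig_vec m l k)"
        unfolding rem_def gap_remainder_def Gk l_def[symmetric] Tn by (simp add: algebra_simps)
      have "Y k n \<omega> = of_real (inverse (T n powr s)) * (of_real (T 0 * v1 m k) +
         (2 * (U l n \<omega> * eig_vec m l k - of_nat n powr l * W \<omega> * eig_vec m l k) + (\<Sum>z\<in>R. U z n \<omega> * eig_vec m z k)))"
        unfolding Y_def by (simp add: divide_inverse sum_distrib_left algebra_simps)
      moreover have "Re (of_real x * (of_real y + (2 * (a - b) + c))) = x * (y + 2 * Re a + Re c - 2 * Re b)"
        for x y and a b c :: complex by (simp add: algebra_simps)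
      ultimately have "Re (Y k n \<omega>) = inverse (T n powr s) * rem n \<omega> k"
        by (simp only: r)
      then show "rem n \<omega> k / T n powr s = Re (Y k n \<omega>)" by (simp add: divide_inverse mult.commute)
    qed
  qed
  have Rn: "negligible (\<lambda>n \<omega>. \<bar>rem n \<omega> k / T n powr s\<bar>)" if k: "k \<in> {1..m}" for k
  proof (rule negligible_dominated[OF Yn[of k], where c = 1])
    show "AE \<omega> in M. norm \<bar>rem n \<omega> k / T n powr s\<bar> \<le> 1 * cmod (Y k n \<omega>)" for n
      using rem_eq
    proof eventually_elim
      case (elim \<omega>)
      then have "rem n \<omega> k / T n powr s = Re (Y k n \<omega>)" using k by blast
      then show ?case by (simp only: real_norm_def abs_idempotent mult_1 abs_Re_le_cmod)
    qed
  qed (use k in measurable)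
  define L where "L n \<omega> = L2_set (rem n \<omega>) {1..m} / T n powr s" for n \<omega>
  have remfun: "gap_remainder m G W n \<omega> = rem n \<omega>" for n \<omega> by (simp add: rem_def fun_eq_iff)
  have L2_meas: "(\<lambda>\<omega>. L2_set (rem n \<omega>) {1..m}) \<in> borel_measurable M" for n
    unfolding L2_set_def by measurable
  have Lneg: "negligible L"
  proof (rule negligible_dominated[where c = 1])
    show "negligible (\<lambda>n \<omega>. \<Sum>k=1..m. \<bar>rem n \<omega> k / T n powr s\<bar>)"
      by (intro negligible_sum Rn) auto
    show "L n \<in> borel_measurable M" for n unfolding L_def[abs_def] using L2_meas by measurable
    show "AE \<omega> in M. norm (L n \<omega>) \<le> 1 * norm (\<Sum>k=1..m. \<bar>rem n \<omega> k / T n powr s\<bar>)" for n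
    proof (rule AE_I2)
      fix \<omega>
      have "L n \<omega> \<le> (\<Sum>k=1..m. \<bar>rem n \<omega> k\<bar>) / T n powr s"
        unfolding L_def by (intro divide_right_mono L2_set_le_sum_abs) auto
      also have "\<dots> = (\<Sum>k=1..m. \<bar>rem n \<omega> k / T n powr s\<bar>)"
        by (simp add: sum_divide_distrib)
      finally show "norm (L n \<omega>) \<le> 1 * norm (\<Sum>k=1..m. \<bar>rem n \<omega> k / T n powr s\<bar>)"
        by (simp add: L_def abs_of_nonneg sum_nonneg)
    qed
  qed simp
  have Lnn: "0 \<le> L n \<omega>" for n \<omega> by (simp add: L_def)
  have L2L: "L2_set (rem n \<omega>) {1..m} = T n powr s * L n \<omega>" for n \<omega>
    using T_pos[of n] by (simp add: L_def)
  have Tnz: "\<forall>\<^sub>F n in sequentially. T n powr s \<noteq> 0"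
    using T_pos by (intro always_eventually allI) (simp add: less_imp_neq[symmetric])
  have smallo: "f \<in> o(\<lambda>n. real n powr s)" if "(\<lambda>n. f n / T n powr s) \<longlonglongrightarrow> 0" for f :: "nat \<Rightarrow> real"
    using smalloI_tendsto[OF that Tnz] T_powr_bigo landau_o.small_big_trans by blast
  have ae: "AE \<omega> in M. (\<lambda>n. L2_set (rem n \<omega>) {1..m}) \<in> o(\<lambda>n. real n powr s)"
  proof -
    have "AE \<omega> in M. (\<lambda>n. L n \<omega>) \<longlonglongrightarrow> 0" using Lneg by (simp add: negligible_def)
    then show ?thesis by eventually_elim (rule smallo, simp add: L_def)
  qed
  have Lp: "(\<forall>n. integrable M (\<lambda>\<omega>. L2_set (rem n \<omega>) {1..m} powr p)) \<and>
      (\<lambda>n. (\<integral>\<omega>. L2_set (rem n \<omega>) {1..m} powr p \<partial>M) powr (1 / p)) \<in> o(\<lambda>n. real n powr s)" if p: "p \<ge> 1" for p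
  proof -
    note Lp = negligible_powr_expectation[OF Lneg Lnn p]
    have e: "L2_set (rem n \<omega>) {1..m} powr p = (T n powr s) powr p * L n \<omega> powr p" for n \<omega>
      unfolding L2L using Lnn by (simp add: powr_mult)
    have "(\<integral>\<omega>. L2_set (rem n \<omega>) {1..m} powr p \<partial>M) powr (1 / p) / T n powr s =
       (expectation (\<lambda>\<omega>. L n \<omega> powr p)) powr (1 / p)" for n
    proof -
      have "(\<integral>\<omega>. L2_set (rem n \<omega>) {1..m} powr p \<partial>M) powr (1 / p) =
        ((T n powr s) powr p) powr (1 / p) * expectation (\<lambda>\<omega>. L n \<omega> powr p) powr (1 / p)"
        unfolding e by (simp add: powr_mult)
      also have "((T n powr s) powr p) powr (1 / p) = T n powr s" using p T_pos[of n] by (simp add: powr_powr)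
      finally show ?thesis using T_pos[of n] by simp
    qed
    moreover have "(\<lambda>n. expectation (\<lambda>\<omega>. L n \<omega> powr p) powr (1 / p)) \<longlonglongrightarrow> 0 powr (1 / p)"
      using p by (intro tendsto_powr' Lp tendsto_const) auto
    ultimately have lim: "(\<lambda>n. (\<integral>\<omega>. L2_set (rem n \<omega>) {1..m} powr p \<partial>M) powr (1 / p) / T n powr s) \<longlonglongrightarrow> 0"
      by simp
    have "integrable M (\<lambda>\<omega>. L2_set (rem n \<omega>) {1..m} powr p)" for n
      unfolding e using Lp(1) by simp
    with smallo[OF lim] show ?thesis by (intro conjI allI)
  qed
  have T0: "T 0 = coord_sum m (gap_init m V)" by (simp add: T_def)
  show ?thesis
    unfolding l_def[symmetric] s_def[symmetric]
    using W(1,2,4) ae Lp unfolding remfun[symmetric] T0 by blast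
qed

end

section \<open>Small phases\<close>

lemma cmod_cis_diff_1: "cmod (cis x - 1) \<le> \<bar>x\<bar>"
  using iexp_approx1[of x 0] by (simp add: cis_conv_exp)

lemma cmod_cis_Taylor_1: "cmod (cis x - 1 - \<i> * of_real x) \<le> x\<^sup>2"
proof -
  have "cmod (cis x - 1 - \<i> * of_real x) \<le> \<bar>x\<bar> ^ 2 / 2"
    using iexp_approx1[of x 1] by (simp add: cis_conv_exp diff_diff_eq power2_eq_square)
  also have "\<dots> \<le> x\<^sup>2" by simp
  finally show ?thesis .
qed

lemma cmod_cis_Taylor_2: "cmod (cis x - 1 - \<i> * of_real x + of_real (x\<^sup>2) / 2) \<le> \<bar>x\<bar> ^ 3"
proof -
  have "cmod (cis x - 1 - \<i> * of_real x + of_real (x\<^sup>2) / 2) \<le> \<bar>x\<bar> ^ 3 / 6"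
    using iexp_approx1[of x 2]
    by (simp add: cis_conv_exp eval_nat_numeral algebra_simps)
  also have "\<dots> \<le> \<bar>x\<bar> ^ 3" by simp
  finally show ?thesis .
qed

lemma cmod_exp_Taylor_1: "cmod (exp h - 1 - h) \<le> exp (cmod h) * (cmod h)\<^sup>2"
proof -
  have "cmod (exp h - (\<Sum>i\<le>1. h ^ i / fact i)) \<le> exp \<bar>Re h\<bar> * cmod h ^ Suc 1 / fact 1"
    by (rule Taylor_exp)
  also have "\<dots> \<le> exp (cmod h) * (cmod h)\<^sup>2"
    using abs_Re_le_cmod[of h] by (simp add: mult_right_mono numeral_2_eq_2)
  finally show ?thesis by (simp add: diff_diff_eq)
qed

text \<open>The error of one step of the Lindeberg comparison: \<open>p\<close> is the law of the increment \<open>y\<close>, and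
  \<open>h\<close> is to be thought of as half of its variance.\<close>

lemma Lindeberg_step:
  fixes p y :: "'i \<Rightarrow> real" and h :: complex
  assumes "finite A" and p: "\<And>k. k \<in> A \<Longrightarrow> p k \<ge> 0" "(\<Sum>k\<in>A. p k) = 1"
    and y: "\<And>k. k \<in> A \<Longrightarrow> \<bar>y k\<bar> \<le> Y"
  shows "cmod (exp h * (\<Sum>k\<in>A. of_real (p k) * cis (y k)) - cis (\<Sum>k\<in>A. p k * y k)) \<le>
     exp (cmod h) * (cmod h)\<^sup>2 + cmod h * Y + Y ^ 3 + cmod (h - of_real (\<Sum>k\<in>A. p k * (y k)\<^sup>2) / 2)
       + Y * \<bar>\<Sum>k\<in>A. p k * y k\<bar>"
proof -
  define S where "S = (\<Sum>k\<in>A. of_real (p k) * cis (y k))"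
  define X where "X = (\<Sum>k\<in>A. p k * y k)"
  define P where "P = (\<Sum>k\<in>A. p k * (y k)\<^sup>2)"
  have p1: "(\<Sum>k\<in>A. complex_of_real (p k)) = 1" using p(2) by (metis of_real_1 of_real_sum)
  have wsum: "cmod (\<Sum>k\<in>A. of_real (p k) * f k) \<le> c" if "\<And>k. k \<in> A \<Longrightarrow> cmod (f k) \<le> c" for f c
  proof -
    have "cmod (\<Sum>k\<in>A. of_real (p k) * f k) \<le> (\<Sum>k\<in>A. p k * c)"
      by (rule order.trans[OF norm_sum sum_mono]) (use that p in \<open>auto simp: norm_mult intro!: mult_left_mono\<close>)
    then show ?thesis using p(2) by (simp add: sum_distrib_right[symmetric])
  qed
  have S1: "cmod S \<le> 1" unfolding S_def by (rule wsum) simp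
  have "S - 1 = (\<Sum>k\<in>A. of_real (p k) * (cis (y k) - 1))"
    by (simp add: S_def right_diff_distrib sum_subtractf p1)
  moreover have "cmod (\<Sum>k\<in>A. of_real (p k) * (cis (y k) - 1)) \<le> Y"
    by (intro wsum order.trans[OF cmod_cis_diff_1] y)
  ultimately have S2: "cmod (S - 1) \<le> Y" by (simp only:)
  have "S - 1 - \<i> * of_real X + of_real P / 2 =
      (\<Sum>k\<in>A. of_real (p k) * (cis (y k) - 1 - \<i> * of_real (y k) + of_real ((y k)\<^sup>2) / 2))"
    by (simp add: S_def X_def P_def right_diff_distrib distrib_left sum_subtractf sum.distrib p1
        sum_distrib_left sum_divide_distrib mult_ac)
  moreover have "cmod (\<Sum>k\<in>A. of_real (p k) * (cis (y k) - 1 - \<i> * of_real (y k) + of_real ((y k)\<^sup>2) / 2)) \<le> Y ^ 3"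
    by (intro wsum order.trans[OF cmod_cis_Taylor_2] power_mono y abs_ge_zero)
  ultimately have S3: "cmod (S - 1 - \<i> * of_real X + of_real P / 2) \<le> Y ^ 3" by (simp only:)
  have "\<bar>X\<bar> \<le> (\<Sum>k\<in>A. p k * Y)"
    unfolding X_def using p y
    by (intro order.trans[OF sum_abs sum_mono]) (auto simp: abs_mult intro!: mult_left_mono)
  then have XY: "\<bar>X\<bar> \<le> Y" using p(2) by (simp add: sum_distrib_right[symmetric])
  have "cmod (cis X - 1 - \<i> * of_real X) \<le> X\<^sup>2" by (rule cmod_cis_Taylor_1)
  also have "X\<^sup>2 = \<bar>X\<bar> * \<bar>X\<bar>" by (simp add: power2_eq_square)
  also have "\<dots> \<le> Y * \<bar>X\<bar>" using XY by (intro mult_right_mono) auto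
  finally have X2: "cmod (cis X - 1 - \<i> * of_real X) \<le> Y * \<bar>X\<bar>" .
  \<comment> \<open>The first-order terms of \<open>S\<close> and \<open>cis X\<close> cancel, so
    the drift \<open>X\<close> enters the error only quadratically; \<open>h\<close> cancels against
    half of the second moment.\<close>
  have "exp h * S - cis X = (exp h - 1 - h) * S + h * (S - 1) + (S - 1 - \<i> * of_real X + of_real P / 2)
      + (h - of_real P / 2) - (cis X - 1 - \<i> * of_real X)"
    by (simp add: algebra_simps)
  also have "cmod \<dots> \<le> cmod ((exp h - 1 - h) * S) + cmod (h * (S - 1)) + cmod (S - 1 - \<i> * of_real X + of_real P / 2)
      + cmod (h - of_real P / 2) + cmod (cis X - 1 - \<i> * of_real X)"
    by (intro order.trans[OF norm_triangle_ineq4] add_right_mono order.trans[OF norm_triangle_ineq]) auto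
  also have "\<dots> \<le> exp (cmod h) * (cmod h)\<^sup>2 + cmod h * Y + Y ^ 3 + cmod (h - of_real P / 2) + Y * \<bar>X\<bar>"
  proof (intro add_mono S3 X2 order_refl)
    show "cmod ((exp h - 1 - h) * S) \<le> exp (cmod h) * (cmod h)\<^sup>2"
      unfolding norm_mult using mult_mono[OF cmod_exp_Taylor_1[of h] S1] by simp
    show "cmod (h * (S - 1)) \<le> cmod h * Y"
      unfolding norm_mult using S2 by (intro mult_left_mono) auto
  qed
  finally show ?thesis unfolding S_def X_def P_def .
qed

text \<open>Bilinear without conjugation: the index set is closed under conjugation, and real linear
  forms correspond to coefficients that respect it.\<close>

definition quad_form :: "complex set \<Rightarrow> (complex \<Rightarrow> complex \<Rightarrow> complex) \<Rightarrow> (complex \<Rightarrow> complex) \<Rightarrow> complex" where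
  "quad_form A b e = (\<Sum>z\<in>A. \<Sum>w\<in>A. e z * e w * b z w)"

lemma quad_form_bound:
  assumes "\<And>z. z \<in> A \<Longrightarrow> cmod (e z) \<le> c"
  shows "cmod (quad_form A b e) \<le> (\<Sum>z\<in>A. \<Sum>w\<in>A. cmod (b z w)) * c\<^sup>2"
proof -
  have "cmod (quad_form A b e) \<le> (\<Sum>z\<in>A. \<Sum>w\<in>A. c\<^sup>2 * cmod (b z w))"
    unfolding quad_form_def
  proof (intro order.trans[OF norm_sum] sum_mono order.trans[OF norm_sum])
    fix z w assume zw: "z \<in> A" "w \<in> A"
    have "cmod (e z) * cmod (e w) \<le> c * c"
      using assms zw by (intro mult_mono order.trans[OF norm_ge_zero assms]) auto
    then show "cmod (e z * e w * b z w) \<le> c\<^sup>2 * cmod (b z w)"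
      unfolding norm_mult power2_eq_square by (intro mult_right_mono) auto
  qed
  then show ?thesis by (simp add: sum_distrib_left sum_distrib_right mult.commute)
qed

text \<open>The small phase is expressed through the spectrum; the dimension enters only when the
  locale is interpreted.\<close>

locale gap_process_small = gap_process +
  assumes small: "\<And>z. z \<in> gap_roots m \<Longrightarrow> z \<noteq> 1 \<Longrightarrow> Re z < 1/2"
begin

section \<open>Estimates uniform over the roots other than 1\<close>

definition Lam :: "complex set" where "Lam = gap_roots m - {1}"

lemma Lam: "finite Lam" "\<And>z. z \<in> Lam \<Longrightarrow> z \<in> gap_roots m \<and> Re z < 1/2" "\<And>z. z \<in> Lam \<Longrightarrow> cnj z \<in> Lam"
  using card_gap_roots(1)[of m] m_ge_2 small cnj_in_gap_roots by (auto simp: Lam_def complex_cnj_cancel_iff dest: arg_cong[of _ _ cnj])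

lemma sum_Lam_real:
  assumes "\<And>z. z \<in> Lam \<Longrightarrow> f (cnj z) = cnj (f z)"
  shows "(\<Sum>z\<in>Lam. f z) = of_real (Re (\<Sum>z\<in>Lam. f z))"
proof -
  have "cnj (\<Sum>z\<in>Lam. f z) = (\<Sum>z\<in>Lam. f (cnj z))" using assms by simp
  also have "\<dots> = (\<Sum>z\<in>Lam. f z)"
    by (rule sum.reindex_bij_witness[where i = cnj and j = cnj]) (use Lam(3) in auto)
  finally have "cnj (\<Sum>z\<in>Lam. f z) = (\<Sum>z\<in>Lam. f z)" .
  then have "Im (\<Sum>z\<in>Lam. f z) = 0" by (metis complex_cnj_cancel_iff Im_complex_of_real Reals_cnj_iff complex_is_Real_iff)
  then show ?thesis by (simp add: complex_eq_iff)
qed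

lemma Lam_gam_bound:
  obtains K s where "K \<ge> 1" "0 \<le> s" "s < 1/2"
    "\<And>z n j. z \<in> Lam \<Longrightarrow> j \<le> n \<Longrightarrow> cmod (gam z n j) \<le> K * (T n / T j) powr s"
proof -
  \<comment> \<open>Inserting \<open>0\<close> makes the exponent nonnegative and the set
    nonempty.\<close>
  define s where "s = Max (insert 0 (Re ` Lam))"
  have "s < 1/2" unfolding s_def using Lam by (subst Max_less_iff) auto
  moreover have "0 \<le> s" "\<And>z. z \<in> Lam \<Longrightarrow> Re z \<le> s"
    unfolding s_def using Lam(1) by (auto intro: Max_ge)
  ultimately have s: "0 \<le> s" "s < 1/2" "\<And>z. z \<in> Lam \<Longrightarrow> Re z \<le> s" by auto
  have "\<forall>z\<in>Lam. \<exists>K\<ge>1. \<forall>n j. j \<le> n \<longrightarrow> cmod (gam z n j) \<le> K * (T n / T j) powr s"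
    using gam_bound s(3) by metis
  then obtain K where K: "\<And>z. z \<in> Lam \<Longrightarrow> K z \<ge> 1"
    "\<And>z n j. z \<in> Lam \<Longrightarrow> j \<le> n \<Longrightarrow> cmod (gam z n j) \<le> K z * (T n / T j) powr s"
    by metis
  define K' where "K' = 1 + (\<Sum>z\<in>Lam. K z)"
  have K0: "0 \<le> K z" if "z \<in> Lam" for z using K(1)[OF that] by simp
  have KK: "K z \<le> K'" if "z \<in> Lam" for z
  proof -
    have "K z \<le> (\<Sum>z\<in>Lam. K z)" using that K0 Lam(1) by (intro member_le_sum) auto
    then show ?thesis by (simp add: K'_def)
  qed
  show thesis
  proof (rule that[of K' s])
    show "K' \<ge> 1" using K0 by (simp add: K'_def sum_nonneg)
    fix z n j assume "z \<in> Lam" "j \<le> (n::nat)"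
    then have "cmod (gam z n j) \<le> K z * (T n / T j) powr s" by (rule K(2))
    also have "\<dots> \<le> K' * (T n / T j) powr s" using KK \<open>z \<in> Lam\<close> by (intro mult_right_mono) auto
    finally show "cmod (gam z n j) \<le> K' * (T n / T j) powr s" .
  qed (use s in auto)
qed

lemma Lam_U_bound:
  obtains C where "C > 0" "\<And>z n. z \<in> Lam \<Longrightarrow> expectation (\<lambda>\<omega>. cmod (U z n \<omega>)) \<le> C * sqrt (T n)"
proof -
  have "\<forall>z\<in>Lam. \<exists>C>0. \<forall>n. expectation (\<lambda>\<omega>. cmod (U z n \<omega>)) \<le> C * sqrt (T n)"
    using U_second_moment_small Lam(2) by metis
  then obtain K where K: "\<And>z. z \<in> Lam \<Longrightarrow> K z > 0"
    "\<And>z n. z \<in> Lam \<Longrightarrow> expectation (\<lambda>\<omega>. cmod (U z n \<omega>)) \<le> K z * sqrt (T n)"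
    by metis
  define K' where "K' = 1 + (\<Sum>z\<in>Lam. K z)"
  have K0: "0 \<le> K z" if "z \<in> Lam" for z using K(1)[OF that] by simp
  have KK: "K z \<le> K'" if "z \<in> Lam" for z
  proof -
    have "K z \<le> (\<Sum>z\<in>Lam. K z)" using that K0 Lam(1) by (intro member_le_sum) auto
    then show ?thesis by (simp add: K'_def)
  qed
  show thesis
  proof (rule that[of K'])
    show "K' > 0" using K0 by (simp add: K'_def sum_nonneg add_pos_nonneg)
    fix z n assume "z \<in> Lam"
    then have "expectation (\<lambda>\<omega>. cmod (U z n \<omega>)) \<le> K z * sqrt (T n)" by (rule K(2))
    also have "\<dots> \<le> K' * sqrt (T n)" using KK \<open>z \<in> Lam\<close> T_pos[of n] by (intro mult_right_mono) auto
    finally show "expectation (\<lambda>\<omega>. cmod (U z n \<omega>)) \<le> K' * sqrt (T n)" .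
  qed
qed

lemma U_integrable_cmod: "z \<in> Lam \<Longrightarrow> integrable M (\<lambda>\<omega>. cmod (U z n \<omega>))"
  using U_integrable_power(1)[of z n 1] Lam(2) by simp

lemma AE_G_deviation:
  "AE \<omega> in M. \<forall>n. \<forall>k\<in>{1..m}. of_real (G n \<omega> k - T n * v1 m k) = (\<Sum>z\<in>Lam. U z n \<omega> * eig_vec m z k)"
  using AE_gap_facts
proof eventually_elim
  case (elim \<omega>)
  show ?case
  proof (intro allI ballI)
    fix n k assume k: "k \<in> {1..m}"
    have "(\<Sum>i=1..m. G n \<omega> i) = T n" using elim by blast
    then have U1: "U 1 n \<omega> = of_real (T n)"
      unfolding U_def eig_form_1 by (metis of_real_sum)
    have "of_real (G n \<omega> k) = (\<Sum>z\<in>gap_roots m. U z n \<omega> * eig_vec m z k)"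
      unfolding U_def by (rule eig_decomposition[OF m_ge_2 k, symmetric])
    also have "\<dots> = U 1 n \<omega> * eig_vec m 1 k + (\<Sum>z\<in>Lam. U z n \<omega> * eig_vec m z k)"
      unfolding Lam_def using card_gap_roots(1)[of m] m_ge_2 one_in_gap_roots
      by (intro sum.remove) auto
    finally show "of_real (G n \<omega> k - T n * v1 m k) = (\<Sum>z\<in>Lam. U z n \<omega> * eig_vec m z k)"
      by (simp add: U1 eig_vec_1)
  qed
qed

text \<open>A law of large numbers with rate: the colour probabilities differ from \<open>v1\<close>
  by \<open>O(1 / sqrt (T n))\<close> in mean. It lets the step variance be replaced by its
  limit.\<close>

lemma expectation_deviation:
  obtains C where "C > 0"
    "\<And>n k. k \<in> {1..m} \<Longrightarrow> integrable M (\<lambda>\<omega>. \<bar>G n \<omega> k - T n * v1 m k\<bar>)"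
    "\<And>n k. k \<in> {1..m} \<Longrightarrow> expectation (\<lambda>\<omega>. \<bar>G n \<omega> k - T n * v1 m k\<bar>) \<le> C * sqrt (T n)"
proof -
  obtain C where C: "C > 0" "\<And>z n. z \<in> Lam \<Longrightarrow> expectation (\<lambda>\<omega>. cmod (U z n \<omega>)) \<le> C * sqrt (T n)"
    using Lam_U_bound by blast
  define D where "D = (\<Sum>k=1..m. \<Sum>z\<in>Lam. cmod (eig_vec m z k)) * C + 1"
  have iU: "integrable M (\<lambda>\<omega>. \<Sum>z\<in>Lam. cmod (U z n \<omega>) * cmod (eig_vec m z k))" for n k
    by (intro Bochner_Integration.integrable_sum integrable_mult_left U_integrable_cmod)
  have ae: "AE \<omega> in M. \<bar>G n \<omega> k - T n * v1 m k\<bar> \<le> (\<Sum>z\<in>Lam. cmod (U z n \<omega>) * cmod (eig_vec m z k))"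
    if k: "k \<in> {1..m}" for n k
    using AE_G_deviation
  proof eventually_elim
    case (elim \<omega>)
    then have "of_real (G n \<omega> k - T n * v1 m k) = (\<Sum>z\<in>Lam. U z n \<omega> * eig_vec m z k)" using k by blast
    then have "\<bar>G n \<omega> k - T n * v1 m k\<bar> = cmod (\<Sum>z\<in>Lam. U z n \<omega> * eig_vec m z k)"
      by (metis norm_of_real)
    also have "\<dots> \<le> (\<Sum>z\<in>Lam. cmod (U z n \<omega>) * cmod (eig_vec m z k))"
      unfolding norm_mult[symmetric] by (rule norm_sum)
    finally show ?case .
  qed
  have int: "integrable M (\<lambda>\<omega>. \<bar>G n \<omega> k - T n * v1 m k\<bar>)" if k: "k \<in> {1..m}" for n k
  proof (rule Bochner_Integration.integrable_bound[OF iU[of n k]])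
    show "(\<lambda>\<omega>. \<bar>G n \<omega> k - T n * v1 m k\<bar>) \<in> borel_measurable M" using k by measurable
    show "AE \<omega> in M. norm \<bar>G n \<omega> k - T n * v1 m k\<bar> \<le> norm (\<Sum>z\<in>Lam. cmod (U z n \<omega>) * cmod (eig_vec m z k))"
      using ae[OF k, of n] by eventually_elim simp
  qed
  show thesis
  proof (rule that[OF _ int])
    show "D > 0" using C by (auto simp: D_def intro!: add_nonneg_pos mult_nonneg_nonneg sum_nonneg)
    fix n k assume k: "k \<in> {1..m}"
    have "expectation (\<lambda>\<omega>. \<bar>G n \<omega> k - T n * v1 m k\<bar>) \<le> expectation (\<lambda>\<omega>. \<Sum>z\<in>Lam. cmod (U z n \<omega>) * cmod (eig_vec m z k))"
      by (rule integral_mono_AE[OF int[OF k] iU ae[OF k]])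
    also have "\<dots> = (\<Sum>z\<in>Lam. expectation (\<lambda>\<omega>. cmod (U z n \<omega>)) * cmod (eig_vec m z k))"
      using U_integrable_cmod by simp
    also have "\<dots> \<le> (\<Sum>z\<in>Lam. (C * sqrt (T n)) * cmod (eig_vec m z k))"
      by (intro sum_mono mult_right_mono C) auto
    also have "\<dots> = (\<Sum>z\<in>Lam. cmod (eig_vec m z k)) * (C * sqrt (T n))"
      unfolding sum_distrib_right by (intro sum.cong refl) (rule mult.commute)
    also have "\<dots> \<le> (\<Sum>k=1..m. \<Sum>z\<in>Lam. cmod (eig_vec m z k)) * (C * sqrt (T n))"
      using k C T_pos[of n]
      by (intro mult_right_mono member_le_sum[of k "{1..m}" "\<lambda>k. \<Sum>z\<in>Lam. cmod (eig_vec m z k)"]) (auto intro: sum_nonneg)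
    also have "\<dots> \<le> D * sqrt (T n)"
      using T_pos[of n] by (simp add: D_def algebra_simps)
    finally show "expectation (\<lambda>\<omega>. \<bar>G n \<omega> k - T n * v1 m k\<bar>) \<le> D * sqrt (T n)" .
  qed
qed

lemma v1_nonneg: "k \<in> {1..m} \<Longrightarrow> v1 m k \<ge> 0"
  by (subst v1_explicit) (auto simp: H_sum_def intro!: divide_nonneg_nonneg mult_nonneg_nonneg sum_nonneg)

end

context gap_process_small
begin

text \<open>Limiting covariance of the jumps \<open>z * eig_coeff m z k\<close>, without complex
  conjugation, when colours are drawn with law \<open>v1\<close>. No means are subtracted: by
  \<open>eig_orthogonal\<close> they vanish for \<open>z \<noteq> 1\<close>.\<close>

definition incr_cov :: "complex \<Rightarrow> complex \<Rightarrow> complex" where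
  "incr_cov z w = z * w * (\<Sum>k=1..m. of_real (v1 m k) * eig_coeff m z k * eig_coeff m w k)"

text \<open>The Lyapunov equation is diagonal in the eigenbasis. The factor
  \<open>1 - z - w\<close>, of positive real part on \<open>Lam\<close>, balances the growth of
  \<open>T j\<close> against the two factors \<open>1 + z / T j\<close> and
  \<open>1 + w / T j\<close>.\<close>

definition lyapunov_cov :: "complex \<Rightarrow> complex \<Rightarrow> complex" where
  "lyapunov_cov z w = incr_cov z w / (1 - z - w)"

definition spectral_form :: "(complex \<Rightarrow> complex) \<Rightarrow> nat \<Rightarrow> 'a \<Rightarrow> complex" where
  "spectral_form d j \<omega> = (\<Sum>z\<in>Lam. d z * U z j \<omega>)"

text \<open>The exponential compensates the variance accumulated up to time \<open>j\<close>. When the coefficients at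
  times \<open>j\<close> and \<open>j + 1\<close> differ by the factors \<open>1 + z / T j\<close>, it is almost constant in \<open>j\<close>, because
  \<open>lyapunov_cov\<close> solves the Lyapunov equation for the increment covariance \<open>incr_cov\<close>.\<close>

definition tilted_char :: "nat \<Rightarrow> (complex \<Rightarrow> complex) \<Rightarrow> complex" where
  "tilted_char j d = expectation (\<lambda>\<omega>. cis (Re (spectral_form d j \<omega>))) * exp (of_real (T j) / 2 * quad_form Lam lyapunov_cov d)"

text \<open>Satisfied by the coefficients of real linear forms on the gaps; it makes
  \<open>spectral_form\<close> real.\<close>

definition symmetric :: "(complex \<Rightarrow> complex) \<Rightarrow> bool" where
  "symmetric d \<longleftrightarrow> (\<forall>z. d (cnj z) = cnj (d z))"

lemma spectral_form_measurable [measurable]: "spectral_form d j \<in> borel_measurable M"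
  unfolding spectral_form_def[abs_def] by measurable

lemma lyapunov_cov_eq: "z \<in> Lam \<Longrightarrow> w \<in> Lam \<Longrightarrow> lyapunov_cov z w * (1 - z - w) = incr_cov z w"
proof -
  assume "z \<in> Lam" "w \<in> Lam"
  then have "Re (1 - z - w) > 0" using Lam(2)[of z] Lam(2)[of w] by simp
  then have "1 - z - w \<noteq> 0" by auto
  then show ?thesis by (simp add: lyapunov_cov_def)
qed

lemma quad_form_incr_cov:
  "quad_form Lam incr_cov d = (\<Sum>k=1..m. of_real (v1 m k) * (\<Sum>z\<in>Lam. d z * z * eig_coeff m z k)\<^sup>2)"
proof -
  have "quad_form Lam incr_cov d = (\<Sum>z\<in>Lam. \<Sum>w\<in>Lam. \<Sum>k=1..m.
      of_real (v1 m k) * ((d z * z * eig_coeff m z k) * (d w * w * eig_coeff m w k)))"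
    unfolding quad_form_def incr_cov_def by (simp add: sum_distrib_left mult_ac)
  also have "\<dots> = (\<Sum>k=1..m. \<Sum>z\<in>Lam. \<Sum>w\<in>Lam.
      of_real (v1 m k) * ((d z * z * eig_coeff m z k) * (d w * w * eig_coeff m w k)))"
    by (subst sum.swap[of _ "{1..m}"], subst sum.swap[of _ "{1..m}"]) simp
  also have "\<dots> = (\<Sum>k=1..m. of_real (v1 m k) * (\<Sum>z\<in>Lam. d z * z * eig_coeff m z k)\<^sup>2)"
    unfolding power2_eq_square sum_product by (simp add: sum_distrib_left)
  finally show ?thesis .
qed

text \<open>The change of the compensating exponent in one step, up to the factor
  \<open>1/2\<close>. By the Lyapunov equation its main part is the increment covariance, which
  leaves an error with a factor \<open>1 / t\<close>.\<close>

lemma quad_form_step: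
  assumes t: "t \<noteq> 0"
  shows "(t + 1) * quad_form Lam lyapunov_cov d - t * quad_form Lam lyapunov_cov (\<lambda>z. d z * (1 + z / t)) =
    quad_form Lam incr_cov d - quad_form Lam (\<lambda>z w. z * w * lyapunov_cov z w) d / t"
  unfolding quad_form_def sum_distrib_left sum_divide_distrib sum_subtractf[symmetric]
proof (intro sum.cong refl)
  fix z w assume zw: "z \<in> Lam" "w \<in> Lam"
  have e: "(t + 1) - t * ((1 + z / t) * (1 + w / t)) = (1 - z - w) - z * w / t"
    using t by (simp add: field_simps)
  have "(t + 1) * (a * b * c) - t * (a * P * (b * R) * c) = a * b * c * ((t + 1) - t * (P * R))"
    for a b c P R :: complex by (simp add: algebra_simps)
  from this[of "d z" "d w" "lyapunov_cov z w" "1 + z / t" "1 + w / t", unfolded e]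
  have "(t + 1) * (d z * d w * lyapunov_cov z w) - t * (d z * (1 + z / t) * (d w * (1 + w / t)) * lyapunov_cov z w) =
     d z * d w * lyapunov_cov z w * ((1 - z - w) - z * w / t)" .
  also have "\<dots> = d z * d w * incr_cov z w - d z * d w * (z * w * lyapunov_cov z w) / t"
    unfolding lyapunov_cov_eq[OF zw, symmetric] by (simp add: algebra_simps)
  finally show "(t + 1) * (d z * d w * lyapunov_cov z w) - t * (d z * (1 + z / t) * (d w * (1 + w / t)) * lyapunov_cov z w) =
     d z * d w * incr_cov z w - d z * d w * (z * w * lyapunov_cov z w) / t" .
qed

text \<open>Coefficients of size \<open>K / sqrt (T j)\<close> make the increments of order
  \<open>r = 1 / sqrt (T j)\<close>. Replacing the colour probabilities by \<open>v1\<close> costs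
  \<open>r\<^sup>2\<close> times a mean deviation of order \<open>r\<close>; the drift has mean
  order \<open>r\<^sup>2\<close> and enters multiplied by a bound of order \<open>r\<close>. The
  other errors are powers of \<open>r\<close> of order at least three.\<close>

lemma tilted_char_step:
  fixes K :: real
  assumes K: "K > 0"
  obtains C where "C > 0" "\<And>j d. symmetric d \<Longrightarrow> (\<And>z. z \<in> Lam \<Longrightarrow> cmod (d z) \<le> K / sqrt (T j)) \<Longrightarrow>
    cmod (tilted_char (Suc j) d - tilted_char j (\<lambda>z. d z * (1 + z / of_real (T j)))) \<le> C * (1 / sqrt (T j)) ^ 3"
proof -
  obtain C1 where C1: "C1 > 0"
    "\<And>n k. k \<in> {1..m} \<Longrightarrow> integrable M (\<lambda>\<omega>. \<bar>G n \<omega> k - T n * v1 m k\<bar>)"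
    "\<And>n k. k \<in> {1..m} \<Longrightarrow> expectation (\<lambda>\<omega>. \<bar>G n \<omega> k - T n * v1 m k\<bar>) \<le> C1 * sqrt (T n)"
    using expectation_deviation by blast
  obtain C2 where C2: "C2 > 0" "\<And>z n. z \<in> Lam \<Longrightarrow> expectation (\<lambda>\<omega>. cmod (U z n \<omega>)) \<le> C2 * sqrt (T n)"
    using Lam_U_bound by blast
  define A0 where "A0 = (\<Sum>z\<in>Lam. cmod z * coeff_sum z)"
  define A1 where "A1 = (\<Sum>z\<in>Lam. \<Sum>w\<in>Lam. cmod (lyapunov_cov z w))"
  define A2 where "A2 = (\<Sum>z\<in>Lam. \<Sum>w\<in>Lam. cmod (incr_cov z w))"
  define A3 where "A3 = (\<Sum>z\<in>Lam. \<Sum>w\<in>Lam. cmod (z * w * lyapunov_cov z w))"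
  define A4 where "A4 = 1 + (\<Sum>z\<in>Lam. cmod z)"
  have A: "A0 \<ge> 0" "A1 \<ge> 0" "A2 \<ge> 0" "A3 \<ge> 0" "A4 \<ge> 0"
    using coeff_sum_nonneg by (auto simp: A0_def A1_def A2_def A3_def A4_def intro!: sum_nonneg add_nonneg_nonneg)
  define H where "H = (A2 + A3) * K\<^sup>2 / 2"
  have H: "H \<ge> 0" using A by (simp add: H_def)
  define S where "S = exp H * H\<^sup>2 + H * (A0 * K) + (A0 * K) ^ 3 + (A0 * K)\<^sup>2 / 2 * (real m * C1) +
     A3 * K\<^sup>2 / 2 + A0 * K * (K * A4 * C2)"
  have S: "S \<ge> 0" unfolding S_def using A H C1(1) C2(1) K
    by (intro add_nonneg_nonneg mult_nonneg_nonneg) auto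
  define E0 where "E0 = exp (A1 * (K * A4)\<^sup>2 / 2)"
  show thesis
  proof (rule that[of "E0 * S + 1"])
    show "E0 * S + 1 > 0" using S by (simp add: E0_def add_nonneg_pos)
    fix j d
    assume sym: "symmetric d" and dK: "\<And>z. z \<in> Lam \<Longrightarrow> cmod (d z) \<le> K / sqrt (T j)"
    define t where "t = T j"
    define r where "r = 1 / sqrt t"
    have t: "t \<ge> 1" "t > 0" using T_ge_1[of j] T_pos[of j] by (auto simp: t_def)
    have r: "0 < r" "r \<le> 1" "r * r = 1 / t" "sqrt t = 1 / r" using t by (auto simp: r_def real_div_sqrt)
    have dB: "cmod (d z) \<le> K * r" if "z \<in> Lam" for z using dK[OF that] by (simp add: r_def t_def)
    define e where "e z = d z * (1 + z / of_real t)" for z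
    define y where "y k = Re (\<Sum>z\<in>Lam. d z * z * eig_coeff m z k)" for k
    have yc: "(\<Sum>z\<in>Lam. d z * z * eig_coeff m z k) = of_real (y k)" for k
      unfolding y_def using sym by (intro sum_Lam_real) (simp add: symmetric_def eig_coeff_cnj)
    define Y where "Y = A0 * K * r"
    have Y0: "Y \<ge> 0" using A K r by (simp add: Y_def)
    have yY: "\<bar>y k\<bar> \<le> Y" if k: "k \<in> {1..m}" for k
    proof -
      have "\<bar>y k\<bar> = cmod (\<Sum>z\<in>Lam. d z * z * eig_coeff m z k)" unfolding yc by simp
      also have "\<dots> \<le> (\<Sum>z\<in>Lam. K * r * (cmod z * coeff_sum z))"
        unfolding mult.assoc
        by (intro order.trans[OF norm_sum] sum_mono, unfold norm_mult mult.assoc[symmetric])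
           (intro mult_mono dB coeff_le_coeff_sum[OF k] mult_nonneg_nonneg norm_ge_zero, use K r dB in auto)
      also have "\<dots> = Y" by (simp add: Y_def A0_def sum_distrib_left sum_distrib_right mult_ac)
      finally show ?thesis .
    qed
    define p where "p k \<omega> = G j \<omega> k / t" for k \<omega>
    define X where "X \<omega> = (\<Sum>k=1..m. p k \<omega> * y k)" for \<omega>
    have Xc: "of_real (X \<omega>) = (\<Sum>z\<in>Lam. d z * z / of_real t * U z j \<omega>)" for \<omega>
    proof -
      have "complex_of_real (X \<omega>) = (\<Sum>k=1..m. \<Sum>z\<in>Lam. d z * z / of_real t * (eig_coeff m z k * of_real (G j \<omega> k)))"
        unfolding X_def p_def by (simp add: yc[symmetric] sum_distrib_left sum_divide_distrib mult_ac)
      also have "\<dots> = (\<Sum>z\<in>Lam. d z * z / of_real t * U z j \<omega>)"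
        unfolding U_def eig_form_eq sum_distrib_left by (rule sum.swap)
      finally show ?thesis .
    qed
    \<comment> \<open>Passing from \<open>d\<close> to \<open>e\<close> adds exactly the mean
      \<open>X\<close> of the next increment given the past; this is how the drift is
      absorbed.\<close>
    have Le: "spectral_form e j \<omega> = spectral_form d j \<omega> + of_real (X \<omega>)" for \<omega>
      unfolding Xc by (simp add: spectral_form_def e_def sum.distrib[symmetric] algebra_simps)
    define lo where "lo \<omega> = Re (spectral_form d j \<omega>)" for \<omega>
    have lom [measurable]: "lo \<in> borel_measurable M" unfolding lo_def[abs_def] by measurable
    have pm [measurable]: "p k \<in> borel_measurable M" if "k \<in> {1..m}" for k
      unfolding p_def[abs_def] using that by measurable
    have Xm [measurable]: "X \<in> borel_measurable M" unfolding X_def[abs_def] by measurable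
    have E1: "expectation (\<lambda>\<omega>. cis (Re (spectral_form d (Suc j) \<omega>))) = expectation (\<lambda>\<omega>. \<Sum>k=1..m. of_real (p k \<omega>) * cis (lo \<omega> + y k))"
    proof -
      define F where "F v = cis (Re (\<Sum>z\<in>Lam. d z * eig_form m z (\<lambda>k. of_real (v (Suc j) k))))" for v :: "nat \<Rightarrow> nat \<Rightarrow> real"
      have F1: "F (path (Suc j) \<omega>) = cis (Re (spectral_form d (Suc j) \<omega>))" for \<omega>
        by (simp add: F_def spectral_form_def eig_form_path)
      have F2: "F (path_step j (path j \<omega>) k) = cis (lo \<omega> + y k)" if k: "k \<in> {1..m}" for k \<omega>
      proof -
        have "eig_form m z (\<lambda>i. of_real (path_step j (path j \<omega>) k (Suc j) i)) = U z j \<omega> + z * eig_coeff m z k"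
          if "z \<in> Lam" for z
        proof -
          have "eig_form m z (\<lambda>i. of_real (path_step j (path j \<omega>) k (Suc j) i)) =
            eig_form m z (\<lambda>i. of_real (G j \<omega> i) + of_real (repl_mat m k i))"
            by (intro eig_form_cong) (simp add: path_step_def path_def)
          then show ?thesis using Lam(2)[OF that] k by (simp add: eig_form_add eig_form_repl_row U_def)
        qed
        then have "(\<Sum>z\<in>Lam. d z * eig_form m z (\<lambda>i. of_real (path_step j (path j \<omega>) k (Suc j) i))) =
          spectral_form d j \<omega> + (\<Sum>z\<in>Lam. d z * z * eig_coeff m z k)"
          by (simp add: spectral_form_def distrib_left sum.distrib mult.assoc)
        then show ?thesis by (simp add: F_def yc lo_def)
      qed
      have "expectation (\<lambda>\<omega>. F (path (Suc j) \<omega>)) =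
        expectation (\<lambda>\<omega>. \<Sum>k=1..m. (G j \<omega> k / T j) *\<^sub>R F (path_step j (path j \<omega>) k))"
      proof (rule expectation_path_Suc)
        show "(\<lambda>\<omega>. F (path (Suc j) \<omega>)) \<in> borel_measurable M" unfolding F1 by measurable
        show "(\<lambda>\<omega>. F (path_step j (path j \<omega>) k)) \<in> borel_measurable M" if "k \<in> {1..m}" for k
          unfolding F2[OF that] by measurable
      qed
      also have "\<dots> = expectation (\<lambda>\<omega>. \<Sum>k=1..m. of_real (p k \<omega>) * cis (lo \<omega> + y k))"
        by (intro Bochner_Integration.integral_cong refl sum.cong) (simp add: F2 scaleR_conv_of_real p_def t_def)
      finally show ?thesis unfolding F1 .
    qed
    \<comment> \<open>The change of the exponent, which is half the limiting variance of the
      increment up to an error with a factor \<open>1 / t\<close>.\<close>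
    define h where "h = of_real (T (Suc j)) / 2 * quad_form Lam lyapunov_cov d - of_real t / 2 * quad_form Lam lyapunov_cov e"
    define q2 where "q2 = quad_form Lam (\<lambda>z w. z * w * lyapunov_cov z w) d"
    have h2: "2 * h = quad_form Lam incr_cov d - q2 / of_real t"
    proof -
      have e_fun: "e = (\<lambda>z. d z * (1 + z / of_real t))" by (simp add: e_def fun_eq_iff)
      have "2 * h = (of_real t + 1) * quad_form Lam lyapunov_cov d - of_real t * quad_form Lam lyapunov_cov e"
        by (simp add: h_def T_Suc t_def[symmetric] right_diff_distrib)
      also have "\<dots> = quad_form Lam incr_cov d - q2 / of_real t"
        unfolding e_fun q2_def using t by (intro quad_form_step) simp
      finally show ?thesis .
    qed
    have qom: "quad_form Lam incr_cov d = of_real (\<Sum>k=1..m. v1 m k * (y k)\<^sup>2)"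
      unfolding quad_form_incr_cov yc by simp
    have q2b: "cmod q2 \<le> A3 * (K * r)\<^sup>2" unfolding q2_def A3_def by (rule quad_form_bound[OF dB])
    have qob: "cmod (quad_form Lam incr_cov d) \<le> A2 * (K * r)\<^sup>2" unfolding A2_def by (rule quad_form_bound[OF dB])
    have hb: "cmod h \<le> H * (r * r)"
    proof -
      have "2 * cmod h = cmod (2 * h)" by (simp add: norm_mult)
      also have "\<dots> \<le> cmod (quad_form Lam incr_cov d) + cmod q2 / t"
        unfolding h2 using t by (intro order.trans[OF norm_triangle_ineq4]) (simp add: norm_divide)
      also have "cmod q2 / t \<le> cmod q2" using t by (simp add: divide_le_eq mult_le_cancel_left1)
      finally have "2 * cmod h \<le> A2 * (K * r)\<^sup>2 + A3 * (K * r)\<^sup>2" using q2b qob by simp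
      then show ?thesis by (simp add: H_def power2_eq_square algebra_simps)
    qed
    have rr: "r * r \<le> 1" using t unfolding r(3) by simp
    have hH: "cmod h \<le> H" using hb rr H by (meson mult_left_le order_trans)
    have Qe: "cmod (of_real t / 2 * quad_form Lam lyapunov_cov e) \<le> A1 * (K * A4)\<^sup>2 / 2"
    proof -
      have "cmod (e z) \<le> K * r * A4" if z: "z \<in> Lam" for z
      proof -
        have "cmod (1 + z / of_real t) \<le> 1 + cmod z / t"
          using t by (intro order.trans[OF norm_triangle_ineq]) (simp add: norm_divide)
        also have "cmod z / t \<le> cmod z" using t by (simp add: divide_le_eq mult_le_cancel_left1)
        also have "cmod z \<le> (\<Sum>z\<in>Lam. cmod z)" using z Lam(1) by (intro member_le_sum) auto
        finally have "cmod (1 + z / of_real t) \<le> A4" by (simp add: A4_def)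
        then show ?thesis unfolding e_def norm_mult using dB[OF z] K r by (intro mult_mono) auto
      qed
      then have "cmod (quad_form Lam lyapunov_cov e) \<le> A1 * (K * r * A4)\<^sup>2" unfolding A1_def by (rule quad_form_bound)
      then have "t / 2 * cmod (quad_form Lam lyapunov_cov e) \<le> t / 2 * (A1 * (K * r * A4)\<^sup>2)"
        using t by (intro mult_left_mono) auto
      also have "\<dots> = A1 * (K * A4)\<^sup>2 / 2 * (t * (r * r))" by (simp add: power2_eq_square)
      also have "t * (r * r) = 1" using r t by simp
      finally show ?thesis using t by (simp add: norm_mult norm_divide)
    qed
    have icis: "integrable M (\<lambda>\<omega>. cis (f \<omega>))" if "f \<in> borel_measurable M" for f :: "'a \<Rightarrow> real"
      using that by (intro integrable_const_bound[where B = 1]) auto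
    have AEp: "AE \<omega> in M. (\<forall>k\<in>{1..m}. p k \<omega> \<ge> 0) \<and> (\<Sum>k=1..m. p k \<omega>) = 1"
      using AE_gap_facts
    proof eventually_elim
      case (elim \<omega>)
      then have s: "(\<Sum>k=1..m. G j \<omega> k) = t" and nn: "\<forall>k\<in>{1..m}. 0 \<le> G j \<omega> k" unfolding t_def by blast+
      have "(\<Sum>k=1..m. p k \<omega>) = 1" unfolding p_def sum_divide_distrib[symmetric] s using t by simp
      then show ?case using nn t by (simp add: p_def)
    qed
    define Df where "Df \<omega> = exp h * (\<Sum>k=1..m. of_real (p k \<omega>) * cis (y k)) - cis (X \<omega>)" for \<omega>
    have Dfm [measurable]: "Df \<in> borel_measurable M" unfolding Df_def[abs_def] by measurable
    have psum: "integrable M (\<lambda>\<omega>. \<Sum>k=1..m. of_real (p k \<omega>) * cis (lo \<omega> + y k))"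
    proof (rule integrable_const_bound[where B = 1])
      show "AE \<omega> in M. cmod (\<Sum>k=1..m. of_real (p k \<omega>) * cis (lo \<omega> + y k)) \<le> 1"
        using AEp
      proof eventually_elim
        case (elim \<omega>)
        have "cmod (\<Sum>k=1..m. of_real (p k \<omega>) * cis (lo \<omega> + y k)) \<le> (\<Sum>k=1..m. p k \<omega>)"
          by (intro order.trans[OF norm_sum] sum_mono) (use elim in \<open>auto simp: norm_mult\<close>)
        then show ?case using elim by simp
      qed
    qed measurable
    have diff: "tilted_char (Suc j) d - tilted_char j e = exp (of_real t / 2 * quad_form Lam lyapunov_cov e) * expectation (\<lambda>\<omega>. cis (lo \<omega>) * Df \<omega>)"
    proof -
      have ex: "exp (of_real (T (Suc j)) / 2 * quad_form Lam lyapunov_cov d) = exp (of_real t / 2 * quad_form Lam lyapunov_cov e) * exp h"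
        unfolding exp_add[symmetric] h_def by simp
      have "cis (lo \<omega>) * Df \<omega> = exp h * (\<Sum>k=1..m. of_real (p k \<omega>) * cis (lo \<omega> + y k)) - cis (Re (spectral_form e j \<omega>))" for \<omega>
        unfolding Df_def Le by (simp add: lo_def cis_mult[symmetric] right_diff_distrib sum_distrib_left mult_ac)
      then have eqD: "expectation (\<lambda>\<omega>. cis (lo \<omega>) * Df \<omega>) =
        exp h * expectation (\<lambda>\<omega>. \<Sum>k=1..m. of_real (p k \<omega>) * cis (lo \<omega> + y k)) - expectation (\<lambda>\<omega>. cis (Re (spectral_form e j \<omega>)))"
        using psum icis[of "\<lambda>\<omega>. Re (spectral_form e j \<omega>)"] by (simp add: Bochner_Integration.integral_diff)
      show ?thesis unfolding tilted_char_def ex E1 t_def[symmetric] eqD by (simp add: algebra_simps)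
    qed
    \<comment> \<open>The pointwise error bound is still random, through the deviations of the gaps
      and the size of the eigenforms; its mean is of order \<open>r ^ 3\<close>.\<close>
    define bnd where "bnd \<omega> = exp H * H\<^sup>2 * (r * r * (r * r)) + H * (r * r) * Y + Y ^ 3 +
       (Y\<^sup>2 / 2 * ((\<Sum>k=1..m. \<bar>G j \<omega> k - T j * v1 m k\<bar>) * (r * r)) + A3 * (K * r)\<^sup>2 / 2 * (r * r))
       + Y * (K * r * (\<Sum>z\<in>Lam. cmod z * cmod (U z j \<omega>)) * (r * r))" for \<omega>
    have ibnd: "integrable M bnd"
      unfolding bnd_def[abs_def]
      by (intro Bochner_Integration.integrable_add integrable_const integrable_mult_right integrable_mult_left
          Bochner_Integration.integrable_sum C1(2) U_integrable_cmod)
    have Dfb: "AE \<omega> in M. cmod (cis (lo \<omega>) * Df \<omega>) \<le> bnd \<omega>"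
      using AEp
    proof eventually_elim
      case (elim \<omega>)
      have 1: "cmod (Df \<omega>) \<le> exp (cmod h) * (cmod h)\<^sup>2 + cmod h * Y + Y ^ 3 +
          cmod (h - of_real (\<Sum>k=1..m. p k \<omega> * (y k)\<^sup>2) / 2) + Y * \<bar>X \<omega>\<bar>"
        unfolding Df_def X_def by (rule Lindeberg_step) (use elim yY in auto)
      have 2: "exp (cmod h) * (cmod h)\<^sup>2 \<le> exp H * H\<^sup>2 * (r * r * (r * r))"
      proof -
        have "exp (cmod h) * (cmod h)\<^sup>2 \<le> exp H * (H * (r * r))\<^sup>2"
          using hb hH by (intro mult_mono power_mono) auto
        then show ?thesis by (simp add: power2_eq_square mult_ac)
      qed
      have 3: "cmod h * Y \<le> H * (r * r) * Y" using hb Y0 by (rule mult_right_mono)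
      have 4: "cmod (h - of_real (\<Sum>k=1..m. p k \<omega> * (y k)\<^sup>2) / 2) \<le>
        Y\<^sup>2 / 2 * ((\<Sum>k=1..m. \<bar>G j \<omega> k - T j * v1 m k\<bar>) * (r * r)) + A3 * (K * r)\<^sup>2 / 2 * (r * r)"
      proof -
        have "2 * (h - of_real (\<Sum>k=1..m. p k \<omega> * (y k)\<^sup>2) / 2) = of_real (\<Sum>k=1..m. (v1 m k - p k \<omega>) * (y k)\<^sup>2) - q2 / of_real t"
          using h2 unfolding qom by (simp add: left_diff_distrib sum_subtractf algebra_simps)
        from arg_cong[OF this, of cmod] have "2 * cmod (h - of_real (\<Sum>k=1..m. p k \<omega> * (y k)\<^sup>2) / 2) =
            cmod (of_real (\<Sum>k=1..m. (v1 m k - p k \<omega>) * (y k)\<^sup>2) - q2 / of_real t)"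
          by (simp only: norm_mult norm_numeral)
        also have "\<dots> \<le> \<bar>\<Sum>k=1..m. (v1 m k - p k \<omega>) * (y k)\<^sup>2\<bar> + cmod q2 / t"
          using t by (intro order.trans[OF norm_triangle_ineq4]) (simp add: norm_divide del: of_real_sum)
        also have "\<bar>\<Sum>k=1..m. (v1 m k - p k \<omega>) * (y k)\<^sup>2\<bar> \<le> (\<Sum>k=1..m. \<bar>G j \<omega> k - T j * v1 m k\<bar> * (r * r) * Y\<^sup>2)"
        proof (intro order.trans[OF sum_abs] sum_mono)
          fix k assume k: "k \<in> {1..m}"
          have "v1 m k - p k \<omega> = - (G j \<omega> k - T j * v1 m k) * (r * r)"
            using t by (simp add: p_def r(3) t_def[symmetric] field_simps)
          then have a: "\<bar>v1 m k - p k \<omega>\<bar> = \<bar>G j \<omega> k - T j * v1 m k\<bar> * (r * r)"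
            using r t by (simp add: abs_mult abs_minus_commute)
          have b: "(y k)\<^sup>2 \<le> Y\<^sup>2" using yY[OF k] by (metis abs_ge_zero power2_abs power_mono)
          have "\<bar>(v1 m k - p k \<omega>) * (y k)\<^sup>2\<bar> = \<bar>v1 m k - p k \<omega>\<bar> * (y k)\<^sup>2" by (simp add: abs_mult)
          also have "\<dots> \<le> \<bar>G j \<omega> k - T j * v1 m k\<bar> * (r * r) * Y\<^sup>2"
            unfolding a by (rule mult_left_mono[OF b mult_nonneg_nonneg[OF abs_ge_zero zero_le_square]])
          finally show "\<bar>(v1 m k - p k \<omega>) * (y k)\<^sup>2\<bar> \<le> \<bar>G j \<omega> k - T j * v1 m k\<bar> * (r * r) * Y\<^sup>2" .
        qed
        also have "(\<Sum>k=1..m. \<bar>G j \<omega> k - T j * v1 m k\<bar> * (r * r) * Y\<^sup>2) = Y\<^sup>2 * ((\<Sum>k=1..m. \<bar>G j \<omega> k - T j * v1 m k\<bar>) * (r * r))"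
          unfolding sum_distrib_right sum_distrib_left by (intro sum.cong refl) (simp only: mult_ac)
        also have "cmod q2 / t \<le> A3 * (K * r)\<^sup>2 * (r * r)"
          using q2b t unfolding r(3) by (simp add: divide_right_mono)
        finally show ?thesis by simp
      qed
      have 5: "Y * \<bar>X \<omega>\<bar> \<le> Y * (K * r * (\<Sum>z\<in>Lam. cmod z * cmod (U z j \<omega>)) * (r * r))"
      proof (rule mult_left_mono[OF _ Y0])
        have "\<bar>X \<omega>\<bar> = cmod (\<Sum>z\<in>Lam. d z * z / of_real t * U z j \<omega>)"
          unfolding Xc[symmetric] by simp
        also have "\<dots> \<le> (\<Sum>z\<in>Lam. K * r * (cmod z * cmod (U z j \<omega>)) * (r * r))"
        proof (intro order.trans[OF norm_sum] sum_mono)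
          fix z assume z: "z \<in> Lam"
          have "cmod (d z * z / of_real t * U z j \<omega>) = cmod (d z) * (cmod z * cmod (U z j \<omega>)) * (r * r)"
            using t by (simp add: norm_mult norm_divide r(3))
          also have "\<dots> \<le> K * r * (cmod z * cmod (U z j \<omega>)) * (r * r)"
            by (intro mult_right_mono dB[OF z] mult_nonneg_nonneg norm_ge_zero zero_le_square)
          finally show "cmod (d z * z / of_real t * U z j \<omega>) \<le> K * r * (cmod z * cmod (U z j \<omega>)) * (r * r)" .
        qed
        also have "\<dots> = K * r * (\<Sum>z\<in>Lam. cmod z * cmod (U z j \<omega>)) * (r * r)"
          by (simp add: sum_distrib_left sum_distrib_right)
        finally show "\<bar>X \<omega>\<bar> \<le> K * r * (\<Sum>z\<in>Lam. cmod z * cmod (U z j \<omega>)) * (r * r)" .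
      qed
      show ?case using 1 2 3 4 5 unfolding bnd_def by (simp add: norm_mult)
    qed
    have Ebnd: "expectation bnd \<le> S * r ^ 3"
    proof -
      have s1: "expectation (\<lambda>\<omega>. \<Sum>k=1..m. \<bar>G j \<omega> k - T j * v1 m k\<bar>) \<le> real m * C1 * (1 / r)"
      proof -
        have "expectation (\<lambda>\<omega>. \<Sum>k=1..m. \<bar>G j \<omega> k - T j * v1 m k\<bar>) = (\<Sum>k=1..m. expectation (\<lambda>\<omega>. \<bar>G j \<omega> k - T j * v1 m k\<bar>))"
          using C1(2) by (intro Bochner_Integration.integral_sum)
        also have "\<dots> \<le> (\<Sum>k=1..m. C1 * sqrt (T j))" by (intro sum_mono C1(3))
        finally show ?thesis using r(4) by (simp add: t_def)
      qed
      have s2: "expectation (\<lambda>\<omega>. \<Sum>z\<in>Lam. cmod z * cmod (U z j \<omega>)) \<le> A4 * C2 * (1 / r)"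
      proof -
        have "expectation (\<lambda>\<omega>. \<Sum>z\<in>Lam. cmod z * cmod (U z j \<omega>)) = (\<Sum>z\<in>Lam. cmod z * expectation (\<lambda>\<omega>. cmod (U z j \<omega>)))"
          using U_integrable_cmod by simp
        also have "\<dots> \<le> (\<Sum>z\<in>Lam. cmod z * (C2 * sqrt (T j)))" by (intro sum_mono mult_left_mono C2) auto
        also have "\<dots> = (\<Sum>z\<in>Lam. cmod z) * (C2 * (1 / r))"
          unfolding sum_distrib_right using r(4) by (simp add: t_def)
        also have "\<dots> \<le> A4 * (C2 * (1 / r))"
          using C2(1) r by (intro mult_right_mono) (auto simp: A4_def)
        finally show ?thesis by simp
      qed
      have i1: "integrable M (\<lambda>\<omega>. \<Sum>k=1..m. \<bar>G j \<omega> k - T j * v1 m k\<bar>)"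
        by (intro Bochner_Integration.integrable_sum C1(2))
      have i2: "integrable M (\<lambda>\<omega>. \<Sum>z\<in>Lam. cmod z * cmod (U z j \<omega>))"
        by (intro Bochner_Integration.integrable_sum integrable_mult_right U_integrable_cmod)
      have "expectation bnd = exp H * H\<^sup>2 * (r * r * (r * r)) + H * (r * r) * Y + Y ^ 3 +
       (Y\<^sup>2 / 2 * (expectation (\<lambda>\<omega>. \<Sum>k=1..m. \<bar>G j \<omega> k - T j * v1 m k\<bar>) * (r * r)) + A3 * (K * r)\<^sup>2 / 2 * (r * r))
       + Y * (K * r * expectation (\<lambda>\<omega>. \<Sum>z\<in>Lam. cmod z * cmod (U z j \<omega>)) * (r * r))"
        unfolding bnd_def[abs_def] using i1 i2
        by (simp add: prob_space del: Bochner_Integration.integral_sum)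
      also have "\<dots> \<le> exp H * H\<^sup>2 * (r * r * (r * r)) + H * (r * r) * Y + Y ^ 3 +
       (Y\<^sup>2 / 2 * ((real m * C1 * (1 / r)) * (r * r)) + A3 * (K * r)\<^sup>2 / 2 * (r * r))
       + Y * (K * r * (A4 * C2 * (1 / r)) * (r * r))"
      proof (intro add_mono order_refl)
        show "Y\<^sup>2 / 2 * (expectation (\<lambda>\<omega>. \<Sum>k=1..m. \<bar>G j \<omega> k - T j * v1 m k\<bar>) * (r * r)) \<le>
          Y\<^sup>2 / 2 * ((real m * C1 * (1 / r)) * (r * r))"
          by (rule mult_left_mono[OF mult_right_mono[OF s1 zero_le_square]]) simp
        have "K * r \<ge> 0" using K r by simp
        then show "Y * (K * r * expectation (\<lambda>\<omega>. \<Sum>z\<in>Lam. cmod z * cmod (U z j \<omega>)) * (r * r)) \<le>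
          Y * (K * r * (A4 * C2 * (1 / r)) * (r * r))"
          by (rule mult_left_mono[OF mult_right_mono[OF mult_left_mono[OF s2] zero_le_square] Y0])
      qed
      also have "\<dots> = exp H * H\<^sup>2 * r ^ 4 + H * (A0 * K) * r ^ 3 + (A0 * K) ^ 3 * r ^ 3 +
        ((A0 * K)\<^sup>2 / 2 * (real m * C1) * r ^ 3 + A3 * K\<^sup>2 / 2 * r ^ 4) + A0 * K * (K * A4 * C2) * r ^ 3"
        using r(1) unfolding Y_def by (simp add: eval_nat_numeral field_simps)
      also have "\<dots> \<le> exp H * H\<^sup>2 * r ^ 3 + H * (A0 * K) * r ^ 3 + (A0 * K) ^ 3 * r ^ 3 +
        ((A0 * K)\<^sup>2 / 2 * (real m * C1) * r ^ 3 + A3 * K\<^sup>2 / 2 * r ^ 3) + A0 * K * (K * A4 * C2) * r ^ 3"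
        using r A by (intro add_mono order_refl mult_left_mono power_decreasing) auto
      also have "\<dots> = S * r ^ 3" by (simp add: S_def algebra_simps)
      finally show ?thesis .
    qed
    have "cmod (expectation (\<lambda>\<omega>. cis (lo \<omega>) * Df \<omega>)) \<le> expectation (\<lambda>\<omega>. cmod (cis (lo \<omega>) * Df \<omega>))"
      by (rule integral_norm_bound)
    also have "\<dots> \<le> expectation bnd"
    proof (rule integral_mono_AE[OF _ ibnd Dfb])
      show "integrable M (\<lambda>\<omega>. cmod (cis (lo \<omega>) * Df \<omega>))"
      proof (rule Bochner_Integration.integrable_bound[OF ibnd])
        show "(\<lambda>\<omega>. cmod (cis (lo \<omega>) * Df \<omega>)) \<in> borel_measurable M" by measurable
        show "AE \<omega> in M. norm (cmod (cis (lo \<omega>) * Df \<omega>)) \<le> norm (bnd \<omega>)"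
          using Dfb unfolding real_norm_def
        proof eventually_elim
          case (elim \<omega>)
          then show ?case using norm_ge_zero[of "cis (lo \<omega>) * Df \<omega>"] by linarith
        qed
      qed
    qed
    also note Ebnd
    finally have "cmod (expectation (\<lambda>\<omega>. cis (lo \<omega>) * Df \<omega>)) \<le> S * r ^ 3" .
    moreover have "cmod (exp (of_real t / 2 * quad_form Lam lyapunov_cov e)) \<le> E0"
      unfolding E0_def norm_exp_eq_Re exp_le_cancel_iff by (rule order.trans[OF complex_Re_le_cmod Qe])
    ultimately have "cmod (tilted_char (Suc j) d - tilted_char j e) \<le> E0 * (S * r ^ 3)"
      unfolding diff norm_mult by (intro mult_mono) (auto simp: E0_def)
    also have "\<dots> \<le> (E0 * S + 1) * r ^ 3" using r by (simp add: algebra_simps)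
    finally show "cmod (tilted_char (Suc j) d - tilted_char j (\<lambda>z. d z * (1 + z / of_real (T j)))) \<le> (E0 * S + 1) * (1 / sqrt (T j)) ^ 3"
      by (simp add: e_def[abs_def] r_def t_def)
  qed
qed

end

section \<open>Limit of the characteristic functions\<close>

lemma shifted_powr_over_sqrt_tendsto_0:
  fixes s t c :: real
  shows "s < 1/2 \<Longrightarrow> (\<lambda>n. c * (t + real n) powr s / sqrt (real n)) \<longlonglongrightarrow> 0"
    and "(\<lambda>n. (t + real n) / real n) \<longlonglongrightarrow> 1"
    and "(\<lambda>n. c / sqrt (real n)) \<longlonglongrightarrow> 0"
  by real_asymp+

context gap_process_small
begin

lemma symmetric_gam: "symmetric c \<Longrightarrow> symmetric (\<lambda>z. c z * gam z n j / of_real x)"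
  by (simp add: symmetric_def gam_def)

lemma spectral_form_small_expectation:
  assumes "\<And>z. z \<in> Lam \<Longrightarrow> cmod (d z) \<le> b"
  shows "cmod (expectation (\<lambda>\<omega>. cis (Re (spectral_form d k \<omega>))) - 1) \<le> b * (\<Sum>z\<in>Lam. expectation (\<lambda>\<omega>. cmod (U z k \<omega>)))"
proof -
  have i: "integrable M (\<lambda>\<omega>. cis (Re (spectral_form d k \<omega>)))"
    by (intro integrable_const_bound[where B = 1]) auto
  have "cmod (expectation (\<lambda>\<omega>. cis (Re (spectral_form d k \<omega>))) - 1) = cmod (expectation (\<lambda>\<omega>. cis (Re (spectral_form d k \<omega>)) - 1))"
    using i by (simp add: prob_space)
  also have "\<dots> \<le> expectation (\<lambda>\<omega>. cmod (cis (Re (spectral_form d k \<omega>)) - 1))" by (rule integral_norm_bound)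
  also have "\<dots> \<le> expectation (\<lambda>\<omega>. \<Sum>z\<in>Lam. b * cmod (U z k \<omega>))"
  proof (rule integral_mono)
    show "integrable M (\<lambda>\<omega>. cmod (cis (Re (spectral_form d k \<omega>)) - 1))" using i by simp
    show "integrable M (\<lambda>\<omega>. \<Sum>z\<in>Lam. b * cmod (U z k \<omega>))"
      by (intro Bochner_Integration.integrable_sum integrable_mult_right U_integrable_cmod)
    fix \<omega>
    have "cmod (cis (Re (spectral_form d k \<omega>)) - 1) \<le> \<bar>Re (spectral_form d k \<omega>)\<bar>" by (rule cmod_cis_diff_1)
    also have "\<dots> \<le> cmod (spectral_form d k \<omega>)" by (rule abs_Re_le_cmod)
    also have "\<dots> \<le> (\<Sum>z\<in>Lam. b * cmod (U z k \<omega>))"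
      unfolding spectral_form_def using assms
      by (intro order.trans[OF norm_sum] sum_mono) (auto simp: norm_mult intro!: mult_right_mono)
    finally show "cmod (cis (Re (spectral_form d k \<omega>)) - 1) \<le> (\<Sum>z\<in>Lam. b * cmod (U z k \<omega>))" .
  qed
  also have "\<dots> = b * (\<Sum>z\<in>Lam. expectation (\<lambda>\<omega>. cmod (U z k \<omega>)))"
    using U_integrable_cmod by (simp add: sum_distrib_left)
  finally show ?thesis .
qed

text \<open>The coefficients \<open>d n j\<close> are transported backwards from
  \<open>c / sqrt n\<close> at time \<open>n\<close>, so that consecutive ones are related as in
  \<open>tilted_char_step\<close>. Between a fixed time \<open>k\<close> and \<open>n\<close> the
  tilted characteristic function then changes by at most a tail of the convergent series over
  \<open>j powr (-3/2)\<close>.\<close>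

lemma char_fun_limit:
  assumes c: "symmetric c"
  shows "(\<lambda>n. expectation (\<lambda>\<omega>. cis (Re (spectral_form c n \<omega>) / sqrt (real n)))) \<longlonglongrightarrow> exp (- quad_form Lam lyapunov_cov c / 2)"
proof -
  obtain Kg s where Kg: "Kg \<ge> 1" "0 \<le> s" "s < 1/2"
    "\<And>z n j. z \<in> Lam \<Longrightarrow> j \<le> n \<Longrightarrow> cmod (gam z n j) \<le> Kg * (T n / T j) powr s"
    using Lam_gam_bound by blast
  define cm where "cm = (\<Sum>z\<in>Lam. cmod (c z)) + 1"
  have cm: "cm \<ge> 1" by (simp add: cm_def sum_nonneg)
  have ccm: "cmod (c z) \<le> cm" if "z \<in> Lam" for z
  proof -
    have "cmod (c z) \<le> (\<Sum>z\<in>Lam. cmod (c z))" using that Lam(1) by (intro member_le_sum) auto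
    then show ?thesis by (simp add: cm_def)
  qed
  define d where "d n j z = c z * gam z n j / of_real (sqrt (real n))" for n j z
  have dsym: "symmetric (d n j)" for n j unfolding d_def[abs_def] by (rule symmetric_gam[OF c])
  have dbound: "cmod (d n j z) \<le> cm * Kg * (T n / T j) powr s / sqrt (real n)" if "z \<in> Lam" "j \<le> n" for n j z
  proof -
    have "cmod (c z) * cmod (gam z n j) \<le> cm * (Kg * (T n / T j) powr s)"
      using that ccm Kg cm by (intro mult_mono) auto
    then show ?thesis by (simp add: d_def norm_mult norm_divide divide_right_mono mult.assoc)
  qed
  \<comment> \<open>The factor \<open>sqrt (1 + T 0)\<close> bounds \<open>sqrt (T n / n)\<close>
    for \<open>n \<ge> 1\<close>.\<close>
  define K where "K = cm * Kg * sqrt (1 + T 0)"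
  have K: "K > 0" using cm Kg T_pos[of 0] by (simp add: K_def)
  obtain C where C: "C > 0" "\<And>j d. symmetric d \<Longrightarrow> (\<And>z. z \<in> Lam \<Longrightarrow> cmod (d z) \<le> K / sqrt (T j)) \<Longrightarrow>
    cmod (tilted_char (Suc j) d - tilted_char j (\<lambda>z. d z * (1 + z / of_real (T j)))) \<le> C * (1 / sqrt (T j)) ^ 3"
    using tilted_char_step[OF K] by blast
  have step: "cmod (tilted_char (Suc j) (d n (Suc j)) - tilted_char j (d n j)) \<le> C * real (Suc j) powr (- (3/2))" if jn: "j < n" for j n
  proof -
    have n: "n > 0" using jn by simp
    have "cmod (d n (Suc j) z) \<le> K / sqrt (T j)" if z: "z \<in> Lam" for z
    proof -
      have q: "T n / T (Suc j) \<ge> 1" using T_mono[of "Suc j" n] T_pos[of "Suc j"] jn by simp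
      have "cmod (d n (Suc j) z) \<le> cm * Kg * (T n / T (Suc j)) powr s / sqrt (real n)"
        using z jn by (intro dbound) auto
      \<comment> \<open>Raising the exponent from \<open>s\<close> to \<open>1/2\<close> gives decay
        away but yields exactly the size \<open>1 / sqrt (T j)\<close> that the step estimate asks
        for.\<close>
      also have "\<dots> \<le> cm * Kg * (T n / T (Suc j)) powr (1/2) / sqrt (real n)"
        using q Kg cm by (intro divide_right_mono mult_left_mono powr_mono) auto
      also have "(T n / T (Suc j)) powr (1/2) = sqrt (T n) / sqrt (T (Suc j))"
        using q T_pos[of n] T_pos[of "Suc j"] by (simp add: powr_half_sqrt real_sqrt_divide)
      also have "cm * Kg * (sqrt (T n) / sqrt (T (Suc j))) / sqrt (real n) = cm * Kg * (sqrt (T n / real n) / sqrt (T (Suc j)))"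
        by (simp add: real_sqrt_divide)
      also have "\<dots> \<le> cm * Kg * (sqrt (1 + T 0) / sqrt (T j))"
      proof (intro mult_left_mono frac_le)
        have "T n / real n = 1 + T 0 / real n" using n by (simp add: T_def add_divide_distrib)
        also have "T 0 / real n \<le> T 0" using n T_pos[of 0] by (simp add: divide_le_eq mult_le_cancel_left1)
        finally show "sqrt (T n / real n) \<le> sqrt (1 + T 0)" by simp
        show "sqrt (T j) \<le> sqrt (T (Suc j))" using T_mono[of j "Suc j"] by simp
      qed (use cm Kg T_pos[of j] T_pos[of 0] in auto)
      finally show ?thesis by (simp add: K_def)
    qed
    then have "cmod (tilted_char (Suc j) (d n (Suc j)) - tilted_char j (\<lambda>z. d n (Suc j) z * (1 + z / of_real (T j)))) \<le> C * (1 / sqrt (T j)) ^ 3"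
      by (rule C(2)[OF dsym])
    also have "(\<lambda>z. d n (Suc j) z * (1 + z / of_real (T j))) = d n j"
      using gam_Suc_right[OF jn] by (simp add: d_def fun_eq_iff)
    also have "C * (1 / sqrt (T j)) ^ 3 \<le> C * real (Suc j) powr (- (3/2))"
    proof (rule mult_left_mono)
      have "(1 / sqrt (T j)) ^ 3 = T j powr (- (3/2))"
        using T_pos[of j] by (simp add: powr_half_sqrt[symmetric] powr_minus_divide[symmetric] powr_realpow[symmetric] powr_powr)
      then show "(1 / sqrt (T j)) ^ 3 \<le> real (Suc j) powr (- (3/2))"
        using T_powr_le_Suc_powr[of "3/2" j] by simp
    qed (use C(1) in simp)
    finally show ?thesis .
  qed
  have tel: "cmod (tilted_char n (d n n) - tilted_char k (d n k)) \<le> (\<Sum>j\<in>{k..<n}. C * real (Suc j) powr (- (3/2)))" if "k \<le> n" for k n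
  proof -
    have "tilted_char n (d n n) - tilted_char k (d n k) = (\<Sum>j\<in>{k..<n}. tilted_char (Suc j) (d n (Suc j)) - tilted_char j (d n j))"
      using sum_Suc_diff'[OF that, of "\<lambda>j. tilted_char j (d n j)"] by simp
    also have "cmod \<dots> \<le> (\<Sum>j\<in>{k..<n}. C * real (Suc j) powr (- (3/2)))"
      by (intro order.trans[OF norm_sum] sum_mono step) auto
    finally show ?thesis .
  qed
  have summ: "summable (\<lambda>j. C * real (Suc j) powr (- (3/2)))"
  proof (rule summable_mult)
    have "summable (\<lambda>n. real n powr (- (3/2)))" by (simp add: summable_real_powr_iff)
    then show "summable (\<lambda>j. real (Suc j) powr (- (3/2)))"
      using summable_Suc_iff[of "\<lambda>n. real n powr (- (3/2))"] by blast
  qed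
  \<comment> \<open>At a fixed time all coefficients tend to zero, because \<open>s < 1/2\<close>;
    the influence of the start of the chain disappears.\<close>
  have fixed: "(\<lambda>n. tilted_char k (d n k)) \<longlonglongrightarrow> 1" for k
  proof -
    define b where "b n = cm * Kg * T n powr s / sqrt (real n)" for n
    have blim: "b \<longlonglongrightarrow> 0" unfolding b_def T_def by (rule shifted_powr_over_sqrt_tendsto_0(1)[OF Kg(3)])
    have db: "cmod (d n k z) \<le> b n" if "z \<in> Lam" "k \<le> n" for n z
    proof -
      have "(T n / T k) powr s \<le> T n powr s"
        using Kg T_pos[of n] T_ge_1[of k] by (intro powr_mono2) (auto simp: divide_le_eq mult_le_cancel_left1)
      then have "cm * Kg * (T n / T k) powr s / sqrt (real n) \<le> b n"
        unfolding b_def using cm Kg by (intro divide_right_mono mult_left_mono) auto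
      then show ?thesis using dbound[OF that] by simp
    qed
    have 1: "(\<lambda>n. expectation (\<lambda>\<omega>. cis (Re (spectral_form (d n k) k \<omega>)))) \<longlonglongrightarrow> 1"
    proof (rule Lim_null[THEN iffD2], rule Lim_null_comparison)
      show "\<forall>\<^sub>F n in sequentially. cmod (expectation (\<lambda>\<omega>. cis (Re (spectral_form (d n k) k \<omega>))) - 1) \<le>
          b n * (\<Sum>z\<in>Lam. expectation (\<lambda>\<omega>. cmod (U z k \<omega>)))"
        using eventually_ge_at_top[of k] by eventually_elim (intro spectral_form_small_expectation db)
      show "(\<lambda>n. b n * (\<Sum>z\<in>Lam. expectation (\<lambda>\<omega>. cmod (U z k \<omega>)))) \<longlonglongrightarrow> 0"
        by (rule tendsto_mult_left_zero[OF blim])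
    qed
    have 2: "(\<lambda>n. quad_form Lam lyapunov_cov (d n k)) \<longlonglongrightarrow> 0"
    proof (rule Lim_null_comparison)
      show "\<forall>\<^sub>F n in sequentially. cmod (quad_form Lam lyapunov_cov (d n k)) \<le> (\<Sum>z\<in>Lam. \<Sum>w\<in>Lam. cmod (lyapunov_cov z w)) * (b n)\<^sup>2"
        using eventually_ge_at_top[of k] by eventually_elim (intro quad_form_bound db)
      have "(\<lambda>n. (\<Sum>z\<in>Lam. \<Sum>w\<in>Lam. cmod (lyapunov_cov z w)) * (b n)\<^sup>2) \<longlonglongrightarrow> (\<Sum>z\<in>Lam. \<Sum>w\<in>Lam. cmod (lyapunov_cov z w)) * 0\<^sup>2"
        by (intro tendsto_intros blim)
      then show "(\<lambda>n. (\<Sum>z\<in>Lam. \<Sum>w\<in>Lam. cmod (lyapunov_cov z w)) * (b n)\<^sup>2) \<longlonglongrightarrow> 0" by simp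
    qed
    have "(\<lambda>n. tilted_char k (d n k)) \<longlonglongrightarrow> 1 * exp (of_real (T k) / 2 * 0)"
      unfolding tilted_char_def by (intro tendsto_intros 1 2)
    then show ?thesis by simp
  qed
  have main: "(\<lambda>n. tilted_char n (d n n)) \<longlonglongrightarrow> 1"
  proof (rule tendstoI)
    fix e :: real assume e: "e > 0"
    obtain k where k: "\<And>m n. m \<ge> k \<Longrightarrow> norm (\<Sum>j\<in>{m..<n}. C * real (Suc j) powr (- (3/2))) < e / 2"
      using summ[unfolded summable_Cauchy] e by (metis half_gt_zero)
    have "\<forall>\<^sub>F n in sequentially. dist (tilted_char k (d n k)) 1 < e / 2"
      using tendstoD[OF fixed, of "e / 2" k] e by simp
    then show "\<forall>\<^sub>F n in sequentially. dist (tilted_char n (d n n)) 1 < e"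
      using eventually_ge_at_top[of k]
    proof eventually_elim
      case (elim n)
      have "dist (tilted_char n (d n n)) (tilted_char k (d n k)) < e / 2"
        using tel[OF elim(2)] k[of k n] unfolding dist_norm by simp
      then show ?case using elim(1) dist_triangle_half_l[of "tilted_char n (d n n)" "tilted_char k (d n k)"] 
        by (metis dist_commute dist_triangle_half_r)
    qed
  qed
  \<comment> \<open>At time \<open>n\<close> the tilt is the deterministic factor
    \<open>exp (T n / n * Q / 2)\<close>, which is divided out and converges.\<close>
  define Q where "Q = quad_form Lam lyapunov_cov c"
  have "(\<lambda>n. exp (- (of_real (T n / real n) / 2 * Q))) \<longlonglongrightarrow> exp (- (of_real 1 / 2 * Q))"
    unfolding T_def by (intro tendsto_intros shifted_powr_over_sqrt_tendsto_0(2)) simp_all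
  from tendsto_mult[OF main this]
  have "(\<lambda>n. tilted_char n (d n n) * exp (- (of_real (T n / real n) / 2 * Q))) \<longlonglongrightarrow> exp (- Q / 2)" by simp
  moreover have "\<forall>\<^sub>F n in sequentially. tilted_char n (d n n) * exp (- (of_real (T n / real n) / 2 * Q)) =
      expectation (\<lambda>\<omega>. cis (Re (spectral_form c n \<omega>) / sqrt (real n)))"
    using eventually_gt_at_top[of 0]
  proof eventually_elim
    case (elim n)
    have dn: "d n n z = c z / of_real (sqrt (real n))" for z by (simp add: d_def)
    have L: "spectral_form (d n n) n \<omega> = spectral_form c n \<omega> / of_real (sqrt (real n))" for \<omega>
      by (simp add: spectral_form_def dn sum_divide_distrib)
    have sq: "of_real (sqrt (real n)) * of_real (sqrt (real n)) = (of_nat n :: complex)"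
      by (metis of_real_mult of_real_of_nat_eq real_sqrt_mult_self abs_of_nat)
    have "quad_form Lam lyapunov_cov (d n n) = Q / of_nat n"
      unfolding Q_def quad_form_def dn sum_divide_distrib sq[symmetric]
      by (simp add: field_simps)
    then have "of_real (T n) / 2 * quad_form Lam lyapunov_cov (d n n) = of_real (T n / real n) / 2 * Q" by simp
    then show ?case
      unfolding tilted_char_def L by (simp add: exp_minus Re_divide_of_real)
  qed
  ultimately show ?thesis unfolding Q_def by (rule Lim_transform_eventually)
qed

end

context gap_process_small
begin

section \<open>The limit covariance and the central limit theorem\<close>

lemma sum_Lam_cnj: "(\<Sum>w\<in>Lam. f (cnj w)) = (\<Sum>w\<in>Lam. f w)"
  by (rule sum.reindex_bij_witness[where i = cnj and j = cnj]) (use Lam(3) in auto)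

lemma lyapunov_cov_cnj: "lyapunov_cov (cnj z) (cnj w) = cnj (lyapunov_cov z w)"
  by (simp add: lyapunov_cov_def incr_cov_def eig_coeff_cnj)

lemma lyapunov_cov_commute: "lyapunov_cov z w = lyapunov_cov w z"
  by (simp add: lyapunov_cov_def incr_cov_def algebra_simps)

text \<open>The coefficients of the linear form \<open>a\<close> with respect to the eigenforms, as
  given by \<open>eig_decomposition\<close>.\<close>

definition lin_coeff :: "(nat \<Rightarrow> real) \<Rightarrow> complex \<Rightarrow> complex" where
  "lin_coeff a z = (\<Sum>k=1..m. of_real (a k) * eig_vec m z k)"

lemma symmetric_lin_coeff: "symmetric (lin_coeff a)"
  by (simp add: symmetric_def lin_coeff_def eig_vec_cnj)

text \<open>The double sum is itself real, because the roots are closed under conjugation;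
  \<open>Re\<close> only adjusts the type.\<close>

definition limit_cov :: "nat \<Rightarrow> nat \<Rightarrow> real" where
  "limit_cov i j = Re (\<Sum>z\<in>Lam. \<Sum>w\<in>Lam. eig_vec m z i * eig_vec m w j * lyapunov_cov z w)"

lemma limit_cov_commute: "limit_cov i j = limit_cov j i"
  unfolding limit_cov_def by (subst sum.swap) (simp add: lyapunov_cov_commute mult_ac)

lemma quad_form_lin_coeff:
  "quad_form Lam lyapunov_cov (lin_coeff a) = of_real (\<Sum>i=1..m. \<Sum>j=1..m. a i * a j * limit_cov i j)"
proof -
  have real: "(\<Sum>z\<in>Lam. \<Sum>w\<in>Lam. eig_vec m z i * eig_vec m w j * lyapunov_cov z w) = of_real (limit_cov i j)" for i j
    unfolding limit_cov_def
  proof (rule sum_Lam_real)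
    fix z
    have "(\<Sum>w\<in>Lam. eig_vec m (cnj z) i * eig_vec m w j * lyapunov_cov (cnj z) w) =
      (\<Sum>w\<in>Lam. eig_vec m (cnj z) i * eig_vec m (cnj w) j * lyapunov_cov (cnj z) (cnj w))"
      by (rule sum_Lam_cnj[symmetric])
    then show "(\<Sum>w\<in>Lam. eig_vec m (cnj z) i * eig_vec m w j * lyapunov_cov (cnj z) w) =
      cnj (\<Sum>w\<in>Lam. eig_vec m z i * eig_vec m w j * lyapunov_cov z w)"
      by (simp add: eig_vec_cnj lyapunov_cov_cnj)
  qed
  have "quad_form Lam lyapunov_cov (lin_coeff a) = (\<Sum>z\<in>Lam. \<Sum>w\<in>Lam. \<Sum>i=1..m. \<Sum>j=1..m.
      of_real (a i * a j) * (eig_vec m z i * eig_vec m w j * lyapunov_cov z w))"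
    unfolding quad_form_def lin_coeff_def
    by (intro sum.cong refl, unfold sum_product, unfold sum_distrib_right, intro sum.cong refl, simp add: mult_ac)
  also have "\<dots> = (\<Sum>i=1..m. \<Sum>j=1..m. \<Sum>z\<in>Lam. \<Sum>w\<in>Lam.
      of_real (a i * a j) * (eig_vec m z i * eig_vec m w j * lyapunov_cov z w))"
    unfolding sum.swap[of _ "{1..m}" Lam] ..
  also have "\<dots> = (\<Sum>i=1..m. \<Sum>j=1..m. of_real (a i * a j) * of_real (limit_cov i j))"
    unfolding real[symmetric] sum_distrib_left ..
  finally show ?thesis by simp
qed

text \<open>Centring at \<open>n * v1\<close> instead of \<open>T n * v1\<close> leaves a constant,
  which disappears after division by \<open>sqrt n\<close>.\<close>

lemma AE_linear_form:
  "AE \<omega> in M. \<forall>n. (\<Sum>k=1..m. a k * (G n \<omega> k - real n * v1 m k)) =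
     T 0 * (\<Sum>k=1..m. a k * v1 m k) + Re (spectral_form (lin_coeff a) n \<omega>)"
  using AE_G_deviation
proof eventually_elim
  case (elim \<omega>)
  show ?case
  proof
    fix n
    have "spectral_form (lin_coeff a) n \<omega> = (\<Sum>k=1..m. of_real (a k) * (\<Sum>z\<in>Lam. U z n \<omega> * eig_vec m z k))"
      unfolding spectral_form_def lin_coeff_def sum_distrib_left sum_distrib_right
      by (subst sum.swap) (simp add: mult_ac)
    also have "\<dots> = (\<Sum>k=1..m. of_real (a k) * of_real (G n \<omega> k - T n * v1 m k))"
      using elim by (intro sum.cong refl) metis
    finally have "Re (spectral_form (lin_coeff a) n \<omega>) = (\<Sum>k=1..m. a k * (G n \<omega> k - T n * v1 m k))"
      by simp
    then show "(\<Sum>k=1..m. a k * (G n \<omega> k - real n * v1 m k)) =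
     T 0 * (\<Sum>k=1..m. a k * v1 m k) + Re (spectral_form (lin_coeff a) n \<omega>)"
      by (simp add: sum_distrib_left sum.distrib[symmetric] T_def algebra_simps)
  qed
qed

lemma fluctuation_measurable: "gap_fluctuation m G n \<in> measurable M (PiM {1..m} (\<lambda>_. borel))"
  unfolding gap_fluctuation_def[abs_def] by (intro measurable_restrict) measurable

lemma fluctuation_char_limit:
  "(\<lambda>n. expectation (\<lambda>\<omega>. cis (\<Sum>i=1..m. a i * gap_fluctuation m G n \<omega> i))) \<longlonglongrightarrow>
    of_real (exp (- (\<Sum>i=1..m. \<Sum>j=1..m. a i * a j * limit_cov i j) / 2))"
proof -
  define b where "b = T 0 * (\<Sum>k=1..m. a k * v1 m k)"
  have eq: "expectation (\<lambda>\<omega>. cis (\<Sum>i=1..m. a i * gap_fluctuation m G n \<omega> i)) =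
    cis (b / sqrt (real n)) * expectation (\<lambda>\<omega>. cis (Re (spectral_form (lin_coeff a) n \<omega>) / sqrt (real n)))" for n
  proof -
    have "expectation (\<lambda>\<omega>. cis (\<Sum>i=1..m. a i * gap_fluctuation m G n \<omega> i)) =
      expectation (\<lambda>\<omega>. cis (b / sqrt (real n)) * cis (Re (spectral_form (lin_coeff a) n \<omega>) / sqrt (real n)))"
    proof (rule integral_cong_AE)
      show "AE \<omega> in M. cis (\<Sum>i=1..m. a i * gap_fluctuation m G n \<omega> i) =
        cis (b / sqrt (real n)) * cis (Re (spectral_form (lin_coeff a) n \<omega>) / sqrt (real n))"
        using AE_linear_form[of a]
      proof eventually_elim
        case (elim \<omega>)
        have "(\<Sum>i=1..m. a i * gap_fluctuation m G n \<omega> i) = (\<Sum>k=1..m. a k * (G n \<omega> k - real n * v1 m k)) / sqrt (real n)"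
          by (simp add: gap_fluctuation_def sum_divide_distrib)
        also have "\<dots> = (b + Re (spectral_form (lin_coeff a) n \<omega>)) / sqrt (real n)"
          using elim by (simp add: b_def)
        finally show ?case by (simp add: cis_mult add_divide_distrib)
      qed
      show "(\<lambda>\<omega>. cis (\<Sum>i=1..m. a i * gap_fluctuation m G n \<omega> i)) \<in> borel_measurable M"
      proof -
        have "(\<lambda>\<omega>. gap_fluctuation m G n \<omega> i) \<in> borel_measurable M" if "i \<in> {1..m}" for i
          using that by (simp add: gap_fluctuation_def)
        then show ?thesis by measurable
      qed
    qed measurable
    then show ?thesis by simp
  qed
  have "(\<lambda>n. cis (b / sqrt (real n))) \<longlonglongrightarrow> cis 0"
    by (intro tendsto_cis shifted_powr_over_sqrt_tendsto_0(3))
  from tendsto_mult[OF this char_fun_limit[OF symmetric_lin_coeff]]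
  show ?thesis unfolding eq quad_form_lin_coeff by (simp add: exp_of_real[symmetric])
qed

text \<open>Characteristic functions are bounded by one, hence so is their limit
  \<open>exp (- Q / 2)\<close>, which forces \<open>Q \<ge> 0\<close>. Positivity is not visible
  from the formula with complex roots.\<close>

lemma limit_cov_psd: "(\<Sum>i=1..m. \<Sum>j=1..m. a i * a j * limit_cov i j) \<ge> 0"
proof -
  define Q where "Q = (\<Sum>i=1..m. \<Sum>j=1..m. a i * a j * limit_cov i j)"
  have lim: "(\<lambda>n. cmod (expectation (\<lambda>\<omega>. cis (\<Sum>i=1..m. a i * gap_fluctuation m G n \<omega> i)))) \<longlonglongrightarrow> cmod (of_real (exp (- Q / 2)))"
    unfolding Q_def by (intro tendsto_norm fluctuation_char_limit)
  have "cmod (expectation (\<lambda>\<omega>. cis (\<Sum>i=1..m. a i * gap_fluctuation m G n \<omega> i))) \<le> 1" for n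
    using integral_norm_bound[of M "\<lambda>\<omega>. cis (\<Sum>i=1..m. a i * gap_fluctuation m G n \<omega> i)"] by (simp add: prob_space)
  then have "cmod (of_real (exp (- Q / 2))) \<le> 1"
    using LIMSEQ_le_const2[OF lim] by blast
  then show ?thesis by (simp add: Q_def)
qed

text \<open>Markov's inequality for a sum over the coordinates whose mean is bounded by
  \<open>D\<close> for all \<open>n > 0\<close>; the level \<open>K\<close> is chosen as
  \<open>(D + 1) / e\<close>.\<close>

lemma fluctuation_tight:
  assumes e: "e > 0"
  shows "\<exists>K. \<forall>\<^sub>F n in sequentially. prob {\<omega> \<in> space M. \<exists>i\<in>{1..m}. \<bar>gap_fluctuation m G n \<omega> i\<bar> > K} \<le> e"
proof -
  obtain C where C: "C > 0"
    "\<And>n k. k \<in> {1..m} \<Longrightarrow> integrable M (\<lambda>\<omega>. \<bar>G n \<omega> k - T n * v1 m k\<bar>)"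
    "\<And>n k. k \<in> {1..m} \<Longrightarrow> expectation (\<lambda>\<omega>. \<bar>G n \<omega> k - T n * v1 m k\<bar>) \<le> C * sqrt (T n)"
    using expectation_deviation by blast
  define D where "D = (\<Sum>k=1..m. C * sqrt (1 + T 0) + T 0 * v1 m k)"
  define K where "K = (D + 1) / e"
  have D: "D \<ge> 0" unfolding D_def using C(1) T_pos[of 0] v1_nonneg by (intro sum_nonneg) auto
  have K: "K > 0" using D e by (simp add: K_def)
  have "prob {\<omega> \<in> space M. \<exists>i\<in>{1..m}. \<bar>gap_fluctuation m G n \<omega> i\<bar> > K} \<le> e" if n: "n > 0" for n
  proof -
    define S where "S \<omega> = (\<Sum>k=1..m. (\<bar>G n \<omega> k - T n * v1 m k\<bar> + T 0 * v1 m k) / sqrt (real n))" for \<omega>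
    have iS: "integrable M S"
      unfolding S_def[abs_def] using C(2)
      by (intro Bochner_Integration.integrable_sum integrable_divide_zero Bochner_Integration.integrable_add integrable_const)
    have S0: "0 \<le> (\<bar>G n \<omega> k - T n * v1 m k\<bar> + T 0 * v1 m k) / sqrt (real n)" if "k \<in> {1..m}" for k \<omega>
      using v1_nonneg[OF that] T_pos[of 0] by (intro divide_nonneg_nonneg add_nonneg_nonneg) auto
    have fS: "\<bar>gap_fluctuation m G n \<omega> k\<bar> \<le> S \<omega>" if k: "k \<in> {1..m}" for k \<omega>
    proof -
      have "G n \<omega> k - real n * v1 m k = (G n \<omega> k - T n * v1 m k) + T 0 * v1 m k"
        by (simp add: T_def algebra_simps)
      then have "\<bar>G n \<omega> k - real n * v1 m k\<bar> \<le> \<bar>G n \<omega> k - T n * v1 m k\<bar> + T 0 * v1 m k"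
        using v1_nonneg[OF k] T_pos[of 0] abs_triangle_ineq[of "G n \<omega> k - T n * v1 m k" "T 0 * v1 m k"] by simp
      then have "\<bar>gap_fluctuation m G n \<omega> k\<bar> \<le> (\<bar>G n \<omega> k - T n * v1 m k\<bar> + T 0 * v1 m k) / sqrt (real n)"
        using k by (simp add: gap_fluctuation_def divide_right_mono)
      also have "\<dots> \<le> S \<omega>"
        unfolding S_def using k S0
        by (intro member_le_sum[where f = "\<lambda>k. (\<bar>G n \<omega> k - T n * v1 m k\<bar> + T 0 * v1 m k) / sqrt (real n)"]) auto
      finally show ?thesis .
    qed
    have ES: "expectation S \<le> D"
    proof -
      have "expectation S = (\<Sum>k=1..m. (expectation (\<lambda>\<omega>. \<bar>G n \<omega> k - T n * v1 m k\<bar>) + T 0 * v1 m k) / sqrt (real n))"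
        unfolding S_def[abs_def] using C(2)
        by (subst Bochner_Integration.integral_sum) (auto simp: prob_space intro!: sum.cong)
      also have "\<dots> \<le> (\<Sum>k=1..m. (C * sqrt (T n) + T 0 * v1 m k) / sqrt (real n))"
        by (intro sum_mono divide_right_mono add_right_mono C(3)) auto
      also have "\<dots> \<le> D"
        unfolding D_def
      proof (intro sum_mono)
        fix k assume k: "k \<in> {1..m}"
        have "T n / real n = 1 + T 0 / real n" using n by (simp add: T_def add_divide_distrib)
        also have "T 0 / real n \<le> T 0" using n T_pos[of 0] by (simp add: divide_le_eq mult_le_cancel_left1)
        finally have "sqrt (T n / real n) \<le> sqrt (1 + T 0)" by simp
        then have "C * (sqrt (T n) / sqrt (real n)) \<le> C * sqrt (1 + T 0)"
          using C(1) unfolding real_sqrt_divide by (intro mult_left_mono) auto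
        moreover have "T 0 * v1 m k / sqrt (real n) \<le> T 0 * v1 m k"
          using n T_pos[of 0] v1_nonneg[OF k] divide_left_mono[of 1 "sqrt (real n)" "T 0 * v1 m k"] by simp
        ultimately show "(C * sqrt (T n) + T 0 * v1 m k) / sqrt (real n) \<le> C * sqrt (1 + T 0) + T 0 * v1 m k"
          by (simp add: add_divide_distrib)
      qed
      finally show ?thesis .
    qed
    have "prob {\<omega> \<in> space M. \<exists>i\<in>{1..m}. \<bar>gap_fluctuation m G n \<omega> i\<bar> > K} \<le> prob {\<omega> \<in> space M. S \<omega> \<ge> K}"
    proof (rule finite_measure_mono)
      show "{\<omega> \<in> space M. \<exists>i\<in>{1..m}. \<bar>gap_fluctuation m G n \<omega> i\<bar> > K} \<subseteq> {\<omega> \<in> space M. S \<omega> \<ge> K}"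
        using less_imp_le[OF order.strict_trans2[OF _ fS]] by blast
      have [measurable]: "S \<in> borel_measurable M" using iS by (rule borel_measurable_integrable)
      show "{\<omega> \<in> space M. S \<omega> \<ge> K} \<in> events" by measurable
    qed
    also have "\<dots> \<le> expectation S / K"
    proof (rule integral_Markov_inequality_measure[where A = "{}"])
      show "AE \<omega> in M. 0 \<le> S \<omega>"
        using S0 unfolding S_def by (intro AE_I2 sum_nonneg) auto
    qed (use iS K in auto)
    also have "\<dots> \<le> D / K" using ES K by (intro divide_right_mono) auto
    also have "\<dots> \<le> e" using D e by (simp add: K_def field_simps)
    finally show ?thesis .
  qed
  then show ?thesis
    by (intro exI[of _ K] eventually_mono[OF eventually_gt_at_top[of 0]])
qed

lemma small_phases:
  "\<exists>\<nu>. centered_gaussian {1..m} \<nu> \<and>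
     weak_conv_pow {1..m} (\<lambda>n. distr M (PiM {1..m} (\<lambda>_. borel)) (gap_fluctuation m G n)) \<nu>"
proof -
  obtain \<nu> where \<nu>: "centered_gaussian {1..m} \<nu>"
    "\<And>a. (\<integral>x. cis (\<Sum>i=1..m. a i * x i) \<partial>\<nu>) = of_real (exp (- (\<Sum>i=1..m. \<Sum>j=1..m. a i * a j * limit_cov i j) / 2))"
    using centered_gaussian_exists[of "{1..m}" limit_cov] limit_cov_commute limit_cov_psd by auto
  let ?\<mu> = "\<lambda>n. distr M (PiM {1..m} (\<lambda>_. borel)) (gap_fluctuation m G n)"
  have comp: "(\<lambda>x. x i) \<in> borel_measurable (PiM {1..m} (\<lambda>_. borel))" if "i \<in> {1..m}" for i
    using measurable_component_singleton[OF that] .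
  have "weak_conv_pow {1..m} ?\<mu> \<nu>"
  proof (rule weak_conv_pow_of_char)
    show "prob_space (?\<mu> n)" for n by (rule prob_space_distr[OF fluctuation_measurable])
    show "prob_space \<nu>" "sets \<nu> = sets (PiM {1..m} (\<lambda>_. borel))"
      using \<nu>(1) by (auto simp: centered_gaussian_def)
    show "(\<lambda>n. \<integral>x. cis (\<Sum>i=1..m. a i * x i) \<partial>?\<mu> n) \<longlonglongrightarrow> (\<integral>x. cis (\<Sum>i=1..m. a i * x i) \<partial>\<nu>)" for a
    proof -
      have "(\<lambda>x. cis (\<Sum>i=1..m. a i * x i)) \<in> borel_measurable (PiM {1..m} (\<lambda>_. borel))"
        using comp by measurable
      then have "(\<integral>x. cis (\<Sum>i=1..m. a i * x i) \<partial>?\<mu> n) = expectation (\<lambda>\<omega>. cis (\<Sum>i=1..m. a i * gap_fluctuation m G n \<omega> i))" for n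
        by (rule integral_distr[OF fluctuation_measurable])
      then show ?thesis unfolding \<nu>(2) using fluctuation_char_limit by simp
    qed
    fix e :: real assume e: "e > 0"
    have m: "{x \<in> space (PiM {1..m} (\<lambda>_. borel)). \<exists>i\<in>{1..m}. \<bar>x i\<bar> > K} \<in> sets (PiM {1..m} (\<lambda>_. borel))" for K :: real
      using comp by measurable
    have "measure (?\<mu> n) {x \<in> space (?\<mu> n). \<exists>i\<in>{1..m}. \<bar>x i\<bar> > K} =
      prob {\<omega> \<in> space M. \<exists>i\<in>{1..m}. \<bar>gap_fluctuation m G n \<omega> i\<bar> > K}" for n K
    proof -
      have "gap_fluctuation m G n -` {x \<in> space (PiM {1..m} (\<lambda>_. borel)). \<exists>i\<in>{1..m}. \<bar>x i\<bar> > K} \<inter> space M =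
        {\<omega> \<in> space M. \<exists>i\<in>{1..m}. \<bar>gap_fluctuation m G n \<omega> i\<bar> > K}"
        using measurable_space[OF fluctuation_measurable] by auto
      then show ?thesis
        using measure_distr[OF fluctuation_measurable m, of n K] by simp
    qed
    then show "\<exists>K. \<forall>\<^sub>F n in sequentially. measure (?\<mu> n) {x \<in> space (?\<mu> n). \<exists>i\<in>{1..m}. \<bar>x i\<bar> > K} \<le> e"
      using fluctuation_tight[OF e] by simp
  qed auto
  then show ?thesis using \<nu>(1) by blast
qed

end

theorem theorem1:
  fixes m :: nat and V :: "nat \<Rightarrow> nat"
    and M :: "'a measure" and G :: "nat \<Rightarrow> 'a \<Rightarrow> nat \<Rightarrow> real"
  assumes "m \<ge> 2"
    and "\<exists>k\<in>{1..m}. V k \<noteq> 0"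
    and "prob_space M"
    and "is_gap_process m V M G"
  shows "(m \<le> 59 \<longrightarrow>
           (\<exists>\<nu>. centered_gaussian {1..m} \<nu> \<and>
                weak_conv_pow {1..m}
                  (\<lambda>n. distr M (PiM {1..m} (\<lambda>_. borel)) (gap_fluctuation m G n)) \<nu>)) \<and>
         (m \<ge> 60 \<longrightarrow>
           (\<exists>W :: 'a \<Rightarrow> complex.
              W \<in> borel_measurable M \<and> integrable M W \<and>
              (\<integral>\<omega>. W \<omega> \<partial>M) =
                Gamma (of_real (coord_sum m (gap_init m V))) /
                Gamma (of_real (coord_sum m (gap_init m V)) + lambda2 m) *
                eig_form m (lambda2 m) (\<lambda>k. of_real (gap_init m V k)) \<and>
              (AE \<omega> in M. (\<lambda>n. L2_set (gap_remainder m G W n \<omega>) {1..m})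
                            \<in> o(\<lambda>n. real n powr sigma2 m)) \<and>
              (\<forall>p::real. p \<ge> 1 \<longrightarrow>
                 (\<forall>n. integrable M (\<lambda>\<omega>. L2_set (gap_remainder m G W n \<omega>) {1..m} powr p)) \<and>
                 (\<lambda>n. (\<integral>\<omega>. L2_set (gap_remainder m G W n \<omega>) {1..m} powr p \<partial>M) powr (1 / p))
                   \<in> o(\<lambda>n. real n powr sigma2 m))))"
proof -
  interpret prob_space M by fact
  interpret gap_process M m V G by unfold_locales fact+
  show ?thesis
  proof (intro conjI impI)
    assume "m \<le> 59"
    interpret gap_process_small M m V G
      by unfold_locales (use gap_roots_small_phases \<open>m \<ge> 2\<close> \<open>m \<le> 59\<close> in blast)
    show "\<exists>\<nu>. centered_gaussian {1..m} \<nu> \<and>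
        weak_conv_pow {1..m} (\<lambda>n. distr M (PiM {1..m} (\<lambda>_. borel)) (gap_fluctuation m G n)) \<nu>"
      by (rule small_phases)
  qed (rule large_phases)
qed

end
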